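(* Let $\lambda\colon\mathcal{C}\to\mathcal{D}$ be a map of graded coalgebras from a connected graded coalgebra $\mathcal{C}$ to a graded Hopf operad $\mathcal{D}$ with composition map $\gamma$. Then the maps $$f_r=\gamma\circ(\mathrm{id}\circ\lambda)\colon\mathcal{D}\circ\mathcal{C}\to\mathcal{D},\qquad d\circ(c_0\cdot\dotsb\cdot c_n)\mapsto\gamma\bigl(d\otimes\lambda(c_0)\otimes\dotsb\otimes\lambda(c_n)\bigr)$$ and $$f_l=\gamma\circ(\lambda\circ\mathrm{id})\colon\mathcal{C}\circ\mathcal{D}\to\mathcal{D},\qquad c\circ(d_0\cdot\dotsb\cdot d_n)\mapsto\gamma\bigl(\lambda(c)\otimes d_0\otimes\dotsb\otimes d_n\bigr)$$ give connections on $\mathcal{D}$, where $\mathcal{D}\circ\mathcal{C}$ is a right and $\mathcal{C}\circ\mathcal{D}$ is a left module coalgebra over the Hopf algebra $\mathcal{D}$.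
   Context: $\mathbb{K}$ is a field of characteristic zero. A graded coalgebra is a vector space $\mathcal{C}=\bigoplus_{n\ge0}\mathcal{C}_n$ with a degree-preserving coassociative coproduct $\Delta$ and a counit $\varepsilon$ vanishing in positive degrees; $|c|=n$ for $c\in\mathcal{C}_n$; $\Delta(c)=\sum_{(c)}c'\otimes c''$; $\Delta^{(n)}$ is the iterated coproduct into $\mathcal{C}^{\otimes(n+1)}$. It is connected if $\mathcal{C}_0=\mathbb{K}$; then $1\in\mathcal{C}_0$ is the element with $\varepsilon(1)=1$. The composition of graded coalgebras $\mathcal{C},\mathcal{D}$ is $\mathcal{D}\circ\mathcal{C}=\bigoplus_{n\ge0}\mathcal{D}_n\otimes\mathcal{C}^{\otimes(n+1)}$, with $d\otimes c_0\otimes\dotsb\otimes c_n$ ($d\in\mathcal{D}_n$) written $d\circ(c_0\cdot\dotsb\cdot c_n)$ and graded by total degree $|d|+|c_0|+\dotsb+|c_n|$; the coproduct is $$\Delta\bigl(d\circ(c_0\cdot\dotsb\cdot c_n)\bigr)=\sum_{i=0}^n\ \sum_{(d),\,|d'|=i}\ \sum_{(c_i)} \bigl(d'\circ(c_0\cdot\dotsb\cdot c_{i-1}\cdot c_i')\bigr)\otimes\bigl(d''\circ(c_i''\cdot c_{i+1}\cdot\dotsb\cdot c_n)\bigr)$$ (the sum over $(d)$ with $|d'|=i$ is over the component of $\Delta(d)$ in $\mathcal{D}_i\otimes\mathcal{D}_{n-i}$), with counit $\varepsilon(d\circ(c_0\cdot\dotsb\cdot c_n))=\varepsilon(d)\prod_j\varepsilon(c_j)$.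 A graded Hopf operad is a connected graded coalgebra $\mathcal{D}$ with a morphism of graded coalgebras $\gamma\colon\mathcal{D}\circ\mathcal{D}\to\mathcal{D}$ which is associative, $$\gamma\bigl(\gamma(d\otimes d_0\otimes\dotsb\otimes d_n)\otimes e_{0,0}\otimes\dotsb\otimes e_{n,|d_n|}\bigr)=\gamma\bigl(d\otimes\gamma(d_0\otimes e_{0,0}\otimes\dotsb\otimes e_{0,|d_0|})\otimes\dotsb\otimes\gamma(d_n\otimes e_{n,0}\otimes\dotsb\otimes e_{n,|d_n|})\bigr)$$ for $d\in\mathcal{D}_n$ and homogeneous $d_i$, and unital, $\gamma(1\otimes d)=d$ and $\gamma(d\otimes1^{\otimes(|d|+1)})=d$. Such a $\mathcal{D}$ is a connected graded Hopf algebra with product $a\cdot b=\gamma(b\otimes\Delta^{(|b|)}a)$ for $b$ homogeneous. The right action of $\mathcal{D}$ on $\mathcal{D}\circ\mathcal{C}$ is $e\star d:=\mu_l(d\otimes\Delta^{(|d|)}e)$, where for $d\in\mathcal{D}_n$ $$\mu_l\bigl(d\otimes (d_0\circ(c_{0,0}\cdot\dotsb\cdot c_{0,i_0}))\otimes\dotsb\otimes(d_n\circ(c_{n,0}\cdot\dotsb\cdot c_{n,i_n}))\bigr)=\gamma(d\otimes d_0\otimes\dotsb\otimes d_n)\circ(c_{0,0}\cdot\dotsb\cdot c_{n,i_n}).$$ The left action of $\mathcal{D}$ on $\mathcal{C}\circ\mathcal{D}$ is $d\star e:=\mu_r(e\otimes\Delta^{(|e|)}d)$, with $|e|$ the total degree,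 where for $c\in\mathcal{C}_m$ and homogeneous $d_i$ with $|d_i|=j_i$ $$\mu_r\bigl((c\circ(d_0\cdot\dotsb\cdot d_m))\otimes d_{0,0}\otimes\dotsb\otimes d_{m,j_m}\bigr)=c\circ\bigl(\gamma(d_0\otimes d_{0,0}\otimes\dotsb\otimes d_{0,j_0})\cdot\dotsb\cdot\gamma(d_m\otimes d_{m,0}\otimes\dotsb\otimes d_{m,j_m})\bigr).$$ A map $f\colon\mathcal{E}\to\mathcal{D}$ of graded coalgebras is a connection on a connected graded Hopf algebra $\mathcal{D}$ if $\mathcal{E}$ is a connected graded coalgebra, $\mathcal{E}$ is an associative unital graded (left or right) $\mathcal{D}$-module whose action $\star$ satisfies $\Delta_{\mathcal E}(e\star d)=\Delta_{\mathcal E}(e)\star\Delta_{\mathcal D}(d)$ (resp. $\Delta_{\mathcal E}(d\star e)=\Delta_{\mathcal D}(d)\star\Delta_{\mathcal E}(e)$ for left modules), i.e. $\mathcal{E}$ is a $\mathcal{D}$-module coalgebra, and $f$ is a map of $\mathcal{D}$-modules: $f(e\star d)=f(e)\cdot d$ (resp. $f(d\star e)=d\cdot f(e)$). *)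

theory Defs
  imports Complex_Main "HOL-Library.Function_Algebras"
begin

section \<open>Tensor products\<close>

text \<open>
  A vector space over the field \<open>'k\<close> is an abelian group type \<open>'v\<close> together with a scalar
  multiplication \<open>s\<close> such that \<open>vector_space s\<close>.  Over a field the canonical map from
  \<open>V \<otimes> W\<close> to the bilinear forms on \<open>V\<^sup>* \<times> W\<^sup>*\<close> is injective, so \<open>V \<otimes> W\<close> is realised
  as the linear span of the functions \<open>(\<phi>, \<psi>) \<mapsto> \<phi> v * \<psi> w\<close> on pairs of linear functionals
  (set to \<open>0\<close> on pairs that are not linear).  Likewise the tensor algebra \<open>T(V)\<close> is the span of
  functions on lists of linear functionals, \<open>V\<^sup>\<otimes>\<^sup>n\<close> being spanned by the \<open>tpow s vs\<close> with
  \<open>length vs = n\<close>.  The universal properties are the lemmas \<open>tens_universal\<close> and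
  \<open>tpow_universal\<close> below.
\<close>

type_synonym ('k, 'v, 'w) tensor = "('v \<Rightarrow> 'k) \<times> ('w \<Rightarrow> 'k) \<Rightarrow> 'k"
type_synonym ('k, 'v) tensor_power = "('v \<Rightarrow> 'k) list \<Rightarrow> 'k"

definition fscale :: "'k::field \<Rightarrow> ('x \<Rightarrow> 'k) \<Rightarrow> 'x \<Rightarrow> 'k" where
  "fscale a f = (\<lambda>x. a * f x)"

definition functional :: "('k::field \<Rightarrow> 'v::ab_group_add \<Rightarrow> 'v) \<Rightarrow> ('v \<Rightarrow> 'k) \<Rightarrow> bool" where
  "functional s \<phi> \<longleftrightarrow> Vector_Spaces.linear s (*) \<phi>"

definition tens ::
  "('k::field \<Rightarrow> 'v::ab_group_add \<Rightarrow> 'v) \<Rightarrow> ('k \<Rightarrow> 'w::ab_group_add \<Rightarrow> 'w) \<Rightarrow>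
   'v \<Rightarrow> 'w \<Rightarrow> ('k, 'v, 'w) tensor" where
  "tens s t v w = (\<lambda>(\<phi>, \<psi>). if functional s \<phi> \<and> functional t \<psi> then \<phi> v * \<psi> w else 0)"

definition tpow ::
  "('k::field \<Rightarrow> 'v::ab_group_add \<Rightarrow> 'v) \<Rightarrow> 'v list \<Rightarrow> ('k, 'v) tensor_power" where
  "tpow s vs = (\<lambda>\<phi>s. if length \<phi>s = length vs \<and> (\<forall>\<phi>\<in>set \<phi>s. functional s \<phi>)
                      then \<Prod>i<length vs. (\<phi>s ! i) (vs ! i) else 0)"

text \<open>
  \<open>lin_ext s t G\<close> is a linear map with prescribed values: \<open>G\<close> is the set of pairs
  (argument, value).  It is only ever evaluated on the span of the arguments occurring in \<open>G\<close>,
  where it is unique; it exists whenever the values depend multilinearly on the tensor factors.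
\<close>

definition lin_ext ::
  "('k::field \<Rightarrow> 'x::ab_group_add \<Rightarrow> 'x) \<Rightarrow> ('k \<Rightarrow> 'y::ab_group_add \<Rightarrow> 'y) \<Rightarrow>
   ('x \<times> 'y) set \<Rightarrow> 'x \<Rightarrow> 'y" where
  "lin_ext s t G = (SOME F. Vector_Spaces.linear s t F \<and> (\<forall>(x, y)\<in>G. F x = y))"

lemma vector_space_fscale: "vector_space (fscale :: 'k::field \<Rightarrow> ('x \<Rightarrow> 'k) \<Rightarrow> 'x \<Rightarrow> 'k)"
  by (simp add: vector_space_def fscale_def fun_eq_iff algebra_simps)

lemma functional_add: "functional s \<phi> \<Longrightarrow> \<phi> (x + y) = \<phi> x + \<phi> y"
  and functional_scale: "functional s \<phi> \<Longrightarrow> \<phi> (s a x) = a * \<phi> x"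
  by (auto simp: functional_def Vector_Spaces.linear_iff)

lemma linear_tens_left:
  assumes "vector_space s"
  shows "Vector_Spaces.linear s fscale (\<lambda>v. tens s t v w)"
  using assms vector_space_fscale
  by (auto simp: Vector_Spaces.linear_iff tens_def fscale_def fun_eq_iff functional_add
      functional_scale algebra_simps)

lemma linear_tens_right:
  assumes "vector_space t"
  shows "Vector_Spaces.linear t fscale (\<lambda>w. tens s t v w)"
  using assms vector_space_fscale
  by (auto simp: Vector_Spaces.linear_iff tens_def fscale_def fun_eq_iff functional_add
      functional_scale algebra_simps)

lemma linear_tpow:
  assumes "vector_space s"
  shows "Vector_Spaces.linear s fscale (\<lambda>v. tpow s (us @ v # ws))"
proof -
  have "\<exists>K. \<forall>v. (\<Prod>i<Suc (length us + length ws). (\<phi>s ! i) ((us @ v # ws) ! i)) =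
      (\<phi>s ! length us) v * K" for \<phi>s :: "('b \<Rightarrow> 'a) list"
  proof (intro exI allI)
    fix v
    let ?I = "{..<Suc (length us + length ws)}"
    have "(\<Prod>i\<in>?I. (\<phi>s ! i) ((us @ v # ws) ! i)) =
        (\<phi>s ! length us) v * (\<Prod>i\<in>?I - {length us}. (\<phi>s ! i) ((us @ v # ws) ! i))"
      by (subst prod.remove[of _ "length us"]) auto
    also have "(\<Prod>i\<in>?I - {length us}. (\<phi>s ! i) ((us @ v # ws) ! i)) =
        (\<Prod>i\<in>?I - {length us}. (\<phi>s ! i) ((us @ 0 # ws) ! i))"
      by (intro prod.cong) (auto simp: nth_append nth_Cons')
    finally show "(\<Prod>i\<in>?I. (\<phi>s ! i) ((us @ v # ws) ! i)) =
        (\<phi>s ! length us) v * (\<Prod>i\<in>?I - {length us}. (\<phi>s ! i) ((us @ 0 # ws) ! i))" .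
  qed
  then have "\<forall>\<phi>s :: ('b \<Rightarrow> 'a) list. \<exists>K. \<forall>v. (\<Prod>i<Suc (length us + length ws). (\<phi>s ! i) ((us @ v # ws) ! i)) =
      (\<phi>s ! length us) v * K" by blast
  from choice[OF this] obtain K where split: "\<And>(\<phi>s :: ('b \<Rightarrow> 'a) list) v. (\<Prod>i<Suc (length us + length ws). (\<phi>s ! i) ((us @ v # ws) ! i)) =
      (\<phi>s ! length us) v * K \<phi>s"
    by blast
  have len: "length (us @ v # ws) = Suc (length us + length ws)" for v by simp
  have fn: "functional s (\<phi>s ! length us)"
    if "length \<phi>s = Suc (length us + length ws)" "\<forall>\<phi>\<in>set \<phi>s. functional s \<phi>" for \<phi>s
    using that by simp
  then show ?thesis
    using assms vector_space_fscale unfolding tpow_def len split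
    by (auto simp: Vector_Spaces.linear_iff fscale_def fun_eq_iff functional_add[OF fn]
        functional_scale[OF fn] algebra_simps)
qed

lemma ex_linear_of_dual_family:
  fixes x :: "'i \<Rightarrow> 'y \<Rightarrow> 'k::field" and u :: "'k \<Rightarrow> 'u::ab_group_add \<Rightarrow> 'u"
  assumes u: "vector_space u"
    and dual: "\<And>i j. i \<in> I \<Longrightarrow> j \<in> I \<Longrightarrow> x i (p j) = (if i = j then 1 else 0)"
  shows "\<exists>F. Vector_Spaces.linear fscale u F \<and> (\<forall>i\<in>I. F (x i) = g i)"
proof -
  interpret V: vector_space_pair "fscale :: 'k \<Rightarrow> ('y \<Rightarrow> 'k) \<Rightarrow> 'y \<Rightarrow> 'k" u
    using u vector_space_fscale by (simp add: vector_space_pair_def)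
  have inj: "inj_on x I"
    by (rule inj_onI) (metis dual zero_neq_one)
  have sum_ev: "(\<Sum>v\<in>T. f v) q = (\<Sum>v\<in>T. f v q)" for T :: "('y \<Rightarrow> 'k) set" and f q
    by (induction T rule: infinite_finite_induct) auto
  have "V.vs1.independent (x ` I)"
    unfolding V.vs1.independent_explicit_module
  proof (intro allI impI)
    fix T c v
    assume T: "finite T" "T \<subseteq> x ` I" and 0: "(\<Sum>v\<in>T. fscale (c v) v) = 0" and "v \<in> T"
    then obtain i where i: "i \<in> I" "v = x i" by auto
    have "(\<Sum>w\<in>T. c w * w (p i)) = 0"
      using fun_cong[OF 0, of "p i"] by (simp add: sum_ev fscale_def)
    also have "(\<Sum>w\<in>T. c w * w (p i)) = (\<Sum>w\<in>T. if w = v then c w else 0)"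
      using T i inj by (intro sum.cong) (auto simp: dual inj_on_eq_iff)
    also have "\<dots> = c v" using T \<open>v \<in> T\<close> by simp
    finally show "c v = 0" .
  qed
  from V.linear_independent_extend[OF this, of "\<lambda>y. g (inv_into I x y)"] inj
  show ?thesis by auto
qed

lemma dual_basis:
  fixes s :: "'k::field \<Rightarrow> 'v::ab_group_add \<Rightarrow> 'v"
  assumes "vector_space s"
  obtains B d where "module.span s B = UNIV" "\<And>b. functional s (d b)"
    "\<And>b b'. b \<in> B \<Longrightarrow> b' \<in> B \<Longrightarrow> d b b' = (if b = b' then 1 else 0)"
proof -
  interpret vector_space s by fact
  define B where "B = extend_basis {}"
  have B: "independent B" "span B = UNIV"
    unfolding B_def by (simp_all add: independent_extend_basis span_extend_basis independent_empty)
  have "vector_space ((*) :: 'k \<Rightarrow> 'k \<Rightarrow> 'k)"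
    by unfold_locales (auto simp: algebra_simps)
  then have "functional s (\<lambda>v. representation B v b)" for b
    using B vector_space_axioms
    by (simp add: functional_def Vector_Spaces.linear_iff representation_add representation_scale)
  moreover have "representation B b' b = (if b = b' then 1 else 0)" if "b' \<in> B" for b b'
    using representation_basis[OF B(1) that] by auto
  ultimately show thesis using that[of B "\<lambda>b v. representation B v b"] B by auto
qed

lemma linear_eqI:
  assumes "Vector_Spaces.linear s t f" "Vector_Spaces.linear s t g"
    and "module.span s B = UNIV" "\<And>b. b \<in> B \<Longrightarrow> f b = g b"
  shows "f x = g x"
proof -
  interpret vector_space_pair s t
    using assms(1) by (simp add: Vector_Spaces.linear_iff vector_space_pair_def)
  show ?thesis using assms by (intro linear_eq_on[of f g x B]) auto
qed

lemma tens_universal: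
  fixes s :: "'k::field \<Rightarrow> 'v::ab_group_add \<Rightarrow> 'v" and t :: "'k \<Rightarrow> 'w::ab_group_add \<Rightarrow> 'w"
    and u :: "'k \<Rightarrow> 'u::ab_group_add \<Rightarrow> 'u"
  assumes left: "\<And>w. Vector_Spaces.linear s u (\<lambda>v. b v w)"
    and right: "\<And>v. Vector_Spaces.linear t u (b v)"
  shows "\<exists>F. Vector_Spaces.linear fscale u F \<and> (\<forall>v w. F (tens s t v w) = b v w)"
proof -
  have vs: "vector_space s" "vector_space t" "vector_space u"
    using left right by (auto simp: Vector_Spaces.linear_iff)
  obtain B d where B: "module.span s B = UNIV" "\<And>b. functional s (d b)"
    "\<And>b b'. b \<in> B \<Longrightarrow> b' \<in> B \<Longrightarrow> d b b' = (if b = b' then 1 else 0)"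
    using dual_basis[OF vs(1)] by blast
  obtain B' d' where B': "module.span t B' = UNIV" "\<And>b. functional t (d' b)"
    "\<And>b b'. b \<in> B' \<Longrightarrow> b' \<in> B' \<Longrightarrow> d' b b' = (if b = b' then 1 else 0)"
    using dual_basis[OF vs(2)] by blast
  obtain F where F: "Vector_Spaces.linear fscale u F"
    "\<And>x. x \<in> B \<times> B' \<Longrightarrow> F (tens s t (fst x) (snd x)) = b (fst x) (snd x)"
    using ex_linear_of_dual_family[OF vs(3), of "B \<times> B'" "\<lambda>x. tens s t (fst x) (snd x)"
        "\<lambda>x. (d (fst x), d' (snd x))" "\<lambda>x. b (fst x) (snd x)"] B B'
    by (fastforce simp: tens_def)
  have Fl: "Vector_Spaces.linear s u (\<lambda>v. F (tens s t v w))" for w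
    using Vector_Spaces.linear_compose[OF linear_tens_left F(1)] vs by (simp add: o_def)
  have Fr: "Vector_Spaces.linear t u (\<lambda>w. F (tens s t v w))" for v
    using Vector_Spaces.linear_compose[OF linear_tens_right F(1)] vs by (simp add: o_def)
  have "F (tens s t v w) = b v w" if "v \<in> B" for v w
    by (rule linear_eqI[OF Fr right B'(1)]) (use F(2) that in force)
  then have "F (tens s t v w) = b v w" for v w
    by (rule linear_eqI[OF Fl left B(1)])
  with F(1) show ?thesis by blast
qed

lemma tpow_universal:
  fixes s :: "'k::field \<Rightarrow> 'v::ab_group_add \<Rightarrow> 'v" and u :: "'k \<Rightarrow> 'u::ab_group_add \<Rightarrow> 'u"
  assumes multilinear: "\<And>us ws. Vector_Spaces.linear s u (\<lambda>v. m (us @ v # ws))"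
  shows "\<exists>F. Vector_Spaces.linear fscale u F \<and> (\<forall>vs. F (tpow s vs) = m vs)"
proof -
  have vs: "vector_space s" "vector_space u"
    using multilinear by (auto simp: Vector_Spaces.linear_iff)
  obtain B d where B: "module.span s B = UNIV" "\<And>b. functional s (d b)"
    "\<And>b b'. b \<in> B \<Longrightarrow> b' \<in> B \<Longrightarrow> d b b' = (if b = b' then 1 else 0)"
    using dual_basis[OF vs(1)] by blast
  have dual: "tpow s vs (map d ws) = (if vs = ws then 1 else 0)"
    if "vs \<in> lists B" "ws \<in> lists B" for vs ws
  proof (cases "length vs = length ws")
    case True
    have "tpow s vs (map d ws) = (\<Prod>i<length vs. if ws ! i = vs ! i then 1 else 0)"
      using that True B(2) by (auto simp: tpow_def in_lists_conv_set B(3) intro!: prod.cong)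
    also have "\<dots> = (if vs = ws then 1 else 0)"
    proof (cases "vs = ws")
      case False
      then obtain i where "i < length vs" "ws ! i \<noteq> vs ! i"
        using True by (metis nth_equalityI)
      then show ?thesis using False by (auto intro!: prod_zero bexI[of _ i])
    qed simp
    finally show ?thesis .
  qed (auto simp: tpow_def)
  obtain F where F: "Vector_Spaces.linear fscale u F"
    "\<And>vs. vs \<in> lists B \<Longrightarrow> F (tpow s vs) = m vs"
    using ex_linear_of_dual_family[OF vs(2), of "lists B" "tpow s" "map d" m] dual by blast
  have Fl: "Vector_Spaces.linear s u (\<lambda>v. F (tpow s (us @ v # ws)))" for us ws
    using Vector_Spaces.linear_compose[OF linear_tpow F(1)] vs by (simp add: o_def)
  have "F (tpow s (us @ vs)) = m (us @ vs)" if "us \<in> lists B" for us vs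
    using that
  proof (induction vs arbitrary: us)
    case Nil
    then show ?case by (simp add: F(2))
  next
    case (Cons v vs)
    have "F (tpow s (us @ b # vs)) = m (us @ b # vs)" if "b \<in> B" for b
      using Cons.IH[of "us @ [b]"] Cons.prems that by simp
    then show ?case
      by (rule linear_eqI[OF Fl multilinear B(1)])
  qed
  from this[of "[]"] F(1) show ?thesis by auto
qed

lemma lin_ext_unique:
  assumes "Vector_Spaces.linear s t F" "\<And>x y. (x, y) \<in> G \<Longrightarrow> F x = y"
    and x: "x \<in> module.span s (fst ` G)"
  shows "lin_ext s t G x = F x"
proof -
  have *: "Vector_Spaces.linear s t (lin_ext s t G) \<and> (\<forall>(x, y)\<in>G. lin_ext s t G x = y)"
    unfolding lin_ext_def by (rule someI[of _ F]) (use assms in auto)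
  interpret vector_space_pair s t
    using assms(1) by (simp add: Vector_Spaces.linear_iff vector_space_pair_def)
  show ?thesis
    by (rule linear_eq_on[OF _ assms(1) x]) (use * assms(2) in auto)
qed


section \<open>Graded coalgebras\<close>

text \<open>
  The underlying graded vector space is the direct sum of the subspaces \<open>gr C n\<close> of the type
  \<open>'v\<close>; this direct sum, \<open>carr C\<close>, need not be all of \<open>'v\<close>.  Linear maps are total functions
  on \<open>'v\<close> (every linear map on a subspace extends), and all axioms are imposed on \<open>carr C\<close> only.
\<close>

record ('k, 'v) coalg =
  scl :: "'k \<Rightarrow> 'v \<Rightarrow> 'v"
  gr  :: "nat \<Rightarrow> 'v set"
  cop :: "'v \<Rightarrow> ('k, 'v, 'v) tensor"
  cou :: "'v \<Rightarrow> 'k"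

definition carr :: "('k::field, 'v::ab_group_add) coalg \<Rightarrow> 'v set" where
  "carr C = module.span (scl C) (\<Union>n. gr C n)"

definition graded_space :: "('k::field, 'v::ab_group_add) coalg \<Rightarrow> bool" where
  "graded_space C \<longleftrightarrow>
     vector_space (scl C) \<and>
     (\<forall>n. module.subspace (scl C) (gr C n)) \<and>
     (\<forall>v N. (\<forall>n. v n \<in> gr C n) \<and> (\<Sum>n\<le>N. v n) = 0 \<longrightarrow> (\<forall>n\<le>N. v n = 0))"

definition tens_gr :: "('k::field, 'v::ab_group_add) coalg \<Rightarrow> nat \<Rightarrow> ('k, 'v, 'v) tensor set" where
  "tens_gr C n = module.span fscale
     {tens (scl C) (scl C) a b | a b i j. a \<in> gr C i \<and> b \<in> gr C j \<and> i + j = n}"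

definition tmap ::
  "('k::field, 'v::ab_group_add) coalg \<Rightarrow> ('k \<Rightarrow> 'w::ab_group_add \<Rightarrow> 'w) \<Rightarrow>
   ('k \<Rightarrow> 'u::ab_group_add \<Rightarrow> 'u) \<Rightarrow> ('v \<Rightarrow> 'w) \<Rightarrow> ('v \<Rightarrow> 'u) \<Rightarrow>
   ('k, 'v, 'v) tensor \<Rightarrow> ('k, 'w, 'u) tensor" where
  "tmap C s t f g = lin_ext fscale fscale
     {(tens (scl C) (scl C) a b, tens s t (f a) (g b)) | a b. a \<in> carr C \<and> b \<in> carr C}"

definition associator ::
  "('k::field, 'v::ab_group_add) coalg \<Rightarrow>
   ('k, ('k, 'v, 'v) tensor, 'v) tensor \<Rightarrow> ('k, 'v, ('k, 'v, 'v) tensor) tensor" where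
  "associator C = lin_ext fscale fscale
     {(tens fscale (scl C) (tens (scl C) (scl C) a b) c,
       tens (scl C) fscale a (tens (scl C) (scl C) b c)) | a b c.
        a \<in> carr C \<and> b \<in> carr C \<and> c \<in> carr C}"

definition graded_coalgebra :: "('k::field, 'v::ab_group_add) coalg \<Rightarrow> bool" where
  "graded_coalgebra C \<longleftrightarrow>
     graded_space C \<and>
     Vector_Spaces.linear (scl C) fscale (cop C) \<and>
     Vector_Spaces.linear (scl C) (*) (cou C) \<and>
     (\<forall>n. \<forall>c\<in>gr C n. cop C c \<in> tens_gr C n) \<and>
     (\<forall>n>0. \<forall>c\<in>gr C n. cou C c = 0) \<and>
     (\<forall>c\<in>carr C. associator C (tmap C fscale (scl C) (cop C) id (cop C c)) =
                   tmap C (scl C) fscale id (cop C) (cop C c)) \<and>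
     (\<forall>c\<in>carr C. lin_ext fscale (scl C)
        {(tens (scl C) (scl C) a b, scl C (cou C a) b) | a b. a \<in> carr C \<and> b \<in> carr C}
        (cop C c) = c) \<and>
     (\<forall>c\<in>carr C. lin_ext fscale (scl C)
        {(tens (scl C) (scl C) a b, scl C (cou C b) a) | a b. a \<in> carr C \<and> b \<in> carr C}
        (cop C c) = c)"

text \<open>\<open>\<C>\<^sub>0 = \<K>\<close> means that \<open>\<C>\<^sub>0\<close> is one-dimensional.\<close>

definition connected_coalgebra :: "('k::field, 'v::ab_group_add) coalg \<Rightarrow> bool" where
  "connected_coalgebra C \<longleftrightarrow> graded_coalgebra C \<and> vector_space.dim (scl C) (gr C 0) = 1"

definition one :: "('k::field, 'v::ab_group_add) coalg \<Rightarrow> 'v" where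
  "one C = (THE u. u \<in> gr C 0 \<and> cou C u = 1)"

definition coalgebra_morphism ::
  "('k::field, 'v::ab_group_add) coalg \<Rightarrow> ('k, 'w::ab_group_add) coalg \<Rightarrow> ('v \<Rightarrow> 'w) \<Rightarrow> bool" where
  "coalgebra_morphism C D f \<longleftrightarrow>
     Vector_Spaces.linear (scl C) (scl D) f \<and>
     (\<forall>n. \<forall>c\<in>gr C n. f c \<in> gr D n) \<and>
     (\<forall>c\<in>carr C. tmap C (scl D) (scl D) f f (cop C c) = cop D (f c)) \<and>
     (\<forall>c\<in>carr C. cou D (f c) = cou C c)"

text \<open>
  The iterated coproduct \<open>\<Delta>\<^sup>(\<^sup>n\<^sup>)\<close>, with values in the \<open>(n+1)\<close>-st tensor power:
  \<open>\<Delta>\<^sup>(\<^sup>0\<^sup>) = id\<close> and \<open>\<Delta>\<^sup>(\<^sup>n\<^sup>+\<^sup>1\<^sup>) = (id \<otimes> \<Delta>\<^sup>(\<^sup>n\<^sup>)) \<circ> \<Delta>\<close>.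
\<close>

definition tprepend ::
  "('k::field, 'v::ab_group_add) coalg \<Rightarrow> 'v \<Rightarrow> ('k, 'v) tensor_power \<Rightarrow> ('k, 'v) tensor_power" where
  "tprepend C c = lin_ext fscale fscale
     {(tpow (scl C) cs, tpow (scl C) (c # cs)) | cs. set cs \<subseteq> carr C}"

fun iter_cop ::
  "('k::field, 'v::ab_group_add) coalg \<Rightarrow> nat \<Rightarrow> 'v \<Rightarrow> ('k, 'v) tensor_power" where
  "iter_cop C 0 c = tpow (scl C) [c]"
| "iter_cop C (Suc n) c = lin_ext fscale fscale
     {(tens (scl C) (scl C) a b, tprepend C a (iter_cop C n b)) | a b. a \<in> carr C \<and> b \<in> carr C}
     (cop C c)"

text \<open>The component of \<open>x \<in> C \<otimes> C\<close> in \<open>C\<^sub>i \<otimes> C\<^sub>j\<close>.\<close>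

definition tcomponent ::
  "('k::field, 'v::ab_group_add) coalg \<Rightarrow> nat \<Rightarrow> nat \<Rightarrow> ('k, 'v, 'v) tensor \<Rightarrow> ('k, 'v, 'v) tensor" where
  "tcomponent C i j = lin_ext fscale fscale
     {(tens (scl C) (scl C) a b, if k = i \<and> l = j then tens (scl C) (scl C) a b else 0) | a b k l.
        a \<in> gr C k \<and> b \<in> gr C l}"


section \<open>Composition of graded coalgebras\<close>

type_synonym ('k, 'd, 'c) composite = "('k, 'd, ('k, 'c) tensor_power) tensor"

text \<open>\<open>circ D C d [c\<^sub>0, \<dots>, c\<^sub>n]\<close> is \<open>d \<circ> (c\<^sub>0 \<cdot> \<dots> \<cdot> c\<^sub>n)\<close>, an element of \<open>D\<^sub>n \<otimes> C\<^sup>\<otimes>\<^sup>(\<^sup>n\<^sup>+\<^sup>1\<^sup>)\<close>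
  if \<open>d \<in> D\<^sub>n\<close>.\<close>

definition circ ::
  "('k::field, 'd::ab_group_add) coalg \<Rightarrow> ('k, 'c::ab_group_add) coalg \<Rightarrow>
   'd \<Rightarrow> 'c list \<Rightarrow> ('k, 'd, 'c) composite" where
  "circ D C d cs = tens (scl D) fscale d (tpow (scl C) cs)"

definition homs :: "('k::field, 'c::ab_group_add) coalg \<Rightarrow> 'c list \<Rightarrow> nat list \<Rightarrow> bool" where
  "homs C cs js \<longleftrightarrow> list_all2 (\<lambda>c j. c \<in> gr C j) cs js"

text \<open>For \<open>d \<in> D\<^sub>n\<close> and \<open>cs = [c\<^sub>0, \<dots>, c\<^sub>n]\<close>.\<close>

definition circ_cop ::
  "('k::field, 'd::ab_group_add) coalg \<Rightarrow> ('k, 'c::ab_group_add) coalg \<Rightarrow> nat \<Rightarrow> 'd \<Rightarrow> 'c list \<Rightarrow>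
   ('k, ('k, 'd, 'c) composite, ('k, 'd, 'c) composite) tensor" where
  "circ_cop D C n d cs = (\<Sum>i\<le>n. lin_ext fscale fscale
     {(tens (scl D) (scl D) d' d'', lin_ext fscale fscale
        {(tens (scl C) (scl C) c' c'',
          tens fscale fscale (circ D C d' (take i cs @ [c']))
                             (circ D C d'' (c'' # drop (Suc i) cs))) | c' c''.
            c' \<in> carr C \<and> c'' \<in> carr C}
        (cop C (cs ! i))) | d' d''. d' \<in> gr D i \<and> d'' \<in> gr D (n - i)}
     (tcomponent D i (n - i) (cop D d)))"

definition comp_coalg ::
  "('k::field, 'd::ab_group_add) coalg \<Rightarrow> ('k, 'c::ab_group_add) coalg \<Rightarrow>
   ('k, ('k, 'd, 'c) composite) coalg" where
  "comp_coalg D C =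
     \<lparr>scl = fscale,
      gr = (\<lambda>N. module.span fscale {circ D C d cs | d cs n js.
              d \<in> gr D n \<and> homs C cs js \<and> length cs = Suc n \<and> n + sum_list js = N}),
      cop = lin_ext fscale fscale {(circ D C d cs, circ_cop D C n d cs) | d cs n.
              d \<in> gr D n \<and> set cs \<subseteq> carr C \<and> length cs = Suc n},
      cou = lin_ext fscale (*) {(circ D C d cs, cou D d * (\<Prod>c\<leftarrow>cs. cou C c)) | d cs n.
              d \<in> gr D n \<and> set cs \<subseteq> carr C \<and> length cs = Suc n}\<rparr>"

text \<open>The map \<open>g \<circ> f : D \<circ> C \<rightarrow> D' \<circ> C'\<close> induced by maps \<open>g : D \<rightarrow> D'\<close> and \<open>f : C \<rightarrow> C'\<close>.\<close>

definition comp_map ::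
  "('k::field, 'd::ab_group_add) coalg \<Rightarrow> ('k, 'c::ab_group_add) coalg \<Rightarrow>
   ('k, 'd2::ab_group_add) coalg \<Rightarrow> ('k, 'c2::ab_group_add) coalg \<Rightarrow>
   ('d \<Rightarrow> 'd2) \<Rightarrow> ('c \<Rightarrow> 'c2) \<Rightarrow> ('k, 'd, 'c) composite \<Rightarrow> ('k, 'd2, 'c2) composite" where
  "comp_map D C D' C' g f = lin_ext fscale fscale
     {(circ D C d cs, circ D' C' (g d) (map f cs)) | d cs n.
        d \<in> gr D n \<and> set cs \<subseteq> carr C \<and> length cs = Suc n}"


section \<open>Graded Hopf operads\<close>

text \<open>\<open>\<gamma>(d \<otimes> d\<^sub>0 \<otimes> \<dots> \<otimes> d\<^sub>n)\<close> is \<open>\<gamma> (circ D D d [d\<^sub>0, \<dots>, d\<^sub>n])\<close>, and \<open>blocks\<close> expresses that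
  \<open>ess = [[e\<^sub>0\<^sub>,\<^sub>0, \<dots>, e\<^sub>0\<^sub>,\<^sub>j\<^sub>0], \<dots>, [e\<^sub>n\<^sub>,\<^sub>0, \<dots>, e\<^sub>n\<^sub>,\<^sub>j\<^sub>n]]\<close> for \<open>js = [j\<^sub>0, \<dots>, j\<^sub>n]\<close>.\<close>

definition blocks :: "('k::field, 'c::ab_group_add) coalg \<Rightarrow> 'c list list \<Rightarrow> nat list \<Rightarrow> bool" where
  "blocks C ess js \<longleftrightarrow> list_all2 (\<lambda>es j. length es = Suc j \<and> set es \<subseteq> carr C) ess js"

definition hopf_operad ::
  "('k::field, 'd::ab_group_add) coalg \<Rightarrow> (('k, 'd, 'd) composite \<Rightarrow> 'd) \<Rightarrow> bool" where
  "hopf_operad D \<gamma> \<longleftrightarrow>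
     connected_coalgebra D \<and>
     coalgebra_morphism (comp_coalg D D) D \<gamma> \<and>
     (\<forall>n js d ds ess. d \<in> gr D n \<and> length ds = Suc n \<and> homs D ds js \<and> blocks D ess js \<longrightarrow>
        \<gamma> (circ D D (\<gamma> (circ D D d ds)) (concat ess)) =
        \<gamma> (circ D D d (map2 (\<lambda>d\<^sub>i es\<^sub>i. \<gamma> (circ D D d\<^sub>i es\<^sub>i)) ds ess))) \<and>
     (\<forall>d\<in>carr D. \<gamma> (circ D D (one D) [d]) = d) \<and>
     (\<forall>n. \<forall>d\<in>gr D n. \<gamma> (circ D D d (replicate (Suc n) (one D))) = d)"

text \<open>The product \<open>a \<cdot> b = \<gamma>(b \<otimes> \<Delta>\<^sup>(\<^sup>|\<^sup>b\<^sup>|\<^sup>) a)\<close>, extended linearly from homogeneous \<open>b\<close>; the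
  tensor product with the tensor algebra accommodates \<open>D\<^sub>n \<otimes> D\<^sup>\<otimes>\<^sup>(\<^sup>n\<^sup>+\<^sup>1\<^sup>)\<close>.\<close>

definition operad_mult ::
  "('k::field, 'd::ab_group_add) coalg \<Rightarrow> (('k, 'd, 'd) composite \<Rightarrow> 'd) \<Rightarrow> 'd \<Rightarrow> 'd \<Rightarrow> 'd" where
  "operad_mult D \<gamma> a = lin_ext (scl D) (scl D)
     {(b, \<gamma> (tens (scl D) fscale b (iter_cop D n a))) | b n. b \<in> gr D n}"

definition mu_l ::
  "('k::field, 'd::ab_group_add) coalg \<Rightarrow> (('k, 'd, 'd) composite \<Rightarrow> 'd) \<Rightarrow>
   ('k, 'c::ab_group_add) coalg \<Rightarrow>
   ('k, 'd, ('k, 'd, 'c) composite) composite \<Rightarrow> ('k, 'd, 'c) composite" where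
  "mu_l D \<gamma> C = lin_ext fscale fscale
     {(circ D (comp_coalg D C) d (map2 (circ D C) ds css),
       circ D C (\<gamma> (circ D D d ds)) (concat css)) | d ds css n js.
        d \<in> gr D n \<and> length ds = Suc n \<and> homs D ds js \<and> blocks C css js}"

definition right_act ::
  "('k::field, 'd::ab_group_add) coalg \<Rightarrow> (('k, 'd, 'd) composite \<Rightarrow> 'd) \<Rightarrow>
   ('k, 'c::ab_group_add) coalg \<Rightarrow>
   ('k, 'd, 'c) composite \<Rightarrow> 'd \<Rightarrow> ('k, 'd, 'c) composite" where
  "right_act D \<gamma> C e = lin_ext (scl D) fscale
     {(d, mu_l D \<gamma> C (tens (scl D) fscale d (iter_cop (comp_coalg D C) n e))) | d n. d \<in> gr D n}"

definition mu_r ::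
  "('k::field, 'd::ab_group_add) coalg \<Rightarrow> (('k, 'd, 'd) composite \<Rightarrow> 'd) \<Rightarrow>
   ('k, 'c::ab_group_add) coalg \<Rightarrow>
   ('k, ('k, 'c, 'd) composite, ('k, 'd) tensor_power) tensor \<Rightarrow> ('k, 'c, 'd) composite" where
  "mu_r D \<gamma> C = lin_ext fscale fscale
     {(tens fscale fscale (circ C D c ds) (tpow (scl D) (concat dss)),
       circ C D c (map2 (\<lambda>d\<^sub>i ds\<^sub>i. \<gamma> (circ D D d\<^sub>i ds\<^sub>i)) ds dss)) | c ds dss m js.
        c \<in> gr C m \<and> length ds = Suc m \<and> homs D ds js \<and> blocks D dss js}"

definition left_act ::
  "('k::field, 'd::ab_group_add) coalg \<Rightarrow> (('k, 'd, 'd) composite \<Rightarrow> 'd) \<Rightarrow>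
   ('k, 'c::ab_group_add) coalg \<Rightarrow>
   'd \<Rightarrow> ('k, 'c, 'd) composite \<Rightarrow> ('k, 'c, 'd) composite" where
  "left_act D \<gamma> C d = lin_ext fscale fscale
     {(e, mu_r D \<gamma> C (tens fscale fscale e (iter_cop D n d))) | e n. e \<in> gr (comp_coalg C D) n}"


section \<open>Hopf algebras, module coalgebras and connections\<close>

definition graded_bilinear ::
  "('k::field, 'u::ab_group_add) coalg \<Rightarrow> ('k, 'v::ab_group_add) coalg \<Rightarrow>
   ('k, 'w::ab_group_add) coalg \<Rightarrow> ('u \<Rightarrow> 'v \<Rightarrow> 'w) \<Rightarrow> bool" where
  "graded_bilinear U V W m \<longleftrightarrow>
     (\<forall>x\<in>carr U. \<forall>x'\<in>carr U. \<forall>y\<in>carr V. m (x + x') y = m x y + m x' y) \<and>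
     (\<forall>x\<in>carr U. \<forall>y\<in>carr V. \<forall>y'\<in>carr V. m x (y + y') = m x y + m x y') \<and>
     (\<forall>a. \<forall>x\<in>carr U. \<forall>y\<in>carr V. m (scl U a x) y = scl W a (m x y)) \<and>
     (\<forall>a. \<forall>x\<in>carr U. \<forall>y\<in>carr V. m x (scl V a y) = scl W a (m x y)) \<and>
     (\<forall>i j. \<forall>x\<in>gr U i. \<forall>y\<in>gr V j. m x y \<in> gr W (i + j))"

text \<open>The operation \<open>(u\<^sub>1 \<otimes> u\<^sub>2, v\<^sub>1 \<otimes> v\<^sub>2) \<mapsto> m u\<^sub>1 v\<^sub>1 \<otimes> m u\<^sub>2 v\<^sub>2\<close>.\<close>

definition tens_op ::
  "('k::field, 'u::ab_group_add) coalg \<Rightarrow> ('k, 'v::ab_group_add) coalg \<Rightarrow>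
   ('k, 'w::ab_group_add) coalg \<Rightarrow> ('u \<Rightarrow> 'v \<Rightarrow> 'w) \<Rightarrow>
   ('k, 'u, 'u) tensor \<Rightarrow> ('k, 'v, 'v) tensor \<Rightarrow> ('k, 'w, 'w) tensor" where
  "tens_op U V W m x y = lin_ext fscale fscale
     {(tens (scl U) (scl U) u\<^sub>1 u\<^sub>2, lin_ext fscale fscale
         {(tens (scl V) (scl V) v\<^sub>1 v\<^sub>2, tens (scl W) (scl W) (m u\<^sub>1 v\<^sub>1) (m u\<^sub>2 v\<^sub>2)) | v\<^sub>1 v\<^sub>2.
            v\<^sub>1 \<in> carr V \<and> v\<^sub>2 \<in> carr V} y) | u\<^sub>1 u\<^sub>2.
        u\<^sub>1 \<in> carr U \<and> u\<^sub>2 \<in> carr U} x"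

text \<open>The convolution product of \<open>f, g : D \<rightarrow> D\<close>.\<close>

definition convolution ::
  "('k::field, 'd::ab_group_add) coalg \<Rightarrow> ('d \<Rightarrow> 'd \<Rightarrow> 'd) \<Rightarrow> ('d \<Rightarrow> 'd) \<Rightarrow> ('d \<Rightarrow> 'd) \<Rightarrow> 'd \<Rightarrow> 'd" where
  "convolution D m f g x = lin_ext fscale (scl D)
     {(tens (scl D) (scl D) a b, m (f a) (g b)) | a b. a \<in> carr D \<and> b \<in> carr D} (cop D x)"

definition antipode ::
  "('k::field, 'd::ab_group_add) coalg \<Rightarrow> ('d \<Rightarrow> 'd \<Rightarrow> 'd) \<Rightarrow> ('d \<Rightarrow> 'd) \<Rightarrow> bool" where
  "antipode D m S \<longleftrightarrow>
     Vector_Spaces.linear (scl D) (scl D) S \<and>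
     (\<forall>n. \<forall>x\<in>gr D n. S x \<in> gr D n) \<and>
     (\<forall>x\<in>carr D. convolution D m S id x = scl D (cou D x) (one D)) \<and>
     (\<forall>x\<in>carr D. convolution D m id S x = scl D (cou D x) (one D))"

text \<open>The unit of a connected graded Hopf algebra is a group-like element of degree \<open>0\<close>, hence
  equal to \<open>one D\<close>.\<close>

definition connected_hopf_algebra ::
  "('k::field, 'd::ab_group_add) coalg \<Rightarrow> ('d \<Rightarrow> 'd \<Rightarrow> 'd) \<Rightarrow> bool" where
  "connected_hopf_algebra D m \<longleftrightarrow>
     connected_coalgebra D \<and>
     graded_bilinear D D D m \<and>
     (\<forall>a\<in>carr D. \<forall>b\<in>carr D. \<forall>c\<in>carr D. m (m a b) c = m a (m b c)) \<and>
     (\<forall>a\<in>carr D. m (one D) a = a \<and> m a (one D) = a) \<and>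
     (\<forall>a\<in>carr D. \<forall>b\<in>carr D. cop D (m a b) = tens_op D D D m (cop D a) (cop D b)) \<and>
     (\<forall>a\<in>carr D. \<forall>b\<in>carr D. cou D (m a b) = cou D a * cou D b) \<and>
     cop D (one D) = tens (scl D) (scl D) (one D) (one D) \<and>
     cou D (one D) = 1 \<and>
     (\<exists>S. antipode D m S)"

definition right_module_coalgebra ::
  "('k::field, 'd::ab_group_add) coalg \<Rightarrow> ('d \<Rightarrow> 'd \<Rightarrow> 'd) \<Rightarrow>
   ('k, 'e::ab_group_add) coalg \<Rightarrow> ('e \<Rightarrow> 'd \<Rightarrow> 'e) \<Rightarrow> bool" where
  "right_module_coalgebra D m E act \<longleftrightarrow>
     graded_bilinear E D E act \<and>
     (\<forall>e\<in>carr E. \<forall>a\<in>carr D. \<forall>b\<in>carr D. act (act e a) b = act e (m a b)) \<and>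
     (\<forall>e\<in>carr E. act e (one D) = e) \<and>
     (\<forall>e\<in>carr E. \<forall>d\<in>carr D. cop E (act e d) = tens_op E D E act (cop E e) (cop D d))"

definition left_module_coalgebra ::
  "('k::field, 'd::ab_group_add) coalg \<Rightarrow> ('d \<Rightarrow> 'd \<Rightarrow> 'd) \<Rightarrow>
   ('k, 'e::ab_group_add) coalg \<Rightarrow> ('d \<Rightarrow> 'e \<Rightarrow> 'e) \<Rightarrow> bool" where
  "left_module_coalgebra D m E act \<longleftrightarrow>
     graded_bilinear D E E act \<and>
     (\<forall>e\<in>carr E. \<forall>a\<in>carr D. \<forall>b\<in>carr D. act a (act b e) = act (m a b) e) \<and>
     (\<forall>e\<in>carr E. act (one D) e = e) \<and>
     (\<forall>e\<in>carr E. \<forall>d\<in>carr D. cop E (act d e) = tens_op D E E act (cop D d) (cop E e))"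

definition right_connection ::
  "('k::field, 'd::ab_group_add) coalg \<Rightarrow> ('d \<Rightarrow> 'd \<Rightarrow> 'd) \<Rightarrow>
   ('k, 'e::ab_group_add) coalg \<Rightarrow> ('e \<Rightarrow> 'd \<Rightarrow> 'e) \<Rightarrow> ('e \<Rightarrow> 'd) \<Rightarrow> bool" where
  "right_connection D m E act f \<longleftrightarrow>
     connected_hopf_algebra D m \<and>
     connected_coalgebra E \<and>
     right_module_coalgebra D m E act \<and>
     coalgebra_morphism E D f \<and>
     (\<forall>e\<in>carr E. \<forall>d\<in>carr D. f (act e d) = m (f e) d)"

definition left_connection ::
  "('k::field, 'd::ab_group_add) coalg \<Rightarrow> ('d \<Rightarrow> 'd \<Rightarrow> 'd) \<Rightarrow>
   ('k, 'e::ab_group_add) coalg \<Rightarrow> ('d \<Rightarrow> 'e \<Rightarrow> 'e) \<Rightarrow> ('e \<Rightarrow> 'd) \<Rightarrow> bool" where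
  "left_connection D m E act f \<longleftrightarrow>
     connected_hopf_algebra D m \<and>
     connected_coalgebra E \<and>
     left_module_coalgebra D m E act \<and>
     coalgebra_morphism E D f \<and>
     (\<forall>e\<in>carr E. \<forall>d\<in>carr D. f (act d e) = m d (f e))"

definition f_r ::
  "('k::field, 'd::ab_group_add) coalg \<Rightarrow> (('k, 'd, 'd) composite \<Rightarrow> 'd) \<Rightarrow>
   ('k, 'c::ab_group_add) coalg \<Rightarrow> ('c \<Rightarrow> 'd) \<Rightarrow> ('k, 'd, 'c) composite \<Rightarrow> 'd" where
  "f_r D \<gamma> C l = \<gamma> \<circ> comp_map D C D D id l"

definition f_l ::
  "('k::field, 'd::ab_group_add) coalg \<Rightarrow> (('k, 'd, 'd) composite \<Rightarrow> 'd) \<Rightarrow>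
   ('k, 'c::ab_group_add) coalg \<Rightarrow> ('c \<Rightarrow> 'd) \<Rightarrow> ('k, 'c, 'd) composite \<Rightarrow> 'd" where
  "f_l D \<gamma> C l = \<gamma> \<circ> comp_map C D D D l id"

end

theory Submission
  imports Defs
begin

text \<open>
  Tensors are functions on functionals, so identities between tensors are read on the dual side.  A
  coproduct is the same thing as the convolution product \<open>\<phi> * \<psi> = (\<phi> \<otimes> \<psi>) \<circ> \<Delta>\<close> of functionals;
  coassociativity and counitality say that convolution is associative and unital, and a linear map is
  a map of coalgebras iff its transpose preserves degree, counit and convolution.  It is enough to
  test all this on a separating family of functionals (\<open>graded_coalgebraI\<close>, \<open>coalgebra_morphismI\<close>).
  The same idea produces the linear maps of the theory: values prescribed on a set of arguments extend
  linearly as soon as their composites with a separating family do (\<open>lin_ext_dual\<close>).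

  A composition \<open>D \<circ> C\<close> is separated by its points
  \<open>d \<circ> (c\<^sub>0 \<cdot> \<dots> \<cdot> c\<^sub>m) \<mapsto> \<delta>(d) \<phi>\<^sub>0(c\<^sub>0) \<dots> \<phi>\<^sub>n(c\<^sub>n)\<close>, which vanish for \<open>m \<noteq> n\<close>.  Its coproduct is dual to a
  product of points (\<open>conv_comp\<close>): the words \<open>\<phi>\<^sub>0 \<dots> \<phi>\<^sub>n\<close> and \<open>\<psi>\<^sub>0 \<dots> \<psi>\<^sub>k\<close> are glued to
  \<open>\<phi>\<^sub>0 \<dots> (\<phi>\<^sub>n * \<psi>\<^sub>0) \<dots> \<psi>\<^sub>k\<close> and the outer functionals are convolved.  From this rule \<open>D \<circ> C\<close> is a
  coalgebra, functorial in both arguments.  The two bracketings of a triple composition have the same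
  points, multiplied in the same way, hence they are isomorphic coalgebras.

  The product of \<open>D\<close> and both actions have the form \<open>\<rho>(x \<circ> \<Delta>\<^sup>(\<^sup>|\<^sup>x\<^sup>|\<^sup>) y)\<close> with a coalgebra map \<open>\<rho>\<close> on
  a composition.  In the universal case \<open>\<rho> = id\<close>, called \<open>spread\<close>, a point takes the value
  \<open>\<delta>(x) (\<phi>\<^sub>0 * \<dots> * \<phi>\<^sub>n)(y)\<close>.  Therefore \<open>spread\<close> is multiplicative for coproducts (\<open>cop_spread\<close>),
  natural (\<open>comp_map_spread\<close>) and compatible with rebracketing (\<open>assoc_spread\<close>).  So the axioms of a
  module coalgebra for an action reduce to associativity and unitality of \<open>\<rho>\<close> (\<open>right_module\<close>,
  \<open>left_module\<close>).  Now \<open>\<mu>\<^sub>l\<close> and \<open>\<mu>\<^sub>r\<close> are a rebracketing followed by \<open>\<gamma> \<circ> id\<close> and by \<open>id \<circ> \<gamma>\<close>; they are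
  coalgebra maps for that reason, and on generators their associativity is the associativity of \<open>\<gamma>\<close>.
  The case of \<open>\<gamma>\<close> itself makes \<open>D\<close> a bialgebra; since \<open>D\<close> is connected, the antipode is Takeuchi's
  geometric series (\<open>antipode_exists\<close>).

  Finally \<open>f\<^sub>r\<close> and \<open>f\<^sub>l\<close> are composites of coalgebra maps.  On generators associativity of \<open>\<gamma>\<close> gives
  \<open>f\<^sub>r \<mu>\<^sub>l = \<gamma> (id \<circ> f\<^sub>r)\<close> and \<open>f\<^sub>l \<mu>\<^sub>r = \<gamma> (f\<^sub>l \<circ> id)\<close>, and naturality of \<open>spread\<close> turns these equations into
  the statement that \<open>f\<^sub>r\<close> and \<open>f\<^sub>l\<close> commute with the actions.
\<close>


text \<open>Tensors are functions on pairs of functionals.  The pointwise rules for sums are restricted to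
  such pairs; applied to an unknown argument the simplifier would use them to eta-expand every sum
  of tensors.\<close>

declare plus_fun_apply [simp del] zero_fun_apply [simp del]

lemma pair_apply [simp]:
  "(f + g) (p, q) = f (p, q) + g (p, q)" "0 (p, q) = 0" "fscale a h (p, q) = a * h (p, q)"
  by (simp_all add: plus_fun_apply zero_fun_apply fscale_def)

section \<open>Linear maps and separating families of functionals\<close>

lemma vector_space_mult: "vector_space ((*) :: 'k::field \<Rightarrow> 'k \<Rightarrow> 'k)"
  by unfold_locales (auto simp: algebra_simps)

lemma linear_D:
  assumes "Vector_Spaces.linear s t f"
  shows "vector_space s" "vector_space t" "f (x + y) = f x + f y" "f (s a x) = t a (f x)"
  using assms by (auto simp: Vector_Spaces.linear_iff)

lemma linear_0: "Vector_Spaces.linear s t f \<Longrightarrow> f 0 = 0"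
  using linear_D(3)[of s t f 0 0] by simp

lemma linear_diff':
  assumes "Vector_Spaces.linear s t f" shows "f (x - y) = f x - f y"
  using linear_D(3)[OF assms, of "x - y" y] by simp

lemma linear_sum':
  assumes "Vector_Spaces.linear s t f" shows "f (\<Sum>i\<in>I. g i) = (\<Sum>i\<in>I. f (g i))"
  by (induction I rule: infinite_finite_induct)
    (simp_all add: linear_0[OF assms] linear_D(3)[OF assms])

lemma functional_0: "functional s \<phi> \<Longrightarrow> \<phi> 0 = 0"
  unfolding functional_def by (rule linear_0)

lemma functional_diff: "functional s \<phi> \<Longrightarrow> \<phi> (x - y) = \<phi> x - \<phi> y"
  unfolding functional_def by (rule linear_diff')

lemma functional_sum: "functional s \<phi> \<Longrightarrow> \<phi> (\<Sum>i\<in>I. g i) = (\<Sum>i\<in>I. \<phi> (g i))"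
  unfolding functional_def by (rule linear_sum')

lemma functionalI:
  assumes "vector_space s" "\<And>x y. \<phi> (x + y) = \<phi> x + \<phi> y" "\<And>a x. \<phi> (s a x) = a * \<phi> x"
  shows "functional s \<phi>"
  using assms vector_space_mult by (auto simp: functional_def Vector_Spaces.linear_iff)

lemma functional_comp:
  "Vector_Spaces.linear s t f \<Longrightarrow> functional t \<phi> \<Longrightarrow> functional s (\<phi> \<circ> f)"
  by (rule functionalI) (auto simp: linear_D functional_add functional_scale)

lemma linear_comp:
  "Vector_Spaces.linear s t f \<Longrightarrow> Vector_Spaces.linear t u g \<Longrightarrow> Vector_Spaces.linear s u (g \<circ> f)"
  by (rule Vector_Spaces.linear_compose)

lemma linear_ident: "vector_space s \<Longrightarrow> Vector_Spaces.linear s s (\<lambda>x. x)"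
  by (simp add: Vector_Spaces.linear_iff)

lemma linear_id: "vector_space s \<Longrightarrow> Vector_Spaces.linear s s id"
  by (simp add: Vector_Spaces.linear_iff)

lemma linear_zero_map:
  "vector_space s \<Longrightarrow> vector_space t \<Longrightarrow> Vector_Spaces.linear s t (\<lambda>x. 0)"
  by (simp add: Vector_Spaces.linear_iff module.scale_zero_right module_iff_vector_space)

lemma linear_add_map:
  assumes f: "Vector_Spaces.linear s t f" and g: "Vector_Spaces.linear s t g"
  shows "Vector_Spaces.linear s t (\<lambda>x. f x + g x)"
proof -
  interpret vector_space t by (rule linear_D(2)[OF f])
  show ?thesis
    using f g by (simp add: Vector_Spaces.linear_iff algebra_simps)
qed

lemma linear_scale_map:
  assumes f: "Vector_Spaces.linear s t f"
  shows "Vector_Spaces.linear s t (\<lambda>x. t a (f x))"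
proof -
  interpret vector_space t by (rule linear_D(2)[OF f])
  show ?thesis
    using f by (simp add: Vector_Spaces.linear_iff algebra_simps)
qed

lemma linear_sum_map:
  assumes s: "vector_space s" and t: "vector_space t"
    and f: "\<And>i. i \<in> I \<Longrightarrow> Vector_Spaces.linear s t (f i)"
  shows "Vector_Spaces.linear s t (\<lambda>x. \<Sum>i\<in>I. f i x)"
  using f
  by (induction I rule: infinite_finite_induct)
    (auto intro: linear_zero_map[OF s t] linear_add_map)

lemma span_ind [consumes 2, case_names zero add scale base]:
  assumes "vector_space s" "x \<in> module.span s A" "P 0"
    "\<And>x y. x \<in> module.span s A \<Longrightarrow> y \<in> module.span s A \<Longrightarrow> P x \<Longrightarrow> P y \<Longrightarrow> P (x + y)"
    "\<And>a x. x \<in> module.span s A \<Longrightarrow> P x \<Longrightarrow> P (s a x)"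
    "\<And>x. x \<in> A \<Longrightarrow> P x"
  shows "P x"
proof -
  interpret vector_space s by fact
  have "x \<in> span A \<and> P x"
    using assms(2)
  proof (induction rule: span_induct_alt)
    case base
    show ?case using assms(3) by (simp add: span_zero)
  next
    case (step c x y)
    then have "x \<in> span A" "P (s c x)" using assms(5,6) by (auto intro: span_base)
    then show ?case using step assms(4)[of "s c x" y] by (auto intro: span_add span_scale)
  qed
  then show ?thesis by simp
qed

lemma linear_eq_span:
  assumes "Vector_Spaces.linear s t f" "Vector_Spaces.linear s t g"
    "x \<in> module.span s A" "\<And>a. a \<in> A \<Longrightarrow> f a = g a"
  shows "f x = g x"
  using linear_D(1)[OF assms(1)] assms(3)
  by (induction rule: span_ind)
    (use assms in \<open>auto simp: linear_0[OF assms(1)] linear_0[OF assms(2)]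
      linear_D[OF assms(1)] linear_D[OF assms(2)]\<close>)

lemma linear_span_into:
  assumes "Vector_Spaces.linear s t f" "x \<in> module.span s A" "module.subspace t B"
    "\<And>a. a \<in> A \<Longrightarrow> f a \<in> B"
  shows "f x \<in> B"
proof -
  interpret vector_space t by (rule linear_D(2)[OF assms(1)])
  show ?thesis
    using linear_D(1)[OF assms(1)] assms(2)
    by (induction rule: span_ind)
      (use assms in \<open>auto simp: linear_0[OF assms(1)] linear_D[OF assms(1)]
        intro: subspace_0 subspace_add subspace_scale\<close>)
qed

lemma functional_eq_span:
  "functional s \<phi> \<Longrightarrow> functional s \<psi> \<Longrightarrow> x \<in> module.span s A \<Longrightarrow>
   (\<And>a. a \<in> A \<Longrightarrow> \<phi> a = \<psi> a) \<Longrightarrow> \<phi> x = \<psi> x"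
  unfolding functional_def by (rule linear_eq_span)

lemma subspace_spanI: "vector_space s \<Longrightarrow> module.subspace s (module.span s A)"
  by (simp add: module.subspace_span module_iff_vector_space)

lemma span_baseI: "vector_space s \<Longrightarrow> x \<in> A \<Longrightarrow> x \<in> module.span s A"
  by (simp add: module.span_base module_iff_vector_space)

lemma span_subset_subspace:
  "vector_space s \<Longrightarrow> module.subspace s B \<Longrightarrow> A \<subseteq> B \<Longrightarrow> module.span s A \<subseteq> B"
  by (simp add: module.span_minimal module_iff_vector_space)

definition ev :: "'x \<Rightarrow> ('x \<Rightarrow> 'k) \<Rightarrow> 'k" where
  "ev p f = f p"

lemma ev_pair_tens:
  "functional s \<phi> \<Longrightarrow> functional t \<psi> \<Longrightarrow> ev (\<phi>, \<psi>) (tens s t v w) = \<phi> v * \<psi> w"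
  by (simp add: ev_def tens_def)

lemma functional_ev [simp]: "functional fscale (ev p)"
  by (rule functionalI[OF vector_space_fscale]) (simp_all add: ev_def fscale_def plus_fun_apply)

text \<open>Equalities in a subspace \<open>A\<close> are tested on a family \<open>S\<close> of functionals that need not be all of
  the dual space; for tensor products the family of products of functionals suffices.\<close>

definition separates ::
  "('k::field \<Rightarrow> 'v::ab_group_add \<Rightarrow> 'v) \<Rightarrow> 'v set \<Rightarrow> ('v \<Rightarrow> 'k) set \<Rightarrow> bool" where
  "separates s A S \<longleftrightarrow>
     (\<forall>\<phi>\<in>S. functional s \<phi>) \<and> (\<forall>x\<in>A. (\<forall>\<phi>\<in>S. \<phi> x = 0) \<longrightarrow> x = 0)"

lemma separatesD: "separates s A S \<Longrightarrow> \<phi> \<in> S \<Longrightarrow> functional s \<phi>"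
  by (simp add: separates_def)

lemma separates_eqI:
  assumes "separates s A S" "module.subspace s A" "vector_space s" "x \<in> A" "y \<in> A"
    "\<And>\<phi>. \<phi> \<in> S \<Longrightarrow> \<phi> x = \<phi> y"
  shows "x = y"
proof -
  interpret vector_space s by fact
  have "x - y \<in> A" using assms by (intro subspace_diff)
  moreover have "\<phi> (x - y) = 0" if "\<phi> \<in> S" for \<phi>
    using assms(6)[OF that] functional_diff[OF separatesD[OF assms(1) that]] by simp
  ultimately have "x - y = 0" using assms(1) unfolding separates_def by blast
  then show ?thesis by simp
qed

lemma separates_mono: "separates s A S \<Longrightarrow> B \<subseteq> A \<Longrightarrow> separates s B S"
  by (auto simp: separates_def)

lemma separates_functionals:
  fixes s :: "'k::field \<Rightarrow> 'v::ab_group_add \<Rightarrow> 'v"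
  assumes "vector_space s"
  shows "separates s A {\<phi>. functional s \<phi>}"
proof -
  interpret vector_space s by fact
  have "x = 0" if 0: "\<And>\<phi>. functional s \<phi> \<Longrightarrow> \<phi> x = 0" for x
  proof (rule ccontr)
    assume "x \<noteq> 0"
    interpret P: vector_space_pair s "(*) :: 'k \<Rightarrow> 'k \<Rightarrow> 'k"
      using assms vector_space_mult by (simp add: vector_space_pair_def)
    have "independent {x}" using \<open>x \<noteq> 0\<close> by simp
    from P.linear_independent_extend[OF this, of "\<lambda>_. 1"] obtain \<phi> where
      "Vector_Spaces.linear s (*) \<phi>" "\<phi> x = 1" by auto
    then show False using 0[of \<phi>] by (simp add: functional_def)
  qed
  then show ?thesis by (auto simp: separates_def)
qed

lemma lin_ext_exists:
  assumes "Vector_Spaces.linear s t F" "\<And>x y. (x, y) \<in> G \<Longrightarrow> F x = y"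
  shows "Vector_Spaces.linear s t (lin_ext s t G)" "(x, y) \<in> G \<Longrightarrow> lin_ext s t G x = y"
proof -
  have *: "Vector_Spaces.linear s t (lin_ext s t G) \<and> (\<forall>(x, y)\<in>G. lin_ext s t G x = y)"
    unfolding lin_ext_def by (rule someI[of _ F]) (use assms in auto)
  then show "Vector_Spaces.linear s t (lin_ext s t G)" by simp
  show "(x, y) \<in> G \<Longrightarrow> lin_ext s t G x = y" using * by auto
qed

text \<open>Any linear relation between the arguments must hold between the values; the values lie in a
  space separated by \<open>S\<close>, and each \<open>\<psi> \<in> S\<close> respects the relation because \<open>\<psi>\<close> of the values is
  itself the restriction of a functional \<open>\<Lambda>\<close>.\<close>

lemma lin_ext_dual_exists:
  fixes s :: "'k::field \<Rightarrow> 'x::ab_group_add \<Rightarrow> 'x" and t :: "'k \<Rightarrow> 'y::ab_group_add \<Rightarrow> 'y"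
  assumes s: "vector_space s" and t: "vector_space t"
    and sep: "separates t (module.span t (snd ` G)) S"
    and dual: "\<And>\<psi>. \<psi> \<in> S \<Longrightarrow> \<exists>\<Lambda>. functional s \<Lambda> \<and> (\<forall>(x, y)\<in>G. \<Lambda> x = \<psi> y)"
  shows "\<exists>F. Vector_Spaces.linear s t F \<and> (\<forall>(x, y)\<in>G. F x = y)"
proof -
  interpret V: vector_space_pair s t using s t by (simp add: vector_space_pair_def)
  obtain B where B: "B \<subseteq> fst ` G" "V.vs1.independent B" "fst ` G \<subseteq> V.vs1.span B"
    by (rule V.vs1.maximal_independent_subset)
  define g where "g b = (SOME y. (b, y) \<in> G)" for b
  have g: "(b, g b) \<in> G" if "b \<in> B" for b
    using that B(1) unfolding g_def by (metis (no_types, lifting) imageE prod.collapse someI subsetD)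
  obtain F where F: "Vector_Spaces.linear s t F" "\<And>b. b \<in> B \<Longrightarrow> F b = g b"
    using V.linear_independent_extend[OF B(2), of g] by auto
  have "F x = y" if xy: "(x, y) \<in> G" for x y
  proof (rule separates_eqI[OF sep V.vs2.subspace_span t])
    have x: "x \<in> V.vs1.span B" using xy B(3) by force
    show "y \<in> V.vs2.span (snd ` G)" using xy by (force intro: V.vs2.span_base)
    show "F x \<in> V.vs2.span (snd ` G)"
      by (rule linear_span_into[OF F(1) x]) (auto simp: F(2) intro!: V.vs2.span_base image_eqI[OF _ g])
    fix \<psi> assume \<psi>: "\<psi> \<in> S"
    then obtain \<Lambda> where \<Lambda>: "functional s \<Lambda>" "\<And>x y. (x, y) \<in> G \<Longrightarrow> \<Lambda> x = \<psi> y"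
      using dual by blast
    have "(\<psi> \<circ> F) x = \<Lambda> x"
      by (rule functional_eq_span[OF functional_comp[OF F(1) separatesD[OF sep \<psi>]] \<Lambda>(1) x])
        (simp add: F(2) \<Lambda>(2)[OF g])
    then show "\<psi> (F x) = \<psi> y" using \<Lambda>(2)[OF xy] by simp
  qed
  then show ?thesis using F(1) by auto
qed

lemma lin_ext_dual:
  fixes s :: "'k::field \<Rightarrow> 'x::ab_group_add \<Rightarrow> 'x" and t :: "'k \<Rightarrow> 'y::ab_group_add \<Rightarrow> 'y"
  assumes "vector_space s" "vector_space t" "separates t (module.span t (snd ` G)) S"
    "\<forall>\<psi>\<in>S. \<exists>\<Lambda>. functional s \<Lambda> \<and> (\<forall>(x, y)\<in>G. \<Lambda> x = \<psi> y)"
  shows "Vector_Spaces.linear s t (lin_ext s t G)" "(x, y) \<in> G \<Longrightarrow> lin_ext s t G x = y"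
proof -
  obtain F where F: "Vector_Spaces.linear s t F" "\<forall>(x, y)\<in>G. F x = y"
    using lin_ext_dual_exists[OF assms(1-3) assms(4)[rule_format]] by blast
  from F(2) have F': "\<And>x y. (x, y) \<in> G \<Longrightarrow> F x = y" by auto
  show "Vector_Spaces.linear s t (lin_ext s t G)" "(x, y) \<in> G \<Longrightarrow> lin_ext s t G x = y"
    using lin_ext_exists[OF F(1) F'] by blast+
qed

lemma projection_exists:
  assumes "vector_space s" "module.subspace s A"
  shows "\<exists>P. Vector_Spaces.linear s s P \<and> (\<forall>x. P x \<in> A) \<and> (\<forall>x\<in>A. P x = x)"
proof -
  interpret vector_space_pair s s using assms by (simp add: vector_space_pair_def)
  show ?thesis
    using linear_exists_left_inverse_on[OF linear_ident[OF assms(1)] assms(2)] by auto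
qed

section \<open>Tensor products of subspaces\<close>

definition tspan ::
  "('k::field \<Rightarrow> 'v::ab_group_add \<Rightarrow> 'v) \<Rightarrow> 'v set \<Rightarrow> ('k \<Rightarrow> 'w::ab_group_add \<Rightarrow> 'w) \<Rightarrow> 'w set \<Rightarrow>
   ('k, 'v, 'w) tensor set" where
  "tspan s A t B = module.span fscale {tens s t a b | a b. a \<in> A \<and> b \<in> B}"

lemma subspace_tspan: "module.subspace fscale (tspan s A t B)"
  unfolding tspan_def by (rule subspace_spanI[OF vector_space_fscale])

lemma tens_in_tspan: "a \<in> A \<Longrightarrow> b \<in> B \<Longrightarrow> tens s t a b \<in> tspan s A t B"
  unfolding tspan_def by (rule span_baseI[OF vector_space_fscale]) auto

lemma tens_apply: "functional s \<phi> \<Longrightarrow> functional t \<psi> \<Longrightarrow> tens s t v w (\<phi>, \<psi>) = \<phi> v * \<psi> w"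
  by (simp add: tens_def)

lemma tspan_ind [consumes 1, case_names zero add scale tens]:
  assumes "x \<in> tspan s A t B" "P 0"
    "\<And>x y. x \<in> tspan s A t B \<Longrightarrow> y \<in> tspan s A t B \<Longrightarrow> P x \<Longrightarrow> P y \<Longrightarrow> P (x + y)"
    "\<And>a x. x \<in> tspan s A t B \<Longrightarrow> P x \<Longrightarrow> P (fscale a x)"
    "\<And>a b. a \<in> A \<Longrightarrow> b \<in> B \<Longrightarrow> P (tens s t a b)"
  shows "P x"
  using vector_space_fscale assms(1)[unfolded tspan_def]
proof (induction rule: span_ind)
  case (base x)
  then show ?case using assms(5) by blast
qed (use assms(2-4)[unfolded tspan_def] in blast)+

lemma tspan_not_functional:
  "x \<in> tspan s A t B \<Longrightarrow> \<not> (functional s \<phi> \<and> functional t \<psi>) \<Longrightarrow> x (\<phi>, \<psi>) = 0"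
  by (induction rule: tspan_ind) (auto simp: tens_def)

lemma tspan_cong:
  "x \<in> tspan s A t B \<Longrightarrow> functional s \<phi> \<Longrightarrow> functional t \<psi> \<Longrightarrow> functional s \<phi>' \<Longrightarrow>
   functional t \<psi>' \<Longrightarrow> (\<And>a. a \<in> A \<Longrightarrow> \<phi> a = \<phi>' a) \<Longrightarrow> (\<And>b. b \<in> B \<Longrightarrow> \<psi> b = \<psi>' b) \<Longrightarrow>
   x (\<phi>, \<psi>) = x (\<phi>', \<psi>')"
  by (induction rule: tspan_ind) (auto simp: tens_apply)

text \<open>Contraction with all but one tensor factor: if the values of generators are given by vectors of \<open>A\<close>,
  then so are the values of all their combinations.\<close>

lemma span_slice:
  assumes "vector_space s" "module.subspace s A" "x \<in> module.span fscale G"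
    and e: "\<And>\<phi>. functional fscale (e \<phi>)"
    and gen: "\<And>g. g \<in> G \<Longrightarrow> \<exists>v\<in>A. \<forall>\<phi>. functional s \<phi> \<longrightarrow> e \<phi> g = \<phi> v"
  shows "\<exists>v\<in>A. \<forall>\<phi>. functional s \<phi> \<longrightarrow> e \<phi> x = \<phi> v"
proof -
  interpret vector_space s by fact
  note lin = functional_0[OF e] functional_add[OF e] functional_scale[OF e]
  show ?thesis
    using vector_space_fscale assms(3)
  proof (induction rule: span_ind)
    case zero
    show ?case using subspace_0[OF assms(2)] by (intro bexI[of _ 0]) (auto simp: lin functional_0)
  next
    case (add x y)
    then obtain v w where "v \<in> A" "\<forall>\<phi>. functional s \<phi> \<longrightarrow> e \<phi> x = \<phi> v"
      "w \<in> A" "\<forall>\<phi>. functional s \<phi> \<longrightarrow> e \<phi> y = \<phi> w" by blast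
    then show ?case using subspace_add[OF assms(2)]
      by (intro bexI[of _ "v + w"]) (auto simp: lin functional_add)
  next
    case (scale a x)
    then obtain v where "v \<in> A" "\<forall>\<phi>. functional s \<phi> \<longrightarrow> e \<phi> x = \<phi> v" by blast
    then show ?case using subspace_scale[OF assms(2)]
      by (intro bexI[of _ "s a v"]) (auto simp: lin functional_scale)
  qed (rule gen)
qed

lemma tspan_slice_left:
  assumes "x \<in> tspan s A t B" "module.subspace s A" "vector_space s" "functional t \<psi>"
  shows "\<exists>v\<in>A. \<forall>\<phi>. functional s \<phi> \<longrightarrow> x (\<phi>, \<psi>) = \<phi> v"
proof -
  have "\<exists>v\<in>A. \<forall>\<phi>. functional s \<phi> \<longrightarrow> ev (\<phi>, \<psi>) x = \<phi> v"
  proof (rule span_slice[OF assms(3,2) assms(1)[unfolded tspan_def]])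
    fix g assume "g \<in> {tens s t a b | a b. a \<in> A \<and> b \<in> B}"
    then obtain a b where "g = tens s t a b" "a \<in> A" by blast
    moreover have "s (\<psi> b) a \<in> A" using module.subspace_scale assms(2,3) \<open>a \<in> A\<close> module_iff_vector_space by metis
    ultimately show "\<exists>v\<in>A. \<forall>\<phi>. functional s \<phi> \<longrightarrow> ev (\<phi>, \<psi>) g = \<phi> v"
      using assms(4) by (intro bexI[of _ "s (\<psi> b) a"]) (auto simp: ev_pair_tens functional_scale)
  qed simp
  then show ?thesis by (simp add: ev_def)
qed

lemma tspan_slice_right:
  assumes "x \<in> tspan s A t B" "module.subspace t B" "vector_space t" "functional s \<phi>"
  shows "\<exists>v\<in>B. \<forall>\<psi>. functional t \<psi> \<longrightarrow> x (\<phi>, \<psi>) = \<psi> v"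
proof -
  have "\<exists>v\<in>B. \<forall>\<psi>. functional t \<psi> \<longrightarrow> ev (\<phi>, \<psi>) x = \<psi> v"
  proof (rule span_slice[OF assms(3,2) assms(1)[unfolded tspan_def]])
    fix g assume "g \<in> {tens s t a b | a b. a \<in> A \<and> b \<in> B}"
    then obtain a b where "g = tens s t a b" "b \<in> B" by blast
    moreover have "t (\<phi> a) b \<in> B" using module.subspace_scale assms(2,3) \<open>b \<in> B\<close> module_iff_vector_space by metis
    ultimately show "\<exists>v\<in>B. \<forall>\<psi>. functional t \<psi> \<longrightarrow> ev (\<phi>, \<psi>) g = \<psi> v"
      using assms(4) by (intro bexI[of _ "t (\<phi> a) b"]) (auto simp: ev_pair_tens functional_scale)
  qed simp
  then show ?thesis by (simp add: ev_def)
qed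

abbreviation evs :: "('v \<Rightarrow> 'k) set \<Rightarrow> ('w \<Rightarrow> 'k) set \<Rightarrow> (('k, 'v, 'w) tensor \<Rightarrow> 'k) set" where
  "evs S T \<equiv> {ev (\<phi>, \<psi>) | \<phi> \<psi>. \<phi> \<in> S \<and> \<psi> \<in> T}"

text \<open>Testing on products of functionals suffices: contract the right factor and test the resulting
  vector on \<open>S\<close>, which replaces \<open>S\<close> by the full dual; then contract the left factor and test on \<open>T\<close>.\<close>

lemma separates_tspan:
  assumes s: "vector_space s" and t: "vector_space t"
    and A: "module.subspace s A" and B: "module.subspace t B"
    and S: "separates s A S" and T: "separates t B T"
  shows "separates fscale (tspan s A t B) (evs S T)"
  unfolding separates_def
proof (intro conjI ballI impI)
  fix x assume x: "x \<in> tspan s A t B" and "\<forall>\<xi>\<in>evs S T. \<xi> x = 0"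
  then have 0: "x (\<phi>, \<psi>) = 0" if "\<phi> \<in> S" "\<psi> \<in> T" for \<phi> \<psi>
    using that by (fastforce simp: ev_def)
  have 1: "x (\<phi>, \<psi>) = 0" if \<psi>: "\<psi> \<in> T" and \<phi>: "functional s \<phi>" for \<phi> \<psi>
  proof -
    obtain v where v: "v \<in> A" "\<And>\<phi>. functional s \<phi> \<Longrightarrow> x (\<phi>, \<psi>) = \<phi> v"
      using tspan_slice_left[OF x A s separatesD[OF T \<psi>]] by blast
    have "\<forall>\<phi>\<in>S. \<phi> v = 0" using 0[OF _ \<psi>] v(2)[OF separatesD[OF S]] by auto
    then have "v = 0" using S v(1) unfolding separates_def by blast
    then show ?thesis using v(2)[OF \<phi>] functional_0[OF \<phi>] by simp
  qed
  have 2: "x (\<phi>, \<psi>) = 0" if \<psi>: "functional t \<psi>" and \<phi>: "functional s \<phi>" for \<phi> \<psi>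
  proof -
    obtain v where v: "v \<in> B" "\<And>\<psi>. functional t \<psi> \<Longrightarrow> x (\<phi>, \<psi>) = \<psi> v"
      using tspan_slice_right[OF x B t \<phi>] by blast
    have "\<forall>\<psi>\<in>T. \<psi> v = 0" using 1[OF _ \<phi>] v(2)[OF separatesD[OF T]] by auto
    then have "v = 0" using T v(1) unfolding separates_def by blast
    then show ?thesis using v(2)[OF \<psi>] functional_0[OF \<psi>] by simp
  qed
  have "x p = 0" for p
    by (cases p) (metis 2 tspan_not_functional[OF x])
  then show "x = 0" by (simp add: fun_eq_iff zero_fun_apply)
qed auto

text \<open>The tensor product of two linear maps acts on functions by precomposition of the
  functionals, which makes sense on all functions.\<close>

definition tens_map ::
  "('k::field \<Rightarrow> 'w::ab_group_add \<Rightarrow> 'w) \<Rightarrow> ('k \<Rightarrow> 'u::ab_group_add \<Rightarrow> 'u) \<Rightarrow>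
   ('v \<Rightarrow> 'w) \<Rightarrow> ('z \<Rightarrow> 'u) \<Rightarrow> ('k, 'v, 'z) tensor \<Rightarrow> ('k, 'w, 'u) tensor" where
  "tens_map s t f g x =
     (\<lambda>(\<phi>, \<psi>). if functional s \<phi> \<and> functional t \<psi> then x (\<phi> \<circ> f, \<psi> \<circ> g) else 0)"

lemma linear_tens_map: "Vector_Spaces.linear fscale fscale (tens_map s t f g)"
  by (auto simp: Vector_Spaces.linear_iff vector_space_fscale tens_map_def fun_eq_iff)

lemma tens_map_tens:
  "Vector_Spaces.linear s' s f \<Longrightarrow> Vector_Spaces.linear t' t g \<Longrightarrow>
   tens_map s t f g (tens s' t' a b) = tens s t (f a) (g b)"
  by (auto simp: tens_map_def tens_def fun_eq_iff functional_comp)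

lemma tens_map_apply:
  "functional s \<phi> \<Longrightarrow> functional t \<psi> \<Longrightarrow> tens_map s t f g x (\<phi>, \<psi>) = x (\<phi> \<circ> f, \<psi> \<circ> g)"
  by (simp add: tens_map_def)

text \<open>If some explicit linear map already takes the prescribed values, the linear extension is that map on
  the span of the arguments.\<close>

lemma lin_ext_eq_span:
  assumes F: "Vector_Spaces.linear s t F" and G: "\<And>x y. (x, y) \<in> G \<Longrightarrow> F x = y"
    and x: "x \<in> module.span s A" and A: "\<And>a. a \<in> A \<Longrightarrow> \<exists>y. (a, y) \<in> G"
  shows "lin_ext s t G x = F x"
proof (rule linear_eq_span[OF lin_ext_exists(1)[OF F G] F x])
  fix a assume "a \<in> A"
  then obtain y where "(a, y) \<in> G" using A by blast
  then show "lin_ext s t G a = F a" using lin_ext_exists(2)[OF F G] G by simp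
qed

section \<open>Graded spaces\<close>

lemma graded_spaceD:
  assumes "graded_space C"
  shows "vector_space (scl C)" "module.subspace (scl C) (gr C n)"
    "\<And>v N. (\<And>n. v n \<in> gr C n) \<Longrightarrow> (\<Sum>n\<le>N. v n) = 0 \<Longrightarrow> n \<le> N \<Longrightarrow> v n = 0"
  using assms unfolding graded_space_def by blast+

lemma subspace_carr: "vector_space (scl C) \<Longrightarrow> module.subspace (scl C) (carr C)"
  unfolding carr_def by (rule subspace_spanI)

lemma gr_carr: "vector_space (scl C) \<Longrightarrow> c \<in> gr C n \<Longrightarrow> c \<in> carr C"
  unfolding carr_def by (rule span_baseI) auto

lemma carr_ind [consumes 2, case_names zero add scale gr]:
  assumes "vector_space (scl C)" "x \<in> carr C" "P 0"
    "\<And>x y. x \<in> carr C \<Longrightarrow> y \<in> carr C \<Longrightarrow> P x \<Longrightarrow> P y \<Longrightarrow> P (x + y)"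
    "\<And>a x. x \<in> carr C \<Longrightarrow> P x \<Longrightarrow> P (scl C a x)"
    "\<And>n x. x \<in> gr C n \<Longrightarrow> P x"
  shows "P x"
  using assms(1) assms(2)[unfolded carr_def]
proof (induction rule: span_ind)
  case (base x)
  then show ?case using assms(6) by blast
qed (use assms(3-5)[unfolded carr_def] in blast)+

lemma gr_inter_zero:
  assumes g: "graded_space C" and "x \<in> gr C m" "x \<in> gr C n" "m \<noteq> n"
  shows "x = 0"
proof -
  interpret vector_space "scl C" by (rule graded_spaceD(1)[OF g])
  note sub = graded_spaceD(2)[OF g]
  let ?v = "\<lambda>k. (if k = m then x else 0) + (if k = n then - x else 0)"
  have "?v k \<in> gr C k" for k
    using assms(2-4) by (auto intro: subspace_0[OF sub] subspace_neg[OF sub])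
  moreover have "(\<Sum>k\<le>m + n. ?v k) = 0"
    by (simp only: sum.distrib sum.delta finite_atMost) simp
  ultimately have "?v m = 0" using graded_spaceD(3)[OF g, of ?v "m + n" m] by simp
  then show ?thesis using \<open>m \<noteq> n\<close> by simp
qed

text \<open>The sum of the graded pieces is direct, so bases of the pieces are together linearly independent.\<close>

lemma graded_extension:
  fixes C :: "('k::field, 'v::ab_group_add) coalg"
  assumes g: "graded_space C" and t: "vector_space t"
    and F: "\<And>n. Vector_Spaces.linear (scl C) t (F n)"
  shows "\<exists>H. Vector_Spaces.linear (scl C) t H \<and> (\<forall>n. \<forall>x\<in>gr C n. H x = F n x)"
proof -
  interpret V: vector_space_pair "scl C" t
    using graded_spaceD(1)[OF g] t by (simp add: vector_space_pair_def)
  note sub = graded_spaceD(2)[OF g]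
  have "\<exists>B. B \<subseteq> gr C n \<and> V.vs1.independent B \<and> gr C n \<subseteq> V.vs1.span B" for n
    by (rule V.vs1.maximal_independent_subset[of "gr C n"]) blast
  then obtain B where B: "B n \<subseteq> gr C n" "V.vs1.independent (B n)" "gr C n \<subseteq> V.vs1.span (B n)" for n
    by metis
  have unique: "m = n" if "b \<in> B m" "b \<in> B n" for b m n
    using gr_inter_zero[OF g, of b m n] that B V.vs1.dependent_zero[of "B m"] by blast
  define deg where "deg b = (THE n. b \<in> B n)" for b
  have deg: "deg b = n" if "b \<in> B n" for b n
    unfolding deg_def using that unique by blast
  have "V.vs1.independent (\<Union>n. B n)"
    unfolding V.vs1.independent_explicit_module
  proof (intro allI impI)
    fix T c v
    assume T: "finite T" "T \<subseteq> (\<Union>n. B n)" and 0: "(\<Sum>b\<in>T. scl C (c b) b) = 0" and v: "v \<in> T"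
    define w where "w n = (\<Sum>b | b \<in> T \<and> deg b = n. scl C (c b) b)" for n
    have sub': "{b \<in> T. deg b = n} \<subseteq> B n" for n using T(2) deg by auto
    have w: "w n \<in> gr C n" for n
      unfolding w_def using sub'[of n] B(1)[of n]
      by (intro V.vs1.subspace_sum[OF sub] V.vs1.subspace_scale[OF sub]) auto
    define N where "N = Max (deg ` T)"
    have N: "deg b \<le> N" if "b \<in> T" for b using that T(1) by (simp add: N_def)
    have "(\<Sum>n\<le>N. w n) = (\<Sum>b\<in>T. scl C (c b) b)"
      unfolding w_def by (rule sum.group) (use T(1) N in auto)
    then have "w (deg v) = 0"
      using graded_spaceD(3)[OF g w, of N "deg v"] 0 N[OF v] by simp
    then show "c v = 0"
      unfolding w_def
      using V.vs1.independentD[OF B(2)[of "deg v"] _ sub'[of "deg v"]] T(1) v by simp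
  qed
  from V.linear_independent_extend[OF this, of "\<lambda>b. F (deg b) b"] obtain H where
    H: "Vector_Spaces.linear (scl C) t H" "\<And>n b. b \<in> B n \<Longrightarrow> H b = F n b"
    using deg by auto
  have "H x = F n x" if "x \<in> gr C n" for n x
    using linear_eq_span[OF H(1) F[of n], of x "B n"] that B(3)[of n] H(2) by blast
  with H(1) show ?thesis by blast
qed

definition proj :: "('k::field, 'v::ab_group_add) coalg \<Rightarrow> nat \<Rightarrow> 'v \<Rightarrow> 'v" where
  "proj C n = lin_ext (scl C) (scl C) {(x, if m = n then x else 0) | x m. x \<in> gr C m}"

lemma
  assumes g: "graded_space C"
  shows linear_proj: "Vector_Spaces.linear (scl C) (scl C) (proj C n)"
    and proj_gr: "x \<in> gr C m \<Longrightarrow> proj C n x = (if m = n then x else 0)"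
proof -
  have "Vector_Spaces.linear (scl C) (scl C) (\<lambda>x. if m = n then x else 0)" for m
    using linear_ident[OF graded_spaceD(1)[OF g]] linear_zero_map[OF graded_spaceD(1)[OF g] graded_spaceD(1)[OF g]]
    by (cases "m = n") simp_all
  from graded_extension[OF g graded_spaceD(1)[OF g], of "\<lambda>m x. if m = n then x else 0", OF this]
  obtain H where
    H: "Vector_Spaces.linear (scl C) (scl C) H" "\<And>m x. x \<in> gr C m \<Longrightarrow> H x = (if m = n then x else 0)"
    by blast
  show "Vector_Spaces.linear (scl C) (scl C) (proj C n)"
    unfolding proj_def by (rule lin_ext_exists(1)[OF H(1)]) (auto simp: H(2))
  show "x \<in> gr C m \<Longrightarrow> proj C n x = (if m = n then x else 0)"
    unfolding proj_def by (rule lin_ext_exists(2)[OF H(1)]) (auto simp: H(2))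
qed

lemma proj_in_gr:
  assumes g: "graded_space C" and x: "x \<in> carr C"
  shows "proj C n x \<in> gr C n"
proof -
  interpret vector_space "scl C" by (rule graded_spaceD(1)[OF g])
  show ?thesis
    by (rule linear_span_into[OF linear_proj[OF g] x[unfolded carr_def] graded_spaceD(2)[OF g]])
      (auto simp: proj_gr[OF g] subspace_0[OF graded_spaceD(2)[OF g]])
qed

lemma proj_sum:
  assumes g: "graded_space C" and x: "x \<in> carr C"
  shows "\<exists>N. \<forall>M\<ge>N. x = (\<Sum>n\<le>M. proj C n x)"
  using graded_spaceD(1)[OF g] x
proof (induction rule: carr_ind)
  case zero
  show ?case by (simp add: linear_0[OF linear_proj[OF g]])
next
  case (add x y)
  then obtain N N' where "\<forall>M\<ge>N. x = (\<Sum>n\<le>M. proj C n x)" "\<forall>M\<ge>N'. y = (\<Sum>n\<le>M. proj C n y)" by blast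
  then have "\<forall>M\<ge>max N N'. x + y = (\<Sum>n\<le>M. proj C n (x + y))"
    by (auto simp: linear_D(3)[OF linear_proj[OF g]] sum.distrib)
  then show ?case by blast
next
  case (scale a x)
  then obtain N where N: "\<forall>M\<ge>N. x = (\<Sum>n\<le>M. proj C n x)" by blast
  have "scl C a x = (\<Sum>n\<le>M. proj C n (scl C a x))" if "M \<ge> N" for M
  proof -
    have "scl C a x = scl C a (\<Sum>n\<le>M. proj C n x)" using N that by simp
    also have "\<dots> = (\<Sum>n\<le>M. scl C a (proj C n x))"
      by (rule linear_sum'[OF linear_scale_map[OF linear_ident[OF graded_spaceD(1)[OF g]]]])
    finally show ?thesis unfolding linear_D(4)[OF linear_proj[OF g]] .
  qed
  then show ?case by blast
next
  case (gr n x)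
  then show ?case
    by (intro exI[of _ n]) (simp add: proj_gr[OF g] if_distrib sum.delta cong: if_cong)
qed

lemma proj_eq_0:
  assumes "graded_space C" "x \<in> carr C" "\<And>n. proj C n x = 0"
  shows "x = 0"
  using proj_sum[OF assms(1,2)] assms(3) by (metis le_refl sum.neutral)

text \<open>The homogeneous functionals of degree \<open>n\<close>: the graded dual of \<open>C\<close> in degree \<open>n\<close>.\<close>

definition hfun :: "('k::field, 'v::ab_group_add) coalg \<Rightarrow> nat \<Rightarrow> ('v \<Rightarrow> 'k) \<Rightarrow> bool" where
  "hfun C n \<phi> \<longleftrightarrow> functional (scl C) \<phi> \<and> (\<forall>m x. m \<noteq> n \<longrightarrow> x \<in> gr C m \<longrightarrow> \<phi> x = 0)"

lemma hfunD: "hfun C n \<phi> \<Longrightarrow> functional (scl C) \<phi>" "hfun C n \<phi> \<Longrightarrow> x \<in> gr C m \<Longrightarrow> m \<noteq> n \<Longrightarrow> \<phi> x = 0"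
  by (auto simp: hfun_def)

lemma hfun_proj:
  assumes "graded_space C" "functional (scl C) \<phi>"
  shows "hfun C n (\<phi> \<circ> proj C n)"
  using assms by (auto simp: hfun_def proj_gr functional_0 intro: functional_comp linear_proj)

lemma separates_gr_hfun:
  assumes g: "graded_space C"
  shows "separates (scl C) (gr C n) {\<phi>. hfun C n \<phi>}"
  unfolding separates_def
proof (intro conjI ballI impI)
  fix x assume x: "x \<in> gr C n" and 0: "\<forall>\<phi>\<in>{\<phi>. hfun C n \<phi>}. \<phi> x = 0"
  have "\<phi> x = 0" if "functional (scl C) \<phi>" for \<phi>
    using 0 hfun_proj[OF g that, of n] x by (auto simp: proj_gr[OF g] dest!: bspec)
  then show "x = 0"
    using separates_functionals[OF graded_spaceD(1)[OF g], of "{x}"] by (auto simp: separates_def)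
qed (auto dest: hfunD)

lemma separates_carr_hfun:
  assumes g: "graded_space C"
  shows "separates (scl C) (carr C) {\<phi>. \<exists>n. hfun C n \<phi>}"
  unfolding separates_def
proof (intro conjI ballI impI)
  fix x assume x: "x \<in> carr C" and 0: "\<forall>\<phi>\<in>{\<phi>. \<exists>n. hfun C n \<phi>}. \<phi> x = 0"
  show "x = 0"
  proof (rule proj_eq_0[OF g x])
    fix n
    have "\<phi> (proj C n x) = 0" if "functional (scl C) \<phi>" for \<phi>
      using 0 hfun_proj[OF g that, of n] by auto
    then show "proj C n x = 0"
      using separates_functionals[OF graded_spaceD(1)[OF g], of "{proj C n x}"]
      by (auto simp: separates_def)
  qed
qed (auto dest: hfunD)

lemma linear_eq_carr:
  assumes "Vector_Spaces.linear (scl C) t f" "Vector_Spaces.linear (scl C) t g" "x \<in> carr C"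
    "\<And>n y. y \<in> gr C n \<Longrightarrow> f y = g y"
  shows "f x = g x"
  by (rule linear_eq_span[OF assms(1,2) assms(3)[unfolded carr_def]]) (use assms(4) in auto)

section \<open>Graded coalgebras through convolution of functionals\<close>

abbreviation sq_carr :: "('k::field, 'v::ab_group_add) coalg \<Rightarrow> ('k, 'v, 'v) tensor set" where
  "sq_carr C \<equiv> tspan (scl C) (carr C) (scl C) (carr C)"

text \<open>The value of a tensor on a pair of functionals is the value of their tensor product, so this is
  \<open>(\<phi> \<otimes> \<psi>) \<circ> \<Delta>\<close>.\<close>

definition conv :: "('k::field, 'v::ab_group_add) coalg \<Rightarrow> ('v \<Rightarrow> 'k) \<Rightarrow> ('v \<Rightarrow> 'k) \<Rightarrow> 'v \<Rightarrow> 'k" where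
  "conv C \<phi> \<psi> = (\<lambda>c. cop C c (\<phi>, \<psi>))"

lemma tens_gr_sq_carr:
  assumes "vector_space (scl C)"
  shows "tens_gr C n \<subseteq> sq_carr C"
  unfolding tens_gr_def
  by (rule span_subset_subspace[OF vector_space_fscale subspace_tspan])
    (auto intro!: tens_in_tspan gr_carr[OF assms])

lemma tens_gr_ind [consumes 1, case_names zero add scale tens]:
  assumes "x \<in> tens_gr C n" "P 0"
    "\<And>x y. x \<in> tens_gr C n \<Longrightarrow> y \<in> tens_gr C n \<Longrightarrow> P x \<Longrightarrow> P y \<Longrightarrow> P (x + y)"
    "\<And>a x. x \<in> tens_gr C n \<Longrightarrow> P x \<Longrightarrow> P (fscale a x)"
    "\<And>a b i j. a \<in> gr C i \<Longrightarrow> b \<in> gr C j \<Longrightarrow> i + j = n \<Longrightarrow> P (tens (scl C) (scl C) a b)"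
  shows "P x"
  using vector_space_fscale assms(1)[unfolded tens_gr_def]
proof (induction rule: span_ind)
  case (base x)
  then show ?case using assms(5) by blast
qed (use assms(2-4)[unfolded tens_gr_def] in blast)+

text \<open>The map \<open>f \<otimes> g\<close> of the definitions is a linear extension from pure tensors; on the tensor square
  it can be replaced by precomposition.\<close>

lemma tmap_eq:
  assumes "Vector_Spaces.linear (scl C) s f" "Vector_Spaces.linear (scl C) t g" "x \<in> sq_carr C"
  shows "tmap C s t f g x = tens_map s t f g x"
  unfolding tmap_def
  by (rule lin_ext_eq_span[OF linear_tens_map _ assms(3)[unfolded tspan_def]])
    (use assms(1,2) in \<open>auto simp: tens_map_tens\<close>)


lemma graded_coalgebraD:
  assumes "graded_coalgebra C"
  shows "graded_space C" "vector_space (scl C)" "Vector_Spaces.linear (scl C) fscale (cop C)"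
    "functional (scl C) (cou C)" "c \<in> gr C n \<Longrightarrow> cop C c \<in> tens_gr C n"
    "hfun C 0 (cou C)"
  using assms unfolding graded_coalgebra_def hfun_def
  by (auto dest: graded_spaceD simp: functional_def)

lemma cop_sq_carr_graded:
  assumes "vector_space (scl C)" "Vector_Spaces.linear (scl C) fscale (cop C)"
    "\<And>n c. c \<in> gr C n \<Longrightarrow> cop C c \<in> tens_gr C n" "c \<in> carr C"
  shows "cop C c \<in> sq_carr C"
  by (rule linear_span_into[OF assms(2) assms(4)[unfolded carr_def] subspace_tspan])
    (use assms(1,3) tens_gr_sq_carr in blast)

lemma cop_sq_carr:
  assumes "graded_coalgebra C" "c \<in> carr C"
  shows "cop C c \<in> sq_carr C"
  by (rule cop_sq_carr_graded) (use assms graded_coalgebraD(2,3,5) in auto)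

lemma functional_conv:
  "graded_coalgebra C \<Longrightarrow> functional (scl C) (conv C \<phi> \<psi>)"
  using linear_D[OF graded_coalgebraD(3)[of C]]
  by (intro functionalI) (auto simp: conv_def)

lemma conv_cong:
  assumes "graded_coalgebra C" "c \<in> carr C" "functional (scl C) \<phi>" "functional (scl C) \<psi>"
    "functional (scl C) \<phi>'" "functional (scl C) \<psi>'"
    "\<And>a. a \<in> carr C \<Longrightarrow> \<phi> a = \<phi>' a" "\<And>a. a \<in> carr C \<Longrightarrow> \<psi> a = \<psi>' a"
  shows "conv C \<phi> \<psi> c = conv C \<phi>' \<psi>' c"
  unfolding conv_def by (rule tspan_cong[OF cop_sq_carr]) (use assms in auto)

lemma hfun_conv:
  assumes C: "graded_coalgebra C" and \<phi>: "hfun C m \<phi>" and \<psi>: "hfun C n \<psi>"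
  shows "hfun C (m + n) (conv C \<phi> \<psi>)"
proof -
  have "x (\<phi>, \<psi>) = 0" if "x \<in> tens_gr C k" "k \<noteq> m + n" for x k
    using that
  proof (induction rule: tens_gr_ind)
    case (tens a b i j)
    then have "i \<noteq> m \<or> j \<noteq> n" by auto
    then have "\<phi> a = 0 \<or> \<psi> b = 0" using tens hfunD(2)[OF \<phi>] hfunD(2)[OF \<psi>] by blast
    then show ?case using hfunD(1)[OF \<phi>] hfunD(1)[OF \<psi>] by (auto simp: tens_apply)
  qed auto
  then have "conv C \<phi> \<psi> x = 0" if "x \<in> gr C k" "k \<noteq> m + n" for x k
    using graded_coalgebraD(5)[OF C that(1)] that(2) unfolding conv_def by blast
  then show ?thesis
    using functional_conv[OF C] unfolding hfun_def by blast
qed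

text \<open>Rebracketing is dual to rebracketing triples of functionals.\<close>

lemma
  assumes C: "vector_space (scl C)"
  shows associator_apply:
      "y \<in> tspan fscale (sq_carr C) (scl C) (carr C) \<Longrightarrow> functional (scl C) \<phi> \<Longrightarrow>
       functional (scl C) \<psi> \<Longrightarrow> functional (scl C) \<chi> \<Longrightarrow>
       associator C y (\<phi>, ev (\<psi>, \<chi>)) = y (ev (\<phi>, \<psi>), \<chi>)"
    and linear_associator: "Vector_Spaces.linear fscale fscale (associator C)"
    and associator_tens: "a \<in> carr C \<Longrightarrow> b \<in> carr C \<Longrightarrow> c \<in> carr C \<Longrightarrow>
       associator C (tens fscale (scl C) (tens (scl C) (scl C) a b) c) =
       tens (scl C) fscale a (tens (scl C) (scl C) b c)"
    and associator_in: "y \<in> tspan fscale (sq_carr C) (scl C) (carr C) \<Longrightarrow>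
       associator C y \<in> tspan (scl C) (carr C) fscale (sq_carr C)"
proof -
  note car = subspace_carr[OF C]
  note F = separates_functionals[OF C, of "carr C"]
  let ?F = "{\<phi>. functional (scl C) \<phi>}"
  let ?G = "{(tens fscale (scl C) (tens (scl C) (scl C) a b) c,
       tens (scl C) fscale a (tens (scl C) (scl C) b c)) | a b c.
        a \<in> carr C \<and> b \<in> carr C \<and> c \<in> carr C}"
  have sub: "module.span fscale (snd ` ?G) \<subseteq> tspan (scl C) (carr C) fscale (sq_carr C)"
    by (rule span_subset_subspace[OF vector_space_fscale subspace_tspan])
      (auto intro!: tens_in_tspan)
  note sep = separates_mono[OF separates_tspan[OF C vector_space_fscale car subspace_tspan F
        separates_tspan[OF C C car car F F]] sub]
  have dual: "\<forall>\<xi>\<in>evs ?F (evs ?F ?F).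
       \<exists>\<Lambda>. functional fscale \<Lambda> \<and> (\<forall>(x, y)\<in>?G. \<Lambda> x = \<xi> y)"
  proof
    fix \<xi> assume \<xi>: "\<xi> \<in> evs ?F (evs ?F ?F)"
    from \<xi> obtain \<phi> \<psi> \<chi> where \<xi>: "\<xi> = ev (\<phi>, ev (\<psi>, \<chi>))" and
      f: "functional (scl C) \<phi>" "functional (scl C) \<psi>" "functional (scl C) \<chi>" by blast
    show "\<exists>\<Lambda>. functional fscale \<Lambda> \<and> (\<forall>(x, y)\<in>?G. \<Lambda> x = \<xi> y)"
      by (rule exI[of _ "ev (ev (\<phi>, \<psi>), \<chi>)"])
        (use f in \<open>auto simp: \<xi> ev_pair_tens\<close>)
  qed
  note ext = lin_ext_dual[OF vector_space_fscale vector_space_fscale sep dual,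
      folded associator_def]
  show lin: "Vector_Spaces.linear fscale fscale (associator C)"
    by (rule ext(1))
  show assoc_tens: "associator C (tens fscale (scl C) (tens (scl C) (scl C) a b) c) =
       tens (scl C) fscale a (tens (scl C) (scl C) b c)"
    if "a \<in> carr C" "b \<in> carr C" "c \<in> carr C" for a b c
    by (rule ext(2), rule CollectI, rule exI[of _ a], rule exI[of _ b], rule exI[of _ c])
      (use that in simp)
  have lin_t: "Vector_Spaces.linear fscale fscale (\<lambda>x. associator C (tens fscale (scl C) x c))" for c
    using linear_comp[OF linear_tens_left[OF vector_space_fscale] lin] by (simp add: o_def)
  show "associator C y \<in> tspan (scl C) (carr C) fscale (sq_carr C)"
    if "y \<in> tspan fscale (sq_carr C) (scl C) (carr C)"
  proof (rule linear_span_into[OF lin that[unfolded tspan_def[of fscale]] subspace_tspan])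
    fix x assume "x \<in> {tens fscale (scl C) a b |a b. a \<in> sq_carr C \<and> b \<in> carr C}"
    then obtain a b where x: "x = tens fscale (scl C) a b" "a \<in> sq_carr C" "b \<in> carr C" by blast
    show "associator C x \<in> tspan (scl C) (carr C) fscale (sq_carr C)"
      unfolding x(1)
      by (rule linear_span_into[OF lin_t x(2)[unfolded tspan_def] subspace_tspan])
        (auto simp: assoc_tens x(3) intro!: tens_in_tspan)
  qed
  show "associator C y (\<phi>, ev (\<psi>, \<chi>)) = y (ev (\<phi>, \<psi>), \<chi>)"
    if y: "y \<in> tspan fscale (sq_carr C) (scl C) (carr C)" and
      f: "functional (scl C) \<phi>" "functional (scl C) \<psi>" "functional (scl C) \<chi>" for y \<phi> \<psi> \<chi>
    using y
  proof (induction rule: tspan_ind)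
    case (tens a b)
    have "associator C (tens fscale (scl C) a b) (\<phi>, ev (\<psi>, \<chi>)) = tens fscale (scl C) a b (ev (\<phi>, \<psi>), \<chi>)"
      using tens(1)
    proof (induction rule: tspan_ind)
      case (tens a a')
      then show ?case using \<open>b \<in> carr C\<close> f
        by (simp add: assoc_tens tens_apply) (simp add: ev_pair_tens)
    qed (use linear_D[OF lin_t] linear_0[OF lin_t] in \<open>auto simp: tens_apply f functional_add[OF functional_ev] functional_scale[OF functional_ev] functional_0[OF functional_ev] algebra_simps\<close>)
    then show ?case .
  qed (auto simp: linear_D[OF lin] linear_0[OF lin])
qed

lemma tens_map_in:
  assumes "x \<in> tspan s A t B" "Vector_Spaces.linear s s' f" "Vector_Spaces.linear t t' g"
    "f ` A \<subseteq> A'" "g ` B \<subseteq> B'"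
  shows "tens_map s' t' f g x \<in> tspan s' A' t' B'"
  by (rule linear_span_into[OF linear_tens_map assms(1)[unfolded tspan_def] subspace_tspan])
    (use assms(2-5) in \<open>auto simp: tens_map_tens[OF assms(2,3)] image_subset_iff intro!: tens_in_tspan\<close>)

text \<open>The two sides of coassociativity, evaluated on three functionals, are the two bracketings of their
  convolution.\<close>

lemma coassoc_apply:
  assumes C: "vector_space (scl C)" and cop: "Vector_Spaces.linear (scl C) fscale (cop C)"
    and sq_all: "\<forall>c\<in>carr C. cop C c \<in> sq_carr C" and c: "c \<in> carr C"
  shows "associator C (tmap C fscale (scl C) (cop C) id (cop C c)) \<in> tspan (scl C) (carr C) fscale (sq_carr C)"
    "tmap C (scl C) fscale id (cop C) (cop C c) \<in> tspan (scl C) (carr C) fscale (sq_carr C)"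
    "functional (scl C) \<phi> \<Longrightarrow> functional (scl C) \<psi> \<Longrightarrow> functional (scl C) \<chi> \<Longrightarrow>
     associator C (tmap C fscale (scl C) (cop C) id (cop C c)) (\<phi>, ev (\<psi>, \<chi>)) = conv C (conv C \<phi> \<psi>) \<chi> c"
    "functional (scl C) \<phi> \<Longrightarrow> functional (scl C) \<psi> \<Longrightarrow> functional (scl C) \<chi> \<Longrightarrow>
     tmap C (scl C) fscale id (cop C) (cop C c) (\<phi>, ev (\<psi>, \<chi>)) = conv C \<phi> (conv C \<psi> \<chi>) c"
proof -
  note id = linear_id[OF C]
  note sq = sq_all[rule_format]
  have l: "tens_map fscale (scl C) (cop C) id (cop C c) \<in> tspan fscale (sq_carr C) (scl C) (carr C)"
    by (rule tens_map_in[OF sq[OF c] cop id]) (use sq in auto)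
  then show "associator C (tmap C fscale (scl C) (cop C) id (cop C c)) \<in> tspan (scl C) (carr C) fscale (sq_carr C)"
    unfolding tmap_eq[OF cop id sq[OF c]] by (rule associator_in[OF C])
  show "tmap C (scl C) fscale id (cop C) (cop C c) \<in> tspan (scl C) (carr C) fscale (sq_carr C)"
    unfolding tmap_eq[OF id cop sq[OF c]]
    by (rule tens_map_in[OF sq[OF c] id cop]) (use sq in auto)
  assume f: "functional (scl C) \<phi>" "functional (scl C) \<psi>" "functional (scl C) \<chi>"
  show "associator C (tmap C fscale (scl C) (cop C) id (cop C c)) (\<phi>, ev (\<psi>, \<chi>)) = conv C (conv C \<phi> \<psi>) \<chi> c"
    unfolding tmap_eq[OF cop id sq[OF c]] associator_apply[OF C l f]
    by (simp add: tens_map_apply f conv_def o_def ev_def id_def)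
  show "tmap C (scl C) fscale id (cop C) (cop C c) (\<phi>, ev (\<psi>, \<chi>)) = conv C \<phi> (conv C \<psi> \<chi>) c"
    unfolding tmap_eq[OF id cop sq[OF c]]
    by (simp add: tens_map_apply f conv_def o_def ev_def id_def)
qed

lemma coassocD:
  assumes C: "graded_coalgebra C" and c: "c \<in> carr C"
    and f: "functional (scl C) \<phi>" "functional (scl C) \<psi>" "functional (scl C) \<chi>"
  shows "conv C (conv C \<phi> \<psi>) \<chi> c = conv C \<phi> (conv C \<psi> \<chi>) c"
proof -
  have sq_all: "\<forall>c\<in>carr C. cop C c \<in> sq_carr C" using cop_sq_carr[OF C] by blast
  note * = coassoc_apply(3,4)[OF graded_coalgebraD(2,3)[OF C] sq_all c f]
  have "associator C (tmap C fscale (scl C) (cop C) id (cop C c)) = tmap C (scl C) fscale id (cop C) (cop C c)"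
    using C c unfolding graded_coalgebra_def by blast
  then show ?thesis using * by simp
qed

text \<open>Contractions of the tensor square such as \<open>(\<epsilon> \<otimes> id)\<close> are dual to inserting a functional.\<close>

lemma
  assumes C: "vector_space (scl C)"
    and h: "\<forall>\<phi> a b. functional (scl C) \<phi> \<longrightarrow> ev (p \<phi>) (tens (scl C) (scl C) a b) = \<phi> (h a b)"
  defines "F \<equiv> lin_ext fscale (scl C) {(tens (scl C) (scl C) a b, h a b) | a b. a \<in> carr C \<and> b \<in> carr C}"
  shows contract_linear: "Vector_Spaces.linear fscale (scl C) F"
    and contract_tens: "a \<in> carr C \<Longrightarrow> b \<in> carr C \<Longrightarrow> F (tens (scl C) (scl C) a b) = h a b"
    and contract_apply: "x \<in> sq_carr C \<Longrightarrow> functional (scl C) \<phi> \<Longrightarrow> \<phi> (F x) = x (p \<phi>)"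
proof -
  let ?G = "{(tens (scl C) (scl C) a b, h a b) | a b. a \<in> carr C \<and> b \<in> carr C}"
  have dual: "\<forall>\<psi>\<in>{\<phi>. functional (scl C) \<phi>}. \<exists>\<Lambda>. functional fscale \<Lambda> \<and> (\<forall>(x, y)\<in>?G. \<Lambda> x = \<psi> y)"
  proof
    fix \<psi> assume "\<psi> \<in> {\<phi>. functional (scl C) \<phi>}"
    then show "\<exists>\<Lambda>. functional fscale \<Lambda> \<and> (\<forall>(x, y)\<in>?G. \<Lambda> x = \<psi> y)"
      by (intro exI[of _ "ev (p \<psi>)"]) (auto simp: h)
  qed
  note ext = lin_ext_dual[OF vector_space_fscale C separates_functionals[OF C] dual, folded F_def]
  show lin: "Vector_Spaces.linear fscale (scl C) F" by (rule ext(1))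
  show tens: "F (tens (scl C) (scl C) a b) = h a b" if "a \<in> carr C" "b \<in> carr C" for a b
    by (rule ext(2)) (use that in blast)
  show "\<phi> (F x) = x (p \<phi>)" if x: "x \<in> sq_carr C" and f: "functional (scl C) \<phi>"
  proof -
    have "(\<phi> \<circ> F) x = ev (p \<phi>) x"
      by (rule functional_eq_span[OF functional_comp[OF lin f] functional_ev x[unfolded tspan_def]])
        (auto simp: tens h f)
    then show ?thesis by (simp add: ev_def)
  qed
qed

abbreviation (input) counit_left :: "('k::field, 'v::ab_group_add) coalg \<Rightarrow> ('k, 'v, 'v) tensor \<Rightarrow> 'v" where
  "counit_left C \<equiv> lin_ext fscale (scl C)
     {(tens (scl C) (scl C) a b, scl C (cou C a) b) | a b. a \<in> carr C \<and> b \<in> carr C}"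

abbreviation (input) counit_right :: "('k::field, 'v::ab_group_add) coalg \<Rightarrow> ('k, 'v, 'v) tensor \<Rightarrow> 'v" where
  "counit_right C \<equiv> lin_ext fscale (scl C)
     {(tens (scl C) (scl C) a b, scl C (cou C b) a) | a b. a \<in> carr C \<and> b \<in> carr C}"

context
  fixes C :: "('k::field, 'v::ab_group_add) coalg"
  assumes C: "vector_space (scl C)" and cou: "functional (scl C) (cou C)"
begin

lemma counit_dual:
  "\<forall>\<phi> a b. functional (scl C) \<phi> \<longrightarrow> ev (cou C, \<phi>) (tens (scl C) (scl C) a b) = \<phi> (scl C (cou C a) b)"
  "\<forall>\<phi> a b. functional (scl C) \<phi> \<longrightarrow> ev (\<phi>, cou C) (tens (scl C) (scl C) a b) = \<phi> (scl C (cou C b) a)"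
  using cou by (simp_all add: ev_pair_tens functional_scale)

lemmas counit_left =
  contract_linear[OF C, where p = "\<lambda>\<phi>. (cou C, \<phi>)" and h = "\<lambda>a b. scl C (cou C a) b", OF counit_dual(1)]
  contract_tens[OF C, where p = "\<lambda>\<phi>. (cou C, \<phi>)" and h = "\<lambda>a b. scl C (cou C a) b", OF counit_dual(1)]
  contract_apply[OF C, where p = "\<lambda>\<phi>. (cou C, \<phi>)" and h = "\<lambda>a b. scl C (cou C a) b", OF counit_dual(1)]
lemmas counit_right =
  contract_linear[OF C, where p = "\<lambda>\<phi>. (\<phi>, cou C)" and h = "\<lambda>a b. scl C (cou C b) a", OF counit_dual(2)]
  contract_tens[OF C, where p = "\<lambda>\<phi>. (\<phi>, cou C)" and h = "\<lambda>a b. scl C (cou C b) a", OF counit_dual(2)]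
  contract_apply[OF C, where p = "\<lambda>\<phi>. (\<phi>, cou C)" and h = "\<lambda>a b. scl C (cou C b) a", OF counit_dual(2)]

end

lemma counitD:
  assumes C: "graded_coalgebra C" and c: "c \<in> carr C" and f: "functional (scl C) \<phi>"
  shows "conv C (cou C) \<phi> c = \<phi> c" "conv C \<phi> (cou C) c = \<phi> c"
proof -
  note * = graded_coalgebraD(2,4)[OF C] cop_sq_carr[OF C c] f
  show "conv C (cou C) \<phi> c = \<phi> c" "conv C \<phi> (cou C) c = \<phi> c"
    using counit_left(3)[OF *] counit_right(3)[OF *] C c
    unfolding conv_def graded_coalgebra_def by simp_all
qed

text \<open>Associativity and unitality of convolution are needed on a separating family only, because the
  products of functionals from the family separate the tensor powers.  The counit laws first pass to
  all functionals: slicing \<open>\<Delta> c\<close> with \<open>\<epsilon>\<close> gives a vector that the family cannot distinguish from \<open>c\<close>.\<close>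

lemma graded_coalgebraI:
  assumes g: "graded_space C" and cop: "Vector_Spaces.linear (scl C) fscale (cop C)"
    and gr: "\<And>n c. c \<in> gr C n \<Longrightarrow> cop C c \<in> tens_gr C n" and cou: "hfun C 0 (cou C)"
    and S: "separates (scl C) (carr C) S"
    and assoc: "\<And>c \<phi> \<psi> \<chi>. c \<in> carr C \<Longrightarrow> \<phi> \<in> S \<Longrightarrow> \<psi> \<in> S \<Longrightarrow> \<chi> \<in> S \<Longrightarrow>
      conv C (conv C \<phi> \<psi>) \<chi> c = conv C \<phi> (conv C \<psi> \<chi>) c"
    and counit: "\<And>c \<phi>. c \<in> carr C \<Longrightarrow> \<phi> \<in> S \<Longrightarrow> conv C (cou C) \<phi> c = \<phi> c"
      "\<And>c \<phi>. c \<in> carr C \<Longrightarrow> \<phi> \<in> S \<Longrightarrow> conv C \<phi> (cou C) c = \<phi> c"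
  shows "graded_coalgebra C"
proof -
  note C = graded_spaceD(1)[OF g]
  note car = subspace_carr[OF C]
  note fn = separatesD[OF S]
  have sq: "\<And>c. c \<in> carr C \<Longrightarrow> cop C c \<in> sq_carr C"
    by (rule cop_sq_carr_graded[OF C cop gr])
  then have sq_all: "\<forall>c\<in>carr C. cop C c \<in> sq_carr C" by blast
  note sep3 = separates_tspan[OF C vector_space_fscale car subspace_tspan S
      separates_tspan[OF C C car car S S]]
  have "associator C (tmap C fscale (scl C) (cop C) id (cop C c)) = tmap C (scl C) fscale id (cop C) (cop C c)"
    if c: "c \<in> carr C" for c
  proof (rule separates_eqI[OF sep3 subspace_tspan vector_space_fscale])
    note * = coassoc_apply[OF C cop sq_all c]
    show "associator C (tmap C fscale (scl C) (cop C) id (cop C c)) \<in> tspan (scl C) (carr C) fscale (sq_carr C)"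
      "tmap C (scl C) fscale id (cop C) (cop C c) \<in> tspan (scl C) (carr C) fscale (sq_carr C)"
      using * by blast+
    fix \<xi> assume "\<xi> \<in> evs S (evs S S)"
    then obtain \<phi> \<psi> \<chi> where \<xi>: "\<xi> = ev (\<phi>, ev (\<psi>, \<chi>))" and f: "\<phi> \<in> S" "\<psi> \<in> S" "\<chi> \<in> S" by blast
    show "\<xi> (associator C (tmap C fscale (scl C) (cop C) id (cop C c))) = \<xi> (tmap C (scl C) fscale id (cop C) (cop C c))"
      unfolding \<xi> ev_def[of "(\<phi>, _)"] *(3,4)[OF f[THEN fn]] by (rule assoc[OF c f])
  qed
  moreover have "counit_left C (cop C c) = c" "counit_right C (cop C c) = c" if c: "c \<in> carr C" for c
  proof -
    note l = counit_left(3)[OF C hfunD(1)[OF cou] sq[OF c]] counit_right(3)[OF C hfunD(1)[OF cou] sq[OF c]]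
    note sepF = separates_functionals[OF C, of UNIV]
    have *: "conv C (cou C) \<phi> c = \<phi> c" "conv C \<phi> (cou C) c = \<phi> c" if \<phi>: "functional (scl C) \<phi>" for \<phi>
    proof -
      obtain v where v: "v \<in> carr C" "\<And>\<phi>. functional (scl C) \<phi> \<Longrightarrow> cop C c (cou C, \<phi>) = \<phi> v"
        using tspan_slice_right[OF sq[OF c] car C hfunD(1)[OF cou]] by blast
      have "v = c"
        by (rule separates_eqI[OF S car C v(1) c]) (use counit(1)[OF c] v(2) fn in \<open>auto simp: conv_def\<close>)
      then show "conv C (cou C) \<phi> c = \<phi> c" using v(2)[OF \<phi>] by (simp add: conv_def)
      obtain w where w: "w \<in> carr C" "\<And>\<phi>. functional (scl C) \<phi> \<Longrightarrow> cop C c (\<phi>, cou C) = \<phi> w"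
        using tspan_slice_left[OF sq[OF c] car C hfunD(1)[OF cou]] by blast
      have "w = c"
        by (rule separates_eqI[OF S car C w(1) c]) (use counit(2)[OF c] w(2) fn in \<open>auto simp: conv_def\<close>)
      then show "conv C \<phi> (cou C) c = \<phi> c" using w(2)[OF \<phi>] by (simp add: conv_def)
    qed
    have U: "module.subspace (scl C) UNIV" by (simp add: module.subspace_UNIV module_iff_vector_space C)
    show "counit_left C (cop C c) = c"
      by (rule separates_eqI[OF sepF U C]) (use l(1) * in \<open>auto simp: conv_def\<close>)
    show "counit_right C (cop C c) = c"
      by (rule separates_eqI[OF sepF U C]) (use l(2) * in \<open>auto simp: conv_def\<close>)
  qed
  ultimately show ?thesis
    unfolding graded_coalgebra_def using g cop gr cou by (auto simp: hfun_def functional_def)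
qed

lemma coalgebra_morphismD:
  assumes "coalgebra_morphism C D f"
  shows "Vector_Spaces.linear (scl C) (scl D) f" "c \<in> gr C n \<Longrightarrow> f c \<in> gr D n"
    "c \<in> carr C \<Longrightarrow> cou D (f c) = cou C c"
    "c \<in> carr C \<Longrightarrow> tmap C (scl D) (scl D) f f (cop C c) = cop D (f c)"
  using assms unfolding coalgebra_morphism_def by blast+

lemma morphism_carr:
  assumes "coalgebra_morphism C D f" "c \<in> carr C"
  shows "f c \<in> carr D"
proof -
  note l = coalgebra_morphismD(1)[OF assms(1)]
  show ?thesis
    by (rule linear_span_into[OF l assms(2)[unfolded carr_def] subspace_carr[OF linear_D(2)[OF l]]])
      (auto intro: gr_carr[OF linear_D(2)[OF l]] coalgebra_morphismD(2)[OF assms(1)])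
qed

lemma morphism_conv:
  assumes C: "graded_coalgebra C" and f: "coalgebra_morphism C D f" and c: "c \<in> carr C"
    and "functional (scl D) \<phi>" "functional (scl D) \<psi>"
  shows "conv C (\<phi> \<circ> f) (\<psi> \<circ> f) c = conv D \<phi> \<psi> (f c)"
  using coalgebra_morphismD(4)[OF f c] tmap_eq[OF coalgebra_morphismD(1)[OF f] coalgebra_morphismD(1)[OF f] cop_sq_carr[OF C c]]
    assms(4,5)
  by (metis conv_def tens_map_apply)

text \<open>The transpose of \<open>f\<close> has to preserve convolution on a separating family of functionals only.\<close>

lemma coalgebra_morphismI:
  assumes C: "graded_coalgebra C" and D: "graded_coalgebra D"
    and lin: "Vector_Spaces.linear (scl C) (scl D) f"
    and gr: "\<And>n c. c \<in> gr C n \<Longrightarrow> f c \<in> gr D n"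
    and cou: "\<And>n c. c \<in> gr C n \<Longrightarrow> cou D (f c) = cou C c"
    and S: "separates (scl D) (carr D) S"
    and conv: "\<And>n c \<phi> \<psi>. c \<in> carr C \<Longrightarrow> \<phi> \<in> S \<Longrightarrow> \<psi> \<in> S \<Longrightarrow>
      conv C (\<phi> \<circ> f) (\<psi> \<circ> f) c = conv D \<phi> \<psi> (f c)"
  shows "coalgebra_morphism C D f"
  unfolding coalgebra_morphism_def
proof (intro conjI allI ballI)
  note vD = graded_coalgebraD(2)[OF D]
  note car = subspace_carr[OF vD]
  fix c assume c: "c \<in> carr C"
  have fc: "f ` carr C \<subseteq> carr D"
    using linear_span_into[OF lin _ car] gr gr_carr[OF vD] unfolding carr_def[of C] by blast
  have "functional (scl C) (cou D \<circ> f)" by (rule functional_comp[OF lin graded_coalgebraD(4)[OF D]])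
  from linear_eq_carr[OF this[unfolded functional_def] graded_coalgebraD(4)[OF C, unfolded functional_def] c] cou
  show "cou D (f c) = cou C c" by simp
  show "tmap C (scl D) (scl D) f f (cop C c) = cop D (f c)"
    unfolding tmap_eq[OF lin lin cop_sq_carr[OF C c]]
  proof (rule separates_eqI[OF separates_tspan[OF vD vD car car S S] subspace_tspan vector_space_fscale])
    show "tens_map (scl D) (scl D) f f (cop C c) \<in> sq_carr D"
      by (rule tens_map_in[OF cop_sq_carr[OF C c] lin lin fc fc])
    show "cop D (f c) \<in> sq_carr D" by (rule cop_sq_carr[OF D]) (use c fc in blast)
    fix \<xi> assume "\<xi> \<in> evs S S"
    then obtain \<phi> \<psi> where \<xi>: "\<xi> = ev (\<phi>, \<psi>)" "\<phi> \<in> S" "\<psi> \<in> S" by blast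
    show "\<xi> (tens_map (scl D) (scl D) f f (cop C c)) = \<xi> (cop D (f c))"
      using conv[OF c \<xi>(2,3)] separatesD[OF S \<xi>(2)] separatesD[OF S \<xi>(3)]
      by (simp add: \<xi>(1) ev_def tens_map_apply conv_def)
  qed
qed (use lin gr in auto)

lemma morphism_comp:
  assumes C: "graded_coalgebra C" and D: "graded_coalgebra D" and E: "graded_coalgebra E"
    and f: "coalgebra_morphism C D f" and g: "coalgebra_morphism D E g"
  shows "coalgebra_morphism C E (g \<circ> f)"
proof (rule coalgebra_morphismI[OF C E])
  show "separates (scl E) (carr E) {\<phi>. functional (scl E) \<phi>}"
    by (rule separates_functionals[OF graded_coalgebraD(2)[OF E]])
  show "Vector_Spaces.linear (scl C) (scl E) (g \<circ> f)"
    by (rule linear_comp[OF coalgebra_morphismD(1)[OF f] coalgebra_morphismD(1)[OF g]])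
  show "(g \<circ> f) c \<in> gr E n" if "c \<in> gr C n" for c n
    using that by (auto intro: coalgebra_morphismD(2) f g)
  show "cou E ((g \<circ> f) c) = cou C c" if "c \<in> gr C n" for c n
    using that coalgebra_morphismD(3)[OF f] coalgebra_morphismD(3)[OF g] morphism_carr[OF f]
      gr_carr[OF graded_coalgebraD(2)[OF C]] by simp
  show "conv C (\<phi> \<circ> (g \<circ> f)) (\<psi> \<circ> (g \<circ> f)) c = conv E \<phi> \<psi> ((g \<circ> f) c)"
    if "c \<in> carr C" "\<phi> \<in> {\<phi>. functional (scl E) \<phi>}" "\<psi> \<in> {\<phi>. functional (scl E) \<phi>}" for c \<phi> \<psi>
    using that morphism_conv[OF C f, of c "\<phi> \<circ> g" "\<psi> \<circ> g"] morphism_conv[OF D g, of "f c" \<phi> \<psi>]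
      morphism_carr[OF f] functional_comp[OF coalgebra_morphismD(1)[OF g]] by (simp add: o_assoc)
qed

lemma id_morphism: "graded_coalgebra C \<Longrightarrow> coalgebra_morphism C C id"
  by (rule coalgebra_morphismI[where S = "{\<phi>. functional (scl C) \<phi>}"])
    (auto intro: linear_id graded_coalgebraD separates_functionals)

section \<open>Iterated coproducts\<close>

text \<open>The value at the empty word is a default.\<close>

fun convs :: "('k::field, 'v::ab_group_add) coalg \<Rightarrow> ('v \<Rightarrow> 'k) list \<Rightarrow> 'v \<Rightarrow> 'k" where
  "convs C [] = (\<lambda>_. 0)"
| "convs C [\<phi>] = \<phi>"
| "convs C (\<phi> # \<psi> # \<psi>s) = conv C \<phi> (convs C (\<psi> # \<psi>s))"

lemma convs_Cons: "\<phi>s \<noteq> [] \<Longrightarrow> convs C (\<phi> # \<phi>s) = conv C \<phi> (convs C \<phi>s)"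
  by (cases \<phi>s) auto

abbreviation functionals :: "('k::field, 'v::ab_group_add) coalg \<Rightarrow> ('v \<Rightarrow> 'k) list \<Rightarrow> bool" where
  "functionals C \<phi>s \<equiv> \<forall>\<phi>\<in>set \<phi>s. functional (scl C) \<phi>"

lemma functional_convs:
  assumes C: "graded_coalgebra C" and "functionals C \<phi>s"
  shows "functional (scl C) (convs C \<phi>s)"
  using assms(2)
proof (induction \<phi>s)
  case Nil
  show ?case
    using linear_zero_map[OF graded_coalgebraD(2)[OF C] vector_space_mult] by (simp add: functional_def)
next
  case (Cons \<phi> \<phi>s)
  then show ?case by (cases "\<phi>s = []") (auto simp: convs_Cons intro: functional_conv[OF C])
qed

lemma convs_append:
  assumes C: "graded_coalgebra C" and "c \<in> carr C" "functionals C \<phi>s" "functionals C \<psi>s"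
    "\<phi>s \<noteq> []" "\<psi>s \<noteq> []"
  shows "convs C (\<phi>s @ \<psi>s) c = conv C (convs C \<phi>s) (convs C \<psi>s) c"
  using assms(2-)
proof (induction \<phi>s arbitrary: c)
  case (Cons \<phi> \<phi>s)
  note f = functional_convs[OF C]
  show ?case
  proof (cases "\<phi>s = []")
    case True
    then show ?thesis using Cons.prems by (simp add: convs_Cons)
  next
    case False
    have "convs C ((\<phi> # \<phi>s) @ \<psi>s) c = conv C \<phi> (convs C (\<phi>s @ \<psi>s)) c"
      using False by (simp add: convs_Cons)
    also have "\<dots> = conv C \<phi> (conv C (convs C \<phi>s) (convs C \<psi>s)) c"
      by (rule conv_cong[OF C]) (use Cons False in \<open>auto intro!: f functional_conv[OF C]\<close>)
    also have "\<dots> = conv C (convs C (\<phi> # \<phi>s)) (convs C \<psi>s) c"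
      using False Cons.prems coassocD[OF C Cons.prems(1), of \<phi> "convs C \<phi>s" "convs C \<psi>s"] f
      by (simp add: convs_Cons)
    finally show ?thesis .
  qed
qed simp

text \<open>By coassociativity a word may be bracketed in any way, in particular around two neighbouring letters or
  as a cut between them.  Products of points glue words in exactly this way.\<close>

lemma convs_glue:
  assumes C: "graded_coalgebra C" and c: "c \<in> carr C" and f: "functionals C (\<phi>s @ \<phi> # \<psi> # \<psi>s)"
  shows "convs C (\<phi>s @ conv C \<phi> \<psi> # \<psi>s) c = conv C (convs C (\<phi>s @ [\<phi>])) (convs C (\<psi> # \<psi>s)) c"
proof -
  have *: "convs C (conv C \<phi> \<psi> # \<psi>s) c = convs C (\<phi> # \<psi> # \<psi>s) c" if c: "c \<in> carr C" for c
    using f coassocD[OF C c, of \<phi> \<psi> "convs C \<psi>s"] functional_convs[OF C]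
    by (cases "\<psi>s = []") (auto simp: convs_Cons)
  have "convs C (\<phi>s @ conv C \<phi> \<psi> # \<psi>s) c = convs C (\<phi>s @ \<phi> # \<psi> # \<psi>s) c"
  proof (cases "\<phi>s = []")
    case False
    have "convs C (\<phi>s @ conv C \<phi> \<psi> # \<psi>s) c = conv C (convs C \<phi>s) (convs C (conv C \<phi> \<psi> # \<psi>s)) c"
      by (rule convs_append[OF C c]) (use f False functional_conv[OF C] in auto)
    also have "\<dots> = conv C (convs C \<phi>s) (convs C (\<phi> # \<psi> # \<psi>s)) c"
      by (rule conv_cong[OF C c])
        (use f * functional_conv[OF C] in \<open>auto intro!: functional_convs[OF C] simp del: convs.simps\<close>)
    also have "\<dots> = convs C (\<phi>s @ \<phi> # \<psi> # \<psi>s) c"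
      by (rule convs_append[OF C c, symmetric]) (use f False in auto)
    finally show ?thesis .
  qed (use *[OF c] in simp)
  also have "\<dots> = conv C (convs C (\<phi>s @ [\<phi>])) (convs C (\<psi> # \<psi>s)) c"
    using convs_append[OF C c, of "\<phi>s @ [\<phi>]" "\<psi> # \<psi>s"] f by simp
  finally show ?thesis .
qed

lemma morphism_convs:
  assumes C: "graded_coalgebra C" and D: "graded_coalgebra D" and f: "coalgebra_morphism C D f"
    and "c \<in> carr C" "functionals D \<phi>s"
  shows "convs C (map (\<lambda>\<phi>. \<phi> \<circ> f) \<phi>s) c = convs D \<phi>s (f c)"
  using assms(4,5)
proof (induction \<phi>s arbitrary: c)
  case (Cons \<phi> \<phi>s)
  note lin = coalgebra_morphismD(1)[OF f]
  show ?case
  proof (cases "\<phi>s = []")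
    case False
    have "convs C (map (\<lambda>\<phi>. \<phi> \<circ> f) (\<phi> # \<phi>s)) c = conv C (\<phi> \<circ> f) (convs C (map (\<lambda>\<phi>. \<phi> \<circ> f) \<phi>s)) c"
      using False by (simp add: convs_Cons)
    also have "\<dots> = conv C (\<phi> \<circ> f) (convs D \<phi>s \<circ> f) c"
    proof (rule conv_cong[OF C Cons.prems(1)])
      show "convs C (map (\<lambda>\<phi>. \<phi> \<circ> f) \<phi>s) a = (convs D \<phi>s \<circ> f) a" if "a \<in> carr C" for a
        unfolding comp_apply[of "convs D \<phi>s"] by (rule Cons.IH[OF that]) (use Cons.prems in simp)
    qed (use Cons.prems in \<open>auto intro!: functional_comp[OF lin] functional_convs[OF C] functional_convs[OF D]\<close>)
    also have "\<dots> = conv D \<phi> (convs D \<phi>s) (f c)"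
      by (rule morphism_conv[OF C f Cons.prems(1)])
        (use Cons in \<open>auto intro!: functional_convs[OF D]\<close>)
    finally show ?thesis using False by (simp add: convs_Cons del: comp_apply)
  qed simp
qed simp

text \<open>The pairing of \<open>T(V\<^sup>*)\<close> with \<open>T(V)\<close> on pure tensors; words of different lengths pair to \<open>0\<close>.\<close>

fun pairing :: "('v \<Rightarrow> 'k::field) list \<Rightarrow> 'v list \<Rightarrow> 'k" where
  "pairing [] [] = 1"
| "pairing (\<phi> # \<phi>s) (v # vs) = \<phi> v * pairing \<phi>s vs"
| "pairing _ _ = 0"

lemma pairing_length: "length \<phi>s \<noteq> length vs \<Longrightarrow> pairing \<phi>s vs = 0"
  by (induction \<phi>s vs rule: pairing.induct) auto

lemma pairing_append:
  "length \<phi>s = length vs \<Longrightarrow> pairing (\<phi>s @ \<psi>s) (vs @ ws) = pairing \<phi>s vs * pairing \<psi>s ws"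
  by (induction \<phi>s vs rule: pairing.induct) auto

lemma pairing_map: "pairing (map (\<lambda>\<phi>. \<phi> \<circ> f) \<phi>s) vs = pairing \<phi>s (map f vs)"
proof (induction \<phi>s arbitrary: vs)
  case Nil
  then show ?case by (cases vs) auto
next
  case (Cons \<phi> \<phi>s)
  then show ?case by (cases vs) auto
qed

lemma pairing_cong:
  "list_all2 (\<lambda>\<phi> \<psi>. \<forall>a\<in>A. \<phi> a = \<psi> a) \<phi>s \<psi>s \<Longrightarrow> set vs \<subseteq> A \<Longrightarrow> pairing \<phi>s vs = pairing \<psi>s vs"
  by (induction \<phi>s \<psi>s arbitrary: vs rule: list_all2_induct) (case_tac vs; auto)+

lemma tpow_pairing:
  "tpow s vs \<phi>s = (if \<forall>\<phi>\<in>set \<phi>s. functional s \<phi> then pairing \<phi>s vs else 0)"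
proof -
  have "length \<phi>s = length vs \<Longrightarrow> pairing \<phi>s vs = (\<Prod>i<length vs. (\<phi>s ! i) (vs ! i))"
    by (induction \<phi>s vs rule: list_induct2) (auto simp: prod.lessThan_Suc_shift simp del: prod.lessThan_Suc)
  then show ?thesis
    by (cases "length \<phi>s = length vs") (auto simp: tpow_def pairing_length)
qed

definition tpow_space :: "('k::field, 'v::ab_group_add) coalg \<Rightarrow> nat \<Rightarrow> ('k, 'v) tensor_power set" where
  "tpow_space C n = module.span fscale {tpow (scl C) cs | cs. set cs \<subseteq> carr C \<and> length cs = n}"

lemma subspace_tpow_space: "module.subspace fscale (tpow_space C n)"
  unfolding tpow_space_def by (rule subspace_spanI[OF vector_space_fscale])

lemma tpow_in_space: "set cs \<subseteq> carr C \<Longrightarrow> tpow (scl C) cs \<in> tpow_space C (length cs)"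
  unfolding tpow_space_def by (rule span_baseI[OF vector_space_fscale]) auto

lemma
  assumes a: "vector_space (scl C)"
  shows tprepend_in: "a \<in> carr C \<Longrightarrow> T \<in> tpow_space C n \<Longrightarrow> tprepend C a T \<in> tpow_space C (Suc n)"
    and tprepend_apply: "T \<in> tpow_space C n \<Longrightarrow> tprepend C a T \<phi>s =
      (case \<phi>s of [] \<Rightarrow> 0 | \<phi> # \<phi>s' \<Rightarrow> if functional (scl C) \<phi> then \<phi> a * T \<phi>s' else 0)"
proof -
  let ?F = "\<lambda>T \<phi>s. case \<phi>s of [] \<Rightarrow> 0 | \<phi> # \<phi>s' \<Rightarrow> if functional (scl C) \<phi> then \<phi> a * T \<phi>s' else 0"
  have F: "Vector_Spaces.linear fscale fscale ?F"
    by (auto simp: Vector_Spaces.linear_iff vector_space_fscale fun_eq_iff plus_fun_apply fscale_def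
        algebra_simps split: list.split)
  have tens: "?F (tpow (scl C) cs) = tpow (scl C) (a # cs)" for cs
    by (auto simp: fun_eq_iff tpow_pairing split: list.split)
  have eq: "tprepend C a T = ?F T" if "T \<in> tpow_space C n" for T n
    unfolding tprepend_def
    by (rule lin_ext_eq_span[OF F _ that[unfolded tpow_space_def]]) (use tens in auto)
  show "T \<in> tpow_space C n \<Longrightarrow> tprepend C a T \<phi>s = ?F T \<phi>s" by (simp add: eq)
  show "tprepend C a T \<in> tpow_space C (Suc n)" if "a \<in> carr C" "T \<in> tpow_space C n"
    unfolding eq[OF that(2)]
  proof (rule linear_span_into[OF F that(2)[unfolded tpow_space_def] subspace_tpow_space])
    fix x assume "x \<in> {tpow (scl C) cs |cs. set cs \<subseteq> carr C \<and> length cs = n}"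
    then obtain cs where x: "x = tpow (scl C) cs" "set cs \<subseteq> carr C" "length cs = n" by blast
    show "?F x \<in> tpow_space C (Suc n)"
      unfolding x(1) tens using tpow_in_space[of "a # cs" C] x that by simp
  qed
qed

text \<open>The linear extension in the recursion of \<open>iter_cop\<close> agrees with an explicit map on functions, which
  feeds the convolution of the tail of a word into the second tensor factor.\<close>

lemma
  assumes C: "graded_coalgebra C"
  shows iter_cop_in: "c \<in> carr C \<Longrightarrow> iter_cop C n c \<in> tpow_space C (Suc n)"
    and iter_cop_apply: "c \<in> carr C \<Longrightarrow> iter_cop C n c \<phi>s =
      (if length \<phi>s = Suc n \<and> functionals C \<phi>s then convs C \<phi>s c else 0)"
proof -
  note vC = graded_coalgebraD(2)[OF C]
  have "(\<forall>c\<in>carr C. iter_cop C n c \<in> tpow_space C (Suc n) \<and>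
      (\<forall>\<phi>s. iter_cop C n c \<phi>s = (if length \<phi>s = Suc n \<and> functionals C \<phi>s then convs C \<phi>s c else 0)))"
  proof (induction n)
    case 0
    have "iter_cop C 0 c \<phi>s = (if length \<phi>s = Suc 0 \<and> functionals C \<phi>s then convs C \<phi>s c else 0)" for c \<phi>s
      by (auto simp: tpow_pairing length_Suc_conv pairing_length)
    moreover have "iter_cop C 0 c \<in> tpow_space C (Suc 0)" if "c \<in> carr C" for c
      using tpow_in_space[of "[c]" C] that by simp
    ultimately show ?case by blast
  next
    case (Suc n)
    let ?F = "\<lambda>x \<phi>s. case \<phi>s of [] \<Rightarrow> 0 | \<phi> # \<phi>s' \<Rightarrow>
       if functionals C \<phi>s \<and> length \<phi>s' = Suc n then x (\<phi>, convs C \<phi>s') else 0"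
    let ?G = "{(tens (scl C) (scl C) a b, tprepend C a (iter_cop C n b)) | a b. a \<in> carr C \<and> b \<in> carr C}"
    have F: "Vector_Spaces.linear fscale fscale ?F"
      by (auto simp: Vector_Spaces.linear_iff vector_space_fscale fun_eq_iff plus_fun_apply fscale_def
          algebra_simps split: list.split)
    have tens: "?F (tens (scl C) (scl C) a b) = tprepend C a (iter_cop C n b)" if "a \<in> carr C" "b \<in> carr C" for a b
    proof
      fix \<phi>s
      have b: "iter_cop C n b \<in> tpow_space C (Suc n)"
        "\<And>\<phi>s. iter_cop C n b \<phi>s = (if length \<phi>s = Suc n \<and> functionals C \<phi>s then convs C \<phi>s b else 0)"
        using Suc that(2) by auto
      show "?F (tens (scl C) (scl C) a b) \<phi>s = tprepend C a (iter_cop C n b) \<phi>s"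
        unfolding tprepend_apply[OF vC b(1)]
        by (auto simp: b(2) tens_apply functional_convs[OF C] split: list.split)
    qed
    have eq: "iter_cop C (Suc n) c = ?F (cop C c)" if "c \<in> carr C" for c
      using lin_ext_eq_span[OF F, of ?G "cop C c" "{tens (scl C) (scl C) a b |a b. a \<in> carr C \<and> b \<in> carr C}"]
        tens cop_sq_carr[OF C that] unfolding tspan_def iter_cop.simps by blast
    moreover have "?F (cop C c) \<in> tpow_space C (Suc (Suc n))" if c: "c \<in> carr C" for c
      by (rule linear_span_into[OF F cop_sq_carr[OF C c, unfolded tspan_def] subspace_tpow_space])
        (use Suc in \<open>auto simp: tens intro!: tprepend_in[OF vC]\<close>)
    moreover have "?F (cop C c) \<phi>s = (if length \<phi>s = Suc (Suc n) \<and> functionals C \<phi>s then convs C \<phi>s c else 0)" for c \<phi>s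
      by (cases \<phi>s; cases "tl \<phi>s") (auto simp: conv_def)
    ultimately show ?case by (simp del: iter_cop.simps)
  qed
  then show "c \<in> carr C \<Longrightarrow> iter_cop C n c \<in> tpow_space C (Suc n)"
    "c \<in> carr C \<Longrightarrow> iter_cop C n c \<phi>s =
      (if length \<phi>s = Suc n \<and> functionals C \<phi>s then convs C \<phi>s c else 0)"
    by blast+
qed

section \<open>Connected coalgebras\<close>

text \<open>By the counit law \<open>\<epsilon>\<close> does not vanish on the line \<open>C\<^sub>0\<close>, so it has a normalised generator.  Its
  coproduct lies in \<open>C\<^sub>0 \<otimes> C\<^sub>0\<close>, hence is a multiple of \<open>1 \<otimes> 1\<close>, and the counit law fixes the factor.\<close>

lemma
  assumes C: "connected_coalgebra C"
  shows one_gr: "one C \<in> gr C 0" and cou_one: "cou C (one C) = 1"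
    and gr_0_eq: "x \<in> gr C 0 \<Longrightarrow> x = scl C (cou C x) (one C)"
    and cop_one: "cop C (one C) = tens (scl C) (scl C) (one C) (one C)"
proof -
  have gc: "graded_coalgebra C" and dim: "vector_space.dim (scl C) (gr C 0) = 1"
    using C by (auto simp: connected_coalgebra_def)
  note vC = graded_coalgebraD(2)[OF gc]
  interpret vector_space "scl C" by (rule vC)
  note sub = graded_spaceD(2)[OF graded_coalgebraD(1)[OF gc], of 0]
  obtain B where B: "B \<subseteq> gr C 0" "independent B" "gr C 0 \<subseteq> span B" "card B = dim (gr C 0)"
    by (rule basis_exists)
  then obtain v where v: "B = {v}" using dim by (auto simp: card_1_singleton_iff)
  have v0: "v \<noteq> 0" using B(2) v by simp
  have vgr: "v \<in> gr C 0" using B(1) v by simp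
  have ex: "\<exists>k. x = scl C k v" if "x \<in> gr C 0" for x
    using B(3) that unfolding v span_singleton by blast
  have "cou C v \<noteq> 0"
  proof
    assume 0: "cou C v = 0"
    have z: "cou C x = 0" if "x \<in> gr C 0" for x
      using ex[OF that] 0 functional_scale[OF graded_coalgebraD(4)[OF gc]] by auto
    have "x (cou C, \<phi>) = 0" if "x \<in> tens_gr C 0" "functional (scl C) \<phi>" for x \<phi>
      using that by (induction rule: tens_gr_ind) (auto simp: tens_apply graded_coalgebraD(4)[OF gc] z)
    note 0 = this
    have "\<phi> v = 0" if \<phi>: "functional (scl C) \<phi>" for \<phi>
      using counitD(1)[OF gc gr_carr[OF vC vgr] \<phi>] 0[OF graded_coalgebraD(5)[OF gc vgr] \<phi>]
      by (simp add: conv_def)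
    then show False using separates_functionals[OF vC, of "{v}"] v0 by (auto simp: separates_def)
  qed
  define u where "u = scl C (1 / cou C v) v"
  have u: "u \<in> gr C 0" "cou C u = 1"
    using subspace_scale[OF sub vgr] \<open>cou C v \<noteq> 0\<close>
    by (auto simp: u_def functional_scale[OF graded_coalgebraD(4)[OF gc]])
  have v_u: "v = scl C (cou C v) u" using \<open>cou C v \<noteq> 0\<close> by (simp add: u_def)
  have x_u: "x = scl C (cou C x) u" if "x \<in> gr C 0" for x
  proof -
    obtain k where k: "x = scl C k v" using ex[OF \<open>x \<in> gr C 0\<close>] by blast
    then have "x = scl C (k * cou C v) u" using v_u by (metis scale_scale)
    moreover from this have "cou C x = k * cou C v"
      using u(2) functional_scale[OF graded_coalgebraD(4)[OF gc]] by (metis mult.right_neutral)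
    ultimately show ?thesis by simp
  qed
  have one: "one C = u"
    unfolding one_def
  proof (rule the_equality)
    show "u \<in> gr C 0 \<and> cou C u = 1" using u by blast
    fix w assume "w \<in> gr C 0 \<and> cou C w = 1"
    then show "w = u" using x_u[of w] by simp
  qed
  show "one C \<in> gr C 0" "cou C (one C) = 1" using u one by auto
  show "x \<in> gr C 0 \<Longrightarrow> x = scl C (cou C x) (one C)" using x_u one by simp
  have "\<exists>k. x = fscale k (tens (scl C) (scl C) u u)" if "x \<in> tens_gr C 0" for x
    using that
  proof (induction rule: tens_gr_ind)
    case zero
    show ?case by (intro exI[of _ 0]) (simp add: fscale_def fun_eq_iff zero_fun_apply)
  next
    case (add x y)
    then obtain k l where "x = fscale k (tens (scl C) (scl C) u u)" "y = fscale l (tens (scl C) (scl C) u u)"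
      by blast
    then show ?case
      by (intro exI[of _ "k + l"]) (simp add: fscale_def fun_eq_iff plus_fun_apply algebra_simps)
  next
    case (scale a x)
    then obtain k where "x = fscale k (tens (scl C) (scl C) u u)" by blast
    then show ?case by (intro exI[of _ "a * k"]) (simp add: fscale_def fun_eq_iff)
  next
    case (tens a b i j)
    then have a: "a = scl C (cou C a) u" and b: "b = scl C (cou C b) u" using x_u by auto
    have "tens (scl C) (scl C) a b = fscale (cou C a) (tens (scl C) (scl C) u b)"
      by (subst a) (rule linear_D(4)[OF linear_tens_left[OF vC]])
    also have "tens (scl C) (scl C) u b = fscale (cou C b) (tens (scl C) (scl C) u u)"
      by (subst b) (rule linear_D(4)[OF linear_tens_right[OF vC]])
    finally show ?case
      by (intro exI[of _ "cou C a * cou C b"]) (simp add: fscale_def fun_eq_iff mult.assoc)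
  qed
  then obtain k where k: "cop C u = fscale k (tens (scl C) (scl C) u u)"
    using graded_coalgebraD(5)[OF gc u(1)] by blast
  have "k = 1"
    using counitD(1)[OF gc gr_carr[OF vC u(1)] graded_coalgebraD(4)[OF gc]] u(2)
      graded_coalgebraD(4)[OF gc]
    by (simp add: conv_def k tens_apply)
  then show "cop C (one C) = tens (scl C) (scl C) (one C) (one C)"
    using k one by (simp add: fscale_def)
qed

lemma convs_one:
  assumes C: "connected_coalgebra C" and "functionals C \<phi>s" "\<phi>s \<noteq> []"
  shows "convs C \<phi>s (one C) = pairing \<phi>s (replicate (length \<phi>s) (one C))"
  using assms(2,3)
proof (induction \<phi>s)
  case (Cons \<phi> \<phi>s)
  have gc: "graded_coalgebra C" using C by (simp add: connected_coalgebra_def)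
  show ?case
    using Cons functional_convs[OF gc, of \<phi>s]
    by (cases "\<phi>s = []") (auto simp: convs_Cons conv_def cop_one[OF C] tens_apply)
qed simp

lemma iter_cop_one:
  assumes C: "connected_coalgebra C"
  shows "iter_cop C n (one C) = tpow (scl C) (replicate (Suc n) (one C))"
proof
  fix \<phi>s
  have gc: "graded_coalgebra C" using C by (simp add: connected_coalgebra_def)
  have "one C \<in> carr C" by (rule gr_carr[OF graded_coalgebraD(2)[OF gc] one_gr[OF C]])
  then show "iter_cop C n (one C) \<phi>s = tpow (scl C) (replicate (Suc n) (one C)) \<phi>s"
    using convs_one[OF C, of \<phi>s] pairing_length[of \<phi>s "replicate (Suc n) (one C)"]
    by (cases "length \<phi>s = Suc n") (force simp: iter_cop_apply[OF gc] tpow_pairing simp del: replicate_Suc)+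
qed

section \<open>The composition of graded coalgebras\<close>

lemma comp_coalg_simps [simp]:
  "scl (comp_coalg D C) = fscale"
  "gr (comp_coalg D C) = (\<lambda>N. module.span fscale {circ D C d cs | d cs n js.
              d \<in> gr D n \<and> homs C cs js \<and> length cs = Suc n \<and> n + sum_list js = N})"
  by (simp_all add: comp_coalg_def)

text \<open>The points of \<open>D \<circ> C\<close>: products of a functional on \<open>D\<close> and a word of functionals on \<open>C\<close>.\<close>

definition pt :: "('d \<Rightarrow> 'k) \<Rightarrow> ('c \<Rightarrow> 'k) list \<Rightarrow> ('k, 'd, 'c) composite \<Rightarrow> 'k" where
  "pt \<delta> \<phi>s = ev (\<delta>, ev \<phi>s)"

lemma functional_pt [simp]: "functional fscale (pt \<delta> \<phi>s)"
  by (simp add: pt_def)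

lemma pt_circ:
  "functional (scl D) \<delta> \<Longrightarrow> functionals C \<phi>s \<Longrightarrow> pt \<delta> \<phi>s (circ D C d cs) = \<delta> d * pairing \<phi>s cs"
  by (simp add: pt_def circ_def ev_pair_tens) (simp add: ev_def tpow_pairing)

lemmas pt_linear = functional_0[OF functional_pt] functional_add[OF functional_pt]
  functional_scale[OF functional_pt]

lemma linear_circ_left:
  "vector_space (scl D) \<Longrightarrow> Vector_Spaces.linear (scl D) fscale (\<lambda>d. circ D C d cs)"
  unfolding circ_def by (rule linear_tens_left)

lemma linear_circ_right:
  assumes "vector_space (scl C)"
  shows "Vector_Spaces.linear (scl C) fscale (\<lambda>c. circ D C d (us @ c # ws))"
  using linear_comp[OF linear_tpow[OF assms] linear_tens_right[OF vector_space_fscale]]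
  unfolding circ_def o_def .

lemma circ_gr:
  "d \<in> gr D n \<Longrightarrow> homs C cs js \<Longrightarrow> length cs = Suc n \<Longrightarrow>
   circ D C d cs \<in> gr (comp_coalg D C) (n + sum_list js)"
  unfolding comp_coalg_simps by (rule span_baseI[OF vector_space_fscale]) blast

lemma homs_carr: "vector_space (scl C) \<Longrightarrow> homs C cs js \<Longrightarrow> set cs \<subseteq> carr C"
  unfolding homs_def by (rotate_tac, induction rule: list_all2_induct) (auto intro: gr_carr)

lemma hfuns_functionals: "list_all2 (\<lambda>\<phi> j. hfun C j \<phi>) \<phi>s js \<Longrightarrow> functionals C \<phi>s"
  by (induction rule: list_all2_induct) (auto dest: hfunD)

lemma homs_append: "homs C cs js \<Longrightarrow> homs C cs' js' \<Longrightarrow> homs C (cs @ cs') (js @ js')"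
  unfolding homs_def by (rule list_all2_appendI)

text \<open>Multilinearity: one letter after the other is decomposed into homogeneous parts.\<close>

lemma circ_carr_homs:
  assumes C: "vector_space (scl C)" and d: "d \<in> gr D n"
  shows "homs C us js \<Longrightarrow> set cs \<subseteq> carr C \<Longrightarrow> length us + length cs = Suc n \<Longrightarrow>
    circ D C d (us @ cs) \<in> carr (comp_coalg D C)"
proof (induction cs arbitrary: us js)
  case Nil
  then have "circ D C d us \<in> gr (comp_coalg D C) (n + sum_list js)" by (intro circ_gr[OF d]) auto
  then show ?case by (simp add: gr_carr vector_space_fscale del: comp_coalg_simps(2))
next
  case (Cons c cs)
  have "circ D C d (us @ c # cs) \<in> carr (comp_coalg D C)" if "c \<in> carr C" for c
  proof (rule linear_span_into[OF linear_circ_right[OF C] that[unfolded carr_def]])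
    show "module.subspace fscale (carr (comp_coalg D C))"
      using subspace_carr[of "comp_coalg D C"] by (simp add: vector_space_fscale)
    fix c assume "c \<in> \<Union> (range (gr C))"
    then obtain j where "c \<in> gr C j" by blast
    then show "circ D C d (us @ c # cs) \<in> carr (comp_coalg D C)"
      using Cons.IH[of "us @ [c]" "js @ [j]"] homs_append[OF Cons.prems(1), of "[c]" "[j]"] Cons.prems
      by (simp add: homs_def)
  qed
  then show ?case using Cons.prems by simp
qed

lemma circ_carr:
  assumes "vector_space (scl C)" "d \<in> gr D n" "set cs \<subseteq> carr C" "length cs = Suc n"
  shows "circ D C d cs \<in> carr (comp_coalg D C)"
  using circ_carr_homs[OF assms(1,2), of "[]" "[]" cs] assms(3,4) by (simp add: homs_def)

lemma carr_comp_homs: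
  "carr (comp_coalg D C) = module.span fscale {circ D C d cs | d cs n js.
      d \<in> gr D n \<and> homs C cs js \<and> length cs = Suc n}" (is "_ = module.span fscale ?B")
proof
  interpret vector_space fscale by (rule vector_space_fscale)
  have "gr (comp_coalg D C) N \<subseteq> span ?B" for N
    unfolding comp_coalg_simps by (rule span_mono) blast
  then show "carr (comp_coalg D C) \<subseteq> span ?B"
    unfolding carr_def comp_coalg_simps(1) by (intro span_minimal) auto
  have "?B \<subseteq> carr (comp_coalg D C)"
    using circ_gr gr_carr[of "comp_coalg D C"] by (fastforce simp: vector_space_fscale simp del: comp_coalg_simps(2))
  then show "span ?B \<subseteq> carr (comp_coalg D C)"
    using subspace_carr[of "comp_coalg D C"] by (intro span_minimal) (auto simp: vector_space_fscale)
qed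

lemma carr_comp:
  assumes C: "vector_space (scl C)"
  shows "carr (comp_coalg D C) = module.span fscale {circ D C d cs | d cs n.
      d \<in> gr D n \<and> set cs \<subseteq> carr C \<and> length cs = Suc n}" (is "_ = module.span fscale ?B")
proof
  interpret vector_space fscale by (rule vector_space_fscale)
  show "carr (comp_coalg D C) \<subseteq> span ?B"
    unfolding carr_comp_homs by (rule span_mono) (use homs_carr[OF C] in blast)
  show "span ?B \<subseteq> carr (comp_coalg D C)"
    using subspace_carr[of "comp_coalg D C"] circ_carr[OF C]
    by (intro span_minimal) (auto simp: vector_space_fscale)
qed

lemma carr_comp_ind [consumes 2, case_names zero add scale circ]:
  assumes C: "vector_space (scl C)" and x: "x \<in> carr (comp_coalg D C)" and "P 0"
    "\<And>x y. x \<in> carr (comp_coalg D C) \<Longrightarrow> y \<in> carr (comp_coalg D C) \<Longrightarrow> P x \<Longrightarrow> P y \<Longrightarrow> P (x + y)"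
    "\<And>a x. x \<in> carr (comp_coalg D C) \<Longrightarrow> P x \<Longrightarrow> P (fscale a x)"
    "\<And>d cs n. d \<in> gr D n \<Longrightarrow> set cs \<subseteq> carr C \<Longrightarrow> length cs = Suc n \<Longrightarrow> P (circ D C d cs)"
  shows "P x"
  using vector_space_fscale x[unfolded carr_comp[OF C]]
proof (induction rule: span_ind)
  case (base x)
  then show ?case using assms(6) by blast
qed (use assms(3-5)[unfolded carr_comp[OF C]] in blast)+

lemma subspace_carr_comp: "module.subspace fscale (carr (comp_coalg D C))"
  using subspace_carr[of "comp_coalg D C"] by (simp add: vector_space_fscale)

text \<open>A value at a point depends on each single functional through a vector only: contraction with the
  other functionals.  This lets separation be checked one tensor factor at a time.\<close>

lemma pt_slice_outer:
  assumes D: "graded_space D" and C: "vector_space (scl C)" and x: "x \<in> carr (comp_coalg D C)"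
    and f: "functionals C \<phi>s"
  shows "\<exists>v\<in>gr D (length \<phi>s - 1). \<forall>\<delta>. functional (scl D) \<delta> \<longrightarrow> pt \<delta> \<phi>s x = \<delta> v"
proof (rule span_slice[OF graded_spaceD(1)[OF D] graded_spaceD(2)[OF D] x[unfolded carr_comp[OF C]]])
  interpret vector_space "scl D" by (rule graded_spaceD(1)[OF D])
  note sub = graded_spaceD(2)[OF D]
  fix g assume "g \<in> {circ D C d cs | d cs n. d \<in> gr D n \<and> set cs \<subseteq> carr C \<and> length cs = Suc n}"
  then obtain d cs n where g: "g = circ D C d cs" "d \<in> gr D n" "length cs = Suc n" by blast
  show "\<exists>v\<in>gr D (length \<phi>s - 1). \<forall>\<delta>. functional (scl D) \<delta> \<longrightarrow> pt \<delta> \<phi>s g = \<delta> v"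
  proof (cases "length \<phi>s = Suc n")
    case True
    then show ?thesis using g subspace_scale[OF sub] f
      by (intro bexI[of _ "scl D (pairing \<phi>s cs) d"]) (auto simp: pt_circ functional_scale)
  next
    case False
    then show ?thesis using g subspace_0[OF sub] f
      by (intro bexI[of _ 0]) (auto simp: pt_circ functional_0 pairing_length)
  qed
qed simp

lemma pt_slice_inner:
  assumes C: "vector_space (scl C)" and x: "x \<in> carr (comp_coalg D C)"
    and \<delta>: "functional (scl D) \<delta>" and f: "functionals C us" "functionals C ws"
  shows "\<exists>v\<in>carr C. \<forall>\<phi>. functional (scl C) \<phi> \<longrightarrow> pt \<delta> (us @ \<phi> # ws) x = \<phi> v"
proof (rule span_slice[OF C subspace_carr[OF C] x[unfolded carr_comp[OF C]]])
  interpret vector_space "scl C" by (rule C)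
  note sub = subspace_carr[OF C]
  fix g assume "g \<in> {circ D C d cs | d cs n. d \<in> gr D n \<and> set cs \<subseteq> carr C \<and> length cs = Suc n}"
  then obtain d cs n where g: "g = circ D C d cs" "set cs \<subseteq> carr C" by blast
  have circ_eq: "pt \<delta> (us @ \<phi> # ws) (circ D C d cs) = \<delta> d * pairing (us @ \<phi> # ws) cs"
    if "functional (scl C) \<phi>" for \<phi>
    by (rule pt_circ[OF \<delta>]) (use f that in auto)
  show "\<exists>v\<in>carr C. \<forall>\<phi>. functional (scl C) \<phi> \<longrightarrow> pt \<delta> (us @ \<phi> # ws) g = \<phi> v"
  proof (cases "length cs = Suc (length us + length ws)")
    case True
    then have "length us < length cs" by simp
    then have cs: "cs = take (length us) cs @ cs ! length us # drop (Suc (length us)) cs"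
      by (rule id_take_nth_drop)
    have "pairing (us @ \<phi> # ws) cs = pairing us (take (length us) cs) *
        (\<phi> (cs ! length us) * pairing ws (drop (Suc (length us)) cs))" for \<phi>
      using pairing_append[of us "take (length us) cs" "\<phi> # ws" "cs ! length us # drop (Suc (length us)) cs"]
        \<open>length us < length cs\<close> cs by simp
    moreover have "cs ! length us \<in> carr C" using g(2) \<open>length us < length cs\<close> by auto
    ultimately show ?thesis using subspace_scale[OF sub] circ_eq
      by (intro bexI[of _ "scl C (\<delta> d * pairing us (take (length us) cs) * pairing ws (drop (Suc (length us)) cs))
         (cs ! length us)"]) (auto simp: g(1) functional_scale)
  next
    case False
    then show ?thesis using subspace_0[OF sub]
      by (intro bexI[of _ 0]) (auto simp: g(1) circ_eq functional_0 pairing_length)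
  qed
qed simp

text \<open>An outer functional of degree \<open>n\<close> is combined with words of length \<open>n + 1\<close> only; with any other
  word it gives a point that vanishes on the carrier.\<close>

definition hpts ::
  "('k::field, 'd::ab_group_add) coalg \<Rightarrow> ('c \<Rightarrow> 'k) set \<Rightarrow> (('k, 'd, 'c) composite \<Rightarrow> 'k) set" where
  "hpts D S = {pt \<delta> \<phi>s | \<delta> \<phi>s n. hfun D n \<delta> \<and> length \<phi>s = Suc n \<and> set \<phi>s \<subseteq> S}"

lemma hpts_pairE:
  assumes "\<xi> \<in> hpts D {\<phi>. functional (scl C) \<phi>}" "\<eta> \<in> hpts D {\<phi>. functional (scl C) \<phi>}"
  obtains \<delta> \<phi>s \<phi> \<epsilon> \<psi> \<psi>s where "\<xi> = pt \<delta> (\<phi>s @ [\<phi>])" "\<eta> = pt \<epsilon> (\<psi> # \<psi>s)"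
    "hfun D (length \<phi>s) \<delta>" "hfun D (length \<psi>s) \<epsilon>" "functionals C (\<phi>s @ \<phi> # \<psi> # \<psi>s)"
proof -
  obtain \<delta> \<phi>s' a \<epsilon> \<psi>s' b where *: "\<xi> = pt \<delta> \<phi>s'" "hfun D a \<delta>" "length \<phi>s' = Suc a" "functionals C \<phi>s'"
    "\<eta> = pt \<epsilon> \<psi>s'" "hfun D b \<epsilon>" "length \<psi>s' = Suc b" "functionals C \<psi>s'"
    using assms unfolding hpts_def by blast
  obtain \<phi>s \<phi> where \<phi>: "\<phi>s' = \<phi>s @ [\<phi>]" using *(3) by (metis length_Suc_conv_rev)
  obtain \<psi> \<psi>s where \<psi>: "\<psi>s' = \<psi> # \<psi>s" using *(7) by (metis length_Suc_conv)
  show thesis by (rule that[of \<delta> \<phi>s \<phi> \<epsilon> \<psi> \<psi>s]) (use * \<phi> \<psi> in auto)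
qed

lemma separates_pts:
  assumes D: "vector_space (scl D)" and C: "vector_space (scl C)" and x: "x \<in> carr (comp_coalg D C)"
    and 0: "\<And>\<delta> \<phi>s. functional (scl D) \<delta> \<Longrightarrow> functionals C \<phi>s \<Longrightarrow> pt \<delta> \<phi>s x = 0"
  shows "x = 0"
proof -
  let ?T = "module.span fscale (range (tpow (scl C)))"
  have T: "module.subspace fscale ?T" by (rule subspace_spanI[OF vector_space_fscale])
  have UNIV: "module.subspace (scl D) UNIV" using D by (simp add: module.subspace_UNIV module_iff_vector_space)
  have sepT: "separates fscale ?T {ev \<phi>s | \<phi>s. functionals C \<phi>s}"
    unfolding separates_def
  proof (intro conjI ballI impI)
    fix t assume t: "t \<in> ?T" and z: "\<forall>\<xi>\<in>{ev \<phi>s | \<phi>s. functionals C \<phi>s}. \<xi> t = 0"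
    have "t \<phi>s = 0" if "\<not> functionals C \<phi>s" for \<phi>s
      using vector_space_fscale t
      by (induction rule: span_ind) (use that in \<open>auto simp: tpow_pairing plus_fun_apply zero_fun_apply fscale_def\<close>)
    moreover have "t \<phi>s = 0" if "functionals C \<phi>s" for \<phi>s
      using bspec[OF z, of "ev \<phi>s"] that by (auto simp: ev_def)
    ultimately have "t \<phi>s = 0" for \<phi>s by blast
    then show "t = 0" by (simp add: fun_eq_iff zero_fun_apply)
  qed auto
  have "x \<in> tspan (scl D) UNIV fscale ?T"
    using x unfolding carr_comp[OF C]
    by (rule subsetD[OF span_subset_subspace[OF vector_space_fscale subspace_tspan], rotated])
      (auto simp: circ_def intro!: tens_in_tspan span_baseI vector_space_fscale)
  then show ?thesis
    using separates_tspan[OF D vector_space_fscale UNIV T separates_functionals[OF D] sepT] 0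
    unfolding separates_def pt_def by blast
qed

text \<open>Starting from points with all functionals arbitrary, the letters of the word are replaced one after
  the other by members of \<open>S\<close>, and finally the outer functional by a member of \<open>T n\<close>.\<close>

lemma separates_pts_family:
  assumes D: "graded_space D" and C: "vector_space (scl C)" and S: "separates (scl C) (carr C) S"
    and T: "\<And>n. separates (scl D) (gr D n) (T n)"
  shows "separates fscale (carr (comp_coalg D C))
    {pt \<delta> \<phi>s | \<delta> \<phi>s n. \<delta> \<in> T n \<and> length \<phi>s = Suc n \<and> set \<phi>s \<subseteq> S}"
  unfolding separates_def
proof (intro conjI ballI impI)
  fix x assume x: "x \<in> carr (comp_coalg D C)" and z: "\<forall>\<xi>\<in>{pt \<delta> \<phi>s | \<delta> \<phi>s n.
      \<delta> \<in> T n \<and> length \<phi>s = Suc n \<and> set \<phi>s \<subseteq> S}. \<xi> x = 0"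
  have 1: "pt \<delta> (us @ ws) x = 0"
    if "\<delta> \<in> T n" "functionals C us" "set ws \<subseteq> S" "length us + length ws = Suc n" for \<delta> us ws n
    using that
  proof (induction us arbitrary: ws rule: rev_induct)
    case Nil
    then have "pt \<delta> ws \<in> {pt \<delta> \<phi>s | \<delta> \<phi>s n. \<delta> \<in> T n \<and> length \<phi>s = Suc n \<and> set \<phi>s \<subseteq> S}" by auto
    from bspec[OF z this] show ?case by simp
  next
    case (snoc u us)
    have ws: "functionals C ws" using snoc.prems(3) separatesD[OF S] by auto
    obtain v where v: "v \<in> carr C" "\<And>\<phi>. functional (scl C) \<phi> \<Longrightarrow> pt \<delta> (us @ \<phi> # ws) x = \<phi> v"
      using pt_slice_inner[OF C x separatesD[OF T snoc.prems(1)] _ ws, of us] snoc.prems(2) by auto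
    have "\<phi> v = 0" if "\<phi> \<in> S" for \<phi>
      using snoc.IH[of "\<phi> # ws"] snoc.prems that v(2)[OF separatesD[OF S that]] by auto
    then have "v = 0" using S v(1) unfolding separates_def by blast
    then show ?case using v(2)[of u] snoc.prems(2) functional_0 by auto
  qed
  show "x = 0"
  proof (rule separates_pts[OF graded_spaceD(1)[OF D] C x])
    fix \<delta> \<phi>s assume \<delta>: "functional (scl D) \<delta>" and f: "functionals C \<phi>s"
    obtain v where v: "v \<in> gr D (length \<phi>s - 1)" "\<And>\<delta>. functional (scl D) \<delta> \<Longrightarrow> pt \<delta> \<phi>s x = \<delta> v"
      using pt_slice_outer[OF D C x f] by blast
    show "pt \<delta> \<phi>s x = 0"
    proof (cases "\<phi>s = []")
      case True
      show ?thesis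
        unfolding True using C x
        by (induction rule: carr_comp_ind) (auto simp: pt_linear pt_circ \<delta> pairing_length)
    next
      case False
      have "\<epsilon> v = 0" if "\<epsilon> \<in> T (length \<phi>s - 1)" for \<epsilon>
        using 1[OF that f, of "[]"] False v(2)[OF separatesD[OF T that]] by simp
      then have "v = 0" using T v(1) unfolding separates_def by blast
      then show ?thesis using v(2)[OF \<delta>] functional_0[OF \<delta>] by simp
    qed
  qed
qed auto

lemma separates_hpts:
  assumes D: "graded_space D" and C: "vector_space (scl C)" and S: "separates (scl C) (carr C) S"
  shows "separates fscale (carr (comp_coalg D C)) (hpts D S)"
  using separates_pts_family[OF D C S separates_gr_hfun[OF D]] by (simp add: hpts_def)

lemma pt_cong:
  assumes C: "vector_space (scl C)" and D: "vector_space (scl D)" and x: "x \<in> carr (comp_coalg D C)"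
    and f: "functional (scl D) \<delta>" "functional (scl D) \<epsilon>" "functionals C \<phi>s" "functionals C \<psi>s"
    and eq: "\<And>d. d \<in> carr D \<Longrightarrow> \<delta> d = \<epsilon> d" "list_all2 (\<lambda>\<phi> \<psi>. \<forall>c\<in>carr C. \<phi> c = \<psi> c) \<phi>s \<psi>s"
  shows "pt \<delta> \<phi>s x = pt \<epsilon> \<psi>s x"
  using C x
  by (induction rule: carr_comp_ind)
    (use f pairing_cong[OF eq(2)] in \<open>auto simp: pt_linear pt_circ eq(1) gr_carr[OF D]\<close>)

lemma pairing_homs:
  "list_all2 (\<lambda>\<phi> j. hfun C j \<phi>) \<phi>s js \<Longrightarrow> homs C cs ks \<Longrightarrow> js \<noteq> ks \<Longrightarrow> pairing \<phi>s cs = 0"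
proof (induction \<phi>s js arbitrary: cs ks rule: list_all2_induct)
  case Nil
  then show ?case by (cases cs) (auto simp: homs_def)
next
  case (Cons \<phi> \<phi>s j js)
  show ?case
  proof (cases cs)
    case c: (Cons c cs')
    then obtain k ks' where k: "ks = k # ks'" "c \<in> gr C k" "homs C cs' ks'"
      using Cons.prems(1) by (auto simp: homs_def list_all2_Cons1)
    then show ?thesis
      using Cons.IH[OF k(3)] hfunD(2)[OF Cons.hyps(1) k(2)] Cons.prems(2) c by (cases "j = k") auto
  qed simp
qed

lemma hfun_pt:
  assumes \<delta>: "hfun D n \<delta>" and f: "list_all2 (\<lambda>\<phi> j. hfun C j \<phi>) \<phi>s js" and l: "length \<phi>s = Suc n"
  shows "hfun (comp_coalg D C) (n + sum_list js) (pt \<delta> \<phi>s)"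
  unfolding hfun_def comp_coalg_simps
proof (intro conjI allI impI)
  fix m x assume m: "m \<noteq> n + sum_list js" and x: "x \<in> module.span fscale {circ D C d cs | d cs n js.
              d \<in> gr D n \<and> homs C cs js \<and> length cs = Suc n \<and> n + sum_list js = m}"
  note fs = hfuns_functionals[OF f]
  show "pt \<delta> \<phi>s x = 0"
    using vector_space_fscale x
  proof (induction rule: span_ind)
    case (base x)
    then obtain d cs k ks where x: "x = circ D C d cs" "d \<in> gr D k" "homs C cs ks" "length cs = Suc k"
      "k + sum_list ks = m" by blast
    consider "k \<noteq> n" | "ks \<noteq> js" using x(5) m by blast
    then show ?case
      using pairing_length[of \<phi>s cs] x(4) l pairing_homs[OF f x(3)]
      by cases (simp_all add: x(1) pt_circ hfunD(1)[OF \<delta>] fs)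
  qed (auto simp: pt_linear)
qed simp

lemma hfuns_degrees: "\<forall>\<phi>\<in>set \<phi>s. \<exists>j. hfun C j \<phi> \<Longrightarrow> \<exists>js. list_all2 (\<lambda>\<phi> j. hfun C j \<phi>) \<phi>s js"
  by (induction \<phi>s) (auto simp: list_all2_Cons1)

lemma hpts_hfun:
  assumes "\<xi> \<in> hpts D {\<phi>. \<exists>j. hfun C j \<phi>}"
  shows "\<exists>N. hfun (comp_coalg D C) N \<xi>"
proof -
  from assms obtain \<delta> \<phi>s n where *: "\<xi> = pt \<delta> \<phi>s" "hfun D n \<delta>" "length \<phi>s = Suc n"
    "set \<phi>s \<subseteq> {\<phi>. \<exists>j. hfun C j \<phi>}" by (auto simp: hpts_def)
  from *(4) have "\<exists>js. list_all2 (\<lambda>\<phi> j. hfun C j \<phi>) \<phi>s js" by (intro hfuns_degrees) blast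
  then show ?thesis using hfun_pt[OF *(2) _ *(3)] *(1) by blast
qed

text \<open>Homogeneous points see only one degree each, and together they separate; so a vanishing sum of
  homogeneous elements vanishes term by term.\<close>

lemma graded_space_comp:
  assumes D: "graded_space D" and C: "graded_space C"
  shows "graded_space (comp_coalg D C)"
  unfolding graded_space_def
proof (intro conjI allI impI)
  show "vector_space (scl (comp_coalg D C))" by (simp add: vector_space_fscale)
  show "module.subspace (scl (comp_coalg D C)) (gr (comp_coalg D C) n)" for n
    by (simp add: subspace_spanI vector_space_fscale)
  fix v :: "nat \<Rightarrow> _" and N m
  assume v: "(\<forall>n. v n \<in> gr (comp_coalg D C) n) \<and> (\<Sum>n\<le>N. v n) = 0" and m: "m \<le> N"
  note sep = separates_hpts[OF D graded_spaceD(1)[OF C] separates_carr_hfun[OF C]]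
  have "v m \<in> carr (comp_coalg D C)"
    using gr_carr[of "comp_coalg D C" "v m" m] v by (simp add: vector_space_fscale del: comp_coalg_simps(2))
  moreover have "\<xi> (v m) = 0" if \<xi>: "\<xi> \<in> hpts D {\<phi>. \<exists>j. hfun C j \<phi>}" for \<xi>
  proof -
    obtain k where k: "hfun (comp_coalg D C) k \<xi>" using hpts_hfun[OF \<xi>] by blast
    have z: "\<xi> (v n) = 0" if "n \<noteq> k" for n using hfunD(2)[OF k, of "v n" n] v that by blast
    show ?thesis
    proof (cases "m = k")
      case True
      have "0 = \<xi> (\<Sum>n\<le>N. v n)" using v functional_0[OF hfunD(1)[OF k]] by simp
      also have "\<dots> = (\<Sum>n\<le>N. \<xi> (v n))" by (rule functional_sum[OF hfunD(1)[OF k]])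
      also have "\<dots> = (\<Sum>n\<le>N. if n = k then \<xi> (v k) else 0)" using z by (intro sum.cong) auto
      finally show ?thesis using m True by simp
    qed (use z in simp)
  qed
  ultimately show "v m = 0" using sep unfolding separates_def by blast
qed

section \<open>The coproduct of a composition\<close>

lemma tspan_scale_args:
  assumes "x \<in> tspan s A t B" "functional s \<phi>" "functional t \<psi>"
  shows "x (\<lambda>v. a * \<phi> v, \<lambda>w. b * \<psi> w) = a * b * x (\<phi>, \<psi>)"
proof -
  have f: "functional s (\<lambda>v. a * \<phi> v)" "functional t (\<lambda>w. b * \<psi> w)"
    using assms(2,3) unfolding functional_def by (auto intro: linear_scale_map)
  show ?thesis
    using assms(1) by (induction rule: tspan_ind) (auto simp: tens_apply f assms algebra_simps)
qed

lemma tcomponent_eq: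
  assumes D: "graded_space D" and x: "x \<in> tens_gr D n"
  shows "tcomponent D i j x = tens_map (scl D) (scl D) (proj D i) (proj D j) x"
proof -
  note lp = linear_proj[OF D]
  have z: "tens (scl D) (scl D) a 0 = 0" "tens (scl D) (scl D) 0 b = 0" for a b
    using linear_0[OF linear_tens_left[OF graded_spaceD(1)[OF D]]]
      linear_0[OF linear_tens_right[OF graded_spaceD(1)[OF D]]] by auto
  have gen: "tens_map (scl D) (scl D) (proj D i) (proj D j) (tens (scl D) (scl D) a b) =
      (if k = i \<and> l = j then tens (scl D) (scl D) a b else 0)" if "a \<in> gr D k" "b \<in> gr D l" for a b k l
    unfolding tens_map_tens[OF lp lp] proj_gr[OF D that(1)] proj_gr[OF D that(2)] by (auto simp: z)
  show ?thesis
    unfolding tcomponent_def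
  proof (rule lin_ext_eq_span[OF linear_tens_map _ x[unfolded tens_gr_def]])
    fix a assume "a \<in> {tens (scl D) (scl D) a b |a b i j. a \<in> gr D i \<and> b \<in> gr D j \<and> i + j = n}"
    then show "\<exists>y. (a, y) \<in> {(tens (scl D) (scl D) a b, if k = i \<and> l = j then tens (scl D) (scl D) a b else 0) |a b k l.
        a \<in> gr D k \<and> b \<in> gr D l}" by blast
  qed (use gen in auto)
qed

lemma hfun_proj_eq:
  assumes D: "graded_space D" and \<phi>: "hfun D n \<phi>" and x: "x \<in> carr D"
  shows "\<phi> (proj D m x) = (if m = n then \<phi> x else 0)"
proof -
  note F = functional_comp[OF linear_proj[OF D] hfunD(1)[OF \<phi>], unfolded functional_def]
  note Z = linear_zero_map[OF graded_spaceD(1)[OF D] vector_space_mult]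
  show ?thesis
  proof (cases "m = n")
    case True
    have "(\<phi> \<circ> proj D m) x = \<phi> x"
      by (rule linear_eq_carr[OF F hfunD(1)[OF \<phi>, unfolded functional_def] x])
        (auto simp: proj_gr[OF D] True hfunD(2)[OF \<phi>] functional_0[OF hfunD(1)[OF \<phi>]])
    then show ?thesis using True by simp
  next
    case False
    have "(\<phi> \<circ> proj D m) x = 0"
      by (rule linear_eq_carr[OF F Z x])
        (use False in \<open>auto simp: proj_gr[OF D] hfunD(2)[OF \<phi>] functional_0[OF hfunD(1)[OF \<phi>]]\<close>)
    then show ?thesis using False by simp
  qed
qed

text \<open>The inner linear extension in \<open>circ_cop\<close>.\<close>

definition split_at ::
  "('k::field, 'd::ab_group_add) coalg \<Rightarrow> ('k, 'c::ab_group_add) coalg \<Rightarrow> nat \<Rightarrow> 'c list \<Rightarrow> 'd \<Rightarrow> 'd \<Rightarrow>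
   ('k, ('k, 'd, 'c) composite, ('k, 'd, 'c) composite) tensor" where
  "split_at D C i cs d' d'' = lin_ext fscale fscale
        {(tens (scl C) (scl C) c' c'',
          tens fscale fscale (circ D C d' (take i cs @ [c']))
                             (circ D C d'' (c'' # drop (Suc i) cs))) | c' c''.
            c' \<in> carr C \<and> c'' \<in> carr C}
        (cop C (cs ! i))"

lemma circ_cop_split_at:
  "circ_cop D C n d cs = (\<Sum>i\<le>n. lin_ext fscale fscale
     {(tens (scl D) (scl D) d' d'', split_at D C i cs d' d'') | d' d''.
        d' \<in> gr D i \<and> d'' \<in> gr D (n - i)} (tcomponent D i (n - i) (cop D d)))"
  by (simp add: circ_cop_def split_at_def)

context
  fixes D :: "('k::field, 'd::ab_group_add) coalg" and C :: "('k, 'c::ab_group_add) coalg"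
  assumes D: "graded_coalgebra D" and C: "graded_coalgebra C"
begin

lemmas compD = graded_coalgebraD[OF D]
lemmas compC = graded_coalgebraD[OF C]

abbreviation (input) "DC \<equiv> comp_coalg D C"

lemma split_at_eq:
  assumes "cs ! i \<in> carr C"
  shows "split_at D C i cs d' d'' =
    tens_map fscale fscale (\<lambda>c'. circ D C d' (take i cs @ [c'])) (\<lambda>c''. circ D C d'' (c'' # drop (Suc i) cs)) (cop C (cs ! i))"
    and "Vector_Spaces.linear (scl C) fscale (\<lambda>c'. circ D C d' (take i cs @ [c']))"
    and "Vector_Spaces.linear (scl C) fscale (\<lambda>c''. circ D C d'' (c'' # drop (Suc i) cs))"
proof -
  show l: "Vector_Spaces.linear (scl C) fscale (\<lambda>c'. circ D C d' (take i cs @ [c']))"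
    by (rule linear_circ_right[OF compC(2)])
  show r: "Vector_Spaces.linear (scl C) fscale (\<lambda>c''. circ D C d'' (c'' # drop (Suc i) cs))"
    using linear_circ_right[OF compC(2), of D d'' "[]"] by simp
  show "split_at D C i cs d' d'' =
    tens_map fscale fscale (\<lambda>c'. circ D C d' (take i cs @ [c'])) (\<lambda>c''. circ D C d'' (c'' # drop (Suc i) cs)) (cop C (cs ! i))"
    unfolding split_at_def
    by (rule lin_ext_eq_span[OF linear_tens_map _ cop_sq_carr[OF C assms, unfolded tspan_def]])
      (use tens_map_tens[OF l r] in auto)
qed

lemma split_at_pt:
  assumes c: "cs ! i \<in> carr C" and f: "functional (scl D) \<delta>" "functional (scl D) \<epsilon>"
    "functionals C (\<phi>s @ \<phi> # \<psi> # \<psi>s)" and i: "i < length cs"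
  shows "split_at D C i cs d' d'' (pt \<delta> (\<phi>s @ [\<phi>]), pt \<epsilon> (\<psi> # \<psi>s)) =
    (if length \<phi>s = i \<and> length \<psi>s = length cs - Suc i
     then \<delta> d' * \<epsilon> d'' * pairing (\<phi>s @ conv C \<phi> \<psi> # \<psi>s) cs else 0)"
proof -
  have lt: "length (take i cs) = i" using i by simp
  have l: "pt \<delta> (\<phi>s @ [\<phi>]) \<circ> (\<lambda>c'. circ D C d' (take i cs @ [c'])) =
      (\<lambda>c. (if length \<phi>s = i then \<delta> d' * pairing \<phi>s (take i cs) else 0) * \<phi> c)"
  proof
    fix c
    have "pt \<delta> (\<phi>s @ [\<phi>]) (circ D C d' (take i cs @ [c])) = \<delta> d' * pairing (\<phi>s @ [\<phi>]) (take i cs @ [c])"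
      by (rule pt_circ) (use f in auto)
    also have "pairing (\<phi>s @ [\<phi>]) (take i cs @ [c]) = (if length \<phi>s = i then pairing \<phi>s (take i cs) * \<phi> c else 0)"
      using lt by (auto simp: pairing_append pairing_length)
    finally show "(pt \<delta> (\<phi>s @ [\<phi>]) \<circ> (\<lambda>c'. circ D C d' (take i cs @ [c']))) c =
      (if length \<phi>s = i then \<delta> d' * pairing \<phi>s (take i cs) else 0) * \<phi> c" by simp
  qed
  have r: "pt \<epsilon> (\<psi> # \<psi>s) \<circ> (\<lambda>c''. circ D C d'' (c'' # drop (Suc i) cs)) =
      (\<lambda>c. (if length \<psi>s = length cs - Suc i then \<epsilon> d'' * pairing \<psi>s (drop (Suc i) cs) else 0) * \<psi> c)"
  proof
    fix c
    have "pt \<epsilon> (\<psi> # \<psi>s) (circ D C d'' (c # drop (Suc i) cs)) = \<epsilon> d'' * pairing (\<psi> # \<psi>s) (c # drop (Suc i) cs)"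
      by (rule pt_circ) (use f in auto)
    also have "pairing (\<psi> # \<psi>s) (c # drop (Suc i) cs) =
        (if length \<psi>s = length cs - Suc i then pairing \<psi>s (drop (Suc i) cs) * \<psi> c else 0)"
      by (auto simp: pairing_length)
    finally show "(pt \<epsilon> (\<psi> # \<psi>s) \<circ> (\<lambda>c''. circ D C d'' (c'' # drop (Suc i) cs))) c =
      (if length \<psi>s = length cs - Suc i then \<epsilon> d'' * pairing \<psi>s (drop (Suc i) cs) else 0) * \<psi> c"
      by simp
  qed
  have f': "functional (scl C) \<phi>" "functional (scl C) \<psi>" using f by auto
  have v: "split_at D C i cs d' d'' (pt \<delta> (\<phi>s @ [\<phi>]), pt \<epsilon> (\<psi> # \<psi>s)) =
      (if length \<phi>s = i then \<delta> d' * pairing \<phi>s (take i cs) else 0) *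
      (if length \<psi>s = length cs - Suc i then \<epsilon> d'' * pairing \<psi>s (drop (Suc i) cs) else 0) *
      conv C \<phi> \<psi> (cs ! i)"
    unfolding split_at_eq(1)[OF c] tens_map_apply[OF functional_pt functional_pt] l r
      tspan_scale_args[OF cop_sq_carr[OF C c] f'] conv_def ..
  have "pairing (\<phi>s @ conv C \<phi> \<psi> # \<psi>s) cs =
      pairing \<phi>s (take i cs) * (conv C \<phi> \<psi> (cs ! i) * pairing \<psi>s (drop (Suc i) cs))" if "length \<phi>s = i"
    using pairing_append[of \<phi>s "take i cs" "conv C \<phi> \<psi> # \<psi>s" "cs ! i # drop (Suc i) cs"]
      id_take_nth_drop[OF i] that lt by simp
  then show ?thesis unfolding v by (auto simp: algebra_simps)
qed

lemma split_at_in: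
  assumes cs: "set cs \<subseteq> carr C" "length cs = Suc n" "i \<le> n" and d: "d' \<in> gr D i" "d'' \<in> gr D (n - i)"
  shows "split_at D C i cs d' d'' \<in> sq_carr DC"
proof -
  have c: "cs ! i \<in> carr C" using cs by auto
  have "circ D C d' (take i cs @ [c]) \<in> carr DC" if "c \<in> carr C" for c
    by (rule circ_carr[OF compC(2) d(1)]) (use cs that in \<open>auto dest: in_set_takeD\<close>)
  moreover have "circ D C d'' (c # drop (Suc i) cs) \<in> carr DC" if "c \<in> carr C" for c
    by (rule circ_carr[OF compC(2) d(2)]) (use cs that in \<open>auto dest: in_set_dropD\<close>)
  ultimately show ?thesis
    unfolding split_at_eq(1)[OF c] comp_coalg_simps(1)
    by (intro tens_map_in[OF cop_sq_carr[OF C c] split_at_eq(2,3)[OF c]]) auto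
qed

lemma split_at_gr:
  assumes cs: "homs C cs js" "length cs = Suc n" "i \<le> n" and d: "d' \<in> gr D i" "d'' \<in> gr D (n - i)"
  shows "split_at D C i cs d' d'' \<in> tens_gr DC (n + sum_list js)"
proof -
  have l: "length js = Suc n" using cs by (auto simp: homs_def list_all2_lengthD)
  have ci: "cs ! i \<in> gr C (js ! i)" using cs by (auto simp: homs_def list_all2_conv_all_nth)
  have c: "cs ! i \<in> carr C" by (rule gr_carr[OF compC(2) ci])
  have t: "homs C (take i cs) (take i js)" "homs C (drop (Suc i) cs) (drop (Suc i) js)"
    using cs(1) by (auto simp: homs_def list_all2_takeI list_all2_dropI)
  have sum: "sum_list js = sum_list (take i js) + js ! i + sum_list (drop (Suc i) js)"
    using id_take_nth_drop[of i js] l cs(3)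
    by (metis add.assoc le_imp_less_Suc sum_list.Cons sum_list.append)
  show ?thesis
    unfolding split_at_eq(1)[OF c] tens_gr_def[of DC]
  proof (rule linear_span_into[OF linear_tens_map compC(5)[OF ci, unfolded tens_gr_def] subspace_spanI[OF vector_space_fscale]])
    fix x assume "x \<in> {tens (scl C) (scl C) a b |a b k l. a \<in> gr C k \<and> b \<in> gr C l \<and> k + l = js ! i}"
    then obtain a b k l where x: "x = tens (scl C) (scl C) a b" "a \<in> gr C k" "b \<in> gr C l" "k + l = js ! i" by blast
    have "homs C (take i cs @ [a]) (take i js @ [k])"
      by (rule homs_append[OF t(1)]) (use x(2) in \<open>simp add: homs_def\<close>)
    then have "circ D C d' (take i cs @ [a]) \<in> gr DC (i + sum_list (take i js @ [k]))"
      by (rule circ_gr[OF d(1)]) (use cs in simp)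
    moreover have "circ D C d'' (b # drop (Suc i) cs) \<in> gr DC (n - i + sum_list (l # drop (Suc i) js))"
      by (rule circ_gr[OF d(2)]) (use cs x(3) t(2) in \<open>auto simp: homs_def\<close>)
    moreover have "i + sum_list (take i js @ [k]) + (n - i + sum_list (l # drop (Suc i) js)) = n + sum_list js"
      using sum x(4) cs(3) by simp
    ultimately show "tens_map fscale fscale (\<lambda>c'. circ D C d' (take i cs @ [c']))
        (\<lambda>c''. circ D C d'' (c'' # drop (Suc i) cs)) x
      \<in> module.span fscale {tens (scl DC) (scl DC) a b |a b k l. a \<in> gr DC k \<and> b \<in> gr DC l \<and> k + l = n + sum_list js}"
      unfolding x(1) tens_map_tens[OF split_at_eq(2,3)[OF c]] comp_coalg_simps(1)
      by (intro span_baseI[OF vector_space_fscale]) blast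
  qed
qed

lemma
  assumes cs: "set cs \<subseteq> carr C" "length cs = Suc n" "i \<le> n"
  defines "G \<equiv> {(tens (scl D) (scl D) d' d'', split_at D C i cs d' d'') | d' d''.
      d' \<in> gr D i \<and> d'' \<in> gr D (n - i)}"
  shows linear_split: "Vector_Spaces.linear fscale fscale (lin_ext fscale fscale G)"
    and split_tens: "d' \<in> gr D i \<Longrightarrow> d'' \<in> gr D (n - i) \<Longrightarrow>
      lin_ext fscale fscale G (tens (scl D) (scl D) d' d'') = split_at D C i cs d' d''"
    and split_in: "x \<in> tspan (scl D) (gr D i) (scl D) (gr D (n - i)) \<Longrightarrow> lin_ext fscale fscale G x \<in> sq_carr DC"
    and split_pt: "x \<in> tspan (scl D) (gr D i) (scl D) (gr D (n - i)) \<Longrightarrow>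
      functional (scl D) \<delta> \<Longrightarrow> functional (scl D) \<epsilon> \<Longrightarrow> functionals C (\<phi>s @ \<phi> # \<psi> # \<psi>s) \<Longrightarrow>
      lin_ext fscale fscale G x (pt \<delta> (\<phi>s @ [\<phi>]), pt \<epsilon> (\<psi> # \<psi>s)) =
      (if length \<phi>s = i \<and> length \<psi>s = n - i then x (\<delta>, \<epsilon>) * pairing (\<phi>s @ conv C \<phi> \<psi> # \<psi>s) cs else 0)"
proof -
  have ci: "cs ! i \<in> carr C" "i < length cs" using cs by auto
  let ?F = "{\<phi>. functional (scl C) \<phi>}"
  note sepE = separates_hpts[OF compD(1) compC(2) separates_functionals[OF compC(2)]]
  have "module.span fscale (snd ` G) \<subseteq> sq_carr DC"
    by (rule span_subset_subspace[OF vector_space_fscale subspace_tspan])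
      (use split_at_in[OF cs] in \<open>auto simp: G_def\<close>)
  note sep = separates_mono[OF separates_tspan[OF vector_space_fscale vector_space_fscale
        subspace_carr_comp subspace_carr_comp sepE sepE] this[unfolded comp_coalg_simps(1)]]
  have val: "\<xi> (split_at D C i cs d' d'') =
       (if length \<phi>s = i \<and> length \<psi>s = n - i then \<delta> d' * \<epsilon> d'' * pairing (\<phi>s @ conv C \<phi> \<psi> # \<psi>s) cs else 0)"
    if "\<xi> = ev (pt \<delta> (\<phi>s @ [\<phi>]), pt \<epsilon> (\<psi> # \<psi>s))" "functional (scl D) \<delta>" "functional (scl D) \<epsilon>"
      "functionals C (\<phi>s @ \<phi> # \<psi> # \<psi>s)" for \<xi> \<delta> \<epsilon> \<phi>s \<phi> \<psi> \<psi>s d' d''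
    using split_at_pt[OF ci(1) that(2,3,4) ci(2)] cs(2) by (simp add: that(1) ev_def)
  have dual: "\<forall>\<xi>\<in>evs (hpts D ?F) (hpts D ?F). \<exists>\<Lambda>. functional fscale \<Lambda> \<and> (\<forall>(x, y)\<in>G. \<Lambda> x = \<xi> y)"
  proof
    fix \<xi> assume "\<xi> \<in> evs (hpts D ?F) (hpts D ?F)"
    then obtain \<zeta> \<eta> where \<zeta>: "\<xi> = ev (\<zeta>, \<eta>)" "\<zeta> \<in> hpts D ?F" "\<eta> \<in> hpts D ?F" by blast
    obtain \<delta> \<phi>s \<phi> \<epsilon> \<psi> \<psi>s where pts: "\<zeta> = pt \<delta> (\<phi>s @ [\<phi>])" "\<eta> = pt \<epsilon> (\<psi> # \<psi>s)"
      and h: "hfun D (length \<phi>s) \<delta>" "hfun D (length \<psi>s) \<epsilon>" "functionals C (\<phi>s @ \<phi> # \<psi> # \<psi>s)"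
      by (rule hpts_pairE[OF \<zeta>(2,3)])
    note \<xi> = \<zeta>(1)[unfolded pts]
    let ?k = "if length \<phi>s = i \<and> length \<psi>s = n - i then pairing (\<phi>s @ conv C \<phi> \<psi> # \<psi>s) cs else 0"
    have f: "functional (scl D) \<delta>" "functional (scl D) \<epsilon>" "functionals C (\<phi>s @ \<phi> # \<psi> # \<psi>s)"
      using h hfunD(1) by auto
    show "\<exists>\<Lambda>. functional fscale \<Lambda> \<and> (\<forall>(x, y)\<in>G. \<Lambda> x = \<xi> y)"
    proof (intro exI conjI)
      show "functional fscale (\<lambda>x. ?k * ev (\<delta>, \<epsilon>) x)"
        unfolding functional_def by (rule linear_scale_map[OF functional_ev[unfolded functional_def]])
      show "\<forall>(x, y)\<in>G. ?k * ev (\<delta>, \<epsilon>) x = \<xi> y"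
        unfolding G_def using val[OF \<xi> f] by (auto simp: ev_pair_tens f)
    qed
  qed
  note ext = lin_ext_dual[OF vector_space_fscale vector_space_fscale sep dual]
  show lin: "Vector_Spaces.linear fscale fscale (lin_ext fscale fscale G)" by (rule ext(1))
  show tens: "lin_ext fscale fscale G (tens (scl D) (scl D) d' d'') = split_at D C i cs d' d''"
    if "d' \<in> gr D i" "d'' \<in> gr D (n - i)" for d' d''
    by (rule ext(2)) (use that in \<open>auto simp: G_def\<close>)
  show "lin_ext fscale fscale G x \<in> sq_carr DC" if "x \<in> tspan (scl D) (gr D i) (scl D) (gr D (n - i))"
    by (rule linear_span_into[OF lin that[unfolded tspan_def] subspace_tspan])
      (use split_at_in[OF cs] in \<open>auto simp: tens\<close>)
  show "lin_ext fscale fscale G x (pt \<delta> (\<phi>s @ [\<phi>]), pt \<epsilon> (\<psi> # \<psi>s)) =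
      (if length \<phi>s = i \<and> length \<psi>s = n - i then x (\<delta>, \<epsilon>) * pairing (\<phi>s @ conv C \<phi> \<psi> # \<psi>s) cs else 0)"
    if x: "x \<in> tspan (scl D) (gr D i) (scl D) (gr D (n - i))" and
      f: "functional (scl D) \<delta>" "functional (scl D) \<epsilon>" "functionals C (\<phi>s @ \<phi> # \<psi> # \<psi>s)"
    using x
  proof (induction rule: tspan_ind)
    case (tens d' d'')
    show ?case unfolding \<open>\<And>d' d''. d' \<in> gr D i \<Longrightarrow> d'' \<in> gr D (n - i) \<Longrightarrow>
        lin_ext fscale fscale G (tens (scl D) (scl D) d' d'') = split_at D C i cs d' d''\<close>[OF tens]
      using val[OF refl f, of d' d''] by (simp add: ev_def tens_apply f)
  qed (auto simp: linear_0[OF lin] linear_D[OF lin] algebra_simps)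
qed

lemma tcomponent_cop:
  assumes d: "d \<in> gr D n"
  shows "tcomponent D i j (cop D d) = tens_map (scl D) (scl D) (proj D i) (proj D j) (cop D d)"
    "tcomponent D i j (cop D d) \<in> tspan (scl D) (gr D i) (scl D) (gr D j)"
proof -
  show eq: "tcomponent D i j (cop D d) = tens_map (scl D) (scl D) (proj D i) (proj D j) (cop D d)"
    by (rule tcomponent_eq[OF compD(1) compD(5)[OF d]])
  show "tcomponent D i j (cop D d) \<in> tspan (scl D) (gr D i) (scl D) (gr D j)"
    unfolding eq
    by (rule tens_map_in[OF cop_sq_carr[OF D gr_carr[OF compD(2) d]] linear_proj[OF compD(1)] linear_proj[OF compD(1)]])
      (auto intro: proj_in_gr[OF compD(1)])
qed

lemma circ_cop_in:
  assumes d: "d \<in> gr D n" and cs: "set cs \<subseteq> carr C" "length cs = Suc n"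
  shows "circ_cop D C n d cs \<in> sq_carr DC"
proof -
  interpret vector_space fscale by (rule vector_space_fscale)
  show ?thesis
    unfolding circ_cop_split_at
    by (rule subspace_sum[OF subspace_tspan], rule split_in[OF cs])
      (use tcomponent_cop(2)[OF d] in auto)
qed

lemma circ_cop_gr:
  assumes d: "d \<in> gr D n" and cs: "homs C cs js" "length cs = Suc n"
  shows "circ_cop D C n d cs \<in> tens_gr DC (n + sum_list js)"
proof -
  interpret vector_space fscale by (rule vector_space_fscale)
  note cs' = homs_carr[OF compC(2) cs(1)] cs(2)
  have sub: "subspace (tens_gr DC (n + sum_list js))" unfolding tens_gr_def by (rule subspace_span)
  show ?thesis
    unfolding circ_cop_split_at
  proof (rule subspace_sum[OF sub])
    fix i assume "i \<in> {..n}"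
    then have i: "i \<le> n" by simp
    show "lin_ext fscale fscale {(tens (scl D) (scl D) d' d'', split_at D C i cs d' d'') | d' d''.
        d' \<in> gr D i \<and> d'' \<in> gr D (n - i)} (tcomponent D i (n - i) (cop D d)) \<in> tens_gr DC (n + sum_list js)"
      by (rule linear_span_into[OF linear_split[OF cs' i] tcomponent_cop(2)[OF d, unfolded tspan_def] sub])
        (use split_tens[OF cs' i] split_at_gr[OF cs i] in auto)
  qed
qed

text \<open>In \<open>circ_cop\<close> the summand that splits at \<open>i\<close> pairs with a word of length \<open>i + 1\<close> on the left only, so
  a pair of points selects one summand; there the split letter meets the last letter of the first word
  and the first letter of the second.\<close>

lemma circ_cop_pt:
  assumes d: "d \<in> gr D n" and cs: "set cs \<subseteq> carr C" "length cs = Suc n"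
    and h: "hfun D (length \<phi>s) \<delta>" "hfun D (length \<psi>s) \<epsilon>" and f: "functionals C (\<phi>s @ \<phi> # \<psi> # \<psi>s)"
  shows "circ_cop D C n d cs (pt \<delta> (\<phi>s @ [\<phi>]), pt \<epsilon> (\<psi> # \<psi>s)) =
    pt (conv D \<delta> \<epsilon>) (\<phi>s @ conv C \<phi> \<psi> # \<psi>s) (circ D C d cs)"
proof -
  let ?a = "length \<phi>s" and ?b = "length \<psi>s"
  note h' = hfunD(1)[OF h(1)] hfunD(1)[OF h(2)]
  have dc: "d \<in> carr D" by (rule gr_carr[OF compD(2) d])
  have comp: "tcomponent D i j (cop D d) (\<delta>, \<epsilon>) = (if i = ?a \<and> j = ?b then conv D \<delta> \<epsilon> d else 0)" for i j
  proof -
    have "tcomponent D i j (cop D d) (\<delta>, \<epsilon>) = cop D d (\<delta> \<circ> proj D i, \<epsilon> \<circ> proj D j)"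
      unfolding tcomponent_cop(1)[OF d] by (rule tens_map_apply[OF h'])
    also have "\<dots> = cop D d (\<lambda>x. (if i = ?a then 1 else 0) * \<delta> x, \<lambda>x. (if j = ?b then 1 else 0) * \<epsilon> x)"
      by (rule tspan_cong[OF cop_sq_carr[OF D dc]])
        (auto simp: hfun_proj_eq[OF compD(1) h(1)] hfun_proj_eq[OF compD(1) h(2)]
          intro!: functional_comp[OF linear_proj[OF compD(1)]] h'
          linear_scale_map[OF h'(1)[unfolded functional_def], folded functional_def, of 0, simplified]
          linear_scale_map[OF h'(2)[unfolded functional_def], folded functional_def, of 0, simplified])
    also have "\<dots> = (if i = ?a then 1 else 0) * (if j = ?b then 1 else 0) * cop D d (\<delta>, \<epsilon>)"
      by (rule tspan_scale_args[OF cop_sq_carr[OF D dc] h'])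
    finally show ?thesis by (simp add: conv_def)
  qed
  have sum_pair: "(\<Sum>i\<in>I. g i) (p, q) = (\<Sum>i\<in>I. g i (p, q))" for g :: "nat \<Rightarrow> _ \<Rightarrow> 'k" and I p q
    by (induction I rule: infinite_finite_induct) auto
  have "circ_cop D C n d cs (pt \<delta> (\<phi>s @ [\<phi>]), pt \<epsilon> (\<psi> # \<psi>s)) =
      (\<Sum>i\<le>n. if ?a = i \<and> ?b = n - i then tcomponent D i (n - i) (cop D d) (\<delta>, \<epsilon>) *
          pairing (\<phi>s @ conv C \<phi> \<psi> # \<psi>s) cs else 0)"
    unfolding circ_cop_split_at sum_pair
    by (rule sum.cong[OF refl], rule split_pt[OF cs]) (use tcomponent_cop(2)[OF d] h' f in auto)
  also have "\<dots> = (\<Sum>i\<le>n. if i = ?a then (if ?b = n - ?a then conv D \<delta> \<epsilon> d *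
          pairing (\<phi>s @ conv C \<phi> \<psi> # \<psi>s) cs else 0) else 0)"
    by (rule sum.cong[OF refl]) (auto simp: comp)
  also have "\<dots> = (if ?a + ?b = n then conv D \<delta> \<epsilon> d * pairing (\<phi>s @ conv C \<phi> \<psi> # \<psi>s) cs else 0)"
    by auto
  also have "\<dots> = conv D \<delta> \<epsilon> d * pairing (\<phi>s @ conv C \<phi> \<psi> # \<psi>s) cs"
    using cs(2) by (auto simp: pairing_length)
  also have "\<dots> = pt (conv D \<delta> \<epsilon>) (\<phi>s @ conv C \<phi> \<psi> # \<psi>s) (circ D C d cs)"
    by (rule pt_circ[symmetric]) (use f functional_conv[OF D] functional_conv[OF C] in auto)
  finally show ?thesis .
qed

text \<open>The product rule for points proves that the coproduct, given by a linear extension, has the prescribed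
  values on generators, and passes from generators to all elements.\<close>

lemma
  shows linear_cop_comp: "Vector_Spaces.linear fscale fscale (cop DC)"
    and cop_circ: "d \<in> gr D n \<Longrightarrow> set cs \<subseteq> carr C \<Longrightarrow> length cs = Suc n \<Longrightarrow>
      cop DC (circ D C d cs) = circ_cop D C n d cs"
    and conv_comp: "x \<in> carr DC \<Longrightarrow> hfun D (length \<phi>s) \<delta> \<Longrightarrow> hfun D (length \<psi>s) \<epsilon> \<Longrightarrow>
      functionals C (\<phi>s @ \<phi> # \<psi> # \<psi>s) \<Longrightarrow>
      conv DC (pt \<delta> (\<phi>s @ [\<phi>])) (pt \<epsilon> (\<psi> # \<psi>s)) x = pt (conv D \<delta> \<epsilon>) (\<phi>s @ conv C \<phi> \<psi> # \<psi>s) x"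
proof -
  let ?G = "{(circ D C d cs, circ_cop D C n d cs) | d cs n. d \<in> gr D n \<and> set cs \<subseteq> carr C \<and> length cs = Suc n}"
  let ?F = "{\<phi>. functional (scl C) \<phi>}"
  note sepE = separates_hpts[OF compD(1) compC(2) separates_functionals[OF compC(2)]]
  have copE: "cop DC = lin_ext fscale fscale ?G" by (simp add: comp_coalg_def)
  have "module.span fscale (snd ` ?G) \<subseteq> sq_carr DC"
    by (rule span_subset_subspace[OF vector_space_fscale subspace_tspan])
      (use circ_cop_in in auto)
  note sep = separates_mono[OF separates_tspan[OF vector_space_fscale vector_space_fscale
        subspace_carr_comp subspace_carr_comp sepE sepE] this[unfolded comp_coalg_simps(1)]]
  have dual: "\<forall>\<xi>\<in>evs (hpts D ?F) (hpts D ?F). \<exists>\<Lambda>. functional fscale \<Lambda> \<and> (\<forall>(x, y)\<in>?G. \<Lambda> x = \<xi> y)"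
  proof
    fix \<xi> assume "\<xi> \<in> evs (hpts D ?F) (hpts D ?F)"
    then obtain \<zeta> \<eta> where \<zeta>: "\<xi> = ev (\<zeta>, \<eta>)" "\<zeta> \<in> hpts D ?F" "\<eta> \<in> hpts D ?F" by blast
    obtain \<delta> \<phi>s \<phi> \<epsilon> \<psi> \<psi>s where pts: "\<zeta> = pt \<delta> (\<phi>s @ [\<phi>])" "\<eta> = pt \<epsilon> (\<psi> # \<psi>s)"
      and h: "hfun D (length \<phi>s) \<delta>" "hfun D (length \<psi>s) \<epsilon>" "functionals C (\<phi>s @ \<phi> # \<psi> # \<psi>s)"
      by (rule hpts_pairE[OF \<zeta>(2,3)])
    note \<xi> = \<zeta>(1)[unfolded pts]
    show "\<exists>\<Lambda>. functional fscale \<Lambda> \<and> (\<forall>(x, y)\<in>?G. \<Lambda> x = \<xi> y)"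
      by (rule exI[of _ "pt (conv D \<delta> \<epsilon>) (\<phi>s @ conv C \<phi> \<psi> # \<psi>s)"])
        (use circ_cop_pt[OF _ _ _ h] in \<open>auto simp: \<xi> ev_def[of "(_, _)"]\<close>)
  qed
  note ext = lin_ext_dual[OF vector_space_fscale vector_space_fscale sep dual, folded copE]
  show lin: "Vector_Spaces.linear fscale fscale (cop DC)" by (rule ext(1))
  show circ: "cop DC (circ D C d cs) = circ_cop D C n d cs"
    if "d \<in> gr D n" "set cs \<subseteq> carr C" "length cs = Suc n" for d cs n
    by (rule ext(2)) (use that in blast)
  show "conv DC (pt \<delta> (\<phi>s @ [\<phi>])) (pt \<epsilon> (\<psi> # \<psi>s)) x = pt (conv D \<delta> \<epsilon>) (\<phi>s @ conv C \<phi> \<psi> # \<psi>s) x"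
    if x: "x \<in> carr DC" and h: "hfun D (length \<phi>s) \<delta>" "hfun D (length \<psi>s) \<epsilon>" "functionals C (\<phi>s @ \<phi> # \<psi> # \<psi>s)"
    using compC(2) x unfolding conv_def
  proof (induction rule: carr_comp_ind)
    case (circ d cs n)
    have "cop DC (circ D C d cs) = circ_cop D C n d cs"
      by (rule ext(2)) (use circ in blast)
    then show ?case
      using circ_cop_pt[OF circ h] unfolding conv_def by simp
  qed (auto simp: linear_0[OF lin] linear_D[OF lin] pt_linear)
qed

lemma
  shows cou_comp: "x \<in> carr DC \<Longrightarrow> cou DC x = pt (cou D) [cou C] x"
    and functional_cou_comp: "functional fscale (cou DC)"
proof -
  have couE: "cou DC = lin_ext fscale (*) {(circ D C d cs, cou D d * (\<Prod>c\<leftarrow>cs. cou C c)) | d cs n.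
              d \<in> gr D n \<and> set cs \<subseteq> carr C \<and> length cs = Suc n}"
    by (simp add: comp_coalg_def)
  note eps = compD(4) compC(4)
  have gen: "pt (cou D) [cou C] (circ D C d cs) = cou D d * (\<Prod>c\<leftarrow>cs. cou C c)"
    if "d \<in> gr D n" "length cs = Suc n" for d cs n
  proof (cases "n = 0")
    case True
    then obtain c where "cs = [c]" using \<open>length cs = Suc n\<close> by (auto simp: length_Suc_conv)
    then show ?thesis by (simp add: pt_circ eps)
  next
    case False
    then show ?thesis using that hfunD(2)[OF compD(6) that(1)] by (simp add: pt_circ eps)
  qed
  show "cou DC x = pt (cou D) [cou C] x" if "x \<in> carr DC" for x
    unfolding couE
    by (rule lin_ext_eq_span[OF functional_pt[unfolded functional_def] _ that[unfolded carr_comp[OF compC(2)]]])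
      (use gen in auto)
  show "functional fscale (cou DC)"
    unfolding couE functional_def
    by (rule lin_ext_exists(1)[OF functional_pt[unfolded functional_def]]) (use gen in auto)
qed

text \<open>By the product rule both bracketings of three points glue the three words in the same way; the case
  distinction is whether the middle word has a single letter, which then meets both neighbours.\<close>

lemma graded_coalgebra_comp: "graded_coalgebra DC"
proof -
  let ?F = "{\<phi>. functional (scl C) \<phi>}"
  note cou = cou_comp and lin_cou = functional_cou_comp
  note sepE = separates_hpts[OF compD(1) compC(2) separates_functionals[OF compC(2)]]
  show ?thesis
  proof (rule graded_coalgebraI)
    show "graded_space DC" by (rule graded_space_comp[OF compD(1) compC(1)])
    show "Vector_Spaces.linear (scl DC) fscale (cop DC)" using linear_cop_comp by simp
    show "separates (scl DC) (carr DC) (hpts D ?F)" using sepE by simp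
    show copgr: "cop DC x \<in> tens_gr DC N" if x: "x \<in> gr DC N" for x N
    proof (rule linear_span_into[OF linear_cop_comp x[unfolded comp_coalg_simps]])
      show "module.subspace fscale (tens_gr DC N)"
        unfolding tens_gr_def by (rule subspace_spanI[OF vector_space_fscale])
    qed (use circ_cop_gr cop_circ homs_carr[OF compC(2)] in auto)
    have h0: "hfun DC 0 (pt (cou D) [cou C])"
      using hfun_pt[OF compD(6), where \<phi>s = "[cou C]" and js = "[0]" and C = C] compC(6) by simp
    have grc: "x \<in> carr DC" if "x \<in> gr DC N" for x N
      using gr_carr[of DC x N] that by (simp add: vector_space_fscale del: comp_coalg_simps(2))
    show "hfun DC 0 (cou DC)"
      using h0 lin_cou cou grc unfolding hfun_def comp_coalg_simps(1) by metis
    have sq: "cop DC x \<in> sq_carr DC" if "x \<in> carr DC" for x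
      by (rule cop_sq_carr_graded[OF _ _ copgr that]) (auto simp: vector_space_fscale linear_cop_comp)
    have cong: "conv DC \<xi> \<eta> x = conv DC \<xi>' \<eta>' x"
      if "x \<in> carr DC" "functional fscale \<xi>" "functional fscale \<eta>" "functional fscale \<xi>'" "functional fscale \<eta>'"
        "\<And>y. y \<in> carr DC \<Longrightarrow> \<xi> y = \<xi>' y" "\<And>y. y \<in> carr DC \<Longrightarrow> \<eta> y = \<eta>' y" for x \<xi> \<eta> \<xi>' \<eta>'
      unfolding conv_def by (rule tspan_cong[OF sq[OF that(1)]]) (use that in auto)
    have fconv: "functional fscale (conv DC \<xi> \<eta>)" for \<xi> \<eta>
      using linear_D[OF linear_cop_comp] by (intro functionalI) (auto simp: conv_def)
    note fD = functional_conv[OF D] and fC = functional_conv[OF C]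
    have refl2: "list_all2 (\<lambda>\<phi> \<psi>. \<forall>c\<in>carr C. \<phi> c = \<psi> c) \<phi>s \<phi>s" for \<phi>s
      by (simp add: list_all2_same)
    {
      fix x \<xi> \<eta> \<zeta> assume x: "x \<in> carr DC" and "\<xi> \<in> hpts D ?F" "\<eta> \<in> hpts D ?F" "\<zeta> \<in> hpts D ?F"
      then obtain \<delta> \<phi>s a \<epsilon> \<psi>s b \<theta> \<chi>s c where *: "\<xi> = pt \<delta> \<phi>s" "hfun D a \<delta>" "length \<phi>s = Suc a" "functionals C \<phi>s"
        "\<eta> = pt \<epsilon> \<psi>s" "hfun D b \<epsilon>" "length \<psi>s = Suc b" "functionals C \<psi>s"
        "\<zeta> = pt \<theta> \<chi>s" "hfun D c \<theta>" "length \<chi>s = Suc c" "functionals C \<chi>s"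
        unfolding hpts_def by blast
      obtain \<phi>s0 \<phi> where \<phi>: "\<phi>s = \<phi>s0 @ [\<phi>]" using *(3) by (metis length_Suc_conv_rev)
      obtain \<chi> \<chi>s0 where \<chi>: "\<chi>s = \<chi> # \<chi>s0" using *(11) by (metis length_Suc_conv)
      obtain \<psi> m0 where \<psi>: "\<psi>s = \<psi> # m0" using *(7) by (metis length_Suc_conv)
      have fx: "functional fscale \<xi>" by (simp add: *(1))
      note hD = *(2,6,10)
      note fd = hD[THEN hfunD(1)]
      have assocD: "conv D (conv D \<delta> \<epsilon>) \<theta> d = conv D \<delta> (conv D \<epsilon> \<theta>) d" if "d \<in> carr D" for d
        by (rule coassocD[OF D that fd])
      show "conv DC (conv DC \<xi> \<eta>) \<zeta> x = conv DC \<xi> (conv DC \<eta> \<zeta>) x"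
      proof (cases m0 rule: rev_cases)
        case Nil
        have l: "a = length \<phi>s0" "b = 0" "c = length \<chi>s0" using * \<phi> \<chi> \<psi> Nil by auto
        have f: "functionals C (\<phi>s0 @ \<phi> # \<psi> # \<chi> # \<chi>s0)" using * \<phi> \<chi> \<psi> by auto
        have 1: "conv DC \<xi> \<eta> y = pt (conv D \<delta> \<epsilon>) (\<phi>s0 @ [conv C \<phi> \<psi>]) y" if "y \<in> carr DC" for y
          using conv_comp[OF that, of \<phi>s0 \<delta> "[]" \<epsilon> \<phi> \<psi>] hD f * l \<phi> \<psi> Nil by simp
        have 2: "conv DC \<eta> \<zeta> y = pt (conv D \<epsilon> \<theta>) (conv C \<psi> \<chi> # \<chi>s0) y" if "y \<in> carr DC" for y
          using conv_comp[OF that, of "[]" \<epsilon> \<chi>s0 \<theta> \<psi> \<chi>] hD f * l \<psi> \<chi> Nil by simp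
        have "conv DC (conv DC \<xi> \<eta>) \<zeta> x = conv DC (pt (conv D \<delta> \<epsilon>) (\<phi>s0 @ [conv C \<phi> \<psi>])) \<zeta> x"
          by (rule cong[OF x fconv _ _ _ 1]) (auto simp: *)
        also have "\<dots> = pt (conv D (conv D \<delta> \<epsilon>) \<theta>) (\<phi>s0 @ conv C (conv C \<phi> \<psi>) \<chi> # \<chi>s0) x"
          unfolding *(9) \<chi>
          by (rule conv_comp[OF x]) (use f hD l hfun_conv[OF D hD(1,2)] fC in auto)
        also have "\<dots> = pt (conv D \<delta> (conv D \<epsilon> \<theta>)) (\<phi>s0 @ conv C \<phi> (conv C \<psi> \<chi>) # \<chi>s0) x"
          by (rule pt_cong[OF compC(2) compD(2) x fD fD _ _ assocD])
            (use f coassocD[OF C, of _ \<phi> \<psi> \<chi>] in \<open>auto simp: fC intro!: list_all2_appendI refl2\<close>)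
        also have "\<dots> = conv DC \<xi> (pt (conv D \<epsilon> \<theta>) (conv C \<psi> \<chi> # \<chi>s0)) x"
          unfolding *(1) \<phi>
          by (rule conv_comp[OF x, symmetric]) (use f hD l hfun_conv[OF D hD(2,3)] fC in auto)
        also have "\<dots> = conv DC \<xi> (conv DC \<eta> \<zeta>) x"
          by (rule cong[OF x, symmetric]) (auto simp: 2 fconv fx)
        finally show ?thesis .
      next
        case (snoc m \<psi>')
        have l: "a = length \<phi>s0" "b = Suc (length m)" "c = length \<chi>s0" using * \<phi> \<chi> \<psi> snoc by auto
        have f: "functionals C (\<phi>s0 @ \<phi> # \<psi> # m @ \<psi>' # \<chi> # \<chi>s0)" using * \<phi> \<chi> \<psi> snoc by auto
        then have f1: "functionals C (\<phi>s0 @ \<phi> # \<psi> # m @ [\<psi>'])" and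
          f2: "functionals C ((\<psi> # m) @ \<psi>' # \<chi> # \<chi>s0)" by auto
        have 1: "conv DC \<xi> \<eta> y = pt (conv D \<delta> \<epsilon>) ((\<phi>s0 @ conv C \<phi> \<psi> # m) @ [\<psi>']) y" if "y \<in> carr DC" for y
          using conv_comp[OF that, of \<phi>s0 \<delta> "m @ [\<psi>']" \<epsilon> \<phi> \<psi>, OF _ _ f1] hD l
          by (simp add: *(1,5) \<phi> \<psi> snoc)
        have 2: "conv DC \<eta> \<zeta> y = pt (conv D \<epsilon> \<theta>) (\<psi> # m @ conv C \<psi>' \<chi> # \<chi>s0) y" if "y \<in> carr DC" for y
          using conv_comp[OF that, of "\<psi> # m" \<epsilon> \<chi>s0 \<theta> \<psi>' \<chi>, OF _ _ f2] hD l
          by (simp add: *(5,9) \<psi> \<chi> snoc)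
        have "conv DC (conv DC \<xi> \<eta>) \<zeta> x = conv DC (pt (conv D \<delta> \<epsilon>) ((\<phi>s0 @ conv C \<phi> \<psi> # m) @ [\<psi>'])) \<zeta> x"
          by (rule cong[OF x fconv _ _ _ 1]) (auto simp: *)
        also have "\<dots> = pt (conv D (conv D \<delta> \<epsilon>) \<theta>) ((\<phi>s0 @ conv C \<phi> \<psi> # m) @ conv C \<psi>' \<chi> # \<chi>s0) x"
          unfolding *(9) \<chi>
          by (rule conv_comp[OF x]) (use f hD l hfun_conv[OF D hD(1,2)] fC in auto)
        also have "\<dots> = pt (conv D \<delta> (conv D \<epsilon> \<theta>)) ((\<phi>s0 @ conv C \<phi> \<psi> # m) @ conv C \<psi>' \<chi> # \<chi>s0) x"
          by (rule pt_cong[OF compC(2) compD(2) x fD fD _ _ assocD refl2]) (use f fC in auto)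
        also have "\<dots> = pt (conv D \<delta> (conv D \<epsilon> \<theta>)) (\<phi>s0 @ conv C \<phi> \<psi> # (m @ conv C \<psi>' \<chi> # \<chi>s0)) x"
          by simp
        also have "\<dots> = conv DC \<xi> (pt (conv D \<epsilon> \<theta>) (\<psi> # m @ conv C \<psi>' \<chi> # \<chi>s0)) x"
          unfolding *(1) \<phi>
          by (rule conv_comp[OF x, symmetric]) (use f hD l hfun_conv[OF D hD(2,3)] fC in auto)
        also have "\<dots> = conv DC \<xi> (conv DC \<eta> \<zeta>) x"
          by (rule cong[OF x, symmetric]) (auto simp: 2 fconv fx)
        finally show ?thesis .
      qed
    }
    {
      fix x \<xi> assume x: "x \<in> carr DC" and \<xi>: "\<xi> \<in> hpts D ?F"
      then obtain \<delta> \<phi>s a where *: "\<xi> = pt \<delta> \<phi>s" "hfun D a \<delta>" "length \<phi>s = Suc a" "functionals C \<phi>s"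
        unfolding hpts_def by blast
      obtain \<phi>s0 \<phi> where \<phi>: "\<phi>s = \<phi>s0 @ [\<phi>]" using *(3) by (metis length_Suc_conv_rev)
      obtain \<psi> \<psi>s0 where \<psi>: "\<phi>s = \<psi> # \<psi>s0" using *(3) by (metis length_Suc_conv)
      have "conv DC (cou DC) \<xi> x = conv DC (pt (cou D) [cou C]) \<xi> x"
        by (rule cong[OF x lin_cou _ _ _ cou]) (auto simp: *)
      also have "\<dots> = pt (conv D (cou D) \<delta>) (conv C (cou C) \<psi> # \<psi>s0) x"
        using conv_comp[OF x, of "[]" "cou D" \<psi>s0 \<delta> "cou C" \<psi>] * \<psi> compD(6) compC(4) by simp
      also have "\<dots> = \<xi> x"
        unfolding *(1) \<psi>
        by (rule pt_cong[OF compC(2) compD(2) x])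
          (use * \<psi> counitD(1)[OF D _ hfunD(1)[OF *(2)]] counitD(1)[OF C, of _ \<psi>] fC fD hfunD(1)[OF *(2)]
           in \<open>auto simp: list_all2_same\<close>)
      finally show "conv DC (cou DC) \<xi> x = \<xi> x" .
      have "conv DC \<xi> (cou DC) x = conv DC \<xi> (pt (cou D) [cou C]) x"
        by (rule cong[OF x _ lin_cou _ _ _ cou]) (auto simp: *)
      also have "\<dots> = pt (conv D \<delta> (cou D)) (\<phi>s0 @ [conv C \<phi> (cou C)]) x"
        using conv_comp[OF x, of \<phi>s0 \<delta> "[]" "cou D" \<phi> "cou C"] * \<phi> compD(6) compC(4) by simp
      also have "\<dots> = \<xi> x"
        unfolding *(1) \<phi>
        by (rule pt_cong[OF compC(2) compD(2) x])
          (use * \<phi> counitD(2)[OF D _ hfunD(1)[OF *(2)]] counitD(2)[OF C, of _ \<phi>] fC fD hfunD(1)[OF *(2)]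
           in \<open>auto simp: list_all2_same intro!: list_all2_appendI\<close>)
      finally show "conv DC \<xi> (cou DC) x = \<xi> x" .
    }
  qed
qed


end

section \<open>Connectedness of a composition\<close>

text \<open>In degree \<open>0\<close> only \<open>d \<circ> c\<close> with \<open>d \<in> D\<^sub>0\<close> and \<open>c \<in> C\<^sub>0\<close> occur, and these are multiples of \<open>1 \<circ> 1\<close>.\<close>

lemma connected_comp:
  assumes D: "connected_coalgebra D" and C: "connected_coalgebra C"
  shows "connected_coalgebra (comp_coalg D C)" "one (comp_coalg D C) = circ D C (one D) [one C]"
proof -
  let ?E = "comp_coalg D C" and ?v = "circ D C (one D) [one C]"
  interpret vector_space fscale by (rule vector_space_fscale)
  have gD: "graded_coalgebra D" and gC: "graded_coalgebra C"
    using D C by (auto simp: connected_coalgebra_def)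
  note gE = graded_coalgebra_comp[OF gD gC]
  note vD = graded_coalgebraD(2)[OF gD] and vC = graded_coalgebraD(2)[OF gC]
  have v: "?v \<in> gr ?E 0"
    using circ_gr[OF one_gr[OF D], of C "[one C]" "[0]"] one_gr[OF C] by (simp add: homs_def)
  have cou1: "cou ?E ?v = 1"
    using cou_comp[OF gD gC gr_carr[OF graded_coalgebraD(2)[OF gE] v]]
    by (simp add: pt_circ graded_coalgebraD(4) gD gC cou_one D C)
  have v0: "?v \<noteq> 0"
    using cou1 functional_0[OF functional_cou_comp[OF gD gC]] by auto
  have "gr ?E 0 = span {?v}"
  proof
    show "gr ?E 0 \<subseteq> span {?v}"
      unfolding comp_coalg_simps
    proof (rule span_minimal[OF _ subspace_span], rule subsetI)
      fix x assume "x \<in> {circ D C d cs |d cs n js. d \<in> gr D n \<and> homs C cs js \<and> length cs = Suc n \<and> n + sum_list js = 0}"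
      then obtain d cs n js where x: "x = circ D C d cs" "d \<in> gr D n" "homs C cs js" "length cs = Suc n"
        "n + sum_list js = 0" unfolding mem_Collect_eq by (elim exE conjE)
      then obtain c where c: "cs = [c]" "c \<in> gr C 0" "d \<in> gr D 0"
        by (auto simp: length_Suc_conv homs_def list_all2_Cons1)
      have "x = circ D C (scl D (cou D d) (one D)) [c]" using gr_0_eq[OF D c(3)] x(1) c(1) by simp
      also have "\<dots> = fscale (cou D d) (circ D C (one D) [c])"
        by (rule linear_D(4)[OF linear_circ_left[OF vD]])
      also have "circ D C (one D) [c] = circ D C (one D) [scl C (cou C c) (one C)]"
        using gr_0_eq[OF C c(2)] by simp
      also have "\<dots> = fscale (cou C c) ?v"
        using linear_D(4)[OF linear_circ_right[OF vC, where us = "[]" and ws = "[]"]] by simp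
      finally show "x \<in> span {?v}" by (simp add: span_scale span_base)
    qed
    show "span {?v} \<subseteq> gr ?E 0"
      using v subspace_span by (intro span_minimal) auto
  qed
  then have "dim (gr ?E 0) = 1"
    using dim_span_eq_card_independent[of "{?v}"] v0 by simp
  then show con: "connected_coalgebra ?E" using gE by (simp add: connected_coalgebra_def)
  show "one ?E = ?v" using gr_0_eq[OF con v] cou1 by simp
qed

section \<open>Operations on tensor squares\<close>

definition bilinear_on ::
  "('k::field, 'u::ab_group_add) coalg \<Rightarrow> ('k, 'v::ab_group_add) coalg \<Rightarrow>
   ('k, 'w::ab_group_add) coalg \<Rightarrow> ('u \<Rightarrow> 'v \<Rightarrow> 'w) \<Rightarrow> bool" where
  "bilinear_on U V W m \<longleftrightarrow>
     (\<forall>x\<in>carr U. \<forall>x'\<in>carr U. \<forall>y\<in>carr V. m (x + x') y = m x y + m x' y) \<and>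
     (\<forall>x\<in>carr U. \<forall>y\<in>carr V. \<forall>y'\<in>carr V. m x (y + y') = m x y + m x y') \<and>
     (\<forall>a. \<forall>x\<in>carr U. \<forall>y\<in>carr V. m (scl U a x) y = scl W a (m x y)) \<and>
     (\<forall>a. \<forall>x\<in>carr U. \<forall>y\<in>carr V. m x (scl V a y) = scl W a (m x y)) \<and>
     (\<forall>x\<in>carr U. \<forall>y\<in>carr V. m x y \<in> carr W)"

text \<open>The operations are bilinear on the carriers only.  Composing with projections onto the carriers makes
  them bilinear everywhere, as linear extension requires.\<close>

definition carr_proj :: "('k::field, 'v::ab_group_add) coalg \<Rightarrow> 'v \<Rightarrow> 'v" where
  "carr_proj C = (SOME P. Vector_Spaces.linear (scl C) (scl C) P \<and> (\<forall>x. P x \<in> carr C) \<and> (\<forall>x\<in>carr C. P x = x))"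

lemma
  assumes "vector_space (scl C)"
  shows linear_carr_proj: "Vector_Spaces.linear (scl C) (scl C) (carr_proj C)"
    and carr_proj_in: "carr_proj C x \<in> carr C"
    and carr_proj_id: "y \<in> carr C \<Longrightarrow> carr_proj C y = y"
  using someI_ex[OF projection_exists[OF assms subspace_carr[OF assms]], folded carr_proj_def] by blast+

context
  fixes U :: "('k::field, 'u::ab_group_add) coalg" and V :: "('k, 'v::ab_group_add) coalg"
    and W :: "('k, 'w::ab_group_add) coalg" and m
  assumes U: "vector_space (scl U)" and V: "vector_space (scl V)" and W: "vector_space (scl W)"
    and m: "bilinear_on U V W m"
begin

lemma bilinear_left: "Vector_Spaces.linear (scl U) (scl W) (\<lambda>u. m (carr_proj U u) v)" if "v \<in> carr V"
  using m that carr_proj_in[OF U] linear_D[OF linear_carr_proj[OF U]]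
  by (simp add: Vector_Spaces.linear_iff U W bilinear_on_def)

lemma bilinear_right: "Vector_Spaces.linear (scl V) (scl W) (\<lambda>v. m u (carr_proj V v))" if "u \<in> carr U"
  using m that carr_proj_in[OF V] linear_D[OF linear_carr_proj[OF V]]
  by (simp add: Vector_Spaces.linear_iff V W bilinear_on_def)

text \<open>For fixed \<open>y\<close> the value of \<open>tens_op\<close> on a pair of functionals depends on \<open>u\<^sub>1 \<otimes> u\<^sub>2\<close> linearly; this is
  the dual extension needed to know that \<open>tens_op\<close> has its prescribed values.\<close>

lemma tens_op_functional:
  assumes y: "y \<in> sq_carr V" and f: "functional (scl W) \<phi>" "functional (scl W) \<psi>"
  shows "\<exists>\<Lambda>. functional fscale \<Lambda> \<and> (\<forall>u\<^sub>1\<in>carr U. \<forall>u\<^sub>2\<in>carr U. \<Lambda> (tens (scl U) (scl U) u\<^sub>1 u\<^sub>2) =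
    y (\<phi> \<circ> (\<lambda>v. m u\<^sub>1 (carr_proj V v)), \<psi> \<circ> (\<lambda>v. m u\<^sub>2 (carr_proj V v))))"
  using y
proof (induction rule: tspan_ind)
  case zero
  show ?case
    by (rule exI[of _ "\<lambda>_. 0"])
      (use linear_zero_map[OF vector_space_fscale vector_space_mult] in \<open>auto simp: functional_def\<close>)
next
  case (add x y)
  then obtain \<Lambda> \<Lambda>' where "functional fscale \<Lambda>" "functional fscale \<Lambda>'"
    "\<forall>u\<^sub>1\<in>carr U. \<forall>u\<^sub>2\<in>carr U. \<Lambda> (tens (scl U) (scl U) u\<^sub>1 u\<^sub>2) =
      x (\<phi> \<circ> (\<lambda>v. m u\<^sub>1 (carr_proj V v)), \<psi> \<circ> (\<lambda>v. m u\<^sub>2 (carr_proj V v)))"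
    "\<forall>u\<^sub>1\<in>carr U. \<forall>u\<^sub>2\<in>carr U. \<Lambda>' (tens (scl U) (scl U) u\<^sub>1 u\<^sub>2) =
      y (\<phi> \<circ> (\<lambda>v. m u\<^sub>1 (carr_proj V v)), \<psi> \<circ> (\<lambda>v. m u\<^sub>2 (carr_proj V v)))" by blast
  then show ?case
    by (intro exI[of _ "\<lambda>x. \<Lambda> x + \<Lambda>' x"]) (simp add: functional_def linear_add_map del: comp_apply)
next
  case (scale a x)
  then obtain \<Lambda> where "functional fscale \<Lambda>"
    "\<forall>u\<^sub>1\<in>carr U. \<forall>u\<^sub>2\<in>carr U. \<Lambda> (tens (scl U) (scl U) u\<^sub>1 u\<^sub>2) =
      x (\<phi> \<circ> (\<lambda>v. m u\<^sub>1 (carr_proj V v)), \<psi> \<circ> (\<lambda>v. m u\<^sub>2 (carr_proj V v)))" by blast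
  then show ?case
    by (intro exI[of _ "\<lambda>x. a * \<Lambda> x"]) (simp add: functional_def linear_scale_map del: comp_apply)
next
  case (tens a b)
  note l = functional_comp[OF bilinear_left f(1)] functional_comp[OF bilinear_left f(2)]
  note r = functional_comp[OF bilinear_right f(1)] functional_comp[OF bilinear_right f(2)]
  show ?case
    by (rule exI[of _ "ev (\<phi> \<circ> (\<lambda>u. m (carr_proj U u) a), \<psi> \<circ> (\<lambda>u. m (carr_proj U u) b))"])
      (use tens in \<open>simp add: ev_pair_tens[OF l] tens_apply[OF r] carr_proj_id[OF U] carr_proj_id[OF V] del: comp_apply\<close>,
        simp add: carr_proj_id U V)
qed

lemma
  assumes y: "y \<in> sq_carr V"
  shows linear_tens_op: "Vector_Spaces.linear fscale fscale (\<lambda>x. tens_op U V W m x y)"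
    and tens_op_tens: "u\<^sub>1 \<in> carr U \<Longrightarrow> u\<^sub>2 \<in> carr U \<Longrightarrow> tens_op U V W m (tens (scl U) (scl U) u\<^sub>1 u\<^sub>2) y =
      tens_map (scl W) (scl W) (\<lambda>v. m u\<^sub>1 (carr_proj V v)) (\<lambda>v. m u\<^sub>2 (carr_proj V v)) y"
    and tens_op_in: "x \<in> sq_carr U \<Longrightarrow> tens_op U V W m x y \<in> sq_carr W"
proof -
  let ?i = "\<lambda>u\<^sub>1 u\<^sub>2. lin_ext fscale fscale
         {(tens (scl V) (scl V) v\<^sub>1 v\<^sub>2, tens (scl W) (scl W) (m u\<^sub>1 v\<^sub>1) (m u\<^sub>2 v\<^sub>2)) | v\<^sub>1 v\<^sub>2.
            v\<^sub>1 \<in> carr V \<and> v\<^sub>2 \<in> carr V} y"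
  let ?G = "{(tens (scl U) (scl U) u\<^sub>1 u\<^sub>2, ?i u\<^sub>1 u\<^sub>2) | u\<^sub>1 u\<^sub>2. u\<^sub>1 \<in> carr U \<and> u\<^sub>2 \<in> carr U}"
  let ?F = "{\<phi>. functional (scl W) \<phi>}"
  have i: "?i u\<^sub>1 u\<^sub>2 = tens_map (scl W) (scl W) (\<lambda>v. m u\<^sub>1 (carr_proj V v)) (\<lambda>v. m u\<^sub>2 (carr_proj V v)) y"
    if "u\<^sub>1 \<in> carr U" "u\<^sub>2 \<in> carr U" for u\<^sub>1 u\<^sub>2
    by (rule lin_ext_eq_span[OF linear_tens_map _ y[unfolded tspan_def]])
      (use tens_map_tens[OF bilinear_right[OF that(1)] bilinear_right[OF that(2)]] carr_proj_id[OF V] in auto)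
  have i_in: "?i u\<^sub>1 u\<^sub>2 \<in> sq_carr W" if "u\<^sub>1 \<in> carr U" "u\<^sub>2 \<in> carr U" for u\<^sub>1 u\<^sub>2
    unfolding i[OF that]
    by (rule tens_map_in[OF y bilinear_right[OF that(1)] bilinear_right[OF that(2)]])
      (use m that carr_proj_in[OF V] in \<open>auto simp: bilinear_on_def\<close>)
  have "module.span fscale (snd ` ?G) \<subseteq> sq_carr W"
    by (rule span_subset_subspace[OF vector_space_fscale subspace_tspan]) (use i_in in auto)
  note sep = separates_mono[OF separates_tspan[OF W W subspace_carr[OF W] subspace_carr[OF W]
        separates_functionals[OF W] separates_functionals[OF W]] this]
  have dual: "\<forall>\<xi>\<in>evs ?F ?F. \<exists>\<Lambda>. functional fscale \<Lambda> \<and> (\<forall>(x, y)\<in>?G. \<Lambda> x = \<xi> y)"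
  proof
    fix \<xi> assume "\<xi> \<in> evs ?F ?F"
    then obtain \<phi> \<psi> where \<xi>: "\<xi> = ev (\<phi>, \<psi>)" and f: "functional (scl W) \<phi>" "functional (scl W) \<psi>" by blast
    obtain \<Lambda> where \<Lambda>: "functional fscale \<Lambda>" "\<And>u\<^sub>1 u\<^sub>2. u\<^sub>1 \<in> carr U \<Longrightarrow> u\<^sub>2 \<in> carr U \<Longrightarrow>
       \<Lambda> (tens (scl U) (scl U) u\<^sub>1 u\<^sub>2) = y (\<phi> \<circ> (\<lambda>v. m u\<^sub>1 (carr_proj V v)), \<psi> \<circ> (\<lambda>v. m u\<^sub>2 (carr_proj V v)))"
      using tens_op_functional[OF y f] by blast
    have "\<forall>(x, y)\<in>?G. \<Lambda> x = \<xi> y"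
    proof clarify
      fix u\<^sub>1 u\<^sub>2 assume u: "u\<^sub>1 \<in> carr U" "u\<^sub>2 \<in> carr U"
      show "\<Lambda> (tens (scl U) (scl U) u\<^sub>1 u\<^sub>2) = \<xi> (?i u\<^sub>1 u\<^sub>2)"
        unfolding i[OF u] \<xi> ev_def tens_map_apply[OF f] by (rule \<Lambda>(2)[OF u])
    qed
    then show "\<exists>\<Lambda>. functional fscale \<Lambda> \<and> (\<forall>(x, y)\<in>?G. \<Lambda> x = \<xi> y)" using \<Lambda>(1) by blast
  qed
  note extn = lin_ext_dual[OF vector_space_fscale vector_space_fscale sep dual, folded tens_op_def]
  have eta: "(\<lambda>x. tens_op U V W m x y) = lin_ext fscale fscale ?G"
    by (rule ext) (simp add: tens_op_def)
  show lin: "Vector_Spaces.linear fscale fscale (\<lambda>x. tens_op U V W m x y)"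
    unfolding eta by (rule extn(1))
  have tens: "tens_op U V W m (tens (scl U) (scl U) u\<^sub>1 u\<^sub>2) y = ?i u\<^sub>1 u\<^sub>2"
    if "u\<^sub>1 \<in> carr U" "u\<^sub>2 \<in> carr U" for u\<^sub>1 u\<^sub>2
    by (rule extn(2)) (use that in blast)
  then show "tens_op U V W m (tens (scl U) (scl U) u\<^sub>1 u\<^sub>2) y =
      tens_map (scl W) (scl W) (\<lambda>v. m u\<^sub>1 (carr_proj V v)) (\<lambda>v. m u\<^sub>2 (carr_proj V v)) y"
    if "u\<^sub>1 \<in> carr U" "u\<^sub>2 \<in> carr U" for u\<^sub>1 u\<^sub>2 using i[OF that] that by simp
  show "x \<in> sq_carr U \<Longrightarrow> tens_op U V W m x y \<in> sq_carr W"
    by (rule linear_span_into[OF lin _ subspace_tspan]) (auto simp: tspan_def[of "scl U"] tens i_in)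
qed

text \<open>Functionals that are multiplicative for \<open>m\<close> factor through the two tensor squares.\<close>

lemma tens_op_eval:
  assumes x: "x \<in> sq_carr U" and y: "y \<in> sq_carr V"
    and F: "functional (scl W) \<Phi>" "functional (scl W) \<Psi>"
    and f: "functional (scl U) \<alpha>" "functional (scl U) \<alpha>'" "functional (scl V) \<beta>" "functional (scl V) \<beta>'"
    and \<Phi>: "\<And>u v. u \<in> carr U \<Longrightarrow> v \<in> carr V \<Longrightarrow> \<Phi> (m u v) = \<alpha> u * \<beta> v"
    and \<Psi>: "\<And>u v. u \<in> carr U \<Longrightarrow> v \<in> carr V \<Longrightarrow> \<Psi> (m u v) = \<alpha>' u * \<beta>' v"
  shows "tens_op U V W m x y (\<Phi>, \<Psi>) = x (\<alpha>, \<alpha>') * y (\<beta>, \<beta>')"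
  using x
proof (induction rule: tspan_ind)
  case (tens a b)
  have fs: "functional (scl V) (\<lambda>v. c * \<beta> v)" "functional (scl V) (\<lambda>v. c * \<beta>' v)" for c
    using f(3,4) unfolding functional_def by (auto intro: linear_scale_map)
  have "tens_op U V W m (tens (scl U) (scl U) a b) y (\<Phi>, \<Psi>) =
      y (\<Phi> \<circ> (\<lambda>v. m a (carr_proj V v)), \<Psi> \<circ> (\<lambda>v. m b (carr_proj V v)))"
    unfolding tens_op_tens[OF y tens] by (rule tens_map_apply[OF F])
  also have "\<dots> = y (\<lambda>v. \<alpha> a * \<beta> v, \<lambda>v. \<alpha>' b * \<beta>' v)"
    by (rule tspan_cong[OF y functional_comp[OF bilinear_right[OF tens(1)] F(1)]
          functional_comp[OF bilinear_right[OF tens(2)] F(2)] fs])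
      (simp_all add: carr_proj_id[OF V] \<Phi> \<Psi> tens)
  also have "\<dots> = \<alpha> a * \<alpha>' b * y (\<beta>, \<beta>')" by (rule tspan_scale_args[OF y f(3,4)])
  finally show ?case by (simp add: tens_apply f)
qed (simp_all add: linear_0[OF linear_tens_op[OF y]] linear_D[OF linear_tens_op[OF y]] algebra_simps)

end

lemma tens_op_morphism:
  assumes U: "vector_space (scl U)" and V: "vector_space (scl V)"
    and m: "bilinear_on U V W m" and m': "bilinear_on U V W' m'"
    and f: "Vector_Spaces.linear (scl W) (scl W') f"
    and eq: "\<And>u v. u \<in> carr U \<Longrightarrow> v \<in> carr V \<Longrightarrow> m' u v = f (m u v)"
    and x: "x \<in> sq_carr U" and y: "y \<in> sq_carr V"
  shows "tens_map (scl W') (scl W') f f (tens_op U V W m x y) = tens_op U V W' m' x y"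
proof -
  note W = linear_D(1)[OF f] and W' = linear_D(2)[OF f]
  have "(tens_map (scl W') (scl W') f f \<circ> (\<lambda>x. tens_op U V W m x y)) x = tens_op U V W' m' x y"
  proof (rule linear_eq_span[OF linear_comp[OF linear_tens_op[OF U V W m y] linear_tens_map]
        linear_tens_op[OF U V W' m' y] x[unfolded tspan_def]])
    fix a assume "a \<in> {tens (scl U) (scl U) a b |a b. a \<in> carr U \<and> b \<in> carr U}"
    then obtain u\<^sub>1 u\<^sub>2 where a: "a = tens (scl U) (scl U) u\<^sub>1 u\<^sub>2" and u: "u\<^sub>1 \<in> carr U" "u\<^sub>2 \<in> carr U" by blast
    have c: "\<phi> \<circ> f \<circ> (\<lambda>v. m u (carr_proj V v)) = \<phi> \<circ> (\<lambda>v. m' u (carr_proj V v))" if "u \<in> carr U" for u \<phi>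
      by (rule ext) (simp add: eq[OF that carr_proj_in[OF V]])
    show "(tens_map (scl W') (scl W') f f \<circ> (\<lambda>x. tens_op U V W m x y)) a = tens_op U V W' m' a y"
      unfolding a comp_apply tens_op_tens[OF U V W m y u] tens_op_tens[OF U V W' m' y u]
      by (auto simp: fun_eq_iff tens_map_def c u functional_comp[OF f] simp del: comp_apply)
  qed
  then show ?thesis by simp
qed

section \<open>Maps between compositions\<close>

text \<open>The map \<open>T(f)\<close>, by precomposition as for \<open>tens_map\<close>.\<close>

definition tpow_map ::
  "('k::field, 'w::ab_group_add) coalg \<Rightarrow> ('v \<Rightarrow> 'w) \<Rightarrow> ('k, 'v) tensor_power \<Rightarrow> ('k, 'w) tensor_power" where
  "tpow_map C' f t = (\<lambda>\<phi>s. if functionals C' \<phi>s then t (map (\<lambda>\<phi>. \<phi> \<circ> f) \<phi>s) else 0)"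

lemma linear_tpow_map: "Vector_Spaces.linear fscale fscale (tpow_map C' f)"
  by (auto simp: Vector_Spaces.linear_iff vector_space_fscale tpow_map_def fun_eq_iff plus_fun_apply
      fscale_def)

lemma tpow_map_tpow:
  assumes "Vector_Spaces.linear (scl C) (scl C') f"
  shows "tpow_map C' f (tpow (scl C) cs) = tpow (scl C') (map f cs)"
proof
  fix \<phi>s
  show "tpow_map C' f (tpow (scl C) cs) \<phi>s = tpow (scl C') (map f cs) \<phi>s"
    using functional_comp[OF assms]
    by (auto simp: tpow_map_def tpow_pairing pairing_map simp del: comp_apply)
qed

context
  fixes D :: "('k::field, 'd::ab_group_add) coalg" and C :: "('k, 'c::ab_group_add) coalg"
    and D' :: "('k, 'e::ab_group_add) coalg" and C' :: "('k, 'f::ab_group_add) coalg"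
    and g f
  assumes g: "Vector_Spaces.linear (scl D) (scl D') g" and f: "Vector_Spaces.linear (scl C) (scl C') f"
begin

lemma
  shows linear_comp_map: "Vector_Spaces.linear fscale fscale (comp_map D C D' C' g f)"
    and comp_map_circ: "d \<in> gr D n \<Longrightarrow> set cs \<subseteq> carr C \<Longrightarrow> length cs = Suc n \<Longrightarrow>
      comp_map D C D' C' g f (circ D C d cs) = circ D' C' (g d) (map f cs)"
proof -
  let ?F = "tens_map (scl D') fscale g (tpow_map C' f)"
  have F: "?F (circ D C d cs) = circ D' C' (g d) (map f cs)" for d cs
    unfolding circ_def by (simp add: tens_map_tens[OF g linear_tpow_map] tpow_map_tpow[OF f])
  show "Vector_Spaces.linear fscale fscale (comp_map D C D' C' g f)"
    unfolding comp_map_def by (rule lin_ext_exists(1)[OF linear_tens_map]) (use F in auto)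
  show "comp_map D C D' C' g f (circ D C d cs) = circ D' C' (g d) (map f cs)"
    if "d \<in> gr D n" "set cs \<subseteq> carr C" "length cs = Suc n"
    unfolding comp_map_def by (rule lin_ext_exists(2)[OF linear_tens_map]) (use F that in auto)
qed

lemma pt_comp_map:
  assumes x: "x \<in> carr (comp_coalg D C)" and h: "functional (scl D') \<delta>" "functionals C' \<phi>s"
  shows "pt \<delta> \<phi>s (comp_map D C D' C' g f x) = pt (\<delta> \<circ> g) (map (\<lambda>\<phi>. \<phi> \<circ> f) \<phi>s) x"
  using linear_D(1)[OF f] x
proof (induction rule: carr_comp_ind)
  case (circ d cs n)
  have "functionals C (map (\<lambda>\<phi>. \<phi> \<circ> f) \<phi>s)" using h(2) functional_comp[OF f] by auto
  then show ?case
    using pt_circ[OF functional_comp[OF g h(1)], where C = C and \<phi>s = "map (\<lambda>\<phi>. \<phi> \<circ> f) \<phi>s"]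
    by (simp add: comp_map_circ[OF circ] pt_circ[OF h] pairing_map del: comp_apply) simp
qed (simp_all add: linear_0[OF linear_comp_map] linear_D[OF linear_comp_map] pt_linear)

end

text \<open>Pulling points back along \<open>g \<circ> f\<close> pulls back each functional, and pulling back along a coalgebra
  map respects the convolutions in the product rule for points.\<close>

lemma comp_map_morphism:
  assumes D: "graded_coalgebra D" and C: "graded_coalgebra C"
    and D': "graded_coalgebra D'" and C': "graded_coalgebra C'"
    and g: "coalgebra_morphism D D' g" and f: "coalgebra_morphism C C' f"
  shows "coalgebra_morphism (comp_coalg D C) (comp_coalg D' C') (comp_map D C D' C' g f)"
proof (rule coalgebra_morphismI)
  let ?E = "comp_coalg D C" and ?E' = "comp_coalg D' C'" and ?M = "comp_map D C D' C' g f"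
  let ?F = "{\<phi>. functional (scl C') \<phi>}"
  note gl = coalgebra_morphismD(1)[OF g] and fl = coalgebra_morphismD(1)[OF f]
  note vC = graded_coalgebraD(2)[OF C] and vC' = graded_coalgebraD(2)[OF C']
  note vD = graded_coalgebraD(2)[OF D] and vD' = graded_coalgebraD(2)[OF D']
  note M = linear_comp_map[OF gl fl] and pt_M = pt_comp_map[OF gl fl]
  show gE: "graded_coalgebra ?E" by (rule graded_coalgebra_comp[OF D C])
  show gE': "graded_coalgebra ?E'" by (rule graded_coalgebra_comp[OF D' C'])
  show "Vector_Spaces.linear (scl ?E) (scl ?E') ?M" using M by simp
  show "separates (scl ?E') (carr ?E') (hpts D' ?F)"
    using separates_hpts[OF graded_coalgebraD(1)[OF D'] vC' separates_functionals[OF vC']] by simp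
  show Mgr: "?M x \<in> gr ?E' N" if x: "x \<in> gr ?E N" for x N
  proof (rule linear_span_into[OF M x[unfolded comp_coalg_simps]])
    show "module.subspace fscale (gr ?E' N)" by (simp add: subspace_spanI vector_space_fscale)
    fix a assume "a \<in> {circ D C d cs |d cs n js. d \<in> gr D n \<and> homs C cs js \<and> length cs = Suc n \<and> n + sum_list js = N}"
    then obtain d cs n js where a: "a = circ D C d cs" "d \<in> gr D n" "homs C cs js" "length cs = Suc n"
      "n + sum_list js = N" by blast
    have "homs C' (map f cs) js"
      using a(3) coalgebra_morphismD(2)[OF f] by (auto simp: homs_def list_all2_conv_all_nth)
    from circ_gr[OF coalgebra_morphismD(2)[OF g a(2)] this] show "?M a \<in> gr ?E' N"
      unfolding a(1) comp_map_circ[OF gl fl a(2) homs_carr[OF vC a(3)] a(4)] using a(4,5) by simp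
  qed
  have M_carr: "?M x \<in> carr ?E'" if "x \<in> carr ?E" for x
    by (rule linear_span_into[OF M that[unfolded carr_def comp_coalg_simps(1)] subspace_carr_comp])
      (use Mgr gr_carr[OF graded_coalgebraD(2)[OF gE']] in blast)
  show "cou ?E' (?M x) = cou ?E x" if "x \<in> gr ?E N" for x N
  proof -
    have x: "x \<in> carr ?E" using gr_carr[OF graded_coalgebraD(2)[OF gE] that] .
    note eps = graded_coalgebraD(4)[OF C] graded_coalgebraD(4)[OF D] graded_coalgebraD(4)[OF C'] graded_coalgebraD(4)[OF D']
    have "cou ?E' (?M x) = pt (cou D' \<circ> g) [cou C' \<circ> f] x"
      unfolding cou_comp[OF D' C' M_carr[OF x]] using pt_M[OF x, of "cou D'" "[cou C']"] eps by simp
    also have "\<dots> = pt (cou D) [cou C] x"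
      by (rule pt_cong[OF vC vD x])
        (use eps functional_comp[OF gl] functional_comp[OF fl] coalgebra_morphismD(3)[OF g]
          coalgebra_morphismD(3)[OF f] in auto)
    finally show ?thesis unfolding cou_comp[OF D C x] .
  qed
  show "conv ?E (\<xi> \<circ> ?M) (\<eta> \<circ> ?M) x = conv ?E' \<xi> \<eta> (?M x)"
    if x: "x \<in> carr ?E" and pts: "\<xi> \<in> hpts D' ?F" "\<eta> \<in> hpts D' ?F" for x \<xi> \<eta>
  proof -
    obtain \<delta> \<phi>s \<phi> \<epsilon> \<psi> \<psi>s where *: "\<xi> = pt \<delta> (\<phi>s @ [\<phi>])" "\<eta> = pt \<epsilon> (\<psi> # \<psi>s)"
      and h: "hfun D' (length \<phi>s) \<delta>" "hfun D' (length \<psi>s) \<epsilon>" "functionals C' (\<phi>s @ \<phi> # \<psi> # \<psi>s)"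
      by (rule hpts_pairE[OF pts])
    have h': "functionals C' (\<phi>s @ [\<phi>])" "functionals C' (\<psi> # \<psi>s)" using h(3) by auto
    let ?m = "map (\<lambda>\<phi>. \<phi> \<circ> f)"
    have hg: "hfun D n (\<theta> \<circ> g)" if "hfun D' n \<theta>" for n \<theta>
      using that functional_comp[OF gl] coalgebra_morphismD(2)[OF g] by (auto simp: hfun_def)
    have ff: "functionals C (?m \<phi>s @ (\<phi> \<circ> f) # (\<psi> \<circ> f) # ?m \<psi>s)"
      using h(3) functional_comp[OF fl] by auto
    have "conv ?E (\<xi> \<circ> ?M) (\<eta> \<circ> ?M) x =
        conv ?E (pt (\<delta> \<circ> g) (?m \<phi>s @ [\<phi> \<circ> f])) (pt (\<epsilon> \<circ> g) ((\<psi> \<circ> f) # ?m \<psi>s)) x"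
      by (rule conv_cong[OF gE x])
        (use functional_comp[OF M functional_pt] pt_M[OF _ hfunD(1)[OF h(1)] h'(1)] pt_M[OF _ hfunD(1)[OF h(2)] h'(2)]
          in \<open>auto simp: *\<close>)
    also have "\<dots> = pt (conv D (\<delta> \<circ> g) (\<epsilon> \<circ> g)) (?m \<phi>s @ conv C (\<phi> \<circ> f) (\<psi> \<circ> f) # ?m \<psi>s) x"
      by (rule conv_comp[OF D C x _ _ ff]) (use hg h in auto)
    also have "\<dots> = pt (conv D' \<delta> \<epsilon> \<circ> g) (?m (\<phi>s @ conv C' \<phi> \<psi> # \<psi>s)) x"
    proof (rule pt_cong[OF vC vD x])
      show "functionals C (?m \<phi>s @ conv C (\<phi> \<circ> f) (\<psi> \<circ> f) # ?m \<psi>s)"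
        using ff functional_conv[OF C] by auto
      show "functionals C (?m (\<phi>s @ conv C' \<phi> \<psi> # \<psi>s))"
        using ff functional_conv[OF C'] functional_comp[OF fl] by auto
      show "list_all2 (\<lambda>\<phi> \<psi>. \<forall>c\<in>carr C. \<phi> c = \<psi> c) (?m \<phi>s @ conv C (\<phi> \<circ> f) (\<psi> \<circ> f) # ?m \<psi>s)
          (?m (\<phi>s @ conv C' \<phi> \<psi> # \<psi>s))"
        using morphism_conv[OF C f, of _ \<phi> \<psi>] h(3)
        by (auto intro!: list_all2_appendI list_all2_refl simp: list.rel_map)
      show "conv D (\<delta> \<circ> g) (\<epsilon> \<circ> g) d = (conv D' \<delta> \<epsilon> \<circ> g) d" if "d \<in> carr D" for d
        using morphism_conv[OF D g that hfunD(1)[OF h(1)] hfunD(1)[OF h(2)]] by simp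
    qed (auto intro: functional_conv[OF D] functional_comp[OF gl] functional_conv[OF D'])
    also have "\<dots> = pt (conv D' \<delta> \<epsilon>) (\<phi>s @ conv C' \<phi> \<psi> # \<psi>s) (?M x)"
      by (rule pt_M[OF x, symmetric]) (use h functional_conv[OF D'] functional_conv[OF C'] in auto)
    also have "\<dots> = conv ?E' \<xi> \<eta> (?M x)"
      unfolding * by (rule conv_comp[OF D' C' M_carr[OF x] h, symmetric])
    finally show ?thesis .
  qed
qed

section \<open>Actions through the iterated coproduct\<close>

text \<open>The operations \<open>a \<cdot> b\<close>, \<open>e \<star> d\<close> and \<open>d \<star> e\<close> all have the shape
  \<open>\<rho>(x \<otimes> \<Delta>\<^sup>(\<^sup>|\<^sup>x\<^sup>|\<^sup>) y)\<close> for a coalgebra map \<open>\<rho> : X \<circ> Y \<rightarrow> Z\<close>.\<close>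

definition act ::
  "('k::field, 'x::ab_group_add) coalg \<Rightarrow> ('k, 'y::ab_group_add) coalg \<Rightarrow> ('k, 'z::ab_group_add) coalg \<Rightarrow>
   (('k, 'x, 'y) composite \<Rightarrow> 'z) \<Rightarrow> 'y \<Rightarrow> 'x \<Rightarrow> 'z" where
  "act X Y Z \<rho> y = lin_ext (scl X) (scl Z)
     {(x, \<rho> (tens (scl X) fscale x (iter_cop Y n y))) | x n. x \<in> gr X n}"

lemma
  assumes X: "graded_space X" and \<rho>: "Vector_Spaces.linear fscale (scl Z) \<rho>"
  shows linear_act: "Vector_Spaces.linear (scl X) (scl Z) (act X Y Z \<rho> y)"
    and act_gr: "x \<in> gr X n \<Longrightarrow> act X Y Z \<rho> y x = \<rho> (tens (scl X) fscale x (iter_cop Y n y))"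
proof -
  have F: "Vector_Spaces.linear (scl X) (scl Z) (\<lambda>x. \<rho> (tens (scl X) fscale x (iter_cop Y n y)))" for n
    using linear_comp[OF linear_tens_left[OF graded_spaceD(1)[OF X]] \<rho>] by (simp add: o_def)
  obtain H where H: "Vector_Spaces.linear (scl X) (scl Z) H"
    "\<And>n x. x \<in> gr X n \<Longrightarrow> H x = \<rho> (tens (scl X) fscale x (iter_cop Y n y))"
    using graded_extension[OF X linear_D(2)[OF \<rho>],
        of "\<lambda>n x. \<rho> (tens (scl X) fscale x (iter_cop Y n y))", OF F] by blast
  show "Vector_Spaces.linear (scl X) (scl Z) (act X Y Z \<rho> y)"
    unfolding act_def by (rule lin_ext_exists(1)[OF H(1)]) (use H(2) in auto)
  show "act X Y Z \<rho> y x = \<rho> (tens (scl X) fscale x (iter_cop Y n y))" if "x \<in> gr X n"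
    unfolding act_def by (rule lin_ext_exists(2)[OF H(1)]) (use H(2) that in auto)
qed

text \<open>The universal case \<open>x \<otimes> y \<mapsto> x \<circ> \<Delta>\<^sup>(\<^sup>|\<^sup>x\<^sup>|\<^sup>) y\<close>.\<close>

abbreviation spread ::
  "('k::field, 'x::ab_group_add) coalg \<Rightarrow> ('k, 'y::ab_group_add) coalg \<Rightarrow> 'y \<Rightarrow> 'x \<Rightarrow> ('k, 'x, 'y) composite" where
  "spread X Y \<equiv> act X Y (comp_coalg X Y) (\<lambda>e. e)"

lemma linear_id_comp: "Vector_Spaces.linear fscale (scl (comp_coalg X Y)) (\<lambda>e. e)"
  by (simp add: linear_ident vector_space_fscale)

lemma act_spread:
  assumes X: "graded_space X" and \<rho>: "Vector_Spaces.linear fscale (scl Z) \<rho>" and x: "x \<in> carr X"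
  shows "act X Y Z \<rho> y x = \<rho> (spread X Y y x)"
proof -
  note S = linear_act[OF X linear_id_comp[of X Y], where Y = Y and y = y]
  have "act X Y Z \<rho> y x = (\<rho> \<circ> spread X Y y) x"
    by (rule linear_eq_carr[OF linear_act[OF X \<rho>] linear_comp[OF S[unfolded comp_coalg_simps] \<rho>] x])
      (simp add: act_gr[OF X \<rho>] act_gr[OF X linear_id_comp[of X Y]])
  then show ?thesis by simp
qed

text \<open>The components of \<open>x\<close> outside degree \<open>N\<close> vanish when \<open>S\<close> consists of homogeneous functionals and those
  of other degrees kill \<open>x\<close>.\<close>

lemma gr_by_hfun:
  assumes g: "graded_space C" and x: "x \<in> carr C" and S: "separates (scl C) (carr C) S"
    and h: "\<And>\<xi>. \<xi> \<in> S \<Longrightarrow> \<exists>k. hfun C k \<xi> \<and> (k \<noteq> N \<longrightarrow> \<xi> x = 0)"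
  shows "x \<in> gr C N"
proof -
  interpret vector_space "scl C" by (rule graded_spaceD(1)[OF g])
  have z: "proj C n x = 0" if n: "n \<noteq> N" for n
  proof (rule separates_eqI[OF S subspace_carr[OF graded_spaceD(1)[OF g]] graded_spaceD(1)[OF g]])
    show "proj C n x \<in> carr C" by (rule gr_carr[OF graded_spaceD(1)[OF g] proj_in_gr[OF g x]])
    show "0 \<in> carr C" by (rule subspace_0[OF subspace_carr[OF graded_spaceD(1)[OF g]]])
    fix \<xi> assume "\<xi> \<in> S"
    then obtain k where k: "hfun C k \<xi>" "k \<noteq> N \<longrightarrow> \<xi> x = 0" using h by blast
    then show "\<xi> (proj C n x) = \<xi> 0"
      using n by (auto simp: hfun_proj_eq[OF g k(1) x] functional_0[OF hfunD(1)[OF k(1)]])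
  qed
  obtain M where "\<forall>M'\<ge>M. x = (\<Sum>n\<le>M'. proj C n x)" using proj_sum[OF g x] by blast
  then have "x = (\<Sum>n\<le>max M N. proj C n x)" by simp
  also have "\<dots> = (\<Sum>n\<le>max M N. if n = N then proj C N x else 0)"
    by (rule sum.cong) (auto simp: z)
  finally have "x = proj C N x" by simp
  then show ?thesis using proj_in_gr[OF g x, of N] by simp
qed

lemma hfun_convs:
  "graded_coalgebra C \<Longrightarrow> list_all2 (\<lambda>\<phi> j. hfun C j \<phi>) \<phi>s js \<Longrightarrow> \<phi>s \<noteq> [] \<Longrightarrow>
    hfun C (sum_list js) (convs C \<phi>s)"
proof (induction \<phi>s arbitrary: js)
  case (Cons \<phi> \<phi>s)
  then obtain j js' where js: "js = j # js'" "hfun C j \<phi>" "list_all2 (\<lambda>\<phi> j. hfun C j \<phi>) \<phi>s js'"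
    by (auto simp: list_all2_Cons1)
  show ?case
  proof (cases "\<phi>s = []")
    case False
    then show ?thesis using hfun_conv[OF Cons.prems(1) js(2) Cons.IH[OF Cons.prems(1) js(3)]]
      by (simp add: convs_Cons js(1))
  qed (use js in simp)
qed simp

context
  fixes X :: "('k::field, 'x::ab_group_add) coalg" and Y :: "('k, 'y::ab_group_add) coalg"
  assumes X: "graded_coalgebra X" and Y: "graded_coalgebra Y"
begin

lemmas spreadX = graded_coalgebraD[OF X]
lemmas spreadY = graded_coalgebraD[OF Y]

lemma spread_in:
  assumes y: "y \<in> carr Y" and x: "x \<in> carr X"
  shows "spread X Y y x \<in> carr (comp_coalg X Y)"
proof (rule linear_span_into[OF linear_act[OF spreadX(1) linear_id_comp, unfolded comp_coalg_simps] x[unfolded carr_def] subspace_carr_comp])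
  fix a assume "a \<in> \<Union> (range (gr X))"
  then obtain n where a: "a \<in> gr X n" by blast
  show "spread X Y y a \<in> carr (comp_coalg X Y)"
    unfolding act_gr[OF spreadX(1) linear_id_comp a]
    by (rule linear_span_into[OF linear_tens_right[OF vector_space_fscale] iter_cop_in[OF Y y, unfolded tpow_space_def] subspace_carr_comp])
      (use circ_carr[OF spreadY(2) a] in \<open>auto simp: circ_def\<close>)
qed

text \<open>Only the component of \<open>x\<close> of degree \<open>n\<close> matters, and there \<open>\<phi>s\<close> is evaluated on \<open>\<Delta>\<^sup>(\<^sup>n\<^sup>) y\<close>.\<close>

lemma pt_spread:
  assumes y: "y \<in> carr Y" and x: "x \<in> carr X" and h: "hfun X n \<delta>" "length \<phi>s = Suc n" "functionals Y \<phi>s"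
  shows "pt \<delta> \<phi>s (spread X Y y x) = \<delta> x * convs Y \<phi>s y"
proof -
  note lin = linear_act[OF spreadX(1) linear_id_comp[of X Y], where Y = Y and y = y]
  have l: "functional (scl X) (pt \<delta> \<phi>s \<circ> spread X Y y)"
    by (rule functional_comp[OF lin]) simp
  have r: "functional (scl X) (\<lambda>x. convs Y \<phi>s y * \<delta> x)"
    using linear_scale_map[OF hfunD(1)[OF h(1), unfolded functional_def]] by (simp add: functional_def)
  have "(pt \<delta> \<phi>s \<circ> spread X Y y) x = convs Y \<phi>s y * \<delta> x"
  proof (rule linear_eq_carr[OF l[unfolded functional_def] r[unfolded functional_def] x])
    fix m x assume x: "x \<in> gr X m"
    have "(pt \<delta> \<phi>s \<circ> spread X Y y) x = \<delta> x * iter_cop Y m y \<phi>s"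
      by (simp add: act_gr[OF spreadX(1) linear_id_comp x] pt_def ev_pair_tens[OF hfunD(1)[OF h(1)] functional_ev])
        (simp add: ev_def)
    then show "(pt \<delta> \<phi>s \<circ> spread X Y y) x = convs Y \<phi>s y * \<delta> x"
      using h(2,3) hfunD(2)[OF h(1) x] by (cases "m = n") (auto simp: iter_cop_apply[OF Y y])
  qed
  then show ?thesis by simp
qed

lemma spread_eqI:
  assumes "e \<in> carr (comp_coalg X Y)" "e' \<in> carr (comp_coalg X Y)"
    "\<And>\<delta> \<phi>s n. hfun X n \<delta> \<Longrightarrow> length \<phi>s = Suc n \<Longrightarrow> functionals Y \<phi>s \<Longrightarrow> pt \<delta> \<phi>s e = pt \<delta> \<phi>s e'"
  shows "e = e'"
  by (rule separates_eqI[OF separates_hpts[OF spreadX(1) spreadY(2) separates_functionals[OF spreadY(2)]]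
        subspace_carr_comp vector_space_fscale assms(1,2)])
    (use assms(3) in \<open>auto simp: hpts_def\<close>)

lemma spread_gr:
  assumes y: "y \<in> gr Y j" and x: "x \<in> gr X i"
  shows "spread X Y y x \<in> gr (comp_coalg X Y) (j + i)"
proof -
  note y' = gr_carr[OF spreadY(2) y] and x' = gr_carr[OF spreadX(2) x]
  note gE = graded_coalgebra_comp[OF X Y]
  have sep: "separates (scl (comp_coalg X Y)) (carr (comp_coalg X Y)) (hpts X {\<phi>. \<exists>j. hfun Y j \<phi>})"
    using separates_hpts[OF spreadX(1) spreadY(2) separates_carr_hfun[OF spreadY(1)]] by simp
  show ?thesis
  proof (rule gr_by_hfun[OF graded_coalgebraD(1)[OF gE] spread_in[OF y' x'] sep])
    fix \<xi> assume "\<xi> \<in> hpts X {\<phi>. \<exists>j. hfun Y j \<phi>}"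
    then obtain \<delta> \<phi>s n where *: "\<xi> = pt \<delta> \<phi>s" "hfun X n \<delta>" "length \<phi>s = Suc n"
      "set \<phi>s \<subseteq> {\<phi>. \<exists>j. hfun Y j \<phi>}" by (auto simp: hpts_def)
    obtain js where js: "list_all2 (\<lambda>\<phi> j. hfun Y j \<phi>) \<phi>s js" using *(4) hfuns_degrees[of \<phi>s Y] by blast
    have cv: "hfun Y (sum_list js) (convs Y \<phi>s)"
      by (rule hfun_convs[OF Y js]) (use *(3) in auto)
    have "\<xi> (spread X Y y x) = \<delta> x * convs Y \<phi>s y"
      unfolding *(1) by (rule pt_spread[OF y' x' *(2,3) hfuns_functionals[OF js]])
    moreover have "n \<noteq> i \<or> sum_list js \<noteq> j" if "n + sum_list js \<noteq> j + i" using that by auto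
    ultimately have "n + sum_list js \<noteq> j + i \<longrightarrow> \<xi> (spread X Y y x) = 0"
      using hfunD(2)[OF *(2) x] hfunD(2)[OF cv y] by (metis mult_zero_left mult_zero_right)
    then show "\<exists>k. hfun (comp_coalg X Y) k \<xi> \<and> (k \<noteq> j + i \<longrightarrow> \<xi> (spread X Y y x) = 0)"
      using hfun_pt[OF *(2) js *(3)] *(1) by blast
  qed
qed

lemma spread_bilinear: "graded_bilinear Y X (comp_coalg X Y) (spread X Y)"
proof -
  note lin = linear_D[OF linear_act[OF spreadX(1) linear_id_comp[of X Y]]]
  interpret E: vector_space fscale by (rule vector_space_fscale)
  interpret Yv: vector_space "scl Y" by (rule spreadY(2))
  note subY = subspace_carr[OF spreadY(2)]
  have 1: "spread X Y (y + y') x = spread X Y y x + spread X Y y' x" if "y \<in> carr Y" "y' \<in> carr Y" "x \<in> carr X" for y y' x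
  proof (rule spread_eqI)
    show "spread X Y (y + y') x \<in> carr (comp_coalg X Y)"
      by (rule spread_in) (use that Yv.subspace_add[OF subY] in auto)
    show "spread X Y y x + spread X Y y' x \<in> carr (comp_coalg X Y)"
      by (rule E.subspace_add[OF subspace_carr_comp]) (use that spread_in in auto)
    fix \<delta> \<phi>s n assume h: "hfun X n \<delta>" "length \<phi>s = Suc n" "functionals Y \<phi>s"
    show "pt \<delta> \<phi>s (spread X Y (y + y') x) = pt \<delta> \<phi>s (spread X Y y x + spread X Y y' x)"
      using that Yv.subspace_add[OF subY, of y y'] pt_spread[OF _ that(3) h] functional_add[OF functional_convs[OF Y h(3)]]
      by (simp add: pt_linear algebra_simps)
  qed
  have 2: "spread X Y (scl Y a y) x = fscale a (spread X Y y x)" if "y \<in> carr Y" "x \<in> carr X" for a y x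
  proof (rule spread_eqI)
    show "spread X Y (scl Y a y) x \<in> carr (comp_coalg X Y)"
      by (rule spread_in) (use that Yv.subspace_scale[OF subY] in auto)
    show "fscale a (spread X Y y x) \<in> carr (comp_coalg X Y)"
      by (rule E.subspace_scale[OF subspace_carr_comp]) (use that spread_in in auto)
    fix \<delta> \<phi>s n assume h: "hfun X n \<delta>" "length \<phi>s = Suc n" "functionals Y \<phi>s"
    show "pt \<delta> \<phi>s (spread X Y (scl Y a y) x) = pt \<delta> \<phi>s (fscale a (spread X Y y x))"
      using that Yv.subspace_scale[OF subY, of y] pt_spread[OF _ that(2) h] functional_scale[OF functional_convs[OF Y h(3)]]
      by (simp add: pt_linear algebra_simps)
  qed
  show ?thesis
    unfolding graded_bilinear_def using 1 2 lin spread_gr by (auto simp del: comp_coalg_simps(2))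
qed

text \<open>\<open>x \<otimes> y \<mapsto> x \<circ> \<Delta>\<^sup>(\<^sup>|\<^sup>x\<^sup>|\<^sup>) y\<close> is a coalgebra map because a product of points evaluates on it
  to convolutions on the two factors separately.\<close>

lemma cop_spread:
  assumes y: "y \<in> carr Y" and x: "x \<in> carr X"
  shows "cop (comp_coalg X Y) (spread X Y y x) =
    tens_op Y X (comp_coalg X Y) (spread X Y) (cop Y y) (cop X x)"
proof -
  let ?E = "comp_coalg X Y" and ?F = "{\<phi>. functional (scl Y) \<phi>}"
  note gE = graded_coalgebra_comp[OF X Y]
  note vE = graded_coalgebraD(2)[OF gE]
  have bil: "bilinear_on Y X ?E (spread X Y)"
    using spread_bilinear spread_in unfolding graded_bilinear_def bilinear_on_def by blast
  note sepE = separates_hpts[OF spreadX(1) spreadY(2) separates_functionals[OF spreadY(2)]]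
  note sq = cop_sq_carr[OF Y y] cop_sq_carr[OF X x]
  show ?thesis
  proof (rule separates_eqI[OF separates_tspan[OF vector_space_fscale vector_space_fscale
        subspace_carr_comp subspace_carr_comp sepE sepE] subspace_tspan vector_space_fscale])
    show "cop ?E (spread X Y y x) \<in> tspan fscale (carr ?E) fscale (carr ?E)"
      using cop_sq_carr[OF gE spread_in[OF y x]] by simp
    show "tens_op Y X ?E (spread X Y) (cop Y y) (cop X x) \<in> tspan fscale (carr ?E) fscale (carr ?E)"
      using tens_op_in[OF spreadY(2) spreadX(2) vE bil sq(2,1)] by simp
    fix \<xi> assume "\<xi> \<in> evs (hpts X ?F) (hpts X ?F)"
    then obtain \<zeta> \<eta> where \<zeta>: "\<xi> = ev (\<zeta>, \<eta>)" "\<zeta> \<in> hpts X ?F" "\<eta> \<in> hpts X ?F" by blast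
    obtain \<delta> \<phi>s \<phi> \<epsilon> \<psi> \<psi>s where pts: "\<zeta> = pt \<delta> (\<phi>s @ [\<phi>])" "\<eta> = pt \<epsilon> (\<psi> # \<psi>s)"
      and h: "hfun X (length \<phi>s) \<delta>" "hfun X (length \<psi>s) \<epsilon>" "functionals Y (\<phi>s @ \<phi> # \<psi> # \<psi>s)"
      by (rule hpts_pairE[OF \<zeta>(2,3)])
    let ?\<phi>s = "\<phi>s @ [\<phi>]" and ?\<psi>s = "\<psi> # \<psi>s"
    have h': "functionals Y ?\<phi>s" "functionals Y ?\<psi>s" using h(3) by auto
    have "\<xi> (cop ?E (spread X Y y x)) = conv ?E (pt \<delta> (\<phi>s @ [\<phi>])) (pt \<epsilon> (\<psi> # \<psi>s)) (spread X Y y x)"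
      by (simp add: \<zeta>(1) pts ev_def conv_def)
    also have "\<dots> = pt (conv X \<delta> \<epsilon>) (\<phi>s @ conv Y \<phi> \<psi> # \<psi>s) (spread X Y y x)"
      by (rule conv_comp[OF X Y spread_in[OF y x] h])
    also have "\<dots> = conv X \<delta> \<epsilon> x * convs Y (\<phi>s @ conv Y \<phi> \<psi> # \<psi>s) y"
      by (rule pt_spread[OF y x hfun_conv[OF X h(1,2)]]) (use h functional_conv[OF Y] in auto)
    also have "\<dots> = conv X \<delta> \<epsilon> x * conv Y (convs Y ?\<phi>s) (convs Y ?\<psi>s) y"
      unfolding convs_glue[OF Y y h(3)] ..
    also have "\<dots> = tens_op Y X ?E (spread X Y) (cop Y y) (cop X x) (pt \<delta> ?\<phi>s, pt \<epsilon> ?\<psi>s)"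
      by (subst tens_op_eval[OF spreadY(2) spreadX(2) vE bil sq, of _ _ "convs Y ?\<phi>s" "convs Y ?\<psi>s" \<delta> \<epsilon>])
        (use h h' hfunD(1) pt_spread[OF _ _ h(1) _ h'(1)] pt_spread[OF _ _ h(2) _ h'(2)] functional_convs[OF Y h'(1)]
          functional_convs[OF Y h'(2)] in \<open>simp_all add: conv_def del: convs.simps\<close>)
    finally show "\<xi> (cop ?E (spread X Y y x)) = \<xi> (tens_op Y X ?E (spread X Y) (cop Y y) (cop X x))"
      by (simp add: \<zeta>(1) pts ev_def)
  qed
qed

end

section \<open>Associativity of the composition\<close>

lemma separates_superset:
  "separates s A S \<Longrightarrow> S \<subseteq> S' \<Longrightarrow> (\<And>\<phi>. \<phi> \<in> S' \<Longrightarrow> functional s \<phi>) \<Longrightarrow> separates s A S'"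
  unfolding separates_def by blast

lemma circ_carr_span:
  assumes C: "vector_space (scl C)" and B: "carr C = module.span (scl C) B" and d: "d \<in> gr D n"
  defines "S \<equiv> module.span fscale {circ D C d cs | d cs n. d \<in> gr D n \<and> set cs \<subseteq> B \<and> length cs = Suc n}"
  shows "set us \<subseteq> B \<Longrightarrow> set cs \<subseteq> carr C \<Longrightarrow> length us + length cs = Suc n \<Longrightarrow> circ D C d (us @ cs) \<in> S"
proof (induction cs arbitrary: us)
  case Nil
  then show ?case unfolding S_def by (intro span_baseI[OF vector_space_fscale]) (use d in auto)
next
  case (Cons c cs)
  have "circ D C d (us @ c # cs) \<in> S" if "c \<in> carr C" for c
  proof (rule linear_span_into[OF linear_circ_right[OF C] that[unfolded B]])
    show "module.subspace fscale S" unfolding S_def by (rule subspace_spanI[OF vector_space_fscale])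
    fix b assume "b \<in> B"
    then show "circ D C d (us @ b # cs) \<in> S"
      using Cons.IH[of "us @ [b]"] Cons.prems by simp
  qed
  then show ?case using Cons.prems by simp
qed

lemma carr_comp_span:
  assumes C: "vector_space (scl C)" and B: "carr C = module.span (scl C) B"
  shows "carr (comp_coalg D C) \<subseteq>
    module.span fscale {circ D C d cs | d cs n. d \<in> gr D n \<and> set cs \<subseteq> B \<and> length cs = Suc n}"
  unfolding carr_comp[OF C]
  by (rule span_subset_subspace[OF vector_space_fscale subspace_spanI[OF vector_space_fscale]])
    (use circ_carr_span[OF C B, where us = "[]"] in auto)

abbreviation block_list :: "nat list \<Rightarrow> 'a list list \<Rightarrow> bool" where
  "block_list js xss \<equiv> list_all2 (\<lambda>xs j. length xs = Suc j) xss js"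

lemma block_list_exists:
  "length xs = length js + sum_list js \<Longrightarrow> \<exists>xss. xs = concat xss \<and> block_list js xss"
proof (induction js arbitrary: xs)
  case (Cons j js)
  have "length (drop (Suc j) xs) = length js + sum_list js" using Cons.prems by simp
  then obtain xss where "drop (Suc j) xs = concat xss" "block_list js xss" using Cons.IH by blast
  moreover have "length (take (Suc j) xs) = Suc j" using Cons.prems by simp
  ultimately have "xs = concat (take (Suc j) xs # xss)" "block_list (j # js) (take (Suc j) xs # xss)"
    using append_take_drop_id[of "Suc j" xs] by auto
  then show ?case by blast
qed auto

lemma block_list_length: "block_list js xss \<Longrightarrow> length (concat xss) = length js + sum_list js"
  by (induction rule: list_all2_induct) auto

lemma blocks_iff: "blocks C ess js \<longleftrightarrow> block_list js ess \<and> set (concat ess) \<subseteq> carr C"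
proof
  show "blocks C ess js \<Longrightarrow> block_list js ess \<and> set (concat ess) \<subseteq> carr C"
    unfolding blocks_def by (induction rule: list_all2_induct) auto
  have "block_list js ess \<Longrightarrow> set (concat ess) \<subseteq> carr C \<longrightarrow> blocks C ess js"
    unfolding blocks_def by (induction rule: list_all2_induct) auto
  then show "block_list js ess \<and> set (concat ess) \<subseteq> carr C \<Longrightarrow> blocks C ess js" by blast
qed

text \<open>Brings the spanning words of an iterated composition into the shape that the associativity of an
  operad and the rebracketing of triple compositions refer to.\<close>

lemma map2_circ_exists:
  assumes "set es \<subseteq> {circ Y Z y zs | y zs n. y \<in> gr Y n \<and> set zs \<subseteq> B \<and> length zs = Suc n}"
  shows "\<exists>ys zss js. es = map2 (circ Y Z) ys zss \<and> length ys = length es \<and> homs Y ys js \<and>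
    block_list js zss \<and> set (concat zss) \<subseteq> B"
  using assms
proof (induction es)
  case Nil
  show ?case by (intro exI[of _ "[]"]) (auto simp: homs_def)
next
  case (Cons e es)
  then obtain ys zss js where IH: "es = map2 (circ Y Z) ys zss" "length ys = length es" "homs Y ys js"
    "block_list js zss" "set (concat zss) \<subseteq> B" by auto
  obtain y zs n where e: "e = circ Y Z y zs" "y \<in> gr Y n" "set zs \<subseteq> B" "length zs = Suc n"
    using Cons.prems by auto
  show ?case
    by (rule exI[of _ "y # ys"], rule exI[of _ "zs # zss"], rule exI[of _ "n # js"])
      (use IH e in \<open>auto simp: homs_def\<close>)
qed

text \<open>The graph of the rebracketing \<open>X \<circ> (Y \<circ> Z) \<cong> (X \<circ> Y) \<circ> Z\<close> on generators.\<close>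

definition assoc_gens ::
  "('k::field, 'x::ab_group_add) coalg \<Rightarrow> ('k, 'y::ab_group_add) coalg \<Rightarrow> ('k, 'z::ab_group_add) coalg \<Rightarrow>
   (('k, 'x, ('k, 'y, 'z) composite) composite \<times> ('k, ('k, 'x, 'y) composite, 'z) composite) set" where
  "assoc_gens X Y Z =
     {(circ X (comp_coalg Y Z) x (map2 (circ Y Z) ys zss),
       circ (comp_coalg X Y) Z (circ X Y x ys) (concat zss)) | x ys zss n js.
        x \<in> gr X n \<and> length ys = Suc n \<and> homs Y ys js \<and> blocks Z zss js}"

definition assoc_left ::
  "('k::field, 'x::ab_group_add) coalg \<Rightarrow> ('k, 'y::ab_group_add) coalg \<Rightarrow> ('k, 'z::ab_group_add) coalg \<Rightarrow>
   ('k, 'x, ('k, 'y, 'z) composite) composite \<Rightarrow> ('k, ('k, 'x, 'y) composite, 'z) composite" where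
  "assoc_left X Y Z = lin_ext fscale fscale (assoc_gens X Y Z)"

definition assoc_right ::
  "('k::field, 'x::ab_group_add) coalg \<Rightarrow> ('k, 'y::ab_group_add) coalg \<Rightarrow> ('k, 'z::ab_group_add) coalg \<Rightarrow>
   ('k, ('k, 'x, 'y) composite, 'z) composite \<Rightarrow> ('k, 'x, ('k, 'y, 'z) composite) composite" where
  "assoc_right X Y Z = lin_ext fscale fscale (prod.swap ` assoc_gens X Y Z)"

text \<open>Homogeneous data \<open>(\<delta>; \<delta>\<^sub>0, \<dots>, \<delta>\<^sub>n; \<chi>\<^sub>0\<^sub>,\<^sub>0, \<dots>)\<close> define a point of either bracketing of a triple
  composition.  The number of the \<open>\<chi>\<^sub>i\<^sub>,\<^sub>j\<close> is tied to the degree of \<open>\<delta>\<^sub>i\<close>; otherwise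
  \<open>pt_right\<close> would vanish, while \<open>pt_left\<close>, which sees only \<open>concat \<chi>ss\<close>, need not.\<close>

definition triple_point ::
  "('k::field, 'x::ab_group_add) coalg \<Rightarrow> ('k, 'y::ab_group_add) coalg \<Rightarrow> ('k, 'z::ab_group_add) coalg \<Rightarrow>
   ('x \<Rightarrow> 'k) \<Rightarrow> ('y \<Rightarrow> 'k) list \<Rightarrow> ('z \<Rightarrow> 'k) list list \<Rightarrow> nat list \<Rightarrow> bool" where
  "triple_point X Y Z \<delta> \<delta>s \<chi>ss ks \<longleftrightarrow> \<delta>s \<noteq> [] \<and> hfun X (length \<delta>s - 1) \<delta> \<and>
     list_all2 (\<lambda>\<phi> j. hfun Y j \<phi>) \<delta>s ks \<and> block_list ks \<chi>ss \<and>
     (\<forall>\<chi>\<in>set (concat \<chi>ss). \<exists>j. hfun Z j \<chi>)"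

abbreviation pt_left :: "('x \<Rightarrow> 'k) \<Rightarrow> ('y \<Rightarrow> 'k) list \<Rightarrow> ('z \<Rightarrow> 'k) list list \<Rightarrow>
   ('k, ('k, 'x, 'y) composite, 'z) composite \<Rightarrow> 'k" where
  "pt_left \<delta> \<delta>s \<chi>ss \<equiv> pt (pt \<delta> \<delta>s) (concat \<chi>ss)"

abbreviation pt_right :: "('x \<Rightarrow> 'k) \<Rightarrow> ('y \<Rightarrow> 'k) list \<Rightarrow> ('z \<Rightarrow> 'k) list list \<Rightarrow>
   ('k, 'x, ('k, 'y, 'z) composite) composite \<Rightarrow> 'k" where
  "pt_right \<delta> \<delta>s \<chi>ss \<equiv> pt \<delta> (map2 pt \<delta>s \<chi>ss)"

lemma triple_pointD:
  assumes "triple_point X Y Z \<delta> \<delta>s \<chi>ss ks"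
  shows "functional (scl X) \<delta>" "functionals Y \<delta>s" "functionals Z (concat \<chi>ss)"
    "length \<chi>ss = length \<delta>s" "length ks = length \<delta>s"
proof -
  note t = assms[unfolded triple_point_def]
  show "functional (scl X) \<delta>" "functionals Z (concat \<chi>ss)" using t hfunD(1) by blast+
  show "functionals Y \<delta>s" using t hfuns_functionals by blast
  have "length \<delta>s = length ks" "length \<chi>ss = length ks" using t list_all2_lengthD by blast+
  then show "length \<chi>ss = length \<delta>s" "length ks = length \<delta>s" by simp_all
qed

text \<open>If the lengths of two corresponding blocks differ, the functional on \<open>Y\<close> vanishes for reasons of
  degree; otherwise the pairing of the concatenated words splits along the blocks.\<close>

lemma pairing_blocks:
  "list_all2 (\<lambda>\<phi> j. hfun Y j \<phi>) \<delta>s ks \<Longrightarrow> block_list ks \<chi>ss \<Longrightarrow> functionals Z (concat \<chi>ss) \<Longrightarrow>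
   homs Y ys js \<Longrightarrow> block_list js zss \<Longrightarrow>
   pairing (map2 pt \<delta>s \<chi>ss) (map2 (circ Y Z) ys zss) = pairing \<delta>s ys * pairing (concat \<chi>ss) (concat zss)"
proof (induction \<delta>s ks arbitrary: \<chi>ss ys js zss rule: list_all2_induct)
  case Nil
  then show ?case by (cases ys) (auto simp: homs_def list_all2_Cons1 list_all2_Cons2)
next
  case (Cons \<delta> \<delta>s k ks)
  obtain \<chi>s \<chi>ss' where \<chi>: "\<chi>ss = \<chi>s # \<chi>ss'" "length \<chi>s = Suc k" "block_list ks \<chi>ss'"
    using Cons.prems(1) by (auto simp: list_all2_Cons2)
  show ?case
  proof (cases ys)
    case y: (Cons y ys')
    obtain j js' where js: "js = j # js'" "y \<in> gr Y j" "homs Y ys' js'"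
      using Cons.prems(3) y by (auto simp: homs_def list_all2_Cons1)
    obtain zs zss' where z: "zss = zs # zss'" "length zs = Suc j" "block_list js' zss'"
      using Cons.prems(4) js(1) by (auto simp: list_all2_Cons2)
    have IH: "pairing (map2 pt \<delta>s \<chi>ss') (map2 (circ Y Z) ys' zss') = pairing \<delta>s ys' * pairing (concat \<chi>ss') (concat zss')"
      by (rule Cons.IH[OF \<chi>(3) _ js(3) z(3)]) (use Cons.prems(2) \<chi>(1) in simp)
    have "pt \<delta> \<chi>s (circ Y Z y zs) = \<delta> y * pairing \<chi>s zs"
      by (rule pt_circ[OF hfunD(1)[OF Cons.hyps(1)]]) (use Cons.prems(2) \<chi>(1) in simp)
    then have eq: "pairing (map2 pt (\<delta> # \<delta>s) \<chi>ss) (map2 (circ Y Z) ys zss) =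
        \<delta> y * pairing \<chi>s zs * (pairing \<delta>s ys' * pairing (concat \<chi>ss') (concat zss'))"
      by (simp add: \<chi>(1) y z(1) IH)
    show ?thesis
    proof (cases "k = j")
      case True
      then show ?thesis
        unfolding eq using pairing_append[of \<chi>s zs "concat \<chi>ss'" "concat zss'"] \<chi>(2) z(2)
        by (simp add: \<chi>(1) y z(1))
    next
      case False
      then have "\<delta> y = 0" using hfunD(2)[OF Cons.hyps(1) js(2)] by blast
      then show ?thesis unfolding eq by (simp add: y)
    qed
  next
    case Nil
    then show ?thesis by (simp add: \<chi>(1))
  qed
qed

lemma assoc_gensI:
  "x \<in> gr X n \<Longrightarrow> length ys = Suc n \<Longrightarrow> homs Y ys js \<Longrightarrow> blocks Z zss js \<Longrightarrow>
   (circ X (comp_coalg Y Z) x (map2 (circ Y Z) ys zss),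
    circ (comp_coalg X Y) Z (circ X Y x ys) (concat zss)) \<in> assoc_gens X Y Z"
  unfolding assoc_gens_def by blast

context
  fixes X :: "('k::field, 'x::ab_group_add) coalg" and Y :: "('k, 'y::ab_group_add) coalg"
    and Z :: "('k, 'z::ab_group_add) coalg"
  assumes X: "graded_coalgebra X" and Y: "graded_coalgebra Y" and Z: "graded_coalgebra Z"
begin

lemmas coX = graded_coalgebraD[OF X] and coY = graded_coalgebraD[OF Y] and coZ = graded_coalgebraD[OF Z]
lemmas gXY = graded_coalgebra_comp[OF X Y] and gYZ = graded_coalgebra_comp[OF Y Z]
lemmas gL = graded_coalgebra_comp[OF gXY Z] and gR = graded_coalgebra_comp[OF X gYZ]

abbreviation (input) "XY \<equiv> comp_coalg X Y"
abbreviation (input) "YZ \<equiv> comp_coalg Y Z"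
abbreviation (input) "tripL \<equiv> comp_coalg XY Z"
abbreviation (input) "tripR \<equiv> comp_coalg X YZ"

text \<open>Corresponding points agree on corresponding generators, which shows that both directions of the
  rebracketing are well defined.\<close>

lemma triple_point_gens:
  assumes t: "triple_point X Y Z \<delta> \<delta>s \<chi>ss ks" and g: "(r, l) \<in> assoc_gens X Y Z"
  shows "pt_right \<delta> \<delta>s \<chi>ss r = pt_left \<delta> \<delta>s \<chi>ss l"
proof -
  note tD = triple_pointD[OF t]
  obtain x ys zss n js where *: "r = circ X YZ x (map2 (circ Y Z) ys zss)" "l = circ XY Z (circ X Y x ys) (concat zss)"
    "x \<in> gr X n" "length ys = Suc n" "homs Y ys js" "blocks Z zss js"
    using g unfolding assoc_gens_def by blast
  have "pt_right \<delta> \<delta>s \<chi>ss r = \<delta> x * pairing (map2 pt \<delta>s \<chi>ss) (map2 (circ Y Z) ys zss)"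
    unfolding *(1) by (rule pt_circ[OF tD(1)]) (auto simp: set_zip)
  also have "\<dots> = \<delta> x * pairing \<delta>s ys * pairing (concat \<chi>ss) (concat zss)"
  proof -
    have "pairing (map2 pt \<delta>s \<chi>ss) (map2 (circ Y Z) ys zss) = pairing \<delta>s ys * pairing (concat \<chi>ss) (concat zss)"
      by (rule pairing_blocks[OF _ _ tD(3) *(5)]) (use t *(6) in \<open>auto simp: triple_point_def blocks_iff\<close>)
    then show ?thesis by simp
  qed
  also have "\<dots> = pt \<delta> \<delta>s (circ X Y x ys) * pairing (concat \<chi>ss) (concat zss)"
    by (simp add: pt_circ[OF tD(1,2)])
  also have "\<dots> = pt_left \<delta> \<delta>s \<chi>ss l"
    unfolding *(2) by (rule pt_circ[symmetric]) (use tD(3) in auto)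
  finally show ?thesis .
qed

lemma assoc_gens_carr:
  assumes "(r, l) \<in> assoc_gens X Y Z"
  shows "r \<in> carr tripR" "l \<in> carr tripL"
proof -
  obtain x ys zss n js where *: "r = circ X YZ x (map2 (circ Y Z) ys zss)" "l = circ XY Z (circ X Y x ys) (concat zss)"
    "x \<in> gr X n" "length ys = Suc n" "homs Y ys js" "block_list js zss" "set (concat zss) \<subseteq> carr Z"
    using assms unfolding assoc_gens_def blocks_iff by blast
  have len: "length js = Suc n" "length zss = Suc n"
    using *(4) list_all2_lengthD[OF *(5)[unfolded homs_def]] list_all2_lengthD[OF *(6)] by simp_all
  have "circ X Y x ys \<in> gr XY (n + sum_list js)" by (rule circ_gr[OF *(3,5,4)])
  then show "l \<in> carr tripL"
    unfolding *(2) by (rule circ_carr[OF coZ(2)]) (use *(7) block_list_length[OF *(6)] len in auto)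
  have "set (map2 (circ Y Z) ys zss) \<subseteq> carr YZ"
  proof -
    have "set (zss ! i) \<subseteq> carr Z" if "i < Suc n" for i
      using *(7) len that nth_mem[of i zss] by fastforce
    then show ?thesis
      using *(5,6) len *(4)
      by (auto simp: set_zip homs_def list_all2_conv_all_nth intro!: circ_carr[OF coZ(2)])
  qed
  then show "r \<in> carr tripR"
    unfolding *(1) by (intro circ_carr[OF _ *(3)]) (use *(4) len in \<open>auto simp: vector_space_fscale\<close>)
qed

lemma carr_right_span: "carr tripR \<subseteq> module.span fscale (fst ` assoc_gens X Y Z)"
proof -
  interpret vector_space fscale by (rule vector_space_fscale)
  let ?B = "{circ Y Z y zs | y zs n. y \<in> gr Y n \<and> set zs \<subseteq> carr Z \<and> length zs = Suc n}"
  have "carr tripR \<subseteq> span {circ X YZ x es | x es n. x \<in> gr X n \<and> set es \<subseteq> ?B \<and> length es = Suc n}"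
    by (rule carr_comp_span) (simp_all add: carr_comp[OF coZ(2)] vector_space_fscale)
  also have "\<dots> \<subseteq> span (fst ` assoc_gens X Y Z)"
  proof (rule span_mono, rule subsetI)
    fix a assume "a \<in> {circ X YZ x es | x es n. x \<in> gr X n \<and> set es \<subseteq> ?B \<and> length es = Suc n}"
    then obtain x es n where a: "a = circ X YZ x es" "x \<in> gr X n" "set es \<subseteq> ?B" "length es = Suc n" by blast
    obtain ys zss js where es: "es = map2 (circ Y Z) ys zss" "length ys = length es" "homs Y ys js" "blocks Z zss js"
      using map2_circ_exists[OF a(3)] unfolding blocks_iff by blast
    have "(a, circ XY Z (circ X Y x ys) (concat zss)) \<in> assoc_gens X Y Z"
      unfolding a(1) es(1) by (rule assoc_gensI[OF a(2) _ es(3,4)]) (use a(4) es(2) in simp)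
    then show "a \<in> fst ` assoc_gens X Y Z" by force
  qed
  finally show ?thesis .
qed

lemma carr_left_span: "carr tripL \<subseteq> module.span fscale (snd ` assoc_gens X Y Z)"
proof -
  interpret vector_space fscale by (rule vector_space_fscale)
  show ?thesis
    unfolding carr_comp[OF coZ(2)]
  proof (rule span_minimal[OF _ subspace_span], rule subsetI)
    fix a assume "a \<in> {circ XY Z w zs | w zs n. w \<in> gr XY n \<and> set zs \<subseteq> carr Z \<and> length zs = Suc n}"
    then obtain w zs N where a: "a = circ XY Z w zs" "w \<in> gr XY N" "set zs \<subseteq> carr Z" "length zs = Suc N" by blast
    show "a \<in> span (snd ` assoc_gens X Y Z)"
      unfolding a(1)
    proof (rule linear_span_into[OF linear_circ_left[of XY, unfolded comp_coalg_simps, OF vector_space_fscale]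
          a(2)[unfolded comp_coalg_simps] subspace_span])
      fix w assume "w \<in> {circ X Y d cs |d cs n js. d \<in> gr X n \<and> homs Y cs js \<and> length cs = Suc n \<and> n + sum_list js = N}"
      then obtain x ys n js where w: "w = circ X Y x ys" "x \<in> gr X n" "homs Y ys js" "length ys = Suc n"
        "n + sum_list js = N" by blast
      have "length js = Suc n" using w(3,4) by (auto simp: homs_def dest: list_all2_lengthD)
      then obtain zss where "zs = concat zss" "block_list js zss"
        using block_list_exists[of zs js] a(4) w(5) by auto
      then have "(circ X YZ x (map2 (circ Y Z) ys zss), circ XY Z w zs) \<in> assoc_gens X Y Z"
        unfolding w(1) \<open>zs = concat zss\<close>
        by (intro assoc_gensI[OF w(2,4,3)]) (use a(3) \<open>zs = concat zss\<close> in \<open>simp add: blocks_iff\<close>)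
      then show "circ XY Z w zs \<in> span (snd ` assoc_gens X Y Z)" by (force intro: span_base)
    qed
  qed
qed

lemma triple_point_right_hfun:
  assumes t: "triple_point X Y Z \<delta> \<delta>s \<chi>ss ks"
  shows "\<exists>N. hfun tripR N (pt_right \<delta> \<delta>s \<chi>ss) \<and> hfun tripL N (pt_left \<delta> \<delta>s \<chi>ss)"
proof -
  have "\<exists>lss. list_all2 (\<lambda>\<xi> j. hfun YZ j \<xi>) (map2 pt \<delta>s \<chi>ss) (map2 (\<lambda>k ls. k + sum_list ls) ks lss) \<and>
      length lss = length ks \<and> list_all2 (\<lambda>\<chi> j. hfun Z j \<chi>) (concat \<chi>ss) (concat lss)"
    if "list_all2 (\<lambda>\<phi> j. hfun Y j \<phi>) \<delta>s ks" "block_list ks \<chi>ss" "\<forall>\<chi>\<in>set (concat \<chi>ss). \<exists>j. hfun Z j \<chi>"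
    using that
  proof (induction \<delta>s ks arbitrary: \<chi>ss rule: list_all2_induct)
    case Nil
    then show ?case by auto
  next
    case (Cons \<delta> \<delta>s k ks)
    obtain \<chi>s \<chi>ss' where \<chi>: "\<chi>ss = \<chi>s # \<chi>ss'" "length \<chi>s = Suc k" "block_list ks \<chi>ss'"
      using Cons.prems(1) by (auto simp: list_all2_Cons2)
    obtain lss where IH: "list_all2 (\<lambda>\<xi> j. hfun YZ j \<xi>) (map2 pt \<delta>s \<chi>ss') (map2 (\<lambda>k ls. k + sum_list ls) ks lss)"
      "length lss = length ks" "list_all2 (\<lambda>\<chi> j. hfun Z j \<chi>) (concat \<chi>ss') (concat lss)"
      using Cons.IH[OF \<chi>(3)] Cons.prems(2) \<chi>(1) by auto
    obtain ls where ls: "list_all2 (\<lambda>\<chi> j. hfun Z j \<chi>) \<chi>s ls"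
      using hfuns_degrees[of \<chi>s Z] Cons.prems(2) \<chi>(1) by auto
    show ?case
      by (rule exI[of _ "ls # lss"])
        (use IH ls hfun_pt[OF Cons.hyps(1) ls \<chi>(2)] \<chi>(1) in \<open>auto intro: list_all2_appendI\<close>)
  qed
  then obtain lss where lss: "list_all2 (\<lambda>\<xi> j. hfun YZ j \<xi>) (map2 pt \<delta>s \<chi>ss) (map2 (\<lambda>k ls. k + sum_list ls) ks lss)"
    "length lss = length ks" "list_all2 (\<lambda>\<chi> j. hfun Z j \<chi>) (concat \<chi>ss) (concat lss)"
    using t unfolding triple_point_def by blast
  define n where "n = length \<delta>s - 1"
  have n: "length \<delta>s = Suc n" "hfun X n \<delta>" "list_all2 (\<lambda>\<phi> j. hfun Y j \<phi>) \<delta>s ks" "block_list ks \<chi>ss"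
    using t unfolding triple_point_def n_def by (auto simp: neq_Nil_conv)
  have len: "length \<chi>ss = Suc n" "length ks = Suc n" using triple_pointD(4,5)[OF t] n(1) by auto
  have r: "hfun tripR (n + sum_list (map2 (\<lambda>k ls. k + sum_list ls) ks lss)) (pt_right \<delta> \<delta>s \<chi>ss)"
    by (rule hfun_pt[OF n(2) lss(1)]) (simp add: n(1) len)
  have "length (concat \<chi>ss) = Suc (n + sum_list ks)"
    using block_list_length[OF n(4)] len by simp
  then have l: "hfun tripL (n + sum_list ks + sum_list (concat lss)) (pt_left \<delta> \<delta>s \<chi>ss)"
    by (rule hfun_pt[OF hfun_pt[OF n(2,3,1)] lss(3)])
  have "sum_list (map2 (\<lambda>k ls. k + sum_list ls) ks lss) = sum_list ks + sum_list (concat lss)"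
    using lss(2)[symmetric] by (induction ks lss rule: list_induct2) auto
  then show ?thesis using r l by (auto simp: add.assoc)
qed

lemma separates_right:
  "separates fscale (carr tripR) {pt_right \<delta> \<delta>s \<chi>ss | \<delta> \<delta>s \<chi>ss ks. triple_point X Y Z \<delta> \<delta>s \<chi>ss ks}"
proof -
  let ?H = "{\<phi>. \<exists>j. hfun Z j \<phi>}"
  have sepYZ: "separates (scl YZ) (carr YZ) (hpts Y ?H)"
    using separates_hpts[OF coY(1) coZ(2) separates_carr_hfun[OF coZ(1)]] by simp
  have sub: "hpts X (hpts Y ?H) \<subseteq> {pt_right \<delta> \<delta>s \<chi>ss | \<delta> \<delta>s \<chi>ss ks. triple_point X Y Z \<delta> \<delta>s \<chi>ss ks}"
  proof
    fix \<xi> assume "\<xi> \<in> hpts X (hpts Y ?H)"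
    then obtain \<delta> \<phi>s n where *: "\<xi> = pt \<delta> \<phi>s" "hfun X n \<delta>" "length \<phi>s = Suc n" "set \<phi>s \<subseteq> hpts Y ?H"
      unfolding hpts_def by blast
    from *(4) have "\<exists>\<delta>s \<chi>ss ks. \<phi>s = map2 pt \<delta>s \<chi>ss \<and> length \<delta>s = length \<phi>s \<and>
        list_all2 (\<lambda>\<phi> j. hfun Y j \<phi>) \<delta>s ks \<and> block_list ks \<chi>ss \<and> (\<forall>\<chi>\<in>set (concat \<chi>ss). \<exists>j. hfun Z j \<chi>)"
    proof (induction \<phi>s)
      case Nil
      show ?case by (intro exI[of _ "[]"]) auto
    next
      case (Cons \<phi> \<phi>s)
      then obtain \<delta>s \<chi>ss ks where IH: "\<phi>s = map2 pt \<delta>s \<chi>ss" "length \<delta>s = length \<phi>s"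
        "list_all2 (\<lambda>\<phi> j. hfun Y j \<phi>) \<delta>s ks" "block_list ks \<chi>ss" "\<forall>\<chi>\<in>set (concat \<chi>ss). \<exists>j. hfun Z j \<chi>"
        by auto
      obtain \<epsilon> \<chi>s k where "\<phi> = pt \<epsilon> \<chi>s" "hfun Y k \<epsilon>" "length \<chi>s = Suc k" "set \<chi>s \<subseteq> ?H"
        using Cons.prems unfolding hpts_def by auto
      then show ?case
        using IH by (intro exI[of _ "\<epsilon> # \<delta>s"] exI[of _ "\<chi>s # \<chi>ss"] exI[of _ "k # ks"]) auto
    qed
    then obtain \<delta>s \<chi>ss ks where "\<phi>s = map2 pt \<delta>s \<chi>ss" "length \<delta>s = length \<phi>s"
        "list_all2 (\<lambda>\<phi> j. hfun Y j \<phi>) \<delta>s ks" "block_list ks \<chi>ss" "\<forall>\<chi>\<in>set (concat \<chi>ss). \<exists>j. hfun Z j \<chi>"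
      by blast
    moreover from this have "triple_point X Y Z \<delta> \<delta>s \<chi>ss ks"
      using *(2,3) unfolding triple_point_def by auto
    ultimately show "\<xi> \<in> {pt_right \<delta> \<delta>s \<chi>ss | \<delta> \<delta>s \<chi>ss ks. triple_point X Y Z \<delta> \<delta>s \<chi>ss ks}"
      using *(1) by blast
  qed
  have vYZ: "vector_space (scl YZ)" by (simp add: vector_space_fscale)
  show ?thesis
    by (rule separates_superset[OF separates_hpts[OF coX(1) vYZ sepYZ] sub]) auto
qed

text \<open>The outer functionals here are points of \<open>X \<circ> Y\<close>.  Those of total degree \<open>N\<close> already
  separate degree \<open>N\<close>, and this degree fixes the length \<open>N + 1\<close> of the word on \<open>Z\<close>.\<close>

lemma separates_left:
  "separates fscale (carr tripL) {pt_left \<delta> \<delta>s \<chi>ss | \<delta> \<delta>s \<chi>ss ks. triple_point X Y Z \<delta> \<delta>s \<chi>ss ks}"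
proof -
  let ?H = "{\<phi>. \<exists>j. hfun Z j \<phi>}"
  let ?T = "\<lambda>N. {pt \<delta> \<delta>s | \<delta> \<delta>s n ks. hfun X n \<delta> \<and> length \<delta>s = Suc n \<and>
      list_all2 (\<lambda>\<phi> j. hfun Y j \<phi>) \<delta>s ks \<and> N = n + sum_list ks}"
  have T: "separates (scl XY) (gr XY N) (?T N)" for N
    unfolding separates_def
  proof (intro conjI ballI impI)
    fix x assume x: "x \<in> gr XY N" and z: "\<forall>\<phi>\<in>?T N. \<phi> x = 0"
    have xc: "x \<in> carr XY" by (rule gr_carr[OF graded_coalgebraD(2)[OF gXY] x])
    have "\<xi> x = 0" if "\<xi> \<in> hpts X {\<phi>. \<exists>j. hfun Y j \<phi>}" for \<xi>
    proof -
      from that obtain \<delta> \<delta>s n where *: "\<xi> = pt \<delta> \<delta>s" "hfun X n \<delta>" "length \<delta>s = Suc n"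
        "set \<delta>s \<subseteq> {\<phi>. \<exists>j. hfun Y j \<phi>}" by (auto simp: hpts_def)
      obtain js where js: "list_all2 (\<lambda>\<phi> j. hfun Y j \<phi>) \<delta>s js" using *(4) hfuns_degrees[of \<delta>s Y] by blast
      show ?thesis
      proof (cases "N = n + sum_list js")
        case True
        have "\<xi> \<in> ?T N" using * js True by blast
        then show ?thesis using z by blast
      next
        case False
        then show ?thesis using hfunD(2)[OF hfun_pt[OF *(2) js *(3)] x] *(1) by blast
      qed
    qed
    then show "x = 0"
      using separates_hpts[OF coX(1) coY(2) separates_carr_hfun[OF coY(1)]] xc unfolding separates_def by blast
  qed auto
  have sub: "{pt \<theta> \<chi>s | \<theta> \<chi>s n. \<theta> \<in> ?T n \<and> length \<chi>s = Suc n \<and> set \<chi>s \<subseteq> ?H} \<subseteq>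
      {pt_left \<delta> \<delta>s \<chi>ss | \<delta> \<delta>s \<chi>ss ks. triple_point X Y Z \<delta> \<delta>s \<chi>ss ks}"
  proof
    fix \<xi> assume "\<xi> \<in> {pt \<theta> \<chi>s | \<theta> \<chi>s n. \<theta> \<in> ?T n \<and> length \<chi>s = Suc n \<and> set \<chi>s \<subseteq> ?H}"
    then obtain \<delta> \<delta>s \<chi>s n ks where *: "\<xi> = pt (pt \<delta> \<delta>s) \<chi>s" "hfun X n \<delta>" "length \<delta>s = Suc n"
      "list_all2 (\<lambda>\<phi> j. hfun Y j \<phi>) \<delta>s ks" "length \<chi>s = Suc (n + sum_list ks)" "set \<chi>s \<subseteq> ?H" by blast
    have "length ks = Suc n" using *(3,4) by (auto dest: list_all2_lengthD)
    then obtain \<chi>ss where \<chi>: "\<chi>s = concat \<chi>ss" "block_list ks \<chi>ss"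
      using block_list_exists[of \<chi>s ks] *(5) by auto
    have "triple_point X Y Z \<delta> \<delta>s \<chi>ss ks"
      using * \<chi> unfolding triple_point_def by auto
    then show "\<xi> \<in> {pt_left \<delta> \<delta>s \<chi>ss | \<delta> \<delta>s \<chi>ss ks. triple_point X Y Z \<delta> \<delta>s \<chi>ss ks}"
      using *(1) \<chi>(1) by blast
  qed
  show ?thesis
    by (rule separates_superset[OF separates_pts_family[OF graded_coalgebraD(1)[OF gXY] coZ(2)
            separates_carr_hfun[OF coZ(1)] T] sub]) auto
qed

lemma
  shows linear_assoc_left: "Vector_Spaces.linear fscale fscale (assoc_left X Y Z)"
    and assoc_left_gens: "(r, l) \<in> assoc_gens X Y Z \<Longrightarrow> assoc_left X Y Z r = l"
    and linear_assoc_right: "Vector_Spaces.linear fscale fscale (assoc_right X Y Z)"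
    and assoc_right_gens: "(r, l) \<in> assoc_gens X Y Z \<Longrightarrow> assoc_right X Y Z l = r"
proof -
  let ?P = "\<lambda>\<delta> \<delta>s \<chi>ss. \<exists>ks. triple_point X Y Z \<delta> \<delta>s \<chi>ss ks"
  have l: "module.span fscale (snd ` assoc_gens X Y Z) \<subseteq> carr tripL"
    by (rule span_subset_subspace[OF vector_space_fscale subspace_carr_comp])
      (use assoc_gens_carr in auto)
  have r: "module.span fscale (snd ` prod.swap ` assoc_gens X Y Z) \<subseteq> carr tripR"
    by (rule span_subset_subspace[OF vector_space_fscale subspace_carr_comp])
      (use assoc_gens_carr in auto)
  have dl: "\<forall>\<xi>\<in>{pt_left \<delta> \<delta>s \<chi>ss | \<delta> \<delta>s \<chi>ss ks. triple_point X Y Z \<delta> \<delta>s \<chi>ss ks}.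
      \<exists>\<Lambda>. functional fscale \<Lambda> \<and> (\<forall>(x, y)\<in>assoc_gens X Y Z. \<Lambda> x = \<xi> y)"
  proof clarify
    fix \<delta> \<delta>s \<chi>ss ks assume "triple_point X Y Z \<delta> \<delta>s \<chi>ss ks"
    from triple_point_gens[OF this]
    show "\<exists>\<Lambda>. functional fscale \<Lambda> \<and> (\<forall>(x, y)\<in>assoc_gens X Y Z. \<Lambda> x = pt_left \<delta> \<delta>s \<chi>ss y)"
      by (intro exI[of _ "pt_right \<delta> \<delta>s \<chi>ss"]) auto
  qed
  have dr: "\<forall>\<xi>\<in>{pt_right \<delta> \<delta>s \<chi>ss | \<delta> \<delta>s \<chi>ss ks. triple_point X Y Z \<delta> \<delta>s \<chi>ss ks}.
      \<exists>\<Lambda>. functional fscale \<Lambda> \<and> (\<forall>(x, y)\<in>prod.swap ` assoc_gens X Y Z. \<Lambda> x = \<xi> y)"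
  proof clarify
    fix \<delta> \<delta>s \<chi>ss ks assume "triple_point X Y Z \<delta> \<delta>s \<chi>ss ks"
    from triple_point_gens[OF this]
    show "\<exists>\<Lambda>. functional fscale \<Lambda> \<and> (\<forall>(x, y)\<in>prod.swap ` assoc_gens X Y Z. \<Lambda> x = pt_right \<delta> \<delta>s \<chi>ss y)"
      by (intro exI[of _ "pt_left \<delta> \<delta>s \<chi>ss"]) auto
  qed
  note el = lin_ext_dual[OF vector_space_fscale vector_space_fscale separates_mono[OF separates_left l] dl,
      folded assoc_left_def]
  note er = lin_ext_dual[OF vector_space_fscale vector_space_fscale separates_mono[OF separates_right r] dr,
      folded assoc_right_def]
  show "Vector_Spaces.linear fscale fscale (assoc_left X Y Z)" by (rule el(1))
  show "(r, l) \<in> assoc_gens X Y Z \<Longrightarrow> assoc_left X Y Z r = l" by (rule el(2))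
  show "Vector_Spaces.linear fscale fscale (assoc_right X Y Z)" by (rule er(1))
  show "(r, l) \<in> assoc_gens X Y Z \<Longrightarrow> assoc_right X Y Z l = r" by (rule er(2)) force
qed

lemma
  shows assoc_left_in: "e \<in> carr tripR \<Longrightarrow> assoc_left X Y Z e \<in> carr tripL"
    and assoc_right_in: "e' \<in> carr tripL \<Longrightarrow> assoc_right X Y Z e' \<in> carr tripR"
    and pt_assoc_left: "triple_point X Y Z \<delta> \<delta>s \<chi>ss ks \<Longrightarrow> e \<in> carr tripR \<Longrightarrow>
      pt_left \<delta> \<delta>s \<chi>ss (assoc_left X Y Z e) = pt_right \<delta> \<delta>s \<chi>ss e"
    and pt_assoc_right: "triple_point X Y Z \<delta> \<delta>s \<chi>ss ks \<Longrightarrow> e' \<in> carr tripL \<Longrightarrow>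
      pt_right \<delta> \<delta>s \<chi>ss (assoc_right X Y Z e') = pt_left \<delta> \<delta>s \<chi>ss e'"
proof -
  show "assoc_left X Y Z e \<in> carr tripL" if "e \<in> carr tripR"
    by (rule linear_span_into[OF linear_assoc_left subsetD[OF carr_right_span that] subspace_carr_comp])
      (use assoc_left_gens assoc_gens_carr in force)
  show "assoc_right X Y Z e' \<in> carr tripR" if "e' \<in> carr tripL"
    by (rule linear_span_into[OF linear_assoc_right subsetD[OF carr_left_span that] subspace_carr_comp])
      (use assoc_right_gens assoc_gens_carr in force)
  assume t: "triple_point X Y Z \<delta> \<delta>s \<chi>ss ks"
  show "pt_left \<delta> \<delta>s \<chi>ss (assoc_left X Y Z e) = pt_right \<delta> \<delta>s \<chi>ss e" if "e \<in> carr tripR"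
  proof -
    have "(pt_left \<delta> \<delta>s \<chi>ss \<circ> assoc_left X Y Z) e = pt_right \<delta> \<delta>s \<chi>ss e"
      by (rule functional_eq_span[OF functional_comp[OF linear_assoc_left functional_pt] functional_pt
            subsetD[OF carr_right_span that]])
        (use assoc_left_gens triple_point_gens[OF t] in force)
    then show ?thesis by simp
  qed
  show "pt_right \<delta> \<delta>s \<chi>ss (assoc_right X Y Z e') = pt_left \<delta> \<delta>s \<chi>ss e'" if "e' \<in> carr tripL"
  proof -
    have "(pt_right \<delta> \<delta>s \<chi>ss \<circ> assoc_right X Y Z) e' = pt_left \<delta> \<delta>s \<chi>ss e'"
      by (rule functional_eq_span[OF functional_comp[OF linear_assoc_right functional_pt] functional_pt
            subsetD[OF carr_left_span that]])
        (use assoc_right_gens triple_point_gens[OF t] in force)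
    then show ?thesis by simp
  qed
qed

end

text \<open>A linear map that transposes a family of pairs of homogeneous functionals is a coalgebra map if the
  family contains the counits and is closed under products.  The condition is symmetric in the two
  coalgebras, so for an isomorphism one family serves both directions.\<close>

lemma coalgebra_morphism_by_points:
  assumes R: "graded_coalgebra R" and L: "graded_coalgebra L"
    and lin: "Vector_Spaces.linear (scl R) (scl L) A" and A_in: "\<And>e. e \<in> carr R \<Longrightarrow> A e \<in> carr L"
    and sep: "separates (scl L) (carr L) (snd ` T)"
    and hf: "\<And>\<xi> \<eta>. (\<xi>, \<eta>) \<in> T \<Longrightarrow> \<exists>N. hfun R N \<xi> \<and> hfun L N \<eta>"
    and pt: "\<And>\<xi> \<eta> e. (\<xi>, \<eta>) \<in> T \<Longrightarrow> e \<in> carr R \<Longrightarrow> \<eta> (A e) = \<xi> e"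
    and cou: "\<exists>(\<xi>, \<eta>)\<in>T. (\<forall>e\<in>carr R. cou R e = \<xi> e) \<and> (\<forall>e\<in>carr L. cou L e = \<eta> e)"
    and mult: "\<And>\<xi> \<eta> \<xi>' \<eta>'. (\<xi>, \<eta>) \<in> T \<Longrightarrow> (\<xi>', \<eta>') \<in> T \<Longrightarrow> \<exists>(\<zeta>, \<theta>)\<in>T.
      (\<forall>e\<in>carr R. conv R \<xi> \<xi>' e = \<zeta> e) \<and> (\<forall>e\<in>carr L. conv L \<eta> \<eta>' e = \<theta> e)"
  shows "coalgebra_morphism R L A"
proof (rule coalgebra_morphismI[OF R L lin _ _ sep])
  note grR = gr_carr[OF graded_coalgebraD(2)[OF R]]
  show "A e \<in> gr L N" if e: "e \<in> gr R N" for e N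
  proof (rule gr_by_hfun[OF graded_coalgebraD(1)[OF L] A_in[OF grR[OF e]] sep])
    fix \<eta> assume "\<eta> \<in> snd ` T"
    then obtain \<xi> where t: "(\<xi>, \<eta>) \<in> T" by auto
    obtain M where M: "hfun R M \<xi>" "hfun L M \<eta>" using hf[OF t] by blast
    show "\<exists>k. hfun L k \<eta> \<and> (k \<noteq> N \<longrightarrow> \<eta> (A e) = 0)"
      unfolding pt[OF t grR[OF e]] using M(2) hfunD(2)[OF M(1) e] by blast
  qed
  show "cou L (A e) = cou R e" if "e \<in> gr R N" for e N
  proof -
    obtain \<xi> \<eta> where t: "(\<xi>, \<eta>) \<in> T" "\<forall>e\<in>carr R. cou R e = \<xi> e" "\<forall>e\<in>carr L. cou L e = \<eta> e"
      using cou by blast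
    show ?thesis using t(2,3) pt[OF t(1) grR[OF that]] grR[OF that] A_in[OF grR[OF that]] by simp
  qed
  fix e \<eta> \<eta>' assume e: "e \<in> carr R" and "\<eta> \<in> snd ` T" "\<eta>' \<in> snd ` T"
  then obtain \<xi> \<xi>' where t: "(\<xi>, \<eta>) \<in> T" "(\<xi>', \<eta>') \<in> T" by auto
  obtain \<zeta> \<theta> where m: "(\<zeta>, \<theta>) \<in> T" "conv R \<xi> \<xi>' e = \<zeta> e" "conv L \<eta> \<eta>' (A e) = \<theta> (A e)"
    using mult[OF t] e A_in[OF e] by blast
  have "conv R (\<eta> \<circ> A) (\<eta>' \<circ> A) e = conv R \<xi> \<xi>' e"
  proof (rule conv_cong[OF R e])
    show "functional (scl R) (\<eta> \<circ> A)" "functional (scl R) (\<eta>' \<circ> A)" "functional (scl R) \<xi>" "functional (scl R) \<xi>'"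
      using hf[OF t(1)] hf[OF t(2)] hfunD(1) functional_comp[OF lin] by blast+
  qed (simp_all add: pt[OF t(1)] pt[OF t(2)])
  also have "\<dots> = conv L \<eta> \<eta>' (A e)" unfolding m(2,3) by (rule pt[OF m(1) e, symmetric])
  finally show "conv R (\<eta> \<circ> A) (\<eta>' \<circ> A) e = conv L \<eta> \<eta>' (A e)" .
qed

context
  fixes X :: "('k::field, 'x::ab_group_add) coalg" and Y :: "('k, 'y::ab_group_add) coalg"
    and Z :: "('k, 'z::ab_group_add) coalg"
  assumes X: "graded_coalgebra X" and Y: "graded_coalgebra Y" and Z: "graded_coalgebra Z"
begin

text \<open>Apply the product rule to the outer composition and then to the inner one.  In either bracketing only
  the last block of the first point and the first block of the second are glued.\<close>

lemma triple_point_mult: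
  assumes 1: "triple_point X Y Z \<delta> (\<delta>s @ [\<delta>']) (\<chi>ss @ [\<chi>s @ [\<chi>]]) (ks @ [k])"
    and 2: "triple_point X Y Z \<epsilon> (\<epsilon>' # \<epsilon>s) ((\<omega> # \<omega>s) # \<omega>ss) (l # ls)"
  defines "\<theta> \<equiv> conv X \<delta> \<epsilon>" and "\<theta>s \<equiv> \<delta>s @ conv Y \<delta>' \<epsilon>' # \<epsilon>s"
    and "\<eta>ss \<equiv> \<chi>ss @ (\<chi>s @ conv Z \<chi> \<omega> # \<omega>s) # \<omega>ss"
  shows "triple_point X Y Z \<theta> \<theta>s \<eta>ss (ks @ (k + l) # ls)"
    and "e \<in> carr (comp_coalg (comp_coalg X Y) Z) \<Longrightarrow>
      conv (comp_coalg (comp_coalg X Y) Z) (pt_left \<delta> (\<delta>s @ [\<delta>']) (\<chi>ss @ [\<chi>s @ [\<chi>]]))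
        (pt_left \<epsilon> (\<epsilon>' # \<epsilon>s) ((\<omega> # \<omega>s) # \<omega>ss)) e = pt_left \<theta> \<theta>s \<eta>ss e"
    and "e' \<in> carr (comp_coalg X (comp_coalg Y Z)) \<Longrightarrow>
      conv (comp_coalg X (comp_coalg Y Z)) (pt_right \<delta> (\<delta>s @ [\<delta>']) (\<chi>ss @ [\<chi>s @ [\<chi>]]))
        (pt_right \<epsilon> (\<epsilon>' # \<epsilon>s) ((\<omega> # \<omega>s) # \<omega>ss)) e' = pt_right \<theta> \<theta>s \<eta>ss e'"
proof -
  note cX = graded_coalgebraD[OF X] and cY = graded_coalgebraD[OF Y] and cZ = graded_coalgebraD[OF Z]
  note gXY = graded_coalgebra_comp[OF X Y] and gYZ = graded_coalgebra_comp[OF Y Z]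
  note t1 = 1[unfolded triple_point_def] and t2 = 2[unfolded triple_point_def]
  note D1 = triple_pointD[OF 1] and D2 = triple_pointD[OF 2]
  have hX: "hfun X (length \<delta>s) \<delta>" "hfun X (length \<epsilon>s) \<epsilon>" using t1 t2 by auto
  have len: "length ks = length \<delta>s" "length \<chi>ss = length \<delta>s" "length ls = length \<epsilon>s" "length \<omega>ss = length \<epsilon>s"
    using D1 D2 by auto
  have hY1: "list_all2 (\<lambda>\<phi> j. hfun Y j \<phi>) \<delta>s ks" "hfun Y k \<delta>'"
    using t1 len list_all2_append[of \<delta>s ks "\<lambda>\<phi> j. hfun Y j \<phi>" "[\<delta>']" "[k]"] by auto
  have hY2: "list_all2 (\<lambda>\<phi> j. hfun Y j \<phi>) \<epsilon>s ls" "hfun Y l \<epsilon>'" using t2 by auto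
  have b1: "block_list ks \<chi>ss" "length \<chi>s = k"
    using t1 len list_all2_append[of \<chi>ss ks "\<lambda>xs j. length xs = Suc j" "[\<chi>s @ [\<chi>]]" "[k]"] by auto
  have b2: "block_list ls \<omega>ss" "length \<omega>s = l" using t2 by auto
  have hZ1: "\<forall>\<chi>\<in>set (concat \<chi>ss @ \<chi>s @ [\<chi>]). \<exists>j. hfun Z j \<chi>" using t1 by auto
  have hZ2: "\<forall>\<chi>\<in>set (\<omega> # \<omega>s @ concat \<omega>ss). \<exists>j. hfun Z j \<chi>" using t2 by auto
  obtain i j where ij: "hfun Z i \<chi>" "hfun Z j \<omega>" using hZ1 hZ2 by auto
  have fZ: "functionals Z ((concat \<chi>ss @ \<chi>s) @ \<chi> # \<omega> # \<omega>s @ concat \<omega>ss)"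
    using D1(3) D2(3) by auto
  have fY: "functionals Y (\<delta>s @ \<delta>' # \<epsilon>' # \<epsilon>s)" using D1(2) D2(2) by auto
  note conv_fun = functional_conv[OF X] functional_conv[OF Y] functional_conv[OF Z]
    functional_conv[OF gXY, unfolded comp_coalg_simps(1)] functional_conv[OF gYZ, unfolded comp_coalg_simps(1)]
  have eqXY: "conv (comp_coalg X Y) (pt \<delta> (\<delta>s @ [\<delta>'])) (pt \<epsilon> (\<epsilon>' # \<epsilon>s)) x = pt \<theta> \<theta>s x"
    if "x \<in> carr (comp_coalg X Y)" for x
    unfolding \<theta>_def \<theta>s_def by (rule conv_comp[OF X Y that hX fY])
  have fYZ: "functionals Z (\<chi>s @ \<chi> # \<omega> # \<omega>s)" using fZ by auto
  have eqYZ: "conv (comp_coalg Y Z) (pt \<delta>' (\<chi>s @ [\<chi>])) (pt \<epsilon>' (\<omega> # \<omega>s)) x = pt (conv Y \<delta>' \<epsilon>') (\<chi>s @ conv Z \<chi> \<omega> # \<omega>s) x"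
    if "x \<in> carr (comp_coalg Y Z)" for x
    by (rule conv_comp[OF Y Z that]) (use hY1 hY2 b1 b2 fYZ in auto)
  show "triple_point X Y Z \<theta> \<theta>s \<eta>ss (ks @ (k + l) # ls)"
    unfolding triple_point_def
  proof (intro conjI)
    show "hfun X (length \<theta>s - 1) \<theta>"
      using hfun_conv[OF X hX] by (simp add: \<theta>_def \<theta>s_def)
    show "list_all2 (\<lambda>\<phi> j. hfun Y j \<phi>) \<theta>s (ks @ (k + l) # ls)"
      unfolding \<theta>s_def by (intro list_all2_appendI hY1) (use hfun_conv[OF Y hY1(2) hY2(2)] hY2 in auto)
    show "block_list (ks @ (k + l) # ls) \<eta>ss"
      unfolding \<eta>ss_def by (intro list_all2_appendI b1) (use b1 b2 in auto)
    show "\<forall>\<chi>\<in>set (concat \<eta>ss). \<exists>j. hfun Z j \<chi>"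
      using hZ1 hZ2 hfun_conv[OF Z ij] by (auto simp: \<eta>ss_def)
  qed (simp add: \<theta>s_def)
  show "conv (comp_coalg (comp_coalg X Y) Z) (pt_left \<delta> (\<delta>s @ [\<delta>']) (\<chi>ss @ [\<chi>s @ [\<chi>]]))
        (pt_left \<epsilon> (\<epsilon>' # \<epsilon>s) ((\<omega> # \<omega>s) # \<omega>ss)) e = pt_left \<theta> \<theta>s \<eta>ss e"
    if e: "e \<in> carr (comp_coalg (comp_coalg X Y) Z)"
  proof -
    have h1: "hfun (comp_coalg X Y) (length (concat \<chi>ss @ \<chi>s)) (pt \<delta> (\<delta>s @ [\<delta>']))"
    proof -
      have "hfun (comp_coalg X Y) (length \<delta>s + sum_list (ks @ [k])) (pt \<delta> (\<delta>s @ [\<delta>']))"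
        by (rule hfun_pt[OF hX(1)]) (use t1 in auto)
      then show ?thesis using block_list_length[OF b1(1)] b1(2) len(1) by (simp add: add.assoc)
    qed
    have h2: "hfun (comp_coalg X Y) (length (\<omega>s @ concat \<omega>ss)) (pt \<epsilon> (\<epsilon>' # \<epsilon>s))"
    proof -
      have "hfun (comp_coalg X Y) (length \<epsilon>s + sum_list (l # ls)) (pt \<epsilon> (\<epsilon>' # \<epsilon>s))"
        by (rule hfun_pt[OF hX(2)]) (use t2 in auto)
      then show ?thesis using block_list_length[OF b2(1)] b2(2) len(3) by (simp add: ac_simps)
    qed
    have "conv (comp_coalg (comp_coalg X Y) Z) (pt (pt \<delta> (\<delta>s @ [\<delta>'])) ((concat \<chi>ss @ \<chi>s) @ [\<chi>]))
        (pt (pt \<epsilon> (\<epsilon>' # \<epsilon>s)) (\<omega> # (\<omega>s @ concat \<omega>ss))) e =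
      pt (conv (comp_coalg X Y) (pt \<delta> (\<delta>s @ [\<delta>'])) (pt \<epsilon> (\<epsilon>' # \<epsilon>s)))
        ((concat \<chi>ss @ \<chi>s) @ conv Z \<chi> \<omega> # (\<omega>s @ concat \<omega>ss)) e"
      by (rule conv_comp[OF gXY Z e h1 h2 fZ])
    also have "\<dots> = pt (pt \<theta> \<theta>s) ((concat \<chi>ss @ \<chi>s) @ conv Z \<chi> \<omega> # (\<omega>s @ concat \<omega>ss)) e"
      by (rule pt_cong[OF cZ(2) graded_coalgebraD(2)[OF gXY] e _ _ _ _ eqXY])
        (use fZ conv_fun in \<open>auto simp: list_all2_same\<close>)
    finally show ?thesis by (simp add: \<eta>ss_def)
  qed
  show "conv (comp_coalg X (comp_coalg Y Z)) (pt_right \<delta> (\<delta>s @ [\<delta>']) (\<chi>ss @ [\<chi>s @ [\<chi>]]))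
        (pt_right \<epsilon> (\<epsilon>' # \<epsilon>s) ((\<omega> # \<omega>s) # \<omega>ss)) e' = pt_right \<theta> \<theta>s \<eta>ss e'"
    if e: "e' \<in> carr (comp_coalg X (comp_coalg Y Z))"
  proof -
    have F: "functionals (comp_coalg Y Z) (map2 pt us vs)" for us :: "('y \<Rightarrow> 'k) list" and vs :: "('z \<Rightarrow> 'k) list list"
      by (auto simp: set_zip)
    have "conv (comp_coalg X (comp_coalg Y Z)) (pt \<delta> (map2 pt \<delta>s \<chi>ss @ [pt \<delta>' (\<chi>s @ [\<chi>])]))
        (pt \<epsilon> (pt \<epsilon>' (\<omega> # \<omega>s) # map2 pt \<epsilon>s \<omega>ss)) e' =
      pt (conv X \<delta> \<epsilon>) (map2 pt \<delta>s \<chi>ss @ conv (comp_coalg Y Z) (pt \<delta>' (\<chi>s @ [\<chi>])) (pt \<epsilon>' (\<omega> # \<omega>s)) # map2 pt \<epsilon>s \<omega>ss) e'"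
      by (rule conv_comp[OF X gYZ e]) (use hX len F in auto)
    also have "\<dots> = pt \<theta> (map2 pt \<delta>s \<chi>ss @ pt (conv Y \<delta>' \<epsilon>') (\<chi>s @ conv Z \<chi> \<omega> # \<omega>s) # map2 pt \<epsilon>s \<omega>ss) e'"
      unfolding \<theta>_def
      by (rule pt_cong[OF graded_coalgebraD(2)[OF gYZ] cX(2) e])
        (use F conv_fun eqYZ in \<open>auto simp: list_all2_same intro!: list_all2_appendI\<close>)
    finally show ?thesis using len by (simp add: \<theta>s_def \<eta>ss_def)
  qed
qed

lemma triple_point_last:
  assumes "triple_point X Y Z \<delta> \<delta>s \<chi>ss ks"
  obtains \<delta>s' \<delta>' \<chi>ss' \<chi>s \<chi> ks' k where "\<delta>s = \<delta>s' @ [\<delta>']" "\<chi>ss = \<chi>ss' @ [\<chi>s @ [\<chi>]]" "ks = ks' @ [k]"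
proof -
  note t = assms[unfolded triple_point_def] and D = triple_pointD[OF assms]
  obtain \<delta>s' \<delta>' where 1: "\<delta>s = \<delta>s' @ [\<delta>']" using t by (cases \<delta>s rule: rev_cases) auto
  obtain \<chi>ss' \<chi>s where 2: "\<chi>ss = \<chi>ss' @ [\<chi>s]" using D(4) 1 by (cases \<chi>ss rule: rev_cases) auto
  obtain ks' k where 3: "ks = ks' @ [k]" using D(5) 1 by (cases ks rule: rev_cases) auto
  have "length \<chi>s = Suc k"
    using t D list_all2_append[of \<chi>ss' ks' "\<lambda>xs j. length xs = Suc j" "[\<chi>s]" "[k]"] by (auto simp: 1 2 3)
  then obtain \<chi>s' \<chi> where "\<chi>s = \<chi>s' @ [\<chi>]" by (cases \<chi>s rule: rev_cases) auto
  with 1 2 3 show thesis by (intro that) auto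
qed

lemma triple_point_first:
  assumes "triple_point X Y Z \<delta> \<delta>s \<chi>ss ks"
  obtains \<delta>s' \<delta>' \<chi>ss' \<chi>s \<chi> ks' k where "\<delta>s = \<delta>' # \<delta>s'" "\<chi>ss = (\<chi> # \<chi>s) # \<chi>ss'" "ks = k # ks'"
proof -
  note t = assms[unfolded triple_point_def] and D = triple_pointD[OF assms]
  obtain \<delta>s' \<delta>' where 1: "\<delta>s = \<delta>' # \<delta>s'" using t by (cases \<delta>s) auto
  obtain \<chi>ss' \<chi>s where 2: "\<chi>ss = \<chi>s # \<chi>ss'" using D(4) 1 by (cases \<chi>ss) auto
  obtain ks' k where 3: "ks = k # ks'" using D(5) 1 by (cases ks) auto
  have "length \<chi>s = Suc k" using t by (auto simp: 1 2 3)
  then obtain \<chi>s' \<chi> where "\<chi>s = \<chi> # \<chi>s'" by (cases \<chi>s) auto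
  with 1 2 3 show thesis by (intro that) auto
qed

lemma triple_point_counit: "triple_point X Y Z (cou X) [cou Y] [[cou Z]] [0]"
  using graded_coalgebraD(6)[OF X] graded_coalgebraD(6)[OF Y] graded_coalgebraD(6)[OF Z]
  by (auto simp: triple_point_def)

lemma cou_triple:
  shows "e \<in> carr (comp_coalg (comp_coalg X Y) Z) \<Longrightarrow>
      cou (comp_coalg (comp_coalg X Y) Z) e = pt_left (cou X) [cou Y] [[cou Z]] e"
    and "e' \<in> carr (comp_coalg X (comp_coalg Y Z)) \<Longrightarrow>
      cou (comp_coalg X (comp_coalg Y Z)) e' = pt_right (cou X) [cou Y] [[cou Z]] e'"
proof -
  note cX = graded_coalgebraD[OF X] and cY = graded_coalgebraD[OF Y] and cZ = graded_coalgebraD[OF Z]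
  note gXY = graded_coalgebra_comp[OF X Y] and gYZ = graded_coalgebra_comp[OF Y Z]
  show "cou (comp_coalg (comp_coalg X Y) Z) e = pt_left (cou X) [cou Y] [[cou Z]] e"
    if e: "e \<in> carr (comp_coalg (comp_coalg X Y) Z)"
    unfolding cou_comp[OF gXY Z e]
    using pt_cong[OF cZ(2) graded_coalgebraD(2)[OF gXY] e _ _ _ _ cou_comp[OF X Y], where \<phi>s = "[cou Z]" and \<psi>s = "[cou Z]"]
    by (simp add: functional_cou_comp[OF X Y] cZ(4))
  show "cou (comp_coalg X (comp_coalg Y Z)) e' = pt_right (cou X) [cou Y] [[cou Z]] e'"
    if e: "e' \<in> carr (comp_coalg X (comp_coalg Y Z))"
    unfolding cou_comp[OF X gYZ e]
    using pt_cong[OF graded_coalgebraD(2)[OF gYZ] cX(2) e, where \<delta> = "cou X" and \<epsilon> = "cou X" and \<phi>s = "[cou (comp_coalg Y Z)]" and \<psi>s = "[pt (cou Y) [cou Z]]"]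
    by (simp add: functional_cou_comp[OF Y Z] cX(4) cou_comp[OF Y Z])
qed

abbreviation (input) "triple_pairs \<equiv>
  {(pt_right \<delta> \<delta>s \<chi>ss, pt_left \<delta> \<delta>s \<chi>ss) | \<delta> \<delta>s \<chi>ss ks. triple_point X Y Z \<delta> \<delta>s \<chi>ss ks}"

lemma triple_pairs_hfun:
  "(\<xi>, \<eta>) \<in> triple_pairs \<Longrightarrow> \<exists>N. hfun (comp_coalg X (comp_coalg Y Z)) N \<xi> \<and> hfun (comp_coalg (comp_coalg X Y) Z) N \<eta>"
  using triple_point_right_hfun[OF X Y Z] by blast

lemma triple_pairs_cou:
  "\<exists>(\<xi>, \<eta>)\<in>triple_pairs. (\<forall>e\<in>carr (comp_coalg X (comp_coalg Y Z)). cou (comp_coalg X (comp_coalg Y Z)) e = \<xi> e) \<and>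
     (\<forall>e\<in>carr (comp_coalg (comp_coalg X Y) Z). cou (comp_coalg (comp_coalg X Y) Z) e = \<eta> e)"
  using triple_point_counit cou_triple
  by (intro bexI[of _ "(pt_right (cou X) [cou Y] [[cou Z]], pt_left (cou X) [cou Y] [[cou Z]])"]) blast+

lemma triple_pairs_mult:
  assumes "(\<xi>, \<eta>) \<in> triple_pairs" "(\<xi>', \<eta>') \<in> triple_pairs"
  shows "\<exists>(\<zeta>, \<theta>)\<in>triple_pairs.
     (\<forall>e\<in>carr (comp_coalg X (comp_coalg Y Z)). conv (comp_coalg X (comp_coalg Y Z)) \<xi> \<xi>' e = \<zeta> e) \<and>
     (\<forall>e\<in>carr (comp_coalg (comp_coalg X Y) Z). conv (comp_coalg (comp_coalg X Y) Z) \<eta> \<eta>' e = \<theta> e)"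
proof -
  obtain \<delta> \<delta>s \<chi>ss ks \<epsilon> \<epsilon>s \<omega>ss ls where \<xi>: "\<xi> = pt_right \<delta> \<delta>s \<chi>ss" "\<eta> = pt_left \<delta> \<delta>s \<chi>ss"
      "\<xi>' = pt_right \<epsilon> \<epsilon>s \<omega>ss" "\<eta>' = pt_left \<epsilon> \<epsilon>s \<omega>ss"
    and t: "triple_point X Y Z \<delta> \<delta>s \<chi>ss ks" "triple_point X Y Z \<epsilon> \<epsilon>s \<omega>ss ls" using assms by blast
  obtain \<delta>s' \<delta>' \<chi>ss' \<chi>s \<chi> ks' k where l: "\<delta>s = \<delta>s' @ [\<delta>']" "\<chi>ss = \<chi>ss' @ [\<chi>s @ [\<chi>]]" "ks = ks' @ [k]"
    by (rule triple_point_last[OF t(1)])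
  obtain \<epsilon>s' \<epsilon>' \<omega>ss' \<omega>s \<omega> ls' l where f: "\<epsilon>s = \<epsilon>' # \<epsilon>s'" "\<omega>ss = (\<omega> # \<omega>s) # \<omega>ss'" "ls = l # ls'"
    by (rule triple_point_first[OF t(2)])
  note m = triple_point_mult[OF t[unfolded l f]]
  let ?\<eta>ss = "\<chi>ss' @ (\<chi>s @ conv Z \<chi> \<omega> # \<omega>s) # \<omega>ss'"
  let ?\<zeta> = "pt_right (conv X \<delta> \<epsilon>) (\<delta>s' @ conv Y \<delta>' \<epsilon>' # \<epsilon>s') ?\<eta>ss"
  let ?\<theta> = "pt_left (conv X \<delta> \<epsilon>) (\<delta>s' @ conv Y \<delta>' \<epsilon>' # \<epsilon>s') ?\<eta>ss"
  have "(?\<zeta>, ?\<theta>) \<in> triple_pairs" using m(1) by blast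
  moreover note m(2,3)
  ultimately show ?thesis
    unfolding \<xi> l f by (intro bexI[of _ "(?\<zeta>, ?\<theta>)"], unfold prod.case) blast+
qed

lemma assoc_left_morphism:
  "coalgebra_morphism (comp_coalg X (comp_coalg Y Z)) (comp_coalg (comp_coalg X Y) Z) (assoc_left X Y Z)"
proof (rule coalgebra_morphism_by_points[where T = triple_pairs])
  have "snd ` triple_pairs = {pt_left \<delta> \<delta>s \<chi>ss | \<delta> \<delta>s \<chi>ss ks. triple_point X Y Z \<delta> \<delta>s \<chi>ss ks}" by force
  then show "separates (scl (comp_coalg (comp_coalg X Y) Z)) (carr (comp_coalg (comp_coalg X Y) Z)) (snd ` triple_pairs)"
    using separates_left[OF X Y Z] by simp
  show "Vector_Spaces.linear (scl (comp_coalg X (comp_coalg Y Z))) (scl (comp_coalg (comp_coalg X Y) Z)) (assoc_left X Y Z)"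
    using linear_assoc_left[OF X Y Z] by simp
  show "\<eta> (assoc_left X Y Z e) = \<xi> e" if "(\<xi>, \<eta>) \<in> triple_pairs" "e \<in> carr (comp_coalg X (comp_coalg Y Z))" for \<xi> \<eta> e
    using that(1) pt_assoc_left[OF X Y Z _ that(2)] by blast
qed (rule graded_coalgebra_comp[OF X graded_coalgebra_comp[OF Y Z]] graded_coalgebra_comp[OF graded_coalgebra_comp[OF X Y] Z]
    assoc_left_in[OF X Y Z] triple_pairs_hfun triple_pairs_cou triple_pairs_mult; assumption)+

lemma assoc_right_morphism:
  "coalgebra_morphism (comp_coalg (comp_coalg X Y) Z) (comp_coalg X (comp_coalg Y Z)) (assoc_right X Y Z)"
proof (rule coalgebra_morphism_by_points[where T = "prod.swap ` triple_pairs"])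
  have "snd ` prod.swap ` triple_pairs = {pt_right \<delta> \<delta>s \<chi>ss | \<delta> \<delta>s \<chi>ss ks. triple_point X Y Z \<delta> \<delta>s \<chi>ss ks}" by force
  then show "separates (scl (comp_coalg X (comp_coalg Y Z))) (carr (comp_coalg X (comp_coalg Y Z))) (snd ` prod.swap ` triple_pairs)"
    using separates_right[OF X Y Z] by simp
  show "Vector_Spaces.linear (scl (comp_coalg (comp_coalg X Y) Z)) (scl (comp_coalg X (comp_coalg Y Z))) (assoc_right X Y Z)"
    using linear_assoc_right[OF X Y Z] by simp
  show "\<exists>(\<xi>, \<eta>)\<in>prod.swap ` triple_pairs. (\<forall>e\<in>carr (comp_coalg (comp_coalg X Y) Z). cou (comp_coalg (comp_coalg X Y) Z) e = \<xi> e) \<and>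
     (\<forall>e\<in>carr (comp_coalg X (comp_coalg Y Z)). cou (comp_coalg X (comp_coalg Y Z)) e = \<eta> e)"
    using triple_pairs_cou by fastforce
  fix \<xi> \<eta> assume p: "(\<xi>, \<eta>) \<in> prod.swap ` triple_pairs"
  then have p': "(\<eta>, \<xi>) \<in> triple_pairs" by auto
  show "\<exists>N. hfun (comp_coalg (comp_coalg X Y) Z) N \<xi> \<and> hfun (comp_coalg X (comp_coalg Y Z)) N \<eta>"
    using triple_pairs_hfun[OF p'] by blast
  show "\<eta> (assoc_right X Y Z e) = \<xi> e" if "e \<in> carr (comp_coalg (comp_coalg X Y) Z)" for e
    using p' pt_assoc_right[OF X Y Z _ that] by blast
  fix \<xi>' \<eta>' assume "(\<xi>', \<eta>') \<in> prod.swap ` triple_pairs"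
  then have "(\<eta>', \<xi>') \<in> triple_pairs" by auto
  from triple_pairs_mult[OF p' this]
  show "\<exists>(\<zeta>, \<theta>)\<in>prod.swap ` triple_pairs.
     (\<forall>e\<in>carr (comp_coalg (comp_coalg X Y) Z). conv (comp_coalg (comp_coalg X Y) Z) \<xi> \<xi>' e = \<zeta> e) \<and>
     (\<forall>e\<in>carr (comp_coalg X (comp_coalg Y Z)). conv (comp_coalg X (comp_coalg Y Z)) \<eta> \<eta>' e = \<theta> e)"
    by fastforce
qed (rule graded_coalgebra_comp[OF X graded_coalgebra_comp[OF Y Z]] graded_coalgebra_comp[OF graded_coalgebra_comp[OF X Y] Z]
    assoc_right_in[OF X Y Z]; assumption)+

text \<open>By \<open>cop_spread\<close> the convolution of points of \<open>Y \<circ> Z\<close> convolves the functionals on \<open>Y\<close> and on \<open>Z\<close>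
  separately.\<close>

lemma convs_spread:
  assumes y: "y \<in> carr Y" and z: "z \<in> carr Z" and "\<delta>s \<noteq> []"
    "list_all2 (\<lambda>\<phi> j. hfun Y j \<phi>) \<delta>s ks" "block_list ks \<chi>ss" "functionals Z (concat \<chi>ss)"
  shows "convs (comp_coalg Y Z) (map2 pt \<delta>s \<chi>ss) (spread Y Z z y) = convs Y \<delta>s y * convs Z (concat \<chi>ss) z"
  using assms(4,3,5,6,1,2)
proof (induction \<delta>s ks arbitrary: \<chi>ss y z rule: list_all2_induct)
  case (Cons \<delta> \<delta>s k ks)
  let ?E = "comp_coalg Y Z"
  note gE = graded_coalgebra_comp[OF Y Z]
  have bil: "bilinear_on Z Y ?E (spread Y Z)"
    using spread_bilinear[OF Y Z] spread_in[OF Y Z] unfolding graded_bilinear_def bilinear_on_def by blast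
  obtain \<chi>s \<chi>ss' where \<chi>: "\<chi>ss = \<chi>s # \<chi>ss'" "length \<chi>s = Suc k" "block_list ks \<chi>ss'"
    using Cons.prems(2) by (auto simp: list_all2_Cons2)
  have f: "functionals Z \<chi>s" "functionals Z (concat \<chi>ss')" using Cons.prems(3) \<chi>(1) by auto
  have pt1: "pt \<delta> \<chi>s (spread Y Z z y) = \<delta> y * convs Z \<chi>s z" if "y \<in> carr Y" "z \<in> carr Z" for y z
    by (rule pt_spread[OF Y Z that(2,1) Cons.hyps(1) \<chi>(2) f(1)])
  show ?case
  proof (cases "\<delta>s = []")
    case True
    then have "\<chi>ss' = []" using Cons.hyps(2) \<chi>(3) by auto
    then show ?thesis using pt1[OF Cons.prems(4,5)] True \<chi>(1) by simp
  next
    case False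
    have ne: "\<chi>s \<noteq> []" "concat \<chi>ss' \<noteq> []" "map2 pt \<delta>s \<chi>ss' \<noteq> []"
      using False Cons.hyps(2) \<chi>(2,3) by (cases \<delta>s; cases ks; cases \<chi>ss'; auto)+
    have fE: "functionals ?E (map2 pt \<delta>s \<chi>ss')" by (auto simp: set_zip)
    have "convs ?E (map2 pt (\<delta> # \<delta>s) \<chi>ss) (spread Y Z z y) =
        cop ?E (spread Y Z z y) (pt \<delta> \<chi>s, convs ?E (map2 pt \<delta>s \<chi>ss'))"
      using ne(3) by (simp add: \<chi>(1) convs_Cons conv_def)
    also have "\<dots> = cop Z z (convs Z \<chi>s, convs Z (concat \<chi>ss')) * cop Y y (\<delta>, convs Y \<delta>s)"
      unfolding cop_spread[OF Y Z Cons.prems(5,4)]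
    proof (rule tens_op_eval[OF graded_coalgebraD(2)[OF Z] graded_coalgebraD(2)[OF Y] graded_coalgebraD(2)[OF gE] bil
          cop_sq_carr[OF Z Cons.prems(5)] cop_sq_carr[OF Y Cons.prems(4)]])
      show "functional (scl Y) \<delta>" by (rule hfunD(1)[OF Cons.hyps(1)])
      show "functional (scl Y) (convs Y \<delta>s)" by (rule functional_convs[OF Y hfuns_functionals[OF Cons.hyps(2)]])
      show "functional (scl ?E) (convs ?E (map2 pt \<delta>s \<chi>ss'))" by (rule functional_convs[OF gE fE])
      show "convs ?E (map2 pt \<delta>s \<chi>ss') (spread Y Z u v) = convs Z (concat \<chi>ss') u * convs Y \<delta>s v"
        if "u \<in> carr Z" "v \<in> carr Y" for u v
        using Cons.IH[OF False \<chi>(3) f(2) that(2,1)] by simp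
    qed (use pt1 functional_convs[OF Z] f in auto)
    also have "\<dots> = convs Y (\<delta> # \<delta>s) y * convs Z (concat \<chi>ss) z"
      using convs_append[OF Z Cons.prems(5) f ne(1,2)] False by (simp add: \<chi>(1) convs_Cons conv_def)
    finally show ?thesis .
  qed
qed simp

text \<open>Both sides take the value \<open>\<delta>(x) (\<delta>\<^sub>0 * \<dots> * \<delta>\<^sub>n)(y) (\<chi>\<^sub>0\<^sub>,\<^sub>0 * \<dots>)(z)\<close> at a point.\<close>

lemma assoc_spread:
  assumes x: "x \<in> carr X" and y: "y \<in> carr Y" and z: "z \<in> carr Z"
  shows "assoc_left X Y Z (spread X (comp_coalg Y Z) (spread Y Z z y) x) = spread (comp_coalg X Y) Z z (spread X Y y x)"
    and "assoc_right X Y Z (spread (comp_coalg X Y) Z z (spread X Y y x)) = spread X (comp_coalg Y Z) (spread Y Z z y) x"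
proof -
  note gXY = graded_coalgebra_comp[OF X Y] and gYZ = graded_coalgebra_comp[OF Y Z]
  note in_R = spread_in[OF X gYZ spread_in[OF Y Z z y] x] and in_L = spread_in[OF gXY Z z spread_in[OF X Y y x]]
  have eq: "pt_right \<delta> \<delta>s \<chi>ss (spread X (comp_coalg Y Z) (spread Y Z z y) x) =
      pt_left \<delta> \<delta>s \<chi>ss (spread (comp_coalg X Y) Z z (spread X Y y x))"
    if t: "triple_point X Y Z \<delta> \<delta>s \<chi>ss ks" for \<delta> \<delta>s \<chi>ss ks
  proof -
    note t' = t[unfolded triple_point_def] and D = triple_pointD[OF t]
    define n where "n = length \<delta>s - 1"
    have n: "hfun X n \<delta>" "length \<delta>s = Suc n" using t' by (auto simp: n_def neq_Nil_conv)
    have F: "functionals (comp_coalg Y Z) (map2 pt \<delta>s \<chi>ss)" by (auto simp: set_zip)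
    have "pt_right \<delta> \<delta>s \<chi>ss (spread X (comp_coalg Y Z) (spread Y Z z y) x) =
        \<delta> x * convs (comp_coalg Y Z) (map2 pt \<delta>s \<chi>ss) (spread Y Z z y)"
      by (rule pt_spread[OF X gYZ spread_in[OF Y Z z y] x n(1) _ F]) (use D n(2) in simp)
    also have "\<dots> = \<delta> x * (convs Y \<delta>s y * convs Z (concat \<chi>ss) z)"
      using convs_spread[OF y z _ _ _ D(3)] t' by auto
    also have "\<dots> = pt \<delta> \<delta>s (spread X Y y x) * convs Z (concat \<chi>ss) z"
      using pt_spread[OF X Y y x n D(2)] by simp
    also have "\<dots> = pt_left \<delta> \<delta>s \<chi>ss (spread (comp_coalg X Y) Z z (spread X Y y x))"
    proof (rule pt_spread[OF gXY Z z spread_in[OF X Y y x] _ _ D(3), symmetric])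
      show "hfun (comp_coalg X Y) (n + sum_list ks) (pt \<delta> \<delta>s)"
        by (rule hfun_pt[OF n(1) _ n(2)]) (use t' in auto)
      show "length (concat \<chi>ss) = Suc (n + sum_list ks)"
        using block_list_length[where js = ks and xss = \<chi>ss] t' D(5) n(2) by auto
    qed
    finally show ?thesis .
  qed
  show "assoc_left X Y Z (spread X (comp_coalg Y Z) (spread Y Z z y) x) = spread (comp_coalg X Y) Z z (spread X Y y x)"
    by (rule separates_eqI[OF separates_left[OF X Y Z] subspace_carr_comp vector_space_fscale
          assoc_left_in[OF X Y Z in_R] in_L])
      (use eq pt_assoc_left[OF X Y Z _ in_R] in auto)
  show "assoc_right X Y Z (spread (comp_coalg X Y) Z z (spread X Y y x)) = spread X (comp_coalg Y Z) (spread Y Z z y) x"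
    by (rule separates_eqI[OF separates_right[OF X Y Z] subspace_carr_comp vector_space_fscale
          assoc_right_in[OF X Y Z in_L] in_R])
      (use eq pt_assoc_right[OF X Y Z _ in_L] in auto)
qed

end

text \<open>At a point both sides give \<open>\<delta>(g x) (\<phi>\<^sub>0 * \<dots> * \<phi>\<^sub>n)(f y)\<close>, since \<open>f\<close> respects convolution.\<close>

lemma comp_map_spread:
  assumes X: "graded_coalgebra X" and Y: "graded_coalgebra Y" and X': "graded_coalgebra X'" and Y': "graded_coalgebra Y'"
    and g: "coalgebra_morphism X X' g" and f: "coalgebra_morphism Y Y' f"
    and x: "x \<in> carr X" and y: "y \<in> carr Y"
  shows "comp_map X Y X' Y' g f (spread X Y y x) = spread X' Y' (f y) (g x)"
proof (rule spread_eqI[OF X' Y'])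
  note gl = coalgebra_morphismD(1)[OF g] and fl = coalgebra_morphismD(1)[OF f]
  note s = spread_in[OF X Y y x]
  show "comp_map X Y X' Y' g f (spread X Y y x) \<in> carr (comp_coalg X' Y')"
    by (rule morphism_carr[OF comp_map_morphism[OF X Y X' Y' g f] s])
  show "spread X' Y' (f y) (g x) \<in> carr (comp_coalg X' Y')"
    by (rule spread_in[OF X' Y' morphism_carr[OF f y] morphism_carr[OF g x]])
  fix \<delta> \<phi>s n assume h: "hfun X' n \<delta>" "length \<phi>s = Suc n" "functionals Y' \<phi>s"
  have hg: "hfun X n (\<delta> \<circ> g)"
    using h(1) functional_comp[OF gl] coalgebra_morphismD(2)[OF g] by (auto simp: hfun_def)
  have "pt \<delta> \<phi>s (comp_map X Y X' Y' g f (spread X Y y x)) = pt (\<delta> \<circ> g) (map (\<lambda>\<phi>. \<phi> \<circ> f) \<phi>s) (spread X Y y x)"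
    by (rule pt_comp_map[OF gl fl s hfunD(1)[OF h(1)] h(3)])
  also have "\<dots> = (\<delta> \<circ> g) x * convs Y (map (\<lambda>\<phi>. \<phi> \<circ> f) \<phi>s) y"
    by (rule pt_spread[OF X Y y x hg]) (use h functional_comp[OF fl] in auto)
  also have "\<dots> = \<delta> (g x) * convs Y' \<phi>s (f y)"
    unfolding morphism_convs[OF Y Y' f y h(3)] by simp
  also have "\<dots> = pt \<delta> \<phi>s (spread X' Y' (f y) (g x))"
    by (rule pt_spread[OF X' Y' morphism_carr[OF f y] morphism_carr[OF g x] h, symmetric])
  finally show "pt \<delta> \<phi>s (comp_map X Y X' Y' g f (spread X Y y x)) = pt \<delta> \<phi>s (spread X' Y' (f y) (g x))" .
qed

lemma graded_bilinear_on:
  assumes b: "graded_bilinear U V W m" and U: "vector_space (scl U)" and V: "vector_space (scl V)"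
    and W: "vector_space (scl W)"
  shows "bilinear_on U V W m"
proof -
  interpret W: vector_space "scl W" by (rule W)
  interpret U: vector_space "scl U" by (rule U)
  interpret V: vector_space "scl V" by (rule V)
  note sub = subspace_carr[OF W]
  have m0: "m 0 y = 0" "m x 0 = 0" if "x \<in> carr U" "y \<in> carr V" for x y
    using b that U.subspace_0[OF subspace_carr[OF U]] V.subspace_0[OF subspace_carr[OF V]]
    unfolding graded_bilinear_def by (metis W.scale_zero_left U.scale_zero_left V.scale_zero_left)+
  have "m x y \<in> carr W" if x: "x \<in> carr U" and y: "y \<in> carr V" for x y
    using U x
  proof (induction rule: carr_ind)
    case (gr n x)
    show ?case
      using V y
    proof (induction rule: carr_ind)
      case (gr k y)
      then show ?case using b \<open>x \<in> gr U n\<close> gr_carr[OF W] unfolding graded_bilinear_def by blast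
    qed (use b gr_carr[OF U gr] W.subspace_0[OF sub] W.subspace_add[OF sub] W.subspace_scale[OF sub] m0(2)[OF gr_carr[OF U gr] y] in
        \<open>auto simp: graded_bilinear_def\<close>)
  qed (use b y W.subspace_0[OF sub] W.subspace_add[OF sub] W.subspace_scale[OF sub] m0(1)[OF x y] in
        \<open>auto simp: graded_bilinear_def\<close>)
  then show ?thesis using b unfolding graded_bilinear_def bilinear_on_def by blast
qed

context
  fixes X :: "('k::field, 'x::ab_group_add) coalg" and Y :: "('k, 'y::ab_group_add) coalg"
    and Z :: "('k, 'z::ab_group_add) coalg" and \<rho>
  assumes X: "graded_coalgebra X" and Y: "graded_coalgebra Y" and Z: "graded_coalgebra Z"
    and \<rho>: "coalgebra_morphism (comp_coalg X Y) Z \<rho>"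
begin

lemma act_eq_spread: "x \<in> carr X \<Longrightarrow> act X Y Z \<rho> y x = \<rho> (spread X Y y x)"
  using act_spread[OF graded_coalgebraD(1)[OF X]] coalgebra_morphismD(1)[OF \<rho>] by simp

lemma act_carr: "y \<in> carr Y \<Longrightarrow> x \<in> carr X \<Longrightarrow> act X Y Z \<rho> y x \<in> carr Z"
  unfolding act_eq_spread by (rule morphism_carr[OF \<rho> spread_in[OF X Y]])

lemma act_bilinear: "graded_bilinear Y X Z (act X Y Z \<rho>)"
proof -
  note l = linear_D[OF coalgebra_morphismD(1)[OF \<rho>]]
  note vX = graded_coalgebraD(2)[OF X] and vY = graded_coalgebraD(2)[OF Y]
  interpret Xv: vector_space "scl X" by (rule vX)
  interpret Yv: vector_space "scl Y" by (rule vY)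
  note closed = Xv.subspace_add[OF subspace_carr[OF vX]] Xv.subspace_scale[OF subspace_carr[OF vX]]
    Yv.subspace_add[OF subspace_carr[OF vY]] Yv.subspace_scale[OF subspace_carr[OF vY]]
  show ?thesis
    using spread_bilinear[OF X Y] coalgebra_morphismD(2)[OF \<rho>] closed
    by (auto simp: graded_bilinear_def act_eq_spread l gr_carr[OF vX] gr_carr[OF vY] simp del: comp_coalg_simps(2))
      (simp_all add: l[unfolded comp_coalg_simps])
qed

lemma act_bilinear_on: "bilinear_on Y X Z (act X Y Z \<rho>)"
  by (rule graded_bilinear_on[OF act_bilinear]) (use graded_coalgebraD(2) X Y Z in auto)

text \<open>Apply the coalgebra map \<open>\<rho>\<close> to \<open>cop_spread\<close>.\<close>

lemma cop_act:
  assumes y: "y \<in> carr Y" and x: "x \<in> carr X"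
  shows "cop Z (act X Y Z \<rho> y x) = tens_op Y X Z (act X Y Z \<rho>) (cop Y y) (cop X x)"
proof -
  let ?E = "comp_coalg X Y"
  note gE = graded_coalgebra_comp[OF X Y] and l = coalgebra_morphismD(1)[OF \<rho>]
  note s = spread_in[OF X Y y x]
  have bil: "bilinear_on Y X ?E (spread X Y)"
    by (rule graded_bilinear_on[OF spread_bilinear[OF X Y]]) (use graded_coalgebraD(2) X Y vector_space_fscale in auto)
  have "cop Z (act X Y Z \<rho> y x) = tens_map (scl Z) (scl Z) \<rho> \<rho> (cop ?E (spread X Y y x))"
    using coalgebra_morphismD(4)[OF \<rho> s] tmap_eq[OF l l cop_sq_carr[OF gE s]] act_eq_spread[OF x] by simp
  also have "\<dots> = tens_op Y X Z (act X Y Z \<rho>) (cop Y y) (cop X x)"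
    unfolding cop_spread[OF X Y y x]
    by (rule tens_op_morphism[OF graded_coalgebraD(2)[OF Y] graded_coalgebraD(2)[OF X] bil act_bilinear_on l])
      (simp_all add: act_eq_spread cop_sq_carr[OF Y y] cop_sq_carr[OF X x])
  finally show ?thesis .
qed

lemma cou_act:
  assumes y: "y \<in> carr Y" and x: "x \<in> carr X"
  shows "cou Z (act X Y Z \<rho> y x) = cou Y y * cou X x"
proof -
  note s = spread_in[OF X Y y x]
  have "cou Z (act X Y Z \<rho> y x) = pt (cou X) [cou Y] (spread X Y y x)"
    unfolding act_eq_spread[OF x] coalgebra_morphismD(3)[OF \<rho> s] by (rule cou_comp[OF X Y s])
  also have "\<dots> = cou X x * convs Y [cou Y] y"
    by (rule pt_spread[OF X Y y x graded_coalgebraD(6)[OF X]]) (use graded_coalgebraD(4)[OF Y] in auto)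
  finally show ?thesis by simp
qed

end

section \<open>Modules over an operad\<close>

context
  fixes D :: "('k::field, 'd::ab_group_add) coalg" and \<gamma>
  assumes operad: "hopf_operad D \<gamma>"
begin

lemma connD: "connected_coalgebra D" and gD: "graded_coalgebra D"
  and morph: "coalgebra_morphism (comp_coalg D D) D \<gamma>"
  using operad unfolding hopf_operad_def connected_coalgebra_def by blast+

lemmas vD = graded_coalgebraD(2)[OF gD]

lemma linear_gamma: "Vector_Spaces.linear fscale (scl D) \<gamma>"
  using coalgebra_morphismD(1)[OF morph] by simp

lemma gamma_assoc:
  "d \<in> gr D n \<Longrightarrow> length ds = Suc n \<Longrightarrow> homs D ds js \<Longrightarrow> blocks D ess js \<Longrightarrow>
   \<gamma> (circ D D (\<gamma> (circ D D d ds)) (concat ess)) = \<gamma> (circ D D d (map2 (\<lambda>d\<^sub>i es\<^sub>i. \<gamma> (circ D D d\<^sub>i es\<^sub>i)) ds ess))"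
  and gamma_one_left: "d \<in> carr D \<Longrightarrow> \<gamma> (circ D D (one D) [d]) = d"
  and gamma_one_right: "d \<in> gr D n \<Longrightarrow> \<gamma> (circ D D d (replicate (Suc n) (one D))) = d"
  using operad unfolding hopf_operad_def by blast+

lemma gamma_gr:
  "d \<in> gr D n \<Longrightarrow> length ds = Suc n \<Longrightarrow> homs D ds js \<Longrightarrow> \<gamma> (circ D D d ds) \<in> gr D (n + sum_list js)"
  using coalgebra_morphismD(2)[OF morph circ_gr] by blast

lemma operad_mult_act: "operad_mult D \<gamma> = act D D D \<gamma>"
  by (rule ext) (simp add: operad_mult_def act_def)

text \<open>For the associativity of the action: by naturality, acting twice is \<open>\<mu> (id \<circ> \<mu>)\<close> applied to
  an iterated \<open>spread\<close>; by hypothesis this is \<open>\<mu> (\<gamma> \<circ> id)\<close> of the rebracketed element, which \<open>assoc_spread\<close> identifies, and naturality again turns it into one action.\<close>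

lemma right_module:
  assumes E: "graded_coalgebra E" and \<mu>: "coalgebra_morphism (comp_coalg D E) E \<mu>"
    and assoc: "\<And>z. z \<in> carr (comp_coalg D (comp_coalg D E)) \<Longrightarrow>
      \<mu> (comp_map D (comp_coalg D E) D E id \<mu> z) =
      \<mu> (comp_map (comp_coalg D D) E D E \<gamma> id (assoc_left D D E z))"
    and unit: "\<And>e. e \<in> carr E \<Longrightarrow> \<mu> (circ D E (one D) [e]) = e"
  shows "right_module_coalgebra D (operad_mult D \<gamma>) E (act D E E \<mu>)"
  unfolding right_module_coalgebra_def operad_mult_act
proof (intro conjI ballI)
  note gDE = graded_coalgebra_comp[OF gD E] and gDD = graded_coalgebra_comp[OF gD gD]
  note idD = id_morphism[OF gD] and idE = id_morphism[OF E]
  note act = act_eq_spread[OF gD E E \<mu>]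
  show "graded_bilinear E D E (act D E E \<mu>)" by (rule act_bilinear[OF gD E E \<mu>])
  fix e assume e: "e \<in> carr E"
  show "act D E E \<mu> e (one D) = e"
    using act_gr[OF graded_coalgebraD(1)[OF gD] coalgebra_morphismD(1)[OF \<mu>, unfolded comp_coalg_simps] one_gr[OF connD], where y = e and Y = E]
      unit[OF e] by (simp add: circ_def)
  fix a assume a: "a \<in> carr D"
  show "cop E (act D E E \<mu> e a) = tens_op E D E (act D E E \<mu>) (cop E e) (cop D a)"
    by (rule cop_act[OF gD E E \<mu> e a])
  fix b assume b: "b \<in> carr D"
  let ?s = "spread D E e a"
  note s = spread_in[OF gD E e a]
  have ab: "spread D D a b \<in> carr (comp_coalg D D)" by (rule spread_in[OF gD gD a b])
  have "act D E E \<mu> (act D E E \<mu> e a) b = \<mu> (spread D E (\<mu> ?s) b)"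
    by (simp add: act a b)
  also have "spread D E (\<mu> ?s) b = comp_map D (comp_coalg D E) D E id \<mu> (spread D (comp_coalg D E) ?s b)"
    using comp_map_spread[OF gD gDE gD E idD \<mu> b s] by simp
  also have "\<mu> \<dots> = \<mu> (comp_map (comp_coalg D D) E D E \<gamma> id (assoc_left D D E (spread D (comp_coalg D E) ?s b)))"
    by (rule assoc[OF spread_in[OF gD gDE s b]])
  also have "assoc_left D D E (spread D (comp_coalg D E) ?s b) = spread (comp_coalg D D) E e (spread D D a b)"
    by (rule assoc_spread(1)[OF gD gD E b a e])
  also have "comp_map (comp_coalg D D) E D E \<gamma> id (spread (comp_coalg D D) E e (spread D D a b)) =
      spread D E e (\<gamma> (spread D D a b))"
    using comp_map_spread[OF gDD E gD E morph idE ab e] by simp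
  also have "\<gamma> (spread D D a b) = act D D D \<gamma> a b"
    by (rule act_eq_spread[OF gD gD gD morph b, symmetric])
  also have "\<mu> (spread D E e (act D D D \<gamma> a b)) = act D E E \<mu> e (act D D D \<gamma> a b)"
    by (rule act[OF act_carr[OF gD gD gD morph a b], symmetric])
  finally show "act D E E \<mu> (act D E E \<mu> e a) b = act D E E \<mu> e (act D D D \<gamma> a b)" .
qed

text \<open>The mirror image; the unit law for \<open>1 \<star> e\<close> needs \<open>\<Delta>\<^sup>(\<^sup>n\<^sup>) 1 = 1 \<otimes> \<dots> \<otimes> 1\<close>.\<close>

lemma left_module:
  assumes E: "graded_coalgebra E" and \<rho>: "coalgebra_morphism (comp_coalg E D) E \<rho>"
    and assoc: "\<And>z. z \<in> carr (comp_coalg (comp_coalg E D) D) \<Longrightarrow>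
      \<rho> (comp_map (comp_coalg E D) D E D \<rho> id z) =
      \<rho> (comp_map E (comp_coalg D D) E D id \<gamma> (assoc_right E D D z))"
    and unit: "\<And>e n. e \<in> gr E n \<Longrightarrow> \<rho> (circ E D e (replicate (Suc n) (one D))) = e"
  shows "left_module_coalgebra D (operad_mult D \<gamma>) E (act E D E \<rho>)"
  unfolding left_module_coalgebra_def operad_mult_act
proof (intro conjI ballI)
  note gED = graded_coalgebra_comp[OF E gD] and gDD = graded_coalgebra_comp[OF gD gD]
  note idD = id_morphism[OF gD] and idE = id_morphism[OF E]
  note act = act_eq_spread[OF E gD E \<rho>]
  note lr = coalgebra_morphismD(1)[OF \<rho>, unfolded comp_coalg_simps]
  show "graded_bilinear D E E (act E D E \<rho>)" by (rule act_bilinear[OF E gD E \<rho>])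
  fix e assume e: "e \<in> carr E"
  show "act E D E \<rho> (one D) e = e"
    by (rule linear_eq_carr[OF linear_act[OF graded_coalgebraD(1)[OF E] lr] linear_ident[OF graded_coalgebraD(2)[OF E]] e])
      (simp only: act_gr[OF graded_coalgebraD(1)[OF E] lr] iter_cop_one[OF connD] unit[unfolded circ_def])
  fix a assume a: "a \<in> carr D"
  show "cop E (act E D E \<rho> a e) = tens_op D E E (act E D E \<rho>) (cop D a) (cop E e)"
    by (rule cop_act[OF E gD E \<rho> a e])
  fix b assume b: "b \<in> carr D"
  let ?s = "spread E D b e"
  note s = spread_in[OF E gD b e]
  have ab: "spread D D a b \<in> carr (comp_coalg D D)" by (rule spread_in[OF gD gD a b])
  have "act E D E \<rho> a (act E D E \<rho> b e) = \<rho> (spread E D a (\<rho> ?s))"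
    using act[OF act_carr[OF E gD E \<rho> b e]] act[OF e] by simp
  also have "spread E D a (\<rho> ?s) = comp_map (comp_coalg E D) D E D \<rho> id (spread (comp_coalg E D) D a ?s)"
    using comp_map_spread[OF gED gD E gD \<rho> idD s a] by simp
  also have "\<rho> \<dots> = \<rho> (comp_map E (comp_coalg D D) E D id \<gamma> (assoc_right E D D (spread (comp_coalg E D) D a ?s)))"
    by (rule assoc[OF spread_in[OF gED gD a s]])
  also have "assoc_right E D D (spread (comp_coalg E D) D a ?s) = spread E (comp_coalg D D) (spread D D a b) e"
    by (rule assoc_spread(2)[OF E gD gD e b a])
  also have "comp_map E (comp_coalg D D) E D id \<gamma> (spread E (comp_coalg D D) (spread D D a b) e) =
      spread E D (\<gamma> (spread D D a b)) e"
    using comp_map_spread[OF E gDD E gD idE morph e ab] by simp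
  also have "\<gamma> (spread D D a b) = act D D D \<gamma> a b"
    by (rule act_eq_spread[OF gD gD gD morph b, symmetric])
  also have "\<rho> (spread E D (act D D D \<gamma> a b) e) = act E D E \<rho> (act D D D \<gamma> a b) e"
    by (rule act[OF e, symmetric])
  finally show "act E D E \<rho> a (act E D E \<rho> b e) = act E D E \<rho> (act D D D \<gamma> a b) e" .
qed

text \<open>The product of \<open>D\<close> is the right action for \<open>\<mu> = \<gamma>\<close>.\<close>

lemma operad_right_module: "right_module_coalgebra D (operad_mult D \<gamma>) D (operad_mult D \<gamma>)"
proof -
  note gDD = graded_coalgebra_comp[OF gD gD]
  note lid = linear_id[OF vD] and lDD = linear_id[OF graded_coalgebraD(2)[OF gDD]]
  note lg = coalgebra_morphismD(1)[OF morph]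
  have "right_module_coalgebra D (operad_mult D \<gamma>) D (act D D D \<gamma>)"
  proof (rule right_module[OF gD morph _ gamma_one_left])
    fix z assume z: "z \<in> carr (comp_coalg D (comp_coalg D D))"
    let ?l = "\<gamma> \<circ> comp_map D (comp_coalg D D) D D id \<gamma>"
    let ?r = "\<gamma> \<circ> (comp_map (comp_coalg D D) D D D \<gamma> id \<circ> assoc_left D D D)"
    have "?l z = ?r z"
    proof (rule linear_eq_span[OF _ _ subsetD[OF carr_right_span[OF gD gD gD] z]])
      show "Vector_Spaces.linear fscale (scl D) ?l"
        by (rule linear_comp[OF linear_comp_map[OF lid lg] linear_gamma])
      show "Vector_Spaces.linear fscale (scl D) ?r"
        by (rule linear_comp[OF linear_comp[OF linear_assoc_left[OF gD gD gD] linear_comp_map[OF lg lid]] linear_gamma])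
      fix a assume "a \<in> fst ` assoc_gens D D D"
      then obtain d ds ess n js where a: "a = circ D (comp_coalg D D) d (map2 (circ D D) ds ess)"
        "d \<in> gr D n" "length ds = Suc n" "homs D ds js" "blocks D ess js"
        unfolding assoc_gens_def by auto
      have gen: "(a, circ (comp_coalg D D) D (circ D D d ds) (concat ess)) \<in> assoc_gens D D D"
        unfolding a(1) by (rule assoc_gensI[OF a(2-5)])
      have len: "length js = Suc n" "length ess = Suc n"
        using a(3) list_all2_lengthD[OF a(4)[unfolded homs_def]] list_all2_lengthD[OF a(5)[unfolded blocks_def]] by simp_all
      have "set (map2 (circ D D) ds ess) \<subseteq> carr (comp_coalg D D)"
        using a(3-5) len by (auto simp: set_zip homs_def blocks_def list_all2_conv_all_nth intro!: circ_carr[OF vD])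
      from comp_map_circ[OF lid lg a(2) this]
      have "?l a = \<gamma> (circ D D d (map2 (\<lambda>d es. \<gamma> (circ D D d es)) ds ess))"
        using a(1,3) len by (simp add: o_def case_prod_unfold)
      also have "\<dots> = \<gamma> (circ D D (\<gamma> (circ D D d ds)) (concat ess))"
        by (rule gamma_assoc[OF a(2-5), symmetric])
      also have "\<dots> = ?r a"
        using comp_map_circ[OF lg lid circ_gr[OF a(2,4,3)], of "concat ess"]
          a(5)[unfolded blocks_iff] block_list_length[where js = js and xss = ess] len
        by (simp add: assoc_left_gens[OF gD gD gD gen])
      finally show "?l a = ?r a" .
    qed
    then show "\<gamma> (comp_map D (comp_coalg D D) D D id \<gamma> z) =
      \<gamma> (comp_map (comp_coalg D D) D D D \<gamma> id (assoc_left D D D z))" by simp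
  qed
  then show ?thesis by (simp add: operad_mult_act)
qed

lemma operad_mult_one_left: "a \<in> carr D \<Longrightarrow> operad_mult D \<gamma> (one D) a = a"
  unfolding operad_mult_act
  by (rule linear_eq_carr[OF linear_act[OF graded_coalgebraD(1)[OF gD] linear_gamma] linear_ident[OF vD]])
    (simp_all only: act_gr[OF graded_coalgebraD(1)[OF gD] linear_gamma] iter_cop_one[OF connD] gamma_one_right[unfolded circ_def])

end

section \<open>The actions on compositions with an operad\<close>

lemma morphism_cong:
  assumes C: "graded_coalgebra C" and D: "graded_coalgebra D" and f: "coalgebra_morphism C D f"
    and f': "Vector_Spaces.linear (scl C) (scl D) f'" and eq: "\<And>c. c \<in> carr C \<Longrightarrow> f' c = f c"
  shows "coalgebra_morphism C D f'"
proof (rule coalgebra_morphismI[OF C D f'])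
  note vC = graded_coalgebraD(2)[OF C] and vD = graded_coalgebraD(2)[OF D]
  note lf = coalgebra_morphismD(1)[OF f]
  show "separates (scl D) (carr D) {\<phi>. functional (scl D) \<phi>}" by (rule separates_functionals[OF vD])
  show "f' c \<in> gr D n" if "c \<in> gr C n" for c n
    using eq[OF gr_carr[OF vC that]] coalgebra_morphismD(2)[OF f that] by simp
  show "cou D (f' c) = cou C c" if "c \<in> gr C n" for c n
    using eq[OF gr_carr[OF vC that]] coalgebra_morphismD(3)[OF f gr_carr[OF vC that]] by simp
  fix c \<phi> \<psi> assume c: "c \<in> carr C" and "\<phi> \<in> {\<phi>. functional (scl D) \<phi>}" "\<psi> \<in> {\<phi>. functional (scl D) \<phi>}"
  then have F: "functional (scl D) \<phi>" "functional (scl D) \<psi>" by auto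
  have "conv C (\<phi> \<circ> f') (\<psi> \<circ> f') c = conv C (\<phi> \<circ> f) (\<psi> \<circ> f) c"
    by (rule conv_cong[OF C c functional_comp[OF f' F(1)] functional_comp[OF f' F(2)]
          functional_comp[OF lf F(1)] functional_comp[OF lf F(2)]]) (simp_all add: eq)
  then show "conv C (\<phi> \<circ> f') (\<psi> \<circ> f') c = conv D \<phi> \<psi> (f' c)"
    using morphism_conv[OF C f c F] eq[OF c] by simp
qed

lemma carr_comp_span_eq:
  assumes C: "vector_space (scl C)" and B: "carr C = module.span (scl C) B"
  shows "carr (comp_coalg D C) =
    module.span fscale {circ D C d cs | d cs n. d \<in> gr D n \<and> set cs \<subseteq> B \<and> length cs = Suc n}" (is "_ = ?S")
proof
  show "carr (comp_coalg D C) \<subseteq> ?S" by (rule carr_comp_span[OF C B])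
  have "B \<subseteq> carr C" unfolding B by (rule subsetI) (rule span_baseI[OF C])
  then show "?S \<subseteq> carr (comp_coalg D C)"
    by (intro span_subset_subspace[OF vector_space_fscale subspace_carr_comp])
      (use circ_carr[OF C] in blast)
qed

lemma concat_map2_circ:
  "list_all2 (\<lambda>xs ys. length xs = length ys) xss yss \<Longrightarrow>
   concat (map2 (map2 f) xss yss) = map2 f (concat xss) (concat yss)"
  by (induction rule: list_all2_induct) auto

lemma homs_concat: "(\<And>x. x \<in> set xs \<Longrightarrow> homs C (f x) (g x)) \<Longrightarrow> homs C (concat (map f xs)) (concat (map g xs))"
  by (induction xs) (auto intro: homs_append simp: homs_def[of C "[]"])

lemma blocks_concat: "(\<And>x. x \<in> set xs \<Longrightarrow> blocks C (f x) (g x)) \<Longrightarrow> blocks C (concat (map f xs)) (concat (map g xs))"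
  unfolding blocks_def by (induction xs) (auto intro: list_all2_appendI)

lemma homs_length: "homs C cs js \<Longrightarrow> length js = length cs"
  by (simp add: homs_def list_all2_lengthD)

lemma blocks_length: "blocks C css js \<Longrightarrow> length css = length js"
  by (simp add: blocks_def list_all2_lengthD)

context
  fixes D :: "('k::field, 'd::ab_group_add) coalg" and \<gamma> and C :: "('k, 'c::ab_group_add) coalg"
  assumes operad: "hopf_operad D \<gamma>" and C: "graded_coalgebra C"
begin

lemmas op = connD[OF operad] gD[OF operad] morph[OF operad] vD[OF operad] linear_gamma[OF operad]
lemmas vC = graded_coalgebraD(2)[OF C]
lemmas gDC = graded_coalgebra_comp[OF op(2) C] and gCD = graded_coalgebra_comp[OF C op(2)]
  and gDD = graded_coalgebra_comp[OF op(2,2)]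
lemmas gamma_lin = coalgebra_morphismD(1)[OF op(3)]

text \<open>\<open>\<mu>\<^sub>l\<close> is the rebracketing followed by \<open>\<gamma> \<circ> id\<close>: both have the same values on the generators
  \<open>d \<circ> ((d\<^sub>0 \<circ> \<dots>) \<cdot> \<dots> \<cdot> (d\<^sub>n \<circ> \<dots>))\<close>.\<close>

lemma
  shows linear_mu_l: "Vector_Spaces.linear fscale fscale (mu_l D \<gamma> C)"
    and mu_l_gens: "d \<in> gr D n \<Longrightarrow> length ds = Suc n \<Longrightarrow> homs D ds js \<Longrightarrow> blocks C css js \<Longrightarrow>
      mu_l D \<gamma> C (circ D (comp_coalg D C) d (map2 (circ D C) ds css)) =
      circ D C (\<gamma> (circ D D d ds)) (concat css)"
    and mu_l_eq: "z \<in> carr (comp_coalg D (comp_coalg D C)) \<Longrightarrow>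
      mu_l D \<gamma> C z = comp_map (comp_coalg D D) C D C \<gamma> id (assoc_left D D C z)"
proof -
  let ?F = "comp_map (comp_coalg D D) C D C \<gamma> id \<circ> assoc_left D D C"
  note idC = linear_id[OF vC]
  have F: "Vector_Spaces.linear fscale fscale ?F"
    by (rule linear_comp[OF linear_assoc_left[OF op(2,2) C] linear_comp_map[OF gamma_lin idC]])
  have gen: "?F (circ D (comp_coalg D C) d (map2 (circ D C) ds css)) = circ D C (\<gamma> (circ D D d ds)) (concat css)"
    if h: "d \<in> gr D n" "length ds = Suc n" "homs D ds js" "blocks C css js" for d n ds css js
  proof -
    note b = h(4)[unfolded blocks_iff]
    show ?thesis
      using comp_map_circ[OF gamma_lin idC circ_gr[OF h(1,3,2)], of "concat css"]
        assoc_left_gens[OF op(2,2) C assoc_gensI[OF h]] b block_list_length[OF b[THEN conjunct1]]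
        homs_length[OF h(3)] h(2) by simp
  qed
  show "Vector_Spaces.linear fscale fscale (mu_l D \<gamma> C)"
    unfolding mu_l_def by (rule lin_ext_exists(1)[OF F]) (use gen in auto)
  show "mu_l D \<gamma> C (circ D (comp_coalg D C) d (map2 (circ D C) ds css)) = circ D C (\<gamma> (circ D D d ds)) (concat css)"
    if h: "d \<in> gr D n" "length ds = Suc n" "homs D ds js" "blocks C css js"
    unfolding mu_l_def by (rule lin_ext_exists(2)[OF F]) (use gen h in blast)+
  have "mu_l D \<gamma> C z = ?F z" if "z \<in> carr (comp_coalg D (comp_coalg D C))"
    unfolding mu_l_def
  proof (rule lin_ext_eq_span[OF F _ subsetD[OF carr_right_span[OF op(2,2) C] that]])
    fix a assume "a \<in> fst ` assoc_gens D D C"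
    then show "\<exists>y. (a, y) \<in> {(circ D (comp_coalg D C) d (map2 (circ D C) ds css),
       circ D C (\<gamma> (circ D D d ds)) (concat css)) | d ds css n js.
        d \<in> gr D n \<and> length ds = Suc n \<and> homs D ds js \<and> blocks C css js}"
      unfolding assoc_gens_def by fastforce
  qed (use gen in auto)
  then show "z \<in> carr (comp_coalg D (comp_coalg D C)) \<Longrightarrow>
      mu_l D \<gamma> C z = comp_map (comp_coalg D D) C D C \<gamma> id (assoc_left D D C z)" by simp
qed

lemma mu_l_morphism: "coalgebra_morphism (comp_coalg D (comp_coalg D C)) (comp_coalg D C) (mu_l D \<gamma> C)"
proof (rule morphism_cong)
  note gR = graded_coalgebra_comp[OF op(2) gDC] and gL = graded_coalgebra_comp[OF gDD C]
  show "coalgebra_morphism (comp_coalg D (comp_coalg D C)) (comp_coalg D C)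
      (comp_map (comp_coalg D D) C D C \<gamma> id \<circ> assoc_left D D C)"
    by (rule morphism_comp[OF gR gL gDC assoc_left_morphism[OF op(2,2) C]
          comp_map_morphism[OF gDD C op(2) C op(3) id_morphism[OF C]]])
  show "graded_coalgebra (comp_coalg D (comp_coalg D C))" "graded_coalgebra (comp_coalg D C)" by (fact gR gDC)+
qed (simp_all add: linear_mu_l mu_l_eq)

lemma mu_l_one:
  assumes "e \<in> carr (comp_coalg D C)"
  shows "mu_l D \<gamma> C (circ D (comp_coalg D C) (one D) [e]) = e"
proof -
  have lin: "Vector_Spaces.linear fscale fscale (\<lambda>e. circ D (comp_coalg D C) (one D) [e])"
    using linear_circ_right[of "comp_coalg D C", where us = "[]" and ws = "[]"] by (simp add: vector_space_fscale)
  have "(mu_l D \<gamma> C \<circ> (\<lambda>e. circ D (comp_coalg D C) (one D) [e])) e = e"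
  proof (rule linear_eq_span[OF linear_comp[OF lin linear_mu_l] linear_ident[OF vector_space_fscale] assms[unfolded carr_comp[OF vC]]])
    fix a assume "a \<in> {circ D C d cs | d cs n. d \<in> gr D n \<and> set cs \<subseteq> carr C \<and> length cs = Suc n}"
    then obtain d cs n where a: "a = circ D C d cs" "d \<in> gr D n" "set cs \<subseteq> carr C" "length cs = Suc n" by blast
    have "mu_l D \<gamma> C (circ D (comp_coalg D C) (one D) (map2 (circ D C) [d] [cs])) =
        circ D C (\<gamma> (circ D D (one D) [d])) (concat [cs])"
      by (rule mu_l_gens[OF one_gr[OF op(1)], where js = "[n]"]) (use a in \<open>auto simp: homs_def blocks_def\<close>)
    then show "(mu_l D \<gamma> C \<circ> (\<lambda>e. circ D (comp_coalg D C) (one D) [e])) a = a"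
      using gamma_one_left[OF operad gr_carr[OF op(4) a(2)]] a(1) by simp
  qed
  then show ?thesis by simp
qed

text \<open>On generators of the fourfold composition the outer letters are governed by associativity of \<open>\<gamma>\<close>,
  while the letters from \<open>C\<close> are only concatenated.\<close>

lemma mu_l_assoc:
  assumes "z \<in> carr (comp_coalg D (comp_coalg D (comp_coalg D C)))"
  shows "mu_l D \<gamma> C (comp_map D (comp_coalg D (comp_coalg D C)) D (comp_coalg D C) id (mu_l D \<gamma> C) z) =
    mu_l D \<gamma> C (comp_map (comp_coalg D D) (comp_coalg D C) D (comp_coalg D C) \<gamma> id (assoc_left D D (comp_coalg D C) z))"
proof -
  let ?E = "comp_coalg D C" and ?m = "mu_l D \<gamma> C"
  let ?B = "{circ D C d cs | d cs n. d \<in> gr D n \<and> set cs \<subseteq> carr C \<and> length cs = Suc n}"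
  let ?B2 = "{circ D ?E d es | d es n. d \<in> gr D n \<and> set es \<subseteq> ?B \<and> length es = Suc n}"
  note vE = graded_coalgebraD(2)[OF gDC]
  have lm: "Vector_Spaces.linear (scl (comp_coalg D ?E)) (scl ?E) ?m" using linear_mu_l by simp
  note lid = linear_id[OF op(4)] and lidE = linear_id[OF vE]
  have c1: "carr ?E = module.span (scl ?E) ?B" using carr_comp[OF vC] by simp
  have c2: "carr (comp_coalg D ?E) = module.span (scl (comp_coalg D ?E)) ?B2"
    using carr_comp_span_eq[OF vE c1] by simp
  have v2: "vector_space (scl (comp_coalg D ?E))" by (simp add: vector_space_fscale)
  let ?l = "?m \<circ> comp_map D (comp_coalg D ?E) D ?E id ?m"
  let ?r = "?m \<circ> (comp_map (comp_coalg D D) ?E D ?E \<gamma> id \<circ> assoc_left D D ?E)"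
  have "?l z = ?r z"
  proof (rule linear_eq_span[OF _ _ assms[unfolded carr_comp_span_eq[OF v2 c2]]])
    show "Vector_Spaces.linear fscale fscale ?l"
      by (rule linear_comp[OF linear_comp_map[OF lid lm] linear_mu_l])
    show "Vector_Spaces.linear fscale fscale ?r"
      by (rule linear_comp[OF linear_comp[OF linear_assoc_left[OF op(2,2) gDC] linear_comp_map[OF gamma_lin lidE]] linear_mu_l])
    fix a assume "a \<in> {circ D (comp_coalg D ?E) d xs | d xs n. d \<in> gr D n \<and> set xs \<subseteq> ?B2 \<and> length xs = Suc n}"
    then obtain d xs n where a: "a = circ D (comp_coalg D ?E) d xs" "d \<in> gr D n" "set xs \<subseteq> ?B2" "length xs = Suc n"
      by blast
    obtain ds ess js where x: "xs = map2 (circ D ?E) ds ess" "length ds = length xs" "homs D ds js" "block_list js ess"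
      "set (concat ess) \<subseteq> ?B"
      using map2_circ_exists[OF a(3)] by blast
    have len: "length ds = Suc n" "length js = Suc n" "length ess = Suc n"
      using x(2) a(4) homs_length[OF x(3)] list_all2_lengthD[OF x(4)] by simp_all
    have "\<exists>ys zss ks. es = map2 (circ D C) ys zss \<and> length ys = length es \<and> homs D ys ks \<and>
        block_list ks zss \<and> set (concat zss) \<subseteq> carr C" if "es \<in> set ess" for es
      by (rule map2_circ_exists) (use x(5) that in auto)
    then have "\<forall>es\<in>set ess. \<exists>ys zss ks. es = map2 (circ D C) ys zss \<and> length ys = length es \<and> homs D ys ks \<and>
        blocks C zss ks" unfolding blocks_iff by blast
    then obtain f g h where fgh: "\<And>es. es \<in> set ess \<Longrightarrow> es = map2 (circ D C) (f es) (g es)"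
      "\<And>es. es \<in> set ess \<Longrightarrow> length (f es) = length es" "\<And>es. es \<in> set ess \<Longrightarrow> homs D (f es) (h es)"
      "\<And>es. es \<in> set ess \<Longrightarrow> blocks C (g es) (h es)" by metis
    have fg_len: "length (f es) = length (g es)" if "es \<in> set ess" for es
      using homs_length[OF fgh(3)[OF that]] blocks_length[OF fgh(4)[OF that]] by simp
    have essE: "set es \<subseteq> carr ?E" if "es \<in> set ess" for es
    proof -
      have "set es \<subseteq> ?B" using x(5) that by auto
      then show ?thesis unfolding c1 using span_baseI[OF vE] by blast
    qed
    have blE: "blocks ?E ess js" unfolding blocks_iff using x(4) essE by auto
    have blD: "blocks D (map f ess) js"
      unfolding blocks_iff
    proof
      show "block_list js (map f ess)"
        using x(4) fgh(2) by (auto simp: list_all2_conv_all_nth)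
      show "set (concat (map f ess)) \<subseteq> carr D" using homs_carr[OF op(4) fgh(3)] by auto
    qed
    \<comment> \<open>Each inner word of \<open>ess\<close> consists of pure compositions, with outer letters \<open>f es\<close>, words \<open>g es\<close> and
      degrees \<open>h es\<close>.\<close>
    let ?ds' = "map2 (\<lambda>d es. \<gamma> (circ D D d (f es))) ds ess"
    have nth: "ds ! i \<in> gr D (js ! i)" "length (ess ! i) = Suc (js ! i)" "ess ! i \<in> set ess" if "i < Suc n" for i
      using x(3,4) that len by (auto simp: homs_def list_all2_conv_all_nth)
    have ds': "homs D ?ds' (map2 (\<lambda>j es. j + sum_list (h es)) js ess)"
      unfolding homs_def list_all2_conv_all_nth
      using len nth fgh(2,3) by (auto intro!: gamma_gr[OF operad])
    have css': "blocks C (map (\<lambda>es. concat (g es)) ess) (map2 (\<lambda>j es. j + sum_list (h es)) js ess)"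
      unfolding blocks_def list_all2_conv_all_nth
    proof (intro conjI allI impI)
      fix i assume "i < length (map (\<lambda>es. concat (g es)) ess)"
      then have i: "i < Suc n" using len by simp
      note b = fgh(4)[OF nth(3)[OF i], unfolded blocks_iff]
      show "length (map (\<lambda>es. concat (g es)) ess ! i) = Suc (map2 (\<lambda>j es. j + sum_list (h es)) js ess ! i)"
        using block_list_length[OF b[THEN conjunct1]] homs_length[OF fgh(3)[OF nth(3)[OF i]]] fgh(2)[OF nth(3)[OF i]]
          nth(2)[OF i] i len by simp
      show "set (map (\<lambda>es. concat (g es)) ess ! i) \<subseteq> carr C"
        using b i len by simp
    qed (use len in simp)
    have m_i: "?m (circ D ?E (ds ! i) (ess ! i)) = circ D C (\<gamma> (circ D D (ds ! i) (f (ess ! i)))) (concat (g (ess ! i)))"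
      if i: "i < Suc n" for i
      using mu_l_gens[OF nth(1)[OF i] _ fgh(3,4)[OF nth(3)[OF i]]] fgh(1,2)[OF nth(3)[OF i]] nth(2)[OF i] by simp
    have xsE: "set xs \<subseteq> carr (comp_coalg D ?E)"
      using a(3) unfolding c2 using span_baseI[OF v2] by blast
    have "?l a = ?m (circ D ?E d (map ?m xs))"
      using comp_map_circ[OF lid lm a(2) xsE a(4)] a(1) by simp
    also have "map ?m xs = map2 (circ D C) ?ds' (map (\<lambda>es. concat (g es)) ess)"
      by (rule nth_equalityI) (use x(1) len m_i in auto)
    also have "?m (circ D ?E d \<dots>) = circ D C (\<gamma> (circ D D d ?ds')) (concat (map (\<lambda>es. concat (g es)) ess))"
      by (rule mu_l_gens[OF a(2) _ ds' css']) (use len in simp)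
    also have "?ds' = map2 (\<lambda>d es. \<gamma> (circ D D d es)) ds (map f ess)"
      by (rule nth_equalityI) (use len in auto)
    also have "\<gamma> (circ D D d \<dots>) = \<gamma> (circ D D (\<gamma> (circ D D d ds)) (concat (map f ess)))"
      by (rule gamma_assoc[OF operad a(2) len(1) x(3) blD, symmetric])
    also have "concat (map (\<lambda>es. concat (g es)) ess) = concat (concat (map g ess))"
      by (induction ess) auto
    also have "circ D C (\<gamma> (circ D D (\<gamma> (circ D D d ds)) (concat (map f ess)))) (concat (concat (map g ess))) =
        ?m (circ D ?E (\<gamma> (circ D D d ds)) (map2 (circ D C) (concat (map f ess)) (concat (map g ess))))"
    proof (rule mu_l_gens[symmetric])
      show "\<gamma> (circ D D d ds) \<in> gr D (n + sum_list js)" by (rule gamma_gr[OF operad a(2) len(1) x(3)])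
      show "length (concat (map f ess)) = Suc (n + sum_list js)"
        using block_list_length[OF blD[unfolded blocks_iff, THEN conjunct1]] len by simp
      show "homs D (concat (map f ess)) (concat (map h ess))" by (rule homs_concat[OF fgh(3)])
      show "blocks C (concat (map g ess)) (concat (map h ess))" by (rule blocks_concat[OF fgh(4)])
    qed
    also have "map2 (circ D C) (concat (map f ess)) (concat (map g ess)) = concat ess"
    proof -
      have "list_all2 (\<lambda>xs ys. length xs = length ys) (map f ess) (map g ess)"
        using fg_len by (simp add: list_all2_conv_all_nth)
      from concat_map2_circ[OF this, of "circ D C"]
      have "map2 (circ D C) (concat (map f ess)) (concat (map g ess)) = concat (map2 (map2 (circ D C)) (map f ess) (map g ess))"
        by simp
      also have "map2 (map2 (circ D C)) (map f ess) (map g ess) = ess"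
        by (rule nth_equalityI) (use fgh(1)[OF nth_mem, symmetric] in auto)
      finally show ?thesis .
    qed
    also have "?m (circ D ?E (\<gamma> (circ D D d ds)) (concat ess)) = ?r a"
      using comp_map_circ[OF gamma_lin lidE circ_gr[OF a(2) x(3) len(1)], of "concat ess"]
        assoc_left_gens[OF op(2,2) gDC assoc_gensI[OF a(2) len(1) x(3) blE]] blE[unfolded blocks_iff]
        block_list_length[OF x(4)] len by (simp add: a(1) x(1))
    finally show "?l a = ?r a" .
  qed
  then show ?thesis by simp
qed

lemma right_act_module: "right_module_coalgebra D (operad_mult D \<gamma>) (comp_coalg D C) (right_act D \<gamma> C)"
proof -
  have "right_act D \<gamma> C = act D (comp_coalg D C) (comp_coalg D C) (mu_l D \<gamma> C)"
    by (rule ext) (simp add: right_act_def act_def)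
  then show ?thesis
    using right_module[OF operad gDC mu_l_morphism mu_l_assoc mu_l_one] by simp
qed

text \<open>\<open>\<mu>\<^sub>r\<close> is the inverse rebracketing followed by \<open>id \<circ> \<gamma>\<close>.\<close>

lemma
  shows linear_mu_r: "Vector_Spaces.linear fscale fscale (mu_r D \<gamma> C)"
    and mu_r_gens: "c \<in> gr C m \<Longrightarrow> length ds = Suc m \<Longrightarrow> homs D ds js \<Longrightarrow> blocks D dss js \<Longrightarrow>
      mu_r D \<gamma> C (circ (comp_coalg C D) D (circ C D c ds) (concat dss)) =
      circ C D c (map2 (\<lambda>d\<^sub>i ds\<^sub>i. \<gamma> (circ D D d\<^sub>i ds\<^sub>i)) ds dss)"
    and mu_r_eq: "z \<in> carr (comp_coalg (comp_coalg C D) D) \<Longrightarrow>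
      mu_r D \<gamma> C z = comp_map C (comp_coalg D D) C D id \<gamma> (assoc_right C D D z)"
proof -
  let ?F = "comp_map C (comp_coalg D D) C D id \<gamma> \<circ> assoc_right C D D"
  have mu: "mu_r D \<gamma> C = lin_ext fscale fscale
     {(circ (comp_coalg C D) D (circ C D c ds) (concat dss),
       circ C D c (map2 (\<lambda>d\<^sub>i ds\<^sub>i. \<gamma> (circ D D d\<^sub>i ds\<^sub>i)) ds dss)) | c ds dss m js.
        c \<in> gr C m \<and> length ds = Suc m \<and> homs D ds js \<and> blocks D dss js}" (is "_ = lin_ext _ _ ?G")
    unfolding mu_r_def by (simp add: circ_def[of "comp_coalg C D"])
  note idC = linear_id[OF vC]
  have F: "Vector_Spaces.linear fscale fscale ?F"
    by (rule linear_comp[OF linear_assoc_right[OF C op(2,2)] linear_comp_map[OF idC gamma_lin]])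
  have gen: "?F (circ (comp_coalg C D) D (circ C D c ds) (concat dss)) =
      circ C D c (map2 (\<lambda>d\<^sub>i ds\<^sub>i. \<gamma> (circ D D d\<^sub>i ds\<^sub>i)) ds dss)"
    if h: "c \<in> gr C m" "length ds = Suc m" "homs D ds js" "blocks D dss js" for c m ds dss js
  proof -
    have len: "length dss = Suc m" using homs_length[OF h(3)] blocks_length[OF h(4)] h(2) by simp
    have "set (map2 (circ D D) ds dss) \<subseteq> carr (comp_coalg D D)"
      using h(2-4) len by (auto simp: set_zip homs_def blocks_def list_all2_conv_all_nth intro!: circ_carr[OF op(4)])
    then show ?thesis
      using comp_map_circ[OF idC gamma_lin h(1), of "map2 (circ D D) ds dss"]
        assoc_right_gens[OF C op(2,2) assoc_gensI[OF h]] h(2) len by (simp add: o_def case_prod_unfold)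
  qed
  show "Vector_Spaces.linear fscale fscale (mu_r D \<gamma> C)"
    unfolding mu by (rule lin_ext_exists(1)[OF F]) (use gen in auto)
  show "mu_r D \<gamma> C (circ (comp_coalg C D) D (circ C D c ds) (concat dss)) =
      circ C D c (map2 (\<lambda>d\<^sub>i ds\<^sub>i. \<gamma> (circ D D d\<^sub>i ds\<^sub>i)) ds dss)"
    if h: "c \<in> gr C m" "length ds = Suc m" "homs D ds js" "blocks D dss js"
    unfolding mu by (rule lin_ext_exists(2)[OF F]) (use gen h in blast)+
  have "mu_r D \<gamma> C z = ?F z" if "z \<in> carr (comp_coalg (comp_coalg C D) D)"
    unfolding mu
  proof (rule lin_ext_eq_span[OF F _ subsetD[OF carr_left_span[OF C op(2,2)] that]])
    fix a assume "a \<in> snd ` assoc_gens C D D"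
    then show "\<exists>y. (a, y) \<in> ?G"
      unfolding assoc_gens_def by fastforce
  qed (use gen in auto)
  then show "z \<in> carr (comp_coalg (comp_coalg C D) D) \<Longrightarrow>
      mu_r D \<gamma> C z = comp_map C (comp_coalg D D) C D id \<gamma> (assoc_right C D D z)" by simp
qed

lemma mu_r_morphism: "coalgebra_morphism (comp_coalg (comp_coalg C D) D) (comp_coalg C D) (mu_r D \<gamma> C)"
proof (rule morphism_cong)
  note gL = graded_coalgebra_comp[OF gCD op(2)] and gR = graded_coalgebra_comp[OF C gDD]
  show "coalgebra_morphism (comp_coalg (comp_coalg C D) D) (comp_coalg C D)
      (comp_map C (comp_coalg D D) C D id \<gamma> \<circ> assoc_right C D D)"
    by (rule morphism_comp[OF gL gR gCD assoc_right_morphism[OF C op(2,2)]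
          comp_map_morphism[OF C gDD C op(2) id_morphism[OF C] op(3)]])
  show "graded_coalgebra (comp_coalg (comp_coalg C D) D)" "graded_coalgebra (comp_coalg C D)" by (fact gL gCD)+
qed (simp_all add: linear_mu_r mu_r_eq)

lemma mu_r_one:
  assumes "e \<in> gr (comp_coalg C D) n"
  shows "mu_r D \<gamma> C (circ (comp_coalg C D) D e (replicate (Suc n) (one D))) = e"
proof -
  let ?c = "\<lambda>e. circ (comp_coalg C D) D e (replicate (Suc n) (one D))"
  have lin: "Vector_Spaces.linear fscale fscale ?c"
    using linear_circ_left[of "comp_coalg C D"] by (simp add: vector_space_fscale)
  have "(mu_r D \<gamma> C \<circ> ?c) e = e"
  proof (rule linear_eq_span[OF linear_comp[OF lin linear_mu_r] linear_ident[OF vector_space_fscale] assms[unfolded comp_coalg_simps]])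
    fix a assume "a \<in> {circ C D c ds | c ds m js. c \<in> gr C m \<and> homs D ds js \<and> length ds = Suc m \<and> m + sum_list js = n}"
    then obtain c ds m js where a: "a = circ C D c ds" "c \<in> gr C m" "homs D ds js" "length ds = Suc m" "m + sum_list js = n"
      by blast
    let ?os = "map (\<lambda>j. replicate (Suc j) (one D)) js"
    have one: "one D \<in> carr D" by (rule gr_carr[OF op(4) one_gr[OF op(1)]])
    have len: "length js = Suc m" using homs_length[OF a(3)] a(4) by simp
    have bl: "blocks D ?os js"
      unfolding blocks_def using one by (auto simp: list_all2_conv_all_nth simp del: replicate_Suc)
    have "length (concat ?os) = Suc n"
      using block_list_length[OF bl[unfolded blocks_iff, THEN conjunct1]] len a(5) by simp
    moreover have "set (concat ?os) \<subseteq> {one D}" by auto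
    ultimately have os: "concat ?os = replicate (Suc n) (one D)"
      by (intro replicate_eqI) (auto simp del: replicate_Suc)
    have "map2 (\<lambda>d\<^sub>i ds\<^sub>i. \<gamma> (circ D D d\<^sub>i ds\<^sub>i)) ds ?os = ds"
      by (rule nth_equalityI)
        (use a(3,4) len gamma_one_right[OF operad] in \<open>auto simp: homs_def list_all2_conv_all_nth simp del: replicate_Suc\<close>)
    then show "(mu_r D \<gamma> C \<circ> ?c) a = a"
      using mu_r_gens[OF a(2,4,3) bl] unfolding os by (simp add: a(1))
  qed
  then show ?thesis by simp
qed

end

lemma map2_map: "map2 f (map g xs) (map h xs) = map (\<lambda>x. f (g x) (h x)) xs"
  by (induction xs) auto

context
  fixes D :: "('k::field, 'd::ab_group_add) coalg" and \<gamma> and C :: "('k, 'c::ab_group_add) coalg"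
  assumes operad: "hopf_operad D \<gamma>" and C: "graded_coalgebra C"
begin

lemmas op' = connD[OF operad] gD[OF operad] morph[OF operad] vD[OF operad] linear_gamma[OF operad]

text \<open>A generator is \<open>(e \<circ> (y\<^sub>0 \<cdot> \<dots> \<cdot> y\<^sub>n)) \<circ> zs\<close> with \<open>e = c \<circ> (d\<^sub>0 \<cdot> \<dots> \<cdot> d\<^sub>m)\<close>.  Cutting the word of the
  \<open>y\<^sub>k\<close>, together with their blocks of \<open>zs\<close>, according to the degrees of the \<open>d\<^sub>i\<close> reduces the claim to
  associativity of \<open>\<gamma>\<close> for each \<open>d\<^sub>i\<close> separately.\<close>

lemma mu_r_assoc:
  assumes z: "z \<in> carr (comp_coalg (comp_coalg (comp_coalg C D) D) D)"
  shows "mu_r D \<gamma> C (comp_map (comp_coalg (comp_coalg C D) D) D (comp_coalg C D) D (mu_r D \<gamma> C) id z) =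
    mu_r D \<gamma> C (comp_map (comp_coalg C D) (comp_coalg D D) (comp_coalg C D) D id \<gamma> (assoc_right (comp_coalg C D) D D z))"
proof -
  let ?E = "comp_coalg C D" and ?m = "mu_r D \<gamma> C"
  let ?DD = "comp_coalg D D" and ?ED = "comp_coalg (comp_coalg C D) D"
  note gE = graded_coalgebra_comp[OF C op'(2)]
  note vE = graded_coalgebraD(2)[OF gE]
  note linear_m = linear_mu_r[OF operad C] and gens = mu_r_gens[OF operad C]
  note lg = coalgebra_morphismD(1)[OF op'(3)]
  have lm: "Vector_Spaces.linear (scl ?ED) (scl ?E) ?m" using linear_m by simp
  note lid = linear_id[OF op'(4)] and lidE = linear_id[OF vE]
  let ?l = "?m \<circ> comp_map ?ED D ?E D ?m id"
  let ?r = "?m \<circ> (comp_map ?E ?DD ?E D id \<gamma> \<circ> assoc_right ?E D D)"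
  have ll: "Vector_Spaces.linear fscale fscale ?l"
    by (rule linear_comp[OF linear_comp_map[OF lm lid] linear_m])
  have lr: "Vector_Spaces.linear fscale fscale ?r"
    by (rule linear_comp[OF linear_comp[OF linear_assoc_right[OF gE op'(2,2)] linear_comp_map[OF lidE lg]] linear_m])
  have "?l z = ?r z"
  proof (rule linear_eq_span[OF ll lr subsetD[OF carr_left_span[OF gE op'(2,2)] z]])
    fix a assume "a \<in> snd ` assoc_gens ?E D D"
    then obtain e ys zss n ks where a: "a = circ ?ED D (circ ?E D e ys) (concat zss)"
      and e: "e \<in> gr ?E n" and ys: "length ys = Suc n" "homs D ys ks" and zss: "blocks D zss ks"
      unfolding assoc_gens_def by auto
    have len: "length ks = Suc n" "length zss = Suc n"
      using ys homs_length[OF ys(2)] blocks_length[OF zss] by simp_all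
    let ?a = "\<lambda>e. circ ?ED D (circ ?E D e ys) (concat zss)"
    have la: "Vector_Spaces.linear fscale fscale ?a"
      using linear_comp[OF linear_circ_left[of ?E, unfolded comp_coalg_simps, OF vector_space_fscale]
          linear_circ_left[of ?ED, unfolded comp_coalg_simps, OF vector_space_fscale]]
      by (simp add: o_def)
    have "(?l \<circ> ?a) e = (?r \<circ> ?a) e"
    proof (rule linear_eq_span[OF linear_comp[OF la ll] linear_comp[OF la lr] e[unfolded comp_coalg_simps]])
      fix e assume "e \<in> {circ C D c ds | c ds m js. c \<in> gr C m \<and> homs D ds js \<and> length ds = Suc m \<and> m + sum_list js = n}"
      then obtain c ds m js where e: "e = circ C D c ds" "c \<in> gr C m" "homs D ds js" "length ds = Suc m" "m + sum_list js = n"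
        by blast
      have e_gr: "e \<in> gr ?E n" using circ_gr[OF e(2,3,4)] e(1,5) by simp
      have lj: "length js = Suc m" using homs_length[OF e(3)] e(4) by simp
      \<comment> \<open>Zipping the letters with their blocks and degrees lets one list be cut into words.\<close>
      define ws where "ws = zip ys (zip zss ks)"
      have lw: "length ws = Suc n" using ys(1) len by (simp add: ws_def)
      have w: "fst t \<in> gr D (snd (snd t))" "length (fst (snd t)) = Suc (snd (snd t))" "set (fst (snd t)) \<subseteq> carr D"
        if "t \<in> set ws" for t
        using that ys zss len by (auto simp: ws_def set_zip homs_def blocks_def list_all2_conv_all_nth subset_iff)
      have maps: "map fst ws = ys" "map (fst \<circ> snd) ws = zss" "map (snd \<circ> snd) ws = ks"
        unfolding ws_def using ys(1) len by (auto intro!: nth_equalityI)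
      obtain wss where wss: "ws = concat wss" "block_list js wss"
        using block_list_exists[of ws js] lw lj e(5) by auto
      have lws: "length wss = Suc m" using list_all2_lengthD[OF wss(2)] lj by simp
      let ?Y = "map fst" and ?Z = "map (fst \<circ> snd)" and ?K = "map (snd \<circ> snd)"
      have sub: "set us \<subseteq> set ws" if "us \<in> set wss" for us using that wss(1) by auto
      have Y: "homs D (?Y us) (?K us)" if "us \<in> set wss" for us
        unfolding homs_def list_all2_map1 list_all2_map2 list_all2_same
        using w(1) subsetD[OF sub[OF that]] by simp
      have Z: "blocks D (?Z us) (?K us)" if "us \<in> set wss" for us
        unfolding blocks_def list_all2_map1 list_all2_map2 list_all2_same
        using w(2,3) subsetD[OF sub[OF that]] by simp
      have cY: "concat (map ?Y wss) = ys" "concat (map ?Z wss) = zss" "concat (map ?K wss) = ks"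
        using maps unfolding wss(1) map_concat by simp_all
      have nth: "ds ! i \<in> gr D (js ! i)" "length (wss ! i) = Suc (js ! i)" "wss ! i \<in> set wss" if "i < Suc m" for i
        using e(3,4) wss(2) that lj lws by (auto simp: homs_def list_all2_conv_all_nth)
      have bY: "blocks D (map ?Y wss) js"
        unfolding blocks_iff
      proof
        show "block_list js (map ?Y wss)" using wss(2) by (simp add: list_all2_conv_all_nth)
        show "set (concat (map ?Y wss)) \<subseteq> carr D"
          unfolding cY by (rule homs_carr[OF op'(4) ys(2)])
      qed
      let ?g = "\<lambda>d es. \<gamma> (circ D D d es)"
      let ?ds' = "map2 ?g ds (map ?Y wss)"
      let ?js' = "map2 (\<lambda>j us. j + sum_list (?K us)) js wss"
      have ds': "homs D ?ds' ?js'"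
        unfolding homs_def list_all2_conv_all_nth
        using e(4) lj lws nth Y by (auto intro!: gamma_gr[OF operad])
      have bZ: "blocks D (map (\<lambda>us. concat (?Z us)) wss) ?js'"
        unfolding blocks_def list_all2_conv_all_nth
      proof (intro conjI allI impI)
        fix i assume "i < length (map (\<lambda>us. concat (?Z us)) wss)"
        then have i: "i < Suc m" using lws by simp
        note b = Z[OF nth(3)[OF i], unfolded blocks_iff]
        show "length (map (\<lambda>us. concat (?Z us)) wss ! i) = Suc (?js' ! i)"
          using block_list_length[OF b[THEN conjunct1]] nth(2)[OF i] i lws lj by simp
        show "set (map (\<lambda>us. concat (?Z us)) wss ! i) \<subseteq> carr D" using b i lws by simp
      qed (use lj lws in simp)
      have inner: "?m (circ ?E D e ys) = circ C D c ?ds'"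
        using gens[OF e(2,4,3) bY] unfolding cY e(1) .
      have "(?l \<circ> ?a) e = ?m (circ ?E D (?m (circ ?E D e ys)) (concat zss))"
      proof -
        have gr1: "circ ?E D e ys \<in> gr ?ED (n + sum_list ks)" by (rule circ_gr[OF e_gr ys(2,1)])
        have "set (concat zss) \<subseteq> carr D" "length (concat zss) = Suc (n + sum_list ks)"
          using zss[unfolded blocks_iff] block_list_length[of zss ks] len by auto
        from comp_map_circ[OF lm lid gr1 this] show ?thesis by simp
      qed
      also have "\<dots> = ?m (circ ?E D (circ C D c ?ds') (concat (map (\<lambda>us. concat (?Z us)) wss)))"
      proof -
        have "concat zss = concat (map (\<lambda>us. concat (?Z us)) wss)"
          unfolding cY(2)[symmetric] by (induction wss) auto
        then show ?thesis unfolding inner by simp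
      qed
      also have "\<dots> = circ C D c (map2 ?g ?ds' (map (\<lambda>us. concat (?Z us)) wss))"
        by (rule gens[OF e(2) _ ds' bZ]) (use e(4) lws in simp)
      also have "map2 ?g ?ds' (map (\<lambda>us. concat (?Z us)) wss) = map2 ?g ds (map (\<lambda>us. map2 ?g (?Y us) (?Z us)) wss)"
      proof (rule nth_equalityI)
        fix i assume "i < length (map2 ?g ?ds' (map (\<lambda>us. concat (?Z us)) wss))"
        then have i: "i < Suc m" using lws e(4) by simp
        have "\<gamma> (circ D D (\<gamma> (circ D D (ds ! i) (?Y (wss ! i)))) (concat (?Z (wss ! i)))) =
            \<gamma> (circ D D (ds ! i) (map2 ?g (?Y (wss ! i)) (?Z (wss ! i))))"
          by (rule gamma_assoc[OF operad nth(1)[OF i] _ Y[OF nth(3)[OF i]] Z[OF nth(3)[OF i]]])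
            (use nth(2)[OF i] in simp)
        then show "map2 ?g ?ds' (map (\<lambda>us. concat (?Z us)) wss) ! i = map2 ?g ds (map (\<lambda>us. map2 ?g (?Y us) (?Z us)) wss) ! i"
          using i lws e(4) by simp
      qed (use lws e(4) in simp)
      also have "circ C D c \<dots> = ?m (circ ?E D (circ C D c ds) (concat (map (\<lambda>us. map2 ?g (?Y us) (?Z us)) wss)))"
      proof (rule gens[OF e(2,4,3), symmetric])
        show "blocks D (map (\<lambda>us. map2 ?g (?Y us) (?Z us)) wss) js"
          unfolding blocks_def list_all2_conv_all_nth
        proof (intro conjI allI impI)
          fix i assume "i < length (map (\<lambda>us. map2 ?g (?Y us) (?Z us)) wss)"
          then have i: "i < Suc m" using lws by simp
          let ?u = "wss ! i"
          have "?g (fst t) (fst (snd t)) \<in> carr D" if "t \<in> set ?u" for t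
          proof -
            have t: "t \<in> set ws" using that sub[OF nth(3)[OF i]] by blast
            show ?thesis
              by (rule morphism_carr[OF op'(3) circ_carr[OF op'(4) w(1)[OF t] w(3)[OF t] w(2)[OF t]]])
          qed
          then have "set (map2 ?g (?Y ?u) (?Z ?u)) \<subseteq> carr D"
            unfolding map2_map by auto
          then show "set (map (\<lambda>us. map2 ?g (?Y us) (?Z us)) wss ! i) \<subseteq> carr D" using i lws by simp
          show "length (map (\<lambda>us. map2 ?g (?Y us) (?Z us)) wss ! i) = Suc (js ! i)"
            using nth(2)[OF i] i lws by simp
        qed (use lj lws in simp)
      qed
      also have "concat (map (\<lambda>us. map2 ?g (?Y us) (?Z us)) wss) = map2 ?g ys zss"
      proof -
        have "concat (map (\<lambda>us. map2 ?g (?Y us) (?Z us)) wss) = map (\<lambda>t. ?g (fst t) (fst (snd t))) (concat wss)"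
          unfolding map2_map by (induction wss) auto
        also have "\<dots> = map2 ?g (?Y ws) (?Z ws)"
          unfolding wss(1) map2_map by simp
        finally show ?thesis unfolding maps .
      qed
      also have "?m (circ ?E D (circ C D c ds) (map2 ?g ys zss)) = (?r \<circ> ?a) e"
      proof -
        have "set (map2 (circ D D) ys zss) \<subseteq> carr ?DD"
          using ys zss len by (auto simp: set_zip homs_def blocks_def list_all2_conv_all_nth intro!: circ_carr[OF op'(4)])
        moreover have "length (map2 (circ D D) ys zss) = Suc n" using ys(1) len by simp
        ultimately have "comp_map ?E ?DD ?E D id \<gamma> (circ ?E ?DD e (map2 (circ D D) ys zss)) = circ ?E D e (map2 ?g ys zss)"
          using comp_map_circ[OF lidE lg e_gr] by (simp add: case_prod_unfold o_def)
        then show ?thesis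
          using assoc_right_gens[OF gE op'(2,2) assoc_gensI[OF e_gr ys zss]] e(1) by simp
      qed
      finally show "(?l \<circ> ?a) e = (?r \<circ> ?a) e" .
    qed
    then show "?l a = ?r a" unfolding a by simp
  qed
  then show ?thesis by simp
qed

lemma left_act_module: "left_module_coalgebra D (operad_mult D \<gamma>) (comp_coalg C D) (left_act D \<gamma> C)"
proof -
  have "left_act D \<gamma> C = act (comp_coalg C D) D (comp_coalg C D) (mu_r D \<gamma> C)"
    by (rule ext) (simp add: left_act_def act_def)
  then show ?thesis
    using left_module[OF operad graded_coalgebra_comp[OF C op'(2)] mu_r_morphism[OF operad C] mu_r_assoc mu_r_one[OF operad C]]
    by simp
qed

section \<open>The maps into the operad commute with the actions\<close>

context
  fixes l assumes l: "coalgebra_morphism C D l"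
begin

lemmas lin_l = coalgebra_morphismD(1)[OF l]

lemma f_r_morphism: "coalgebra_morphism (comp_coalg D C) D (f_r D \<gamma> C l)"
  unfolding f_r_def
  by (rule morphism_comp[OF graded_coalgebra_comp[OF op'(2) C] graded_coalgebra_comp[OF op'(2,2)] op'(2)
        comp_map_morphism[OF op'(2) C op'(2,2) id_morphism[OF op'(2)] l] op'(3)])

lemma f_l_morphism: "coalgebra_morphism (comp_coalg C D) D (f_l D \<gamma> C l)"
  unfolding f_l_def
  by (rule morphism_comp[OF graded_coalgebra_comp[OF C op'(2)] graded_coalgebra_comp[OF op'(2,2)] op'(2)
        comp_map_morphism[OF C op'(2) op'(2,2) l id_morphism[OF op'(2)]] op'(3)])

lemma f_r_circ:
  "d \<in> gr D n \<Longrightarrow> set cs \<subseteq> carr C \<Longrightarrow> length cs = Suc n \<Longrightarrow> f_r D \<gamma> C l (circ D C d cs) = \<gamma> (circ D D d (map l cs))"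
  using comp_map_circ[OF linear_id[OF op'(4)] lin_l] by (simp add: f_r_def)

lemma f_l_circ:
  "c \<in> gr C n \<Longrightarrow> set ds \<subseteq> carr D \<Longrightarrow> length ds = Suc n \<Longrightarrow> f_l D \<gamma> C l (circ C D c ds) = \<gamma> (circ D D (l c) ds)"
  using comp_map_circ[OF lin_l linear_id[OF op'(4)]] by (simp add: f_l_def)

text \<open>On generators both sides are \<open>\<gamma> (\<gamma> (d \<otimes> d\<^sub>0 \<otimes> \<dots> \<otimes> d\<^sub>n) \<otimes> \<lambda>(c\<^sub>0\<^sub>,\<^sub>0) \<otimes> \<dots>)\<close>.\<close>

lemma f_r_mu_l:
  assumes z: "z \<in> carr (comp_coalg D (comp_coalg D C))"
  shows "f_r D \<gamma> C l (mu_l D \<gamma> C z) = \<gamma> (comp_map D (comp_coalg D C) D D id (f_r D \<gamma> C l) z)"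
proof -
  let ?f = "f_r D \<gamma> C l"
  note lf = coalgebra_morphismD(1)[OF f_r_morphism] and lid = linear_id[OF op'(4)]
  have "(?f \<circ> mu_l D \<gamma> C) z = (\<gamma> \<circ> comp_map D (comp_coalg D C) D D id ?f) z"
  proof (rule linear_eq_span[OF linear_comp[OF linear_mu_l[OF operad C]] linear_comp[OF linear_comp_map[OF lid lf] op'(5)]
        subsetD[OF carr_right_span[OF op'(2,2) C] z]])
    show "Vector_Spaces.linear fscale (scl D) ?f" using lf by simp
    fix a assume "a \<in> fst ` assoc_gens D D C"
    then obtain d ds css n js where a: "a = circ D (comp_coalg D C) d (map2 (circ D C) ds css)"
      and h: "d \<in> gr D n" "length ds = Suc n" "homs D ds js" "blocks C css js"
      unfolding assoc_gens_def by auto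
    have len: "length js = Suc n" "length css = Suc n" using h homs_length[OF h(3)] blocks_length[OF h(4)] by simp_all
    note b = h(4)[unfolded blocks_iff]
    have nth: "ds ! i \<in> gr D (js ! i)" "length (css ! i) = Suc (js ! i)" "set (css ! i) \<subseteq> carr C" if "i < Suc n" for i
      using h(2-4) that len by (auto simp: homs_def blocks_def list_all2_conv_all_nth)
    have set: "set (map2 (circ D C) ds css) \<subseteq> carr (comp_coalg D C)"
      using nth h(2) len by (auto simp: set_zip intro!: circ_carr[OF graded_coalgebraD(2)[OF C]])
    have bl: "blocks D (map (map l) css) js"
      using b morphism_carr[OF l] by (auto simp: blocks_iff list_all2_conv_all_nth)
    have "?f (mu_l D \<gamma> C a) = \<gamma> (circ D D (\<gamma> (circ D D d ds)) (map l (concat css)))"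
      unfolding a mu_l_gens[OF operad C h]
      by (rule f_r_circ[OF gamma_gr[OF operad h(1-3)]]) (use b block_list_length[OF b[THEN conjunct1]] len in auto)
    also have "\<dots> = \<gamma> (circ D D d (map2 (\<lambda>d es. \<gamma> (circ D D d es)) ds (map (map l) css)))"
      using gamma_assoc[OF operad h(1-3) bl] by (simp add: map_concat)
    also have "map2 (\<lambda>d es. \<gamma> (circ D D d es)) ds (map (map l) css) = map ?f (map2 (circ D C) ds css)"
      by (rule nth_equalityI) (use h(2) len f_r_circ[OF nth(1,3,2)] in auto)
    also have "\<gamma> (circ D D d \<dots>) = \<gamma> (comp_map D (comp_coalg D C) D D id ?f a)"
      using comp_map_circ[OF lid lf h(1) set] h(2) len a by simp
    finally show "(?f \<circ> mu_l D \<gamma> C) a = (\<gamma> \<circ> comp_map D (comp_coalg D C) D D id ?f) a" by simp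
  qed
  then show ?thesis by simp
qed

text \<open>On generators both sides are \<open>\<gamma> (\<gamma> (\<lambda>(c) \<otimes> d\<^sub>0 \<otimes> \<dots> \<otimes> d\<^sub>m) \<otimes> d\<^sub>0\<^sub>,\<^sub>0 \<otimes> \<dots>)\<close>.\<close>

lemma f_l_mu_r:
  assumes z: "z \<in> carr (comp_coalg (comp_coalg C D) D)"
  shows "f_l D \<gamma> C l (mu_r D \<gamma> C z) = \<gamma> (comp_map (comp_coalg C D) D D D (f_l D \<gamma> C l) id z)"
proof -
  let ?f = "f_l D \<gamma> C l"
  note lf = coalgebra_morphismD(1)[OF f_l_morphism] and lid = linear_id[OF op'(4)]
  have "(?f \<circ> mu_r D \<gamma> C) z = (\<gamma> \<circ> comp_map (comp_coalg C D) D D D ?f id) z"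
  proof (rule linear_eq_span[OF linear_comp[OF linear_mu_r[OF operad C]] linear_comp[OF linear_comp_map[OF lf lid] op'(5)]
        subsetD[OF carr_left_span[OF C op'(2,2)] z]])
    show "Vector_Spaces.linear fscale (scl D) ?f" using lf by simp
    fix a assume "a \<in> snd ` assoc_gens C D D"
    then obtain c ds dss n js where a: "a = circ (comp_coalg C D) D (circ C D c ds) (concat dss)"
      and h: "c \<in> gr C n" "length ds = Suc n" "homs D ds js" "blocks D dss js"
      unfolding assoc_gens_def by auto
    have len: "length js = Suc n" "length dss = Suc n" using h homs_length[OF h(3)] blocks_length[OF h(4)] by simp_all
    note b = h(4)[unfolded blocks_iff]
    have nth: "ds ! i \<in> gr D (js ! i)" "length (dss ! i) = Suc (js ! i)" "set (dss ! i) \<subseteq> carr D" if "i < Suc n" for i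
      using h(2-4) that len by (auto simp: homs_def blocks_def list_all2_conv_all_nth)
    have set: "set (map2 (\<lambda>d es. \<gamma> (circ D D d es)) ds dss) \<subseteq> carr D"
      using nth h(2) len by (auto simp: set_zip intro!: morphism_carr[OF op'(3)] circ_carr[OF op'(4)])
    have "?f (mu_r D \<gamma> C a) = \<gamma> (circ D D (l c) (map2 (\<lambda>d es. \<gamma> (circ D D d es)) ds dss))"
      unfolding a mu_r_gens[OF operad C h] by (rule f_l_circ[OF h(1) set]) (use h(2) len in simp)
    also have "\<dots> = \<gamma> (circ D D (\<gamma> (circ D D (l c) ds)) (concat dss))"
      by (rule gamma_assoc[OF operad coalgebra_morphismD(2)[OF l h(1)] h(2-4), symmetric])
    also have "\<gamma> (circ D D (l c) ds) = ?f (circ C D c ds)"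
      by (rule f_l_circ[OF h(1) homs_carr[OF op'(4) h(3)] h(2), symmetric])
    also have "\<gamma> (circ D D \<dots> (concat dss)) = \<gamma> (comp_map (comp_coalg C D) D D D ?f id a)"
      using comp_map_circ[OF lf lid circ_gr[OF h(1,3,2)], of "concat dss"] b block_list_length[OF b[THEN conjunct1]] len a
      by simp
    finally show "(?f \<circ> mu_r D \<gamma> C) a = (\<gamma> \<circ> comp_map (comp_coalg C D) D D D ?f id) a" by simp
  qed
  then show ?thesis by simp
qed

text \<open>\<open>f\<^sub>r(e \<star> d) = f\<^sub>r \<mu>\<^sub>l (spread e d) = \<gamma> (id \<circ> f\<^sub>r)(spread e d) = \<gamma> (spread (f\<^sub>r e) d) = f\<^sub>r(e) \<cdot> d\<close>.\<close>

lemma f_r_right_act: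
  assumes e: "e \<in> carr (comp_coalg D C)" and d: "d \<in> carr D"
  shows "f_r D \<gamma> C l (right_act D \<gamma> C e d) = operad_mult D \<gamma> (f_r D \<gamma> C l e) d"
proof -
  let ?E = "comp_coalg D C" and ?f = "f_r D \<gamma> C l"
  note gE = graded_coalgebra_comp[OF op'(2) C]
  have "right_act D \<gamma> C e d = act D ?E ?E (mu_l D \<gamma> C) e d"
    by (simp add: right_act_def act_def)
  also have "\<dots> = mu_l D \<gamma> C (spread D ?E e d)"
    by (rule act_eq_spread[OF op'(2) gE gE mu_l_morphism[OF operad C] d])
  finally have "?f (right_act D \<gamma> C e d) = \<gamma> (comp_map D ?E D D id ?f (spread D ?E e d))"
    using f_r_mu_l[OF spread_in[OF op'(2) gE e d]] by simp
  also have "comp_map D ?E D D id ?f (spread D ?E e d) = spread D D (?f e) d"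
    using comp_map_spread[OF op'(2) gE op'(2,2) id_morphism[OF op'(2)] f_r_morphism d e] by simp
  also have "\<gamma> \<dots> = operad_mult D \<gamma> (?f e) d"
    unfolding operad_mult_act[OF operad] by (rule act_eq_spread[OF op'(2,2,2,3) d, symmetric])
  finally show ?thesis .
qed

lemma f_l_left_act:
  assumes e: "e \<in> carr (comp_coalg C D)" and d: "d \<in> carr D"
  shows "f_l D \<gamma> C l (left_act D \<gamma> C d e) = operad_mult D \<gamma> d (f_l D \<gamma> C l e)"
proof -
  let ?E = "comp_coalg C D" and ?f = "f_l D \<gamma> C l"
  note gE = graded_coalgebra_comp[OF C op'(2)]
  have "left_act D \<gamma> C d e = act ?E D ?E (mu_r D \<gamma> C) d e"
    by (simp add: left_act_def act_def)
  also have "\<dots> = mu_r D \<gamma> C (spread ?E D d e)"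
    by (rule act_eq_spread[OF gE op'(2) gE mu_r_morphism[OF operad C] e])
  finally have "?f (left_act D \<gamma> C d e) = \<gamma> (comp_map ?E D D D ?f id (spread ?E D d e))"
    using f_l_mu_r[OF spread_in[OF gE op'(2) d e]] by simp
  also have "comp_map ?E D D D ?f id (spread ?E D d e) = spread D D d (?f e)"
    using comp_map_spread[OF gE op'(2,2,2) f_l_morphism id_morphism[OF op'(2)] e d] by simp
  also have "\<gamma> \<dots> = operad_mult D \<gamma> d (?f e)"
    unfolding operad_mult_act[OF operad] by (rule act_eq_spread[OF op'(2,2,2,3) morphism_carr[OF f_l_morphism e], symmetric])
  finally show ?thesis .
qed

end

end

section \<open>The antipode of a connected graded bialgebra\<close>

lemma tens_map_comp:
  assumes "Vector_Spaces.linear s' s f'" "Vector_Spaces.linear t' t g'"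
  shows "tens_map s t (f' \<circ> f) (g' \<circ> g) x = tens_map s t f' g' (tens_map s' t' f g x)"
proof (rule ext, goal_cases)
  case (1 p)
  obtain \<phi> \<psi> where p: "p = (\<phi>, \<psi>)" by (cases p)
  show "tens_map s t (f' \<circ> f) (g' \<circ> g) x p = tens_map s t f' g' (tens_map s' t' f g x) p"
  proof (cases "functional s \<phi> \<and> functional t \<psi>")
    case True
    then show ?thesis
      unfolding p using functional_comp[OF assms(1), of \<phi>] functional_comp[OF assms(2), of \<psi>]
      by (simp only: tens_map_apply o_assoc)
  qed (auto simp: p tens_map_def)
qed

context
  fixes D :: "('k::field, 'd::ab_group_add) coalg" and m
  assumes con: "connected_coalgebra D" and bil: "graded_bilinear D D D m"
    and massoc: "\<And>a b c. a \<in> carr D \<Longrightarrow> b \<in> carr D \<Longrightarrow> c \<in> carr D \<Longrightarrow> m (m a b) c = m a (m b c)"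
    and munit: "\<And>a. a \<in> carr D \<Longrightarrow> m (one D) a = a" "\<And>a. a \<in> carr D \<Longrightarrow> m a (one D) = a"
begin

lemma gcD: "graded_coalgebra D" using con by (simp add: connected_coalgebra_def)
lemmas cD = graded_coalgebraD[OF gcD]
lemma bilD: "bilinear_on D D D m" by (rule graded_bilinear_on[OF bil cD(2) cD(2) cD(2)])
lemma m_carr: "a \<in> carr D \<Longrightarrow> b \<in> carr D \<Longrightarrow> m a b \<in> carr D"
  using bilD unfolding bilinear_on_def by blast
lemma m_gr: "a \<in> gr D i \<Longrightarrow> b \<in> gr D j \<Longrightarrow> m a b \<in> gr D (i + j)"
  using bil unfolding graded_bilinear_def by blast
lemma one_carr: "one D \<in> carr D" by (rule gr_carr[OF cD(2) one_gr[OF con]])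

text \<open>The product as a linear map on the tensor square.\<close>

definition mult_map :: "('k, 'd, 'd) tensor \<Rightarrow> 'd" where
  "mult_map = (SOME F. Vector_Spaces.linear fscale (scl D) F \<and>
     (\<forall>v w. F (tens (scl D) (scl D) v w) = m (carr_proj D v) (carr_proj D w)))"

lemma
  shows linear_mult_map: "Vector_Spaces.linear fscale (scl D) mult_map"
    and mult_map_tens: "a \<in> carr D \<Longrightarrow> b \<in> carr D \<Longrightarrow> mult_map (tens (scl D) (scl D) a b) = m a b"
proof -
  have "\<exists>F. Vector_Spaces.linear fscale (scl D) F \<and>
     (\<forall>v w. F (tens (scl D) (scl D) v w) = m (carr_proj D v) (carr_proj D w))"
    by (rule tens_universal)
      (use bilinear_left[OF cD(2) cD(2) cD(2) bilD] bilinear_right[OF cD(2) cD(2) cD(2) bilD] carr_proj_in[OF cD(2)] in auto)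
  from someI_ex[OF this, folded mult_map_def]
  show "Vector_Spaces.linear fscale (scl D) mult_map"
    "a \<in> carr D \<Longrightarrow> b \<in> carr D \<Longrightarrow> mult_map (tens (scl D) (scl D) a b) = m a b"
    using carr_proj_id[OF cD(2)] by auto
qed

definition graded_endo :: "('d \<Rightarrow> 'd) \<Rightarrow> bool" where
  "graded_endo f \<longleftrightarrow> Vector_Spaces.linear (scl D) (scl D) f \<and> (\<forall>n. \<forall>x\<in>gr D n. f x \<in> gr D n)"

lemma graded_endoD:
  assumes "graded_endo f"
  shows "Vector_Spaces.linear (scl D) (scl D) f" "x \<in> gr D n \<Longrightarrow> f x \<in> gr D n" "x \<in> carr D \<Longrightarrow> f x \<in> carr D"
proof -
  show l: "Vector_Spaces.linear (scl D) (scl D) f" and g: "x \<in> gr D n \<Longrightarrow> f x \<in> gr D n" for x n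
    using assms by (auto simp: graded_endo_def)
  show "f x \<in> carr D" if "x \<in> carr D"
    by (rule linear_span_into[OF l that[unfolded carr_def] subspace_carr[OF cD(2)]])
      (use g gr_carr[OF cD(2)] in blast)
qed

text \<open>The convolution product of endomorphisms; composed of linear maps, it is easier to compute with than
  the linear extension in \<open>convolution\<close>.\<close>

definition cv :: "('d \<Rightarrow> 'd) \<Rightarrow> ('d \<Rightarrow> 'd) \<Rightarrow> 'd \<Rightarrow> 'd" where
  "cv f g = mult_map \<circ> tens_map (scl D) (scl D) f g \<circ> cop D"

lemma linear_cv: "Vector_Spaces.linear (scl D) (scl D) (cv f g)"
  unfolding cv_def by (rule linear_comp[OF cD(3) linear_comp[OF linear_tens_map linear_mult_map]])

lemma cv_gr_eqI:
  assumes f: "graded_endo f" and g: "graded_endo g" and x: "x \<in> gr D n" and sub: "module.subspace (scl D) A"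
    and A: "\<And>a b i j. a \<in> gr D i \<Longrightarrow> b \<in> gr D j \<Longrightarrow> i + j = n \<Longrightarrow> m (f a) (g b) \<in> A"
  shows "cv f g x \<in> A"
  unfolding cv_def comp_apply
proof (rule linear_span_into[OF linear_mult_map _ sub])
  show "tens_map (scl D) (scl D) f g (cop D x) \<in> module.span fscale
      {tens (scl D) (scl D) (f a) (g b) | a b i j. a \<in> gr D i \<and> b \<in> gr D j \<and> i + j = n}"
    by (rule linear_span_into[OF linear_tens_map cD(5)[OF x, unfolded tens_gr_def] subspace_spanI[OF vector_space_fscale]])
      (force simp: tens_map_tens[OF graded_endoD(1)[OF f] graded_endoD(1)[OF g]] intro: span_baseI[OF vector_space_fscale])
  fix t assume "t \<in> {tens (scl D) (scl D) (f a) (g b) | a b i j. a \<in> gr D i \<and> b \<in> gr D j \<and> i + j = n}"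
  then obtain a b i j where t: "t = tens (scl D) (scl D) (f a) (g b)" "a \<in> gr D i" "b \<in> gr D j" "i + j = n" by blast
  show "mult_map t \<in> A"
    using A[OF t(2-4)] mult_map_tens graded_endoD(3)[OF f gr_carr[OF cD(2) t(2)]] graded_endoD(3)[OF g gr_carr[OF cD(2) t(3)]]
    by (simp add: t(1))
qed

lemma graded_endo_cv:
  assumes f: "graded_endo f" and g: "graded_endo g"
  shows "graded_endo (cv f g)"
  unfolding graded_endo_def
proof (intro conjI allI ballI linear_cv)
  fix n x assume x: "x \<in> gr D n"
  show "cv f g x \<in> gr D n"
  proof (rule cv_gr_eqI[OF f g x graded_spaceD(2)[OF cD(1)]])
    show "m (f a) (g b) \<in> gr D n" if "a \<in> gr D i" "b \<in> gr D j" "i + j = n" for a b i j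
      using m_gr[OF graded_endoD(2)[OF f that(1)] graded_endoD(2)[OF g that(2)]] that(3) by simp
  qed
qed

lemma cv_linear_eq:
  assumes f: "graded_endo f" "graded_endo g" and L: "Vector_Spaces.linear fscale (scl D) L"
    and x: "x \<in> carr D"
    and eq: "\<And>a b. a \<in> carr D \<Longrightarrow> b \<in> carr D \<Longrightarrow> m (f a) (g b) = L (tens (scl D) (scl D) a b)"
  shows "cv f g x = L (cop D x)"
proof -
  have "(mult_map \<circ> tens_map (scl D) (scl D) f g) (cop D x) = L (cop D x)"
    by (rule linear_eq_span[OF linear_comp[OF linear_tens_map linear_mult_map] L cop_sq_carr[OF gcD x, unfolded tspan_def]])
      (auto simp: tens_map_tens[OF graded_endoD(1)[OF f(1)] graded_endoD(1)[OF f(2)]] mult_map_tens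
        graded_endoD(3)[OF f(1)] graded_endoD(3)[OF f(2)] eq)
  then show ?thesis by (simp add: cv_def)
qed

lemma linear_cv_tensor: "Vector_Spaces.linear fscale (scl D) (\<lambda>t. mult_map (tens_map (scl D) (scl D) f g t))"
  using linear_comp[OF linear_tens_map linear_mult_map] by (simp add: o_def)

lemma cv_tensor_tens:
  assumes "graded_endo f" "graded_endo g" "a \<in> carr D" "b \<in> carr D"
  shows "mult_map (tens_map (scl D) (scl D) f g (tens (scl D) (scl D) a b)) = m (f a) (g b)"
  unfolding tens_map_tens[OF graded_endoD(1)[OF assms(1)] graded_endoD(1)[OF assms(2)]]
  by (rule mult_map_tens[OF graded_endoD(3)[OF assms(1,3)] graded_endoD(3)[OF assms(2,4)]])

lemma cv_cong:
  assumes f: "graded_endo f" "graded_endo g" "graded_endo f'" "graded_endo g'" and x: "x \<in> gr D n"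
    and eq: "\<And>i a. i \<le> n \<Longrightarrow> a \<in> gr D i \<Longrightarrow> f a = f' a" "\<And>i a. i \<le> n \<Longrightarrow> a \<in> gr D i \<Longrightarrow> g a = g' a"
  shows "cv f g x = cv f' g' x"
proof -
  have "mult_map (tens_map (scl D) (scl D) f g (cop D x)) = mult_map (tens_map (scl D) (scl D) f' g' (cop D x))"
  proof (rule linear_eq_span[OF linear_cv_tensor linear_cv_tensor cD(5)[OF x, unfolded tens_gr_def]])
    fix t assume "t \<in> {tens (scl D) (scl D) a b |a b i j. a \<in> gr D i \<and> b \<in> gr D j \<and> i + j = n}"
    then obtain a b i j where t: "t = tens (scl D) (scl D) a b" "a \<in> gr D i" "b \<in> gr D j" "i + j = n" by blast
    note c = gr_carr[OF cD(2) t(2)] gr_carr[OF cD(2) t(3)]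
    show "mult_map (tens_map (scl D) (scl D) f g t) = mult_map (tens_map (scl D) (scl D) f' g' t)"
      unfolding t(1) cv_tensor_tens[OF f(1,2) c] cv_tensor_tens[OF f(3,4) c]
      using eq(1)[OF _ t(2)] eq(2)[OF _ t(3)] t(4) by simp
  qed
  then show ?thesis by (simp add: cv_def)
qed

text \<open>Coassociativity of \<open>D\<close> on one side and associativity of \<open>m\<close> on the other.\<close>

lemma cv_assoc:
  assumes f: "graded_endo f" and g: "graded_endo g" and h: "graded_endo h" and x: "x \<in> carr D"
  shows "cv (cv f g) h x = cv f (cv g h) x"
proof -
  let ?T = "tens_map (scl D) (scl D)" and ?M = mult_map
  let ?sq = "sq_carr D"
  note fl = graded_endoD(1)[OF f] and hl = graded_endoD(1)[OF h]
  note fc = graded_endoD(3)[OF f] and gc = graded_endoD(3)[OF g] and hc = graded_endoD(3)[OF h]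
  note lM = linear_comp[OF linear_tens_map linear_mult_map]
  note id = linear_id[OF cD(2)]
  define y where "y = tens_map fscale (scl D) (cop D) id (cop D x)"
  note sq = cop_sq_carr[OF gcD]
  have y: "y \<in> tspan fscale ?sq (scl D) (carr D)"
    unfolding y_def by (rule tens_map_in[OF sq[OF x] cD(3) id]) (use sq in auto)
  have ay: "associator D y = tens_map (scl D) fscale id (cop D) (cop D x)"
    unfolding y_def tmap_eq[OF cD(3) id sq[OF x], symmetric] tmap_eq[OF id cD(3) sq[OF x], symmetric]
    using gcD x unfolding graded_coalgebra_def by blast
  have "cv (cv f g) h x = ?M (?T ((?M \<circ> ?T f g) \<circ> cop D) (h \<circ> id) (cop D x))"
    by (simp add: cv_def)
  also have "\<dots> = ?M (?T (?M \<circ> ?T f g) h y)"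
    unfolding y_def tens_map_comp[OF lM hl] ..
  also have "\<dots> = ?M (?T f (?M \<circ> ?T g h) (associator D y))"
  proof -
    let ?l = "?M \<circ> ?T (?M \<circ> ?T f g) h" and ?r = "?M \<circ> ?T f (?M \<circ> ?T g h) \<circ> associator D"
    have ll: "Vector_Spaces.linear fscale (scl D) ?l" by (rule lM)
    have lr: "Vector_Spaces.linear fscale (scl D) ?r" by (rule linear_comp[OF linear_associator[OF cD(2)] lM])
    have "?l y = ?r y"
    proof (rule linear_eq_span[OF ll lr y[unfolded tspan_def[of fscale]]])
      fix z assume "z \<in> {tens fscale (scl D) a b |a b. a \<in> ?sq \<and> b \<in> carr D}"
      then obtain t c where z: "z = tens fscale (scl D) t c" "t \<in> ?sq" "c \<in> carr D" by blast
      let ?z = "\<lambda>t. tens fscale (scl D) t c"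
      note lz = linear_tens_left[OF vector_space_fscale, of "scl D" c]
      have "(?l \<circ> ?z) t = (?r \<circ> ?z) t"
      proof (rule linear_eq_span[OF linear_comp[OF lz ll] linear_comp[OF lz lr] z(2)[unfolded tspan_def]])
        fix w assume "w \<in> {tens (scl D) (scl D) a b |a b. a \<in> carr D \<and> b \<in> carr D}"
        then obtain a b where w: "w = tens (scl D) (scl D) a b" "a \<in> carr D" "b \<in> carr D" by blast
        have "?l (?z w) = m (m (f a) (g b)) (h c)"
          using tens_map_tens[OF lM hl, where a = w and b = c] cv_tensor_tens[OF f g w(2,3)]
          by (simp add: w(1) mult_map_tens m_carr fc gc hc w z(3))
        also have "\<dots> = m (f a) (m (g b) (h c))" by (rule massoc[OF fc[OF w(2)] gc[OF w(3)] hc[OF z(3)]])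
        also have "\<dots> = ?r (?z w)"
          using tens_map_tens[OF fl lM, where a = a and b = "tens (scl D) (scl D) b c"] cv_tensor_tens[OF g h w(3) z(3)]
          by (simp add: w(1) associator_tens[OF cD(2) w(2,3) z(3)] mult_map_tens m_carr fc gc hc w z(3))
        finally show "(?l \<circ> ?z) w = (?r \<circ> ?z) w" by simp
      qed
      then show "?l z = ?r z" by (simp add: z(1))
    qed
    then show ?thesis by simp
  qed
  also have "\<dots> = ?M (?T (f \<circ> id) ((?M \<circ> ?T g h) \<circ> cop D) (cop D x))"
    unfolding ay tens_map_comp[OF fl lM] ..
  also have "\<dots> = cv f (cv g h) x" by (simp add: cv_def)
  finally show ?thesis .
qed

definition unit_counit :: "'d \<Rightarrow> 'd" where
  "unit_counit x = scl D (cou D x) (one D)"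

lemma graded_endo_unit_counit: "graded_endo unit_counit"
  unfolding graded_endo_def
proof (intro conjI allI ballI)
  interpret vector_space "scl D" by (rule cD(2))
  note sub = graded_spaceD(2)[OF cD(1)]
  show "Vector_Spaces.linear (scl D) (scl D) unit_counit"
    using cD(2,4) by (auto simp: Vector_Spaces.linear_iff unit_counit_def functional_add functional_scale scale_left_distrib)
  fix n x assume x: "x \<in> gr D n"
  show "unit_counit x \<in> gr D n"
    using subspace_scale[OF sub one_gr[OF con]] subspace_0[OF sub] hfunD(2)[OF cD(6) x]
    by (cases "n = 0") (auto simp: unit_counit_def)
qed

lemma graded_endo_id: "graded_endo id"
  by (simp add: graded_endo_def linear_id[OF cD(2)])

lemma cv_unit:
  assumes f: "graded_endo f" and x: "x \<in> carr D"
  shows "cv f unit_counit x = f x" "cv unit_counit f x = f x"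
proof -
  interpret vector_space "scl D" by (rule cD(2))
  note fl = graded_endoD(1)[OF f] and fc = graded_endoD(3)[OF f]
  have sc: "m a (scl D k b) = scl D k (m a b)" "m (scl D k a) b = scl D k (m a b)" if "a \<in> carr D" "b \<in> carr D" for a b k
    using bil that unfolding graded_bilinear_def by blast+
  note cl = counit_left[OF cD(2,4)] and cr = counit_right[OF cD(2,4)]
  have cop: "counit_left D (cop D x) = x" "counit_right D (cop D x) = x"
    using gcD x unfolding graded_coalgebra_def by blast+
  have "cv f unit_counit x = (f \<circ> counit_right D) (cop D x)"
    by (rule cv_linear_eq[OF f graded_endo_unit_counit linear_comp[OF cr(1) fl] x])
      (simp add: cr(2) unit_counit_def sc fc one_carr munit linear_D(4)[OF fl])
  then show "cv f unit_counit x = f x" by (simp add: cop)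
  have "cv unit_counit f x = (f \<circ> counit_left D) (cop D x)"
    by (rule cv_linear_eq[OF graded_endo_unit_counit f linear_comp[OF cl(1) fl] x])
      (simp add: cl(2) unit_counit_def sc fc one_carr munit linear_D(4)[OF fl])
  then show "cv unit_counit f x = f x" by (simp add: cop)
qed

lemma m_sum:
  assumes a: "a \<in> carr D" and b: "\<And>k. k \<in> I \<Longrightarrow> b k \<in> carr D"
  shows "m a (\<Sum>k\<in>I. b k) = (\<Sum>k\<in>I. m a (b k))" "m (\<Sum>k\<in>I. b k) a = (\<Sum>k\<in>I. m (b k) a)"
proof -
  interpret vector_space "scl D" by (rule cD(2))
  have "(\<lambda>v. m a (carr_proj D v)) (\<Sum>k\<in>I. b k) = (\<Sum>k\<in>I. m a (carr_proj D (b k)))"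
    by (rule linear_sum'[OF bilinear_right[OF cD(2) cD(2) cD(2) bilD a]])
  moreover have "(\<lambda>v. m (carr_proj D v) a) (\<Sum>k\<in>I. b k) = (\<Sum>k\<in>I. m (carr_proj D (b k)) a)"
    by (rule linear_sum'[OF bilinear_left[OF cD(2) cD(2) cD(2) bilD a]])
  moreover have "(\<Sum>k\<in>I. b k) \<in> carr D" by (rule subspace_sum[OF subspace_carr[OF cD(2)] b])
  ultimately show "m a (\<Sum>k\<in>I. b k) = (\<Sum>k\<in>I. m a (b k))" "m (\<Sum>k\<in>I. b k) a = (\<Sum>k\<in>I. m (b k) a)"
    using b by (simp_all add: carr_proj_id[OF cD(2)])
qed

lemma graded_endo_sum: "(\<And>k. k \<in> I \<Longrightarrow> graded_endo (F k)) \<Longrightarrow> graded_endo (\<lambda>x. \<Sum>k\<in>I. F k x)"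
  unfolding graded_endo_def
proof (intro conjI allI ballI)
  interpret vector_space "scl D" by (rule cD(2))
  assume F: "\<And>k. k \<in> I \<Longrightarrow> Vector_Spaces.linear (scl D) (scl D) (F k) \<and> (\<forall>n. \<forall>x\<in>gr D n. F k x \<in> gr D n)"
  then show "Vector_Spaces.linear (scl D) (scl D) (\<lambda>x. \<Sum>k\<in>I. F k x)"
    by (intro linear_sum_map[OF cD(2) cD(2)]) blast
  show "(\<Sum>k\<in>I. F k x) \<in> gr D n" if "x \<in> gr D n" for x n
    by (rule subspace_sum[OF graded_spaceD(2)[OF cD(1)]]) (use F that in blast)
qed

lemma cv_sum:
  assumes F: "\<And>k. k \<in> I \<Longrightarrow> graded_endo (F k)" and g: "graded_endo g" and x: "x \<in> carr D"
  shows "cv (\<lambda>x. \<Sum>k\<in>I. F k x) g x = (\<Sum>k\<in>I. cv (F k) g x)"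
    "cv g (\<lambda>x. \<Sum>k\<in>I. F k x) x = (\<Sum>k\<in>I. cv g (F k) x)"
proof -
  note FS = graded_endo_sum[of I F, OF F]
  note gc = graded_endoD(3)[OF g] and Fc = graded_endoD(3)[OF F]
  have "cv (\<lambda>x. \<Sum>k\<in>I. F k x) g x = (\<Sum>k\<in>I. mult_map (tens_map (scl D) (scl D) (F k) g (cop D x)))"
    by (rule cv_linear_eq[OF FS g linear_sum_map[OF vector_space_fscale cD(2) linear_cv_tensor] x])
      (simp_all add: cv_tensor_tens F g m_sum(2) gc Fc)
  then show "cv (\<lambda>x. \<Sum>k\<in>I. F k x) g x = (\<Sum>k\<in>I. cv (F k) g x)" by (simp add: cv_def)
  have "cv g (\<lambda>x. \<Sum>k\<in>I. F k x) x = (\<Sum>k\<in>I. mult_map (tens_map (scl D) (scl D) g (F k) (cop D x)))"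
    by (rule cv_linear_eq[OF g FS linear_sum_map[OF vector_space_fscale cD(2) linear_cv_tensor] x])
      (simp_all add: cv_tensor_tens F g m_sum(1) gc Fc)
  then show "cv g (\<lambda>x. \<Sum>k\<in>I. F k x) x = (\<Sum>k\<in>I. cv g (F k) x)" by (simp add: cv_def)
qed

text \<open>The map \<open>u \<epsilon> - id\<close>, whose geometric series inverts \<open>id = u \<epsilon> - (u \<epsilon> - id)\<close>.\<close>

definition kap :: "'d \<Rightarrow> 'd" where "kap x = unit_counit x - x"

lemma graded_endo_kap: "graded_endo kap"
proof -
  interpret vector_space "scl D" by (rule cD(2))
  note u = graded_endo_unit_counit[unfolded graded_endo_def]
  show ?thesis
    unfolding graded_endo_def
    using u subspace_diff[OF graded_spaceD(2)[OF cD(1)]]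
    by (auto simp: kap_def Vector_Spaces.linear_iff scale_right_diff_distrib)
qed

lemma cv_kap:
  assumes f: "graded_endo f" and x: "x \<in> carr D"
  shows "cv f id x + cv f kap x = f x" "cv id f x + cv kap f x = f x"
proof -
  let ?F = "\<lambda>k. if k then kap else id"
  have F: "graded_endo (?F k)" for k using graded_endo_kap graded_endo_id by simp
  have s: "(\<lambda>x. \<Sum>k\<in>UNIV. ?F k x) = unit_counit" by (rule ext) (simp add: UNIV_bool kap_def)
  have e: "(\<Sum>k\<in>UNIV. G (?F k) x) = G id x + G kap x" for G :: "('d \<Rightarrow> 'd) \<Rightarrow> 'd \<Rightarrow> 'd"
    by (simp add: UNIV_bool)
  show "cv f id x + cv f kap x = f x"
    using cv_sum(2)[of UNIV ?F, OF F f x] unfolding s cv_unit[OF f x] e[of "cv f"] by (rule sym)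
  show "cv id f x + cv kap f x = f x"
    using cv_sum(1)[of UNIV ?F, OF F f x] unfolding s cv_unit[OF f x] e[of "\<lambda>g. cv g f"] by (rule sym)
qed

fun kap_pow :: "nat \<Rightarrow> 'd \<Rightarrow> 'd" where
  "kap_pow 0 = unit_counit"
| "kap_pow (Suc k) = cv kap (kap_pow k)"

lemma graded_endo_kap_pow: "graded_endo (kap_pow k)"
  by (induction k) (auto intro: graded_endo_unit_counit graded_endo_cv graded_endo_kap)

lemma kap_pow_commute: "x \<in> carr D \<Longrightarrow> cv (kap_pow k) kap x = kap_pow (Suc k) x"
proof (induction k arbitrary: x)
  case 0
  then show ?case by (simp only: kap_pow.simps cv_unit[OF graded_endo_kap 0])
next
  case (Suc k)
  note K = graded_endo_kap_pow and kk = graded_endo_kap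
  have "cv (kap_pow (Suc k)) kap x = cv kap (cv (kap_pow k) kap) x"
    unfolding kap_pow.simps(2) by (rule cv_assoc[OF kk K kk Suc.prems])
  also have "\<dots> = cv kap (kap_pow (Suc k)) x"
    by (rule linear_eq_carr[OF linear_cv linear_cv Suc.prems], rule cv_cong[OF kk graded_endo_cv[OF K kk] kk K])
      (assumption, rule refl, rule Suc.IH[OF gr_carr[OF cD(2)]])
  finally show ?case by (simp only: kap_pow.simps)
qed

text \<open>\<open>kap\<close> vanishes in degree \<open>0\<close>, so its powers vanish in small degrees.\<close>

lemma kap_pow_zero: "x \<in> gr D n \<Longrightarrow> n < k \<Longrightarrow> kap_pow k x = 0"
proof (induction k arbitrary: x n)
  case (Suc k)
  interpret vector_space "scl D" by (rule cD(2))
  have m0: "m 0 b = 0" "m b 0 = 0" if "b \<in> carr D" for b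
    using m_sum[OF that, where I = "{} :: nat set"] by (simp_all only: sum.empty empty_iff simp_thms)
  have k0: "kap a = 0" if "a \<in> gr D 0" for a
    by (simp add: kap_def unit_counit_def gr_0_eq[OF con that, symmetric])
  have "cv kap (kap_pow k) x \<in> {0}"
  proof (rule cv_gr_eqI[OF graded_endo_kap graded_endo_kap_pow Suc.prems(1)])
    fix a b i j assume a: "a \<in> gr D i" "b \<in> gr D j" "i + j = n"
    note c = graded_endoD(3)[OF graded_endo_kap gr_carr[OF cD(2) a(1)]]
      graded_endoD(3)[OF graded_endo_kap_pow gr_carr[OF cD(2) a(2)]]
    show "m (kap a) (kap_pow k b) \<in> {0}"
    proof (cases "i = 0")
      case True
      then show ?thesis using k0[of a] a(1) m0(1)[OF c(2)] by simp
    next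
      case False
      then have "kap_pow k b = 0" using a(3) Suc.prems(2) by (intro Suc.IH[OF a(2)]) simp
      then show ?thesis using m0(2)[OF c(1)] by simp
    qed
  qed simp
  then show ?case by (simp only: kap_pow.simps singleton_iff)
next
  case 0
  then show ?case by blast
qed

text \<open>Takeuchi's formula: the antipode is the geometric series \<open>\<Sum>\<^sub>k (u\<epsilon> - id)\<^sup>*\<^sup>k\<close>, a finite sum in each degree.\<close>

lemma antipode_exists: "\<exists>S. antipode D m S"
proof -
  let ?S = "\<lambda>n x. \<Sum>k\<le>n. kap_pow k x"
  have Sn: "graded_endo (?S n)" for n by (rule graded_endo_sum) (rule graded_endo_kap_pow)
  obtain S where S: "Vector_Spaces.linear (scl D) (scl D) S" "\<And>n x. x \<in> gr D n \<Longrightarrow> S x = ?S n x"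
    using graded_extension[OF cD(1) cD(2), of ?S] graded_endoD(1)[OF Sn] by blast
  have Sg: "graded_endo S"
    unfolding graded_endo_def using S graded_endoD(2)[OF Sn] by auto
  have S_eq: "S x = ?S n x" if "x \<in> gr D i" "i \<le> n" for x i n
    unfolding S(2)[OF that(1)] using that kap_pow_zero[OF that(1)]
    by (intro sum.mono_neutral_left) auto
  have telescope: "(\<Sum>k\<le>n. kap_pow (Suc k) x) = ?S n x - unit_counit x" if "x \<in> gr D n" for x n
  proof -
    have "unit_counit x + (\<Sum>k\<le>n. kap_pow (Suc k) x) = ?S (Suc n) x"
      by (simp add: sum.atMost_Suc_shift del: kap_pow.simps(2) sum.atMost_Suc)
    then show ?thesis using kap_pow_zero[OF that, of "Suc n"] by (simp add: algebra_simps del: kap_pow.simps)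
  qed
  have gr: "cv S id x = unit_counit x" "cv id S x = unit_counit x" if x: "x \<in> gr D n" for x n
  proof -
    note xc = gr_carr[OF cD(2) x]
    note K = graded_endo_kap_pow
    have "cv S id x = cv (?S n) id x"
      by (rule cv_cong[OF Sg graded_endo_id Sn graded_endo_id x]) (use S_eq in auto)
    also have "\<dots> = ?S n x - cv (?S n) kap x" using cv_kap(1)[OF Sn xc, of n] by (simp add: algebra_simps)
    also have "cv (?S n) kap x = ?S n x - unit_counit x"
      using cv_sum(1)[of "{..n}" kap_pow, OF K graded_endo_kap xc] kap_pow_commute[OF xc] telescope[OF x] by simp
    finally show "cv S id x = unit_counit x" by (simp only: diff_diff_eq2 add_diff_cancel_left')
    have "cv id S x = cv id (?S n) x"
      by (rule cv_cong[OF graded_endo_id Sg graded_endo_id Sn x]) (use S_eq in auto)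
    also have "\<dots> = ?S n x - cv kap (?S n) x" using cv_kap(2)[OF Sn xc, of n] by (simp add: algebra_simps)
    also have "cv kap (?S n) x = ?S n x - unit_counit x"
      using cv_sum(2)[of "{..n}" kap_pow, OF K graded_endo_kap xc] telescope[OF x] by simp
    finally show "cv id S x = unit_counit x" by (simp only: diff_diff_eq2 add_diff_cancel_left')
  qed
  have conv: "convolution D m f g x = cv f g x" if "graded_endo f" "graded_endo g" "x \<in> carr D" for f g x
    unfolding convolution_def cv_def comp_apply
    by (rule lin_ext_eq_span[OF linear_cv_tensor _ cop_sq_carr[OF gcD that(3), unfolded tspan_def]])
      (use that in \<open>auto simp: cv_tensor_tens\<close>)
  note lu = graded_endoD(1)[OF graded_endo_unit_counit]
  have "antipode D m S"
    unfolding antipode_def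
    using S(1) graded_endoD(2)[OF Sg] conv[OF Sg graded_endo_id] conv[OF graded_endo_id Sg]
      linear_eq_carr[OF linear_cv lu] gr by (auto simp: unit_counit_def)
  then show ?thesis by blast
qed

end

section \<open>The connections\<close>

lemma operad_hopf_algebra:
  assumes "hopf_operad D \<gamma>"
  shows "connected_hopf_algebra D (operad_mult D \<gamma>)"
proof -
  note rm = operad_right_module[OF assms, unfolded right_module_coalgebra_def]
  note u = operad_mult_one_left[OF assms]
  note con = connD[OF assms] and g = gD[OF assms]
  have "cou D (operad_mult D \<gamma> a b) = cou D a * cou D b" if "a \<in> carr D" "b \<in> carr D" for a b
    unfolding operad_mult_act[OF assms] by (rule cou_act[OF g g g morph[OF assms] that])
  moreover have "\<exists>S. antipode D (operad_mult D \<gamma>) S"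
    by (rule antipode_exists[OF con]) (use rm u in blast)+
  ultimately show ?thesis
    unfolding connected_hopf_algebra_def using con rm u cop_one[OF con] cou_one[OF con] by blast
qed


theorem theorem3p9:
  fixes C :: "('k::field_char_0, 'c::ab_group_add) coalg"
    and D :: "('k, 'd::ab_group_add) coalg"
    and \<gamma> :: "('k, 'd, 'd) composite \<Rightarrow> 'd"
    and l :: "'c \<Rightarrow> 'd"
  assumes "connected_coalgebra C"
    and "hopf_operad D \<gamma>"
    and "coalgebra_morphism C D l"
  shows "right_connection D (operad_mult D \<gamma>) (comp_coalg D C) (right_act D \<gamma> C) (f_r D \<gamma> C l) \<and>
         left_connection D (operad_mult D \<gamma>) (comp_coalg C D) (left_act D \<gamma> C) (f_l D \<gamma> C l)"
proof -
  have C: "graded_coalgebra C" using assms(1) by (simp add: connected_coalgebra_def)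
  note connD = connD[OF assms(2)]
  show ?thesis
    unfolding right_connection_def left_connection_def
    by (intro conjI ballI operad_hopf_algebra[OF assms(2)]
        connected_comp(1)[OF connD assms(1)] connected_comp(1)[OF assms(1) connD]
        right_act_module[OF assms(2) C] left_act_module[OF assms(2) C]
        f_r_morphism[OF assms(2) C assms(3)] f_l_morphism[OF assms(2) C assms(3)]
        f_r_right_act[OF assms(2) C assms(3)] f_l_left_act[OF assms(2) C assms(3)])
qed

end
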